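(* There exists a triple $(M,M^1,C)$, where: (i) $M$ is a $\mathcal{C}^\infty$-smooth generic submanifold in $\mathbb{C}^3$ of CR dimension $1$, diffeomorphic to a real $4$-ball; (ii) $M^1$ is a $\mathcal{C}^\infty$-smooth one-codimensional submanifold of $M$ which is maximally real in $\mathbb{C}^3$ and diffeomorphic to a real $3$-ball; (iii) $C$ is a compact subset of $M^1$ diffeomorphic to a real two-dimensional torus which is everywhere transversal to the characteristic foliation $\mathcal{F}^c_{M^1}$, hence the nontransversality condition $\mathcal{F}^c_{M^1}\{C\}$ (defined in the context) does not hold; (iv) $M$ is of finite type $4$ in the sense of T. Bloom and I. Graham at every point, hence globally minimal; such that $C$ is neither CR-removable, nor $\mathcal{W}$-removable, nor $L^{\mathsf p}$-removable with respect to $M$.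
   Context: For a real submanifold $M\subset\mathbb{C}^n$ and the complex structure $J$, $T_p^cM=T_pM\cap JT_pM$. $M$ is generic if $T_pM+JT_pM=T_p\mathbb{C}^n$ for all $p\in M$; its CR dimension is $\dim_{\mathbb{C}}T^c_pM$. Maximally real means totally real of real dimension $n$. Type $4$ at $p$ means that the Lie brackets of sections of $T^cM$ up to length $4$ generate $T_pM$. The CR orbit of $p\in M$ is the set of endpoints of piecewise smooth curves in $M$ starting at $p$ whose velocities are nonzero and lie in $T^cM$; $M$ is globally minimal if it consists of a single CR orbit. A function (continuous or $L^1_{loc}$) is CR if it is annihilated in the distributional sense by all $(0,1)$ vector fields tangent to $M$. Characteristic foliation: if $M$ is generic of CR dimension $1$ and $M^1\subset M$ is a one-codimensional maximally real submanifold, $\mathcal{F}^c_{M^1}$ is the foliation of $M^1$ by the integral curves of the line field $TM^1\cap T^cM|_{M^1}$. Nontransversality condition $\mathcal{F}^c_{M^1}\{C\}$ for a closed set $C\subset M^1$ (here $0<\alpha<1$): for every nonempty closed subset $C'\subset C$, there exists a simple $\mathcal{C}^{2,\alpha}$-smooth curve $\gamma:[-1,1]\to M^1$ whose range is contained in a single leaf of $\mathcal{F}^c_{M^1}$, with $\gamma(-1)\notin C'$, $\gamma(0)\in C'$ and $\gamma(1)\notin C'$, there exists a local $(n-1)$-dimensional transversal $R^1\subset M^1$ to $\gamma$ passing through $\gamma(0)$, and there exists a thin elongated open neighborhood $V_1$ of $\gamma[-1,1]$ in $M^1$ such that, if $\pi:V_1\to R^1$ denotes the semi-local projection parallel to the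 leaves of $\mathcal{F}^c_{M^1}$, then $\gamma(0)$ lies on the boundary, relative to the topology of $R^1$, of $\pi(C'\cap V_1)$. Wedges: a local wedge of edge $M$ at $p_1\in M$ is a set $\{p+c:\ p\in M,\ c\in {\sf C}\}\cap\Delta_n(p_1,\delta)$, where $\Delta_n(p_1,\delta)$ is the open polydisc of center $p_1$ and radius $\delta>0$ and ${\sf C}$ is an open infinite cone in the normal space $T_{p_1}\mathbb{C}^n/T_{p_1}M$ (identified with a complementary real linear subspace). A wedgelike domain attached to a generic submanifold $M'$ is a nonempty domain containing a local wedge of edge $M'$ at every point of $M'$. Removability of a closed subset $C\subset M$: $C$ is CR-removable if there is a wedgelike domain attached to $M$ to which every continuous CR function on $M\setminus C$ extends holomorphically. $C$ is $\mathcal{W}$-removable if for every wedgelike domain $\mathcal{W}_1$ attached to $M\setminus C$ there are a wedgelike domain $\mathcal{W}_2$ attached to $M$ and a wedgelike domain $\mathcal{W}_3\subset\mathcal{W}_1\cap\mathcal{W}_2$ attached to $M\setminus C$ such that for every $f\in\mathcal{O}(\mathcal{W}_1)$ there is $F\in\mathcal{O}(\mathcal{W}_2)$ with $F=f$ on $\mathcal{W}_3$. For ${\mathsf p}\in\mathbb{R}\cup\{+\infty\}$ with ${\mathsf p}\ge 1$, $C$ is $L^{\mathsf p}$-removable if every $f\in L^{\mathsf p}_{loc}(M)$ which is CR in the distributional sense on $M\setminus C$ is CR on all of $M$.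
   Formalization: Non-L^p-removability is asserted exactly for 1 ≤ p < 2: for p ≥ 2 the claim is false, since C is a compact smooth surface of codimension 2 in M and a cut-off argument for the first-order tangential CR operator shows that C is always L^p-removable. *)

theory Defs
  imports "HOL-Analysis.Analysis"
begin

section \<open>Smooth maps and embedded submanifolds\<close>

text \<open>Meaningful for open sets only: all iterated directional derivatives up to the given order
  exist as Frechet derivatives and are continuous.\<close>

primrec Ck_on :: "nat \<Rightarrow> 'a::euclidean_space set \<Rightarrow> ('a \<Rightarrow> 'b::euclidean_space) \<Rightarrow> bool" where
  "Ck_on 0 U f \<longleftrightarrow> continuous_on U f"
| "Ck_on (Suc k) U f \<longleftrightarrow>
     (\<forall>x\<in>U. f differentiable (at x)) \<and> (\<forall>v. Ck_on k U (\<lambda>x. frechet_derivative f (at x) v))"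

text \<open>On an arbitrary set, smoothness means the existence of local \<open>C\<^sup>\<infinity>\<close> extensions to the ambient
  space.\<close>

definition smooth_on :: "'a::euclidean_space set \<Rightarrow> ('a \<Rightarrow> 'b::euclidean_space) \<Rightarrow> bool" where
  "smooth_on S f \<longleftrightarrow>
     (\<forall>x\<in>S. \<exists>U g. open U \<and> x \<in> U \<and> (\<forall>k. Ck_on k U g) \<and> (\<forall>y\<in>S \<inter> U. g y = f y))"

definition diffeomorphism ::
    "'a::euclidean_space set \<Rightarrow> 'b::euclidean_space set \<Rightarrow> ('a \<Rightarrow> 'b) \<Rightarrow> ('b \<Rightarrow> 'a) \<Rightarrow> bool" where
  "diffeomorphism S T f g \<longleftrightarrow> homeomorphism S T f g \<and> smooth_on S f \<and> smooth_on T g"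

definition diffeomorphic :: "'a::euclidean_space set \<Rightarrow> 'b::euclidean_space set \<Rightarrow> bool" where
  "diffeomorphic S T \<longleftrightarrow> (\<exists>f g. diffeomorphism S T f g)"

definition smooth_submanifold :: "nat \<Rightarrow> 'a::euclidean_space set \<Rightarrow> bool" where
  "smooth_submanifold d S \<longleftrightarrow>
     (\<forall>p\<in>S. \<exists>U V \<phi> \<psi> L. open U \<and> p \<in> U \<and> open (V :: 'a set) \<and> diffeomorphism U V \<phi> \<psi> \<and>
        subspace L \<and> dim L = d \<and> \<phi> ` (S \<inter> U) = L \<inter> V)"

definition tangent_space :: "'a::euclidean_space set \<Rightarrow> 'a \<Rightarrow> 'a set" where
  "tangent_space S p =
     {v. \<exists>\<gamma> e. 0 < e \<and> smooth_on {-e<..<e} \<gamma> \<and> \<gamma> ` {-e<..<e} \<subseteq> S \<and> \<gamma> 0 = p \<and>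
           (\<gamma> has_vector_derivative v) (at (0::real))}"


section \<open>CR geometry in complex Euclidean space\<close>

definition J :: "complex ^ 'n \<Rightarrow> complex ^ 'n" where
  "J v = \<i> *s v"

definition complex_tangent :: "(complex ^ 'n) set \<Rightarrow> complex ^ 'n \<Rightarrow> (complex ^ 'n) set" where
  "complex_tangent M p = tangent_space M p \<inter> J ` tangent_space M p"

text \<open>Here \<open>+\<close> is the elementwise sum of sets.\<close>

definition generic :: "(complex ^ 'n) set \<Rightarrow> bool" where
  "generic M \<longleftrightarrow> (\<forall>p\<in>M. tangent_space M p + J ` tangent_space M p = UNIV)"

text \<open>\<open>vec.dim\<close> is the dimension over the scalar field of the vectors, here the complex numbers,
  whereas \<open>dim\<close> is the real dimension.\<close>

definition CR_dimension :: "(complex ^ 'n) set \<Rightarrow> nat \<Rightarrow> bool" where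
  "CR_dimension M m \<longleftrightarrow> (\<forall>p\<in>M. vec.dim (complex_tangent M p) = m)"

definition maximally_real :: "(complex ^ 'n) set \<Rightarrow> bool" where
  "maximally_real N \<longleftrightarrow>
     smooth_submanifold CARD('n) N \<and> (\<forall>p\<in>N. complex_tangent N p = {0})"

text \<open>Vector fields on \<open>M\<close> are represented by smooth extensions to open subsets of the ambient space;
  along \<open>M\<close>, the ambient bracket of two fields tangent to \<open>M\<close> is tangent to \<open>M\<close> and does not depend
  on the extensions.\<close>

definition lie_bracket ::
    "('a::euclidean_space \<Rightarrow> 'a) \<Rightarrow> ('a \<Rightarrow> 'a) \<Rightarrow> 'a \<Rightarrow> 'a" where
  "lie_bracket X Y = (\<lambda>x. frechet_derivative Y (at x) (X x) - frechet_derivative X (at x) (Y x))"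

text \<open>The number counts the sections occurring in the iterated bracket, so that a section itself has
  length one.\<close>

inductive CR_bracket ::
    "(complex ^ 'n) set \<Rightarrow> (complex ^ 'n) set \<Rightarrow> nat \<Rightarrow> (complex ^ 'n \<Rightarrow> complex ^ 'n) \<Rightarrow> bool"
  for M U where
  CR_section: "smooth_on U X \<Longrightarrow> (\<forall>q\<in>M \<inter> U. X q \<in> complex_tangent M q) \<Longrightarrow> CR_bracket M U 1 X"
| CR_Lie: "CR_bracket M U j X \<Longrightarrow> CR_bracket M U k Y \<Longrightarrow> CR_bracket M U (j + k) (lie_bracket X Y)"

text \<open>Brackets of length up to \<open>k\<close> span the tangent space. Minimality of \<open>k\<close> is not part of the notion.\<close>

definition finite_type_at :: "nat \<Rightarrow> (complex ^ 'n) set \<Rightarrow> complex ^ 'n \<Rightarrow> bool" where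
  "finite_type_at k M p \<longleftrightarrow>
     span {Z p | Z U j. open U \<and> p \<in> U \<and> j \<le> k \<and> CR_bracket M U j Z} = tangent_space M p"

definition CR_curve :: "(complex ^ 'n) set \<Rightarrow> (real \<Rightarrow> complex ^ 'n) \<Rightarrow> bool" where
  "CR_curve M \<gamma> \<longleftrightarrow>
     (\<exists>(n::nat) (\<tau> :: nat \<Rightarrow> real). \<tau> 0 = 0 \<and> \<tau> n = 1 \<and>
        (\<forall>i<n. \<tau> i < \<tau> (Suc i) \<and> smooth_on {\<tau> i..\<tau> (Suc i)} \<gamma> \<and>
           (\<forall>t\<in>{\<tau> i..\<tau> (Suc i)}. \<gamma> t \<in> M \<and>
              vector_derivative \<gamma> (at t within {\<tau> i..\<tau> (Suc i)}) \<in> complex_tangent M (\<gamma> t) - {0})))"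

definition CR_orbit :: "(complex ^ 'n) set \<Rightarrow> complex ^ 'n \<Rightarrow> (complex ^ 'n) set" where
  "CR_orbit M p = {\<gamma> 1 | \<gamma>. CR_curve M \<gamma> \<and> \<gamma> 0 = p}"

definition globally_minimal :: "(complex ^ 'n) set \<Rightarrow> bool" where
  "globally_minimal M \<longleftrightarrow> (\<forall>p\<in>M. CR_orbit M p = M)"


section \<open>The characteristic foliation and the nontransversality condition\<close>

definition char_line ::
    "(complex ^ 'n) set \<Rightarrow> (complex ^ 'n) set \<Rightarrow> complex ^ 'n \<Rightarrow> (complex ^ 'n) set" where
  "char_line M M1 p = tangent_space M1 p \<inter> complex_tangent M p"

definition char_integral_curve ::
    "(complex ^ 'n) set \<Rightarrow> (complex ^ 'n) set \<Rightarrow> real \<Rightarrow> real \<Rightarrow> (real \<Rightarrow> complex ^ 'n) \<Rightarrow> bool" where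
  "char_integral_curve M M1 a b c \<longleftrightarrow>
     smooth_on {a<..<b} c \<and>
     (\<forall>t\<in>{a<..<b}. c t \<in> M1 \<and> vector_derivative c (at t) \<in> char_line M M1 (c t) - {0})"

definition char_leaf ::
    "(complex ^ 'n) set \<Rightarrow> (complex ^ 'n) set \<Rightarrow> complex ^ 'n \<Rightarrow> (complex ^ 'n) set" where
  "char_leaf M M1 p =
     {c t | c a b s t. char_integral_curve M M1 a b c \<and> s \<in> {a<..<b} \<and> t \<in> {a<..<b} \<and> c s = p}"

definition transversal_to_char_foliation ::
    "(complex ^ 'n) set \<Rightarrow> (complex ^ 'n) set \<Rightarrow> (complex ^ 'n) set \<Rightarrow> bool" where
  "transversal_to_char_foliation M M1 S \<longleftrightarrow>
     S \<subseteq> M1 \<and> (\<forall>p\<in>S. tangent_space S p + char_line M M1 p = tangent_space M1 p)"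

definition simple_C2_hoelder_curve :: "real \<Rightarrow> (real \<Rightarrow> 'a::euclidean_space) \<Rightarrow> bool" where
  "simple_C2_hoelder_curve \<alpha> \<gamma> \<longleftrightarrow>
     inj_on \<gamma> {-1..1} \<and>
     (\<exists>\<gamma>' \<gamma>'' K.
        (\<forall>t\<in>{-1..1}. (\<gamma> has_vector_derivative \<gamma>' t) (at t within {-1..1}) \<and>
                     (\<gamma>' has_vector_derivative \<gamma>'' t) (at t within {-1..1})) \<and>
        (\<forall>s\<in>{-1..1}. \<forall>t\<in>{-1..1}. norm (\<gamma>'' s - \<gamma>'' t) \<le> K * \<bar>s - t\<bar> powr \<alpha>))"

text \<open>\<open>V\<close> is a flow box of the characteristic foliation with central transversal \<open>R\<close>, and \<open>\<pi>\<close> is the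
  projection of \<open>V\<close> onto \<open>R\<close> along the plaques \<open>\<Phi> ({r} \<times> {a<..<b})\<close>.\<close>

definition semilocal_projection ::
    "(complex ^ 'n) set \<Rightarrow> (complex ^ 'n) set \<Rightarrow> (complex ^ 'n) set \<Rightarrow> (complex ^ 'n) set \<Rightarrow>
     (complex ^ 'n \<Rightarrow> complex ^ 'n) \<Rightarrow> bool" where
  "semilocal_projection M M1 R V \<pi> \<longleftrightarrow>
     (\<exists>a b \<Phi> \<Psi>. a < 0 \<and> 0 < b \<and> diffeomorphism (R \<times> {a<..<b}) V \<Phi> \<Psi> \<and>
        (\<forall>r\<in>R. \<Phi> (r, 0) = r \<and> char_integral_curve M M1 a b (\<lambda>t. \<Phi> (r, t)) \<and>
               (\<forall>t\<in>{a<..<b}. \<pi> (\<Phi> (r, t)) = r)))"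

text \<open>No thinness of the flow box \<open>V\<close> has to be imposed: shrinking \<open>V\<close> around the curve shrinks the
  projection of \<open>C' \<inter> V\<close>, so the boundary condition for some \<open>V\<close> implies it for all smaller ones.\<close>

definition nontransversality ::
    "real \<Rightarrow> (complex ^ 'n) set \<Rightarrow> (complex ^ 'n) set \<Rightarrow> (complex ^ 'n) set \<Rightarrow> bool" where
  "nontransversality \<alpha> M M1 C \<longleftrightarrow>
     (\<forall>C'. C' \<noteq> {} \<and> closedin (top_of_set C) C' \<longrightarrow>
        (\<exists>\<gamma> R V \<pi>.
           simple_C2_hoelder_curve \<alpha> \<gamma> \<and>
           \<gamma> ` {-1..1} \<subseteq> char_leaf M M1 (\<gamma> 0) \<and>
           \<gamma> (-1) \<notin> C' \<and> \<gamma> 0 \<in> C' \<and> \<gamma> 1 \<notin> C' \<and>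
           smooth_submanifold (CARD('n) - 1) R \<and> transversal_to_char_foliation M M1 R \<and>
           \<gamma> 0 \<in> R \<and>
           openin (top_of_set M1) V \<and> \<gamma> ` {-1..1} \<subseteq> V \<and>
           semilocal_projection M M1 R V \<pi> \<and>
           \<gamma> 0 \<in> top_of_set R frontier_of (\<pi> ` (C' \<inter> V))))"


section \<open>Wedges and holomorphic functions of several variables\<close>

definition polydisc :: "complex ^ 'n \<Rightarrow> real \<Rightarrow> (complex ^ 'n) set" where
  "polydisc p \<delta> = {z. \<forall>i. norm (z $ i - p $ i) < \<delta>}"

text \<open>The normal space at \<open>p\<close> is identified with an arbitrary real linear complement \<open>N\<close> of the
  tangent space.\<close>

definition local_wedge :: "(complex ^ 'n) set \<Rightarrow> complex ^ 'n \<Rightarrow> (complex ^ 'n) set \<Rightarrow> bool" where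
  "local_wedge M p W \<longleftrightarrow>
     (\<exists>N K \<delta>. subspace N \<and> N \<inter> tangent_space M p = {0} \<and> N + tangent_space M p = UNIV \<and>
        openin (top_of_set N) K \<and> K \<noteq> {} \<and> (\<forall>c\<in>K. \<forall>t>0. t *\<^sub>R c \<in> K) \<and>
        0 < \<delta> \<and> W = (M + K) \<inter> polydisc p \<delta>)"

definition wedgelike_domain :: "(complex ^ 'n) set \<Rightarrow> (complex ^ 'n) set \<Rightarrow> bool" where
  "wedgelike_domain M W \<longleftrightarrow>
     open W \<and> connected W \<and> W \<noteq> {} \<and> (\<forall>p\<in>M. \<exists>W'. local_wedge M p W' \<and> W' \<subseteq> W)"

definition holomorphic_several :: "(complex ^ 'n) set \<Rightarrow> (complex ^ 'n \<Rightarrow> complex) \<Rightarrow> bool" where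
  "holomorphic_several W F \<longleftrightarrow>
     (\<forall>z\<in>W. \<exists>D. (F has_derivative D) (at z) \<and> (\<forall>c v. D (c *s v) = c * D v))"


section \<open>CR functions in the sense of distributions\<close>

text \<open>Local parametrizations of \<open>S\<close> by open subsets of \<open>'d\<close>. They exist only if \<open>DIM('d)\<close> is the
  dimension of \<open>S\<close>, so the type argument of the notions below has to be chosen accordingly.\<close>

definition local_parametrization ::
    "'a::euclidean_space set \<Rightarrow> 'd::euclidean_space set \<Rightarrow> ('d \<Rightarrow> 'a) \<Rightarrow> bool" where
  "local_parametrization S U \<psi> \<longleftrightarrow>
     open U \<and> openin (top_of_set S) (\<psi> ` U) \<and> (\<exists>g. diffeomorphism U (\<psi> ` U) \<psi> g)"

definition Lp_loc ::
    "'d::euclidean_space itself \<Rightarrow> ereal \<Rightarrow> 'a::euclidean_space set \<Rightarrow> ('a \<Rightarrow> complex) \<Rightarrow> bool" where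
  "Lp_loc _ p S f \<longleftrightarrow>
     (\<forall>U (\<psi> :: 'd \<Rightarrow> 'a). local_parametrization S U \<psi> \<longrightarrow>
        set_borel_measurable lebesgue U (f \<circ> \<psi>) \<and>
        (\<forall>K. compact K \<and> K \<subseteq> U \<longrightarrow>
           (if p = \<infinity> then \<exists>B. AE x in lebesgue. x \<in> K \<longrightarrow> norm (f (\<psi> x)) \<le> B
            else set_integrable lebesgue K (\<lambda>x. norm (f (\<psi> x)) powr real_of_ereal p))))"

definition divergence :: "('d::euclidean_space \<Rightarrow> 'd) \<Rightarrow> 'd \<Rightarrow> real" where
  "divergence X x = (\<Sum>b\<in>Basis. frechet_derivative X (at x) b \<bullet> b)"

text \<open>In a local parametrization \<open>\<psi>\<close>, the complex vector field \<open>A + i B\<close> with real \<open>A\<close>, \<open>B\<close> is pushed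
  forward to a field of type \<open>(0,1)\<close> exactly if \<open>d\<psi> B = J (d\<psi> A)\<close>, since the vectors of type
  \<open>(0,1)\<close> are those of the form \<open>X + i J X\<close>. The formal transpose of \<open>A + i B\<close> maps a test function
  \<open>\<theta>\<close> to \<open>- div (\<theta> A) - i div (\<theta> B)\<close>. Real-valued test functions suffice by linearity.\<close>

definition CR_function ::
    "'d::euclidean_space itself \<Rightarrow> (complex ^ 'n) set \<Rightarrow> (complex ^ 'n \<Rightarrow> complex) \<Rightarrow> bool" where
  "CR_function T S f \<longleftrightarrow>
     Lp_loc T 1 S f \<and>
     (\<forall>U (\<psi> :: 'd \<Rightarrow> complex ^ 'n) A B \<theta>.
        local_parametrization S U \<psi> \<and> smooth_on U A \<and> smooth_on U B \<and>
        (\<forall>x\<in>U. frechet_derivative \<psi> (at x) (B x) = J (frechet_derivative \<psi> (at x) (A x))) \<and>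
        smooth_on UNIV (\<theta> :: 'd \<Rightarrow> real) \<and>
        compact (closure {x. \<theta> x \<noteq> 0}) \<and> closure {x. \<theta> x \<noteq> 0} \<subseteq> U \<longrightarrow>
        (LINT x:U|lebesgue. f (\<psi> x) * Complex (divergence (\<lambda>y. \<theta> y *\<^sub>R A y) x)
                                               (divergence (\<lambda>y. \<theta> y *\<^sub>R B y) x)) = 0)"


section \<open>Removability\<close>

definition CR_removable ::
    "'d::euclidean_space itself \<Rightarrow> (complex ^ 'n) set \<Rightarrow> (complex ^ 'n) set \<Rightarrow> bool" where
  "CR_removable T M C \<longleftrightarrow>
     (\<exists>W. wedgelike_domain M W \<and>
        (\<forall>f. continuous_on (M - C) f \<and> CR_function T (M - C) f \<longrightarrow>
           (\<exists>F. holomorphic_several W F \<and> continuous_on (W \<union> (M - C)) F \<and>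
                (\<forall>p\<in>M - C. F p = f p))))"

definition W_removable :: "(complex ^ 'n) set \<Rightarrow> (complex ^ 'n) set \<Rightarrow> bool" where
  "W_removable M C \<longleftrightarrow>
     (\<forall>W1. wedgelike_domain (M - C) W1 \<longrightarrow>
        (\<exists>W2 W3. wedgelike_domain M W2 \<and> wedgelike_domain (M - C) W3 \<and> W3 \<subseteq> W1 \<inter> W2 \<and>
           (\<forall>f. holomorphic_several W1 f \<longrightarrow>
              (\<exists>F. holomorphic_several W2 F \<and> (\<forall>z\<in>W3. F z = f z)))))"

text \<open>A compact smooth submanifold of codimension at least two is \<open>L\<^sup>p\<close>-removable for all \<open>p \<ge> 2\<close> (a
  cut-off argument, the defining operators being of first order). Hence non-removability of a
  surface in a four-dimensional manifold can hold for \<open>1 \<le> p < 2\<close> only.\<close>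

definition Lp_removable ::
    "'d::euclidean_space itself \<Rightarrow> ereal \<Rightarrow> (complex ^ 'n) set \<Rightarrow> (complex ^ 'n) set \<Rightarrow> bool" where
  "Lp_removable T p M C \<longleftrightarrow>
     (\<forall>f. Lp_loc T p M f \<and> CR_function T (M - C) f \<longrightarrow> CR_function T M f)"

end

theory Submission
  imports Defs "HOL-Complex_Analysis.Conformal_Mappings"
begin

text \<open>On the unit sphere of \<open>\<complex>\<^sup>2\<close>, punctured at \<open>(1, 0)\<close>, let \<open>\<xi> = z\<^sup>2 - w\<^sup>2\<close> and \<open>\<mu> = 2 Re (z cnj w)\<close>, so
  that \<open>(Re \<xi>, Im \<xi>, \<mu>)\<close> is the Hopf map. Put \<open>q = Re \<xi> - \<mu> Im \<xi> / 2\<close> and \<open>E = \<mu> q\<^sup>2 Re \<xi> / 4\<close>. Over the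
  punctured sphere, \<open>M\<close> is given by \<open>Im t = q\<close> and \<open>M\<^sub>1\<close> by \<open>t = E + \<i> q\<close>, where \<open>t\<close> is the third
  coordinate. Since \<open>E\<close> vanishes together with \<open>q\<close>, the zero set of \<open>t\<close> in \<open>M\<close> is the torus \<open>C = {t = 0, q = 0}\<close>,
  which lies in \<open>M\<^sub>1\<close>. The choice of \<open>E\<close> makes \<open>M\<^sub>1\<close> totally real, and \<open>q\<close> has nonzero derivative along the
  characteristic directions at \<open>C\<close>; hence the projection of \<open>C\<close> along the leaves is open, which
  contradicts the nontransversality condition for \<open>C' = C\<close>.

  The function \<open>1 / t\<close> shows that \<open>C\<close> is not removable. An extension \<open>F\<close> of it to a wedgelike domain satisfies
  \<open>F t = 1\<close> there, by the identity theorem or a boundary uniqueness theorem (reflection along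
  the complexification of a totally real submanifold), whereas every wedge at a point of \<open>C\<close>
  meets \<open>{t = 0}\<close>. Near \<open>C\<close> the function \<open>t\<close> is a submersion of \<open>M\<close> onto a neighbourhood of \<open>0\<close> in \<open>\<complex>\<close>; so
  \<open>1 / t\<close> is locally in \<open>L\<^sup>p\<close> for \<open>p < 2\<close>, and the tangential Cauchy-Riemann operator maps it to a
  nonzero measure on \<open>C\<close>.

  Any two points of \<open>M\<close> are joined by complex tangential lifts of great circles, whose
  holonomy realizes every translation of \<open>Re t\<close>.\<close>

section \<open>Calculus of smooth maps\<close>

text \<open>With \<open>q\<close> equal to \<open>Re \<xi>\<close> alone,
  \<open>t - \<i> \<xi>\<close> would be real on \<open>M\<close> and complex tangential curves
  would stay in its level sets; the term in \<open>\<mu> Im \<xi>\<close> destroys this product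
  structure and produces the holonomy.

  The frame \<open>zt\<close> of the complex tangent lines has third entry \<open>cc\<close> with
  \<open>dq (\<zeta> zt) = Im (\<zeta> cc)\<close>. The graph of \<open>E\<close> is totally real
  iff the real-linear functional \<open>Re (\<zeta> cc) - dE (\<zeta> zt)\<close> of \<zeta> is
  nowhere identically zero. For \<open>E = 0\<close> this fails precisely where
  \<open>cc = 0\<close>, that is, on the Hopf circles where \<mu> = 0 and \<xi> is 1 or -1. There
  \<mu> has nonzero derivative along the complex tangent line, which the factor
  \<open>\<mu> Re \<xi>\<close> of \<open>E\<close> exploits. The factor \<open>q^2\<close> makes
  \<open>E\<close> vanish to second order on the torus, so that the characteristic lines there are
  those for \<open>E = 0\<close>; the small coefficient prevents the functional from acquiring new
  zeros. The puncture lies on one of these circles, hence off the torus, and turns the three-sphere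
  into a three-space.\<close>

lemma Ck_on_cong_imp:
  fixes f g :: "'a::euclidean_space \<Rightarrow> 'b::euclidean_space"
  assumes "open U" "\<And>x. x \<in> U \<Longrightarrow> f x = g x" "Ck_on k U f"
  shows "Ck_on k U g"
  using assms(2,3)
proof (induction k arbitrary: f g)
  case 0
  then show ?case by (simp cong: continuous_on_cong)
next
  case (Suc k)
  have g: "(g has_derivative frechet_derivative f (at x)) (at x)" if x: "x \<in> U" for x
  proof -
    have "(f has_derivative frechet_derivative f (at x)) (at x)"
      using Suc.prems(2) x by (simp add: frechet_derivative_works[symmetric])
    then show ?thesis
      by (rule has_derivative_transform_within_open[OF _ \<open>open U\<close> x]) (use Suc.prems in auto)
  qed
  have "Ck_on k U (\<lambda>x. frechet_derivative g (at x) v)" for v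
    by (rule Suc.IH[where f = "\<lambda>x. frechet_derivative f (at x) v"])
      (use Suc.prems g frechet_derivative_at in \<open>fastforce+\<close>)
  then show ?case using g by (auto simp: differentiable_def)
qed

text \<open>\<open>Ck_on\<close> refers to the derivative picked by
  \<open>frechet_derivative\<close>; this form accepts any explicitly computed one. The smoothness
  inductions for concrete maps go through it.\<close>

lemma Ck_on_Suc:
  fixes f :: "'a::euclidean_space \<Rightarrow> 'b::euclidean_space"
  assumes "open U" "\<And>x. x \<in> U \<Longrightarrow> (f has_derivative f' x) (at x)" "\<And>v. Ck_on k U (\<lambda>x. f' x v)"
  shows "Ck_on (Suc k) U f"
proof -
  have "Ck_on k U (\<lambda>x. frechet_derivative f (at x) v)" for v
    by (rule Ck_on_cong_imp[OF assms(1) _ assms(3)[of v]]) (simp add: frechet_derivative_at[OF assms(2), symmetric])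
  then show ?thesis using assms(2) by (auto simp: differentiable_def)
qed

lemma Ck_on_SucD:
  assumes "Ck_on (Suc k) U f" "x \<in> U"
  shows "(f has_derivative frechet_derivative f (at x)) (at x)"
  using assms by (auto simp: frechet_derivative_works)

lemma Ck_on_deriv: "Ck_on (Suc k) U f \<Longrightarrow> Ck_on k U (\<lambda>x. frechet_derivative f (at x) v)"
  by simp

lemma Ck_on_decr: "Ck_on (Suc k) U f \<Longrightarrow> Ck_on k U f"
proof (induction k arbitrary: f)
  case 0
  then show ?case
    by (auto intro!: differentiable_imp_continuous_on simp: differentiable_on_def differentiable_at_withinI)
next
  case (Suc k)
  then show ?case by (subst Ck_on.simps(2)) (metis Ck_on.simps(2))
qed

lemma Ck_on_subset: "Ck_on k U f \<Longrightarrow> V \<subseteq> U \<Longrightarrow> Ck_on k V f"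
  by (induction k arbitrary: f) (auto intro: continuous_on_subset)

lemma Ck_on_local:
  assumes "\<And>x. x \<in> U \<Longrightarrow> \<exists>V. open V \<and> x \<in> V \<and> Ck_on k V f"
  shows "Ck_on k U f"
  using assms
proof (induction k arbitrary: f)
  case 0
  then show ?case
    by (metis (no_types, lifting) Ck_on.simps(1) continuous_at_imp_continuous_on continuous_on_eq_continuous_at)
next
  case (Suc k)
  show ?case
    unfolding Ck_on.simps
  proof (intro conjI ballI allI)
    show "f differentiable at x" if "x \<in> U" for x using Suc.prems[OF that] by auto
    show "Ck_on k U (\<lambda>x. frechet_derivative f (at x) v)" for v
      by (rule Suc.IH) (use Suc.prems in force)
  qed
qed

lemma Ck_on_const: "Ck_on k U (\<lambda>x. c)"
  by (induction k arbitrary: c) auto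

lemma Ck_on_bounded_linear:
  assumes "open U" "bounded_linear L"
  shows "Ck_on k U L"
proof (cases k)
  case 0
  then show ?thesis using assms by (simp add: linear_continuous_on)
next
  case (Suc j)
  then show ?thesis
    using Ck_on_Suc[OF assms(1) bounded_linear_imp_has_derivative[OF assms(2)] Ck_on_const] by simp
qed

text \<open>Products and sums need one simultaneous induction, because the derivative of a product
  is a sum of two products.\<close>

lemma Ck_on_bilinear:
  fixes p :: "'b::euclidean_space \<Rightarrow> 'c::euclidean_space \<Rightarrow> 'd::euclidean_space"
  assumes "bounded_bilinear p" and U: "open (U :: 'a::euclidean_space set)"
  shows "Ck_on k U f \<Longrightarrow> Ck_on k U g \<Longrightarrow> Ck_on k U (\<lambda>x. p (f x) (g x))"
    and "Ck_on k U f1 \<Longrightarrow> Ck_on k U f2 \<Longrightarrow> Ck_on k U (\<lambda>x. f1 x + f2 x :: 'd)"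
proof (induction k arbitrary: f g f1 f2)
  case 0
  { case 1 then show ?case by (simp add: bounded_bilinear.continuous_on[OF assms(1)]) }
  { case 2 then show ?case by (simp add: continuous_on_add) }
next
  case (Suc k)
  { case 1
    show ?case
    proof (rule Ck_on_Suc[OF U])
      show "((\<lambda>x. p (f x) (g x)) has_derivative
          (\<lambda>v. p (f x) (frechet_derivative g (at x) v) + p (frechet_derivative f (at x) v) (g x))) (at x)"
        if "x \<in> U" for x
        using bounded_bilinear.FDERIV[OF assms(1) Ck_on_SucD[OF 1(1) that] Ck_on_SucD[OF 1(2) that]] .
      show "Ck_on k U (\<lambda>x. p (f x) (frechet_derivative g (at x) v) + p (frechet_derivative f (at x) v) (g x))" for v
        using 1 Ck_on_decr[OF 1(1)] Ck_on_decr[OF 1(2)] by (intro Suc.IH) auto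
    qed }
  { case 2
    show ?case
    proof (rule Ck_on_Suc[OF U])
      show "((\<lambda>x. f1 x + f2 x) has_derivative
          (\<lambda>v. frechet_derivative f1 (at x) v + frechet_derivative f2 (at x) v)) (at x)"
        if "x \<in> U" for x
        using has_derivative_add[OF Ck_on_SucD[OF 2(1) that] Ck_on_SucD[OF 2(2) that]] .
      show "Ck_on k U (\<lambda>x. frechet_derivative f1 (at x) v + frechet_derivative f2 (at x) v)" for v
        using 2 by (intro Suc.IH(2)) auto
    qed }
qed

lemmas Ck_on_scaleR = Ck_on_bilinear(1)[OF bounded_bilinear_scaleR]
lemmas Ck_on_add = Ck_on_bilinear(2)[OF bounded_bilinear_scaleR]

lemma Ck_on_sum:
  assumes "open U" "\<And>i. i \<in> I \<Longrightarrow> Ck_on k U (f i)"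
  shows "Ck_on k U (\<lambda>x. \<Sum>i\<in>I. f i x)"
  using assms(2) by (induction I rule: infinite_finite_induct) (auto intro: Ck_on_const Ck_on_add[OF assms(1)])

text \<open>In the chain rule the derivative of \<open>g\<close> is applied to a vector that moves
  with \<open>x\<close>. Expanding this vector in the basis gives a sum of products whose factors
  are covered by the induction hypothesis.\<close>

lemma Ck_on_compose:
  fixes f :: "'a::euclidean_space \<Rightarrow> 'b::euclidean_space" and g :: "'b \<Rightarrow> 'c::euclidean_space"
  assumes U: "open U" and V: "open V"
  shows "Ck_on k V g \<Longrightarrow> Ck_on k U f \<Longrightarrow> f ` U \<subseteq> V \<Longrightarrow> Ck_on k U (\<lambda>x. g (f x))"
proof (induction k arbitrary: f g)
  case 0
  then show ?case by (simp add: continuous_on_compose2)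
next
  case (Suc k)
  show ?case
  proof (rule Ck_on_Suc[OF U])
    fix x assume x: "x \<in> U"
    then have fx: "f x \<in> V" using Suc.prems by auto
    have lin: "linear (frechet_derivative g (at (f x)))"
      using Ck_on_SucD[OF Suc.prems(1) fx] has_derivative_linear by blast
    have "((\<lambda>x. g (f x)) has_derivative (\<lambda>v. frechet_derivative g (at (f x)) (frechet_derivative f (at x) v))) (at x)"
      using has_derivative_compose[OF Ck_on_SucD[OF Suc.prems(2) x] Ck_on_SucD[OF Suc.prems(1) fx]] .
    also have "(\<lambda>v. frechet_derivative g (at (f x)) (frechet_derivative f (at x) v)) =
       (\<lambda>v. \<Sum>b\<in>Basis. (frechet_derivative f (at x) v \<bullet> b) *\<^sub>R frechet_derivative g (at (f x)) b)"
    proof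
      fix v
      show "frechet_derivative g (at (f x)) (frechet_derivative f (at x) v) =
        (\<Sum>b\<in>Basis. (frechet_derivative f (at x) v \<bullet> b) *\<^sub>R frechet_derivative g (at (f x)) b)"
        unfolding linear_scale[OF lin, symmetric] linear_sum[OF lin, symmetric] euclidean_representation ..
    qed
    finally show "((\<lambda>x. g (f x)) has_derivative
       (\<lambda>v. \<Sum>b\<in>Basis. (frechet_derivative f (at x) v \<bullet> b) *\<^sub>R frechet_derivative g (at (f x)) b)) (at x)" .
  next
    fix v
    have ip: "Ck_on k U (\<lambda>x. frechet_derivative f (at x) v \<bullet> b)" for b
      using Ck_on_bilinear(1)[OF bounded_bilinear_inner U Ck_on_deriv[OF Suc.prems(2)] Ck_on_const] .
    have "Ck_on k U f" using Suc.prems(2) by (rule Ck_on_decr)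
    then have "Ck_on k U (\<lambda>x. frechet_derivative g (at (f x)) b)" for b
      using Suc.prems by (intro Suc.IH[where g = "\<lambda>y. frechet_derivative g (at y) b"]) auto
    then show "Ck_on k U (\<lambda>x. \<Sum>b\<in>Basis. (frechet_derivative f (at x) v \<bullet> b) *\<^sub>R frechet_derivative g (at (f x)) b)"
      by (intro Ck_on_sum[OF U] Ck_on_scaleR[OF U] ip)
  qed
qed

lemma Ck_on_inverse: "Ck_on k (- {0}) (inverse :: real \<Rightarrow> real)"
proof (induction k)
  case 0
  then show ?case by (auto intro!: continuous_intros)
next
  case (Suc k)
  show ?case
  proof (rule Ck_on_Suc)
    show "(inverse has_derivative (\<lambda>v. - (inverse x * v * inverse x))) (at x)" if "x \<in> - {0}" for x :: real
      using that by (auto intro: has_derivative_inverse')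
    show "Ck_on k (- {0}) (\<lambda>x. - (inverse x * v * inverse x))" for v :: real
    proof -
      have "Ck_on k (- {0}) (\<lambda>x. (- v) *\<^sub>R (inverse x *\<^sub>R inverse x))"
        by (intro Ck_on_scaleR Ck_on_const Suc open_Compl) auto
      then show ?thesis by (simp add: mult_ac)
    qed
  qed auto
qed

lemma Ck_on_sqrt: "Ck_on k {0<..} sqrt"
proof (induction k)
  case 0
  then show ?case by (auto intro!: continuous_intros)
next
  case (Suc k)
  show ?case
  proof (rule Ck_on_Suc)
    show "(sqrt has_derivative (\<lambda>v. (v / 2) *\<^sub>R inverse (sqrt x))) (at x)" if "x \<in> {0<..}" for x
      using DERIV_real_sqrt[of x] that
      by (auto simp: has_field_derivative_def field_simps elim!: has_derivative_eq_rhs)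
    show "Ck_on k {0<..} (\<lambda>x. (v / 2) *\<^sub>R inverse (sqrt x))" for v
      by (rule Ck_on_scaleR[OF _ Ck_on_const Ck_on_compose[OF _ _ Ck_on_inverse Suc]]) auto
  qed auto
qed

text \<open>Openness is part of the notion because \<open>Ck_on\<close> is meaningful on open sets
  only; the introduction rules then propagate it.\<close>

definition Cinf :: "'a::euclidean_space set \<Rightarrow> ('a \<Rightarrow> 'b::euclidean_space) \<Rightarrow> bool" where
  "Cinf U f \<longleftrightarrow> open U \<and> (\<forall>k. Ck_on k U f)"

named_theorems Cinf_intros

lemma Cinf_open: "Cinf U f \<Longrightarrow> open U"
  by (simp add: Cinf_def)

lemma Cinf_subset: "Cinf U f \<Longrightarrow> V \<subseteq> U \<Longrightarrow> open V \<Longrightarrow> Cinf V f"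
  using Ck_on_subset[of _ U f V] by (simp add: Cinf_def)

lemma Cinf_cong: "Cinf U f \<Longrightarrow> (\<And>x. x \<in> U \<Longrightarrow> f x = g x) \<Longrightarrow> Cinf U g"
  using Ck_on_cong_imp[of U f g] by (simp add: Cinf_def)

lemma Cinf_has_derivative: "Cinf U f \<Longrightarrow> x \<in> U \<Longrightarrow> (f has_derivative frechet_derivative f (at x)) (at x)"
  using Ck_on_SucD[of 0 U f x] by (simp add: Cinf_def del: Ck_on.simps)

lemma Cinf_differentiable: "Cinf U f \<Longrightarrow> x \<in> U \<Longrightarrow> f differentiable at x"
  using Cinf_has_derivative by (auto simp: differentiable_def)

lemma Cinf_continuous_on: "Cinf U f \<Longrightarrow> continuous_on U f"
  using Ck_on.simps(1)[of U f] by (simp add: Cinf_def del: Ck_on.simps)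

lemma Cinf_frechet: "Cinf U f \<Longrightarrow> Cinf U (\<lambda>x. frechet_derivative f (at x) v)"
  using Ck_on_deriv[of _ U f v] by (simp add: Cinf_def del: Ck_on.simps)

lemma CinfI_deriv:
  assumes "open U" "\<And>x. x \<in> U \<Longrightarrow> (f has_derivative f' x) (at x)" "\<And>v. Cinf U (\<lambda>x. f' x v)"
  shows "Cinf U f"
  unfolding Cinf_def
proof (intro conjI allI)
  fix k
  have "Ck_on (Suc k) U f" using Ck_on_Suc[OF assms(1,2)] assms(3) by (auto simp: Cinf_def)
  then show "Ck_on k U f" by (rule Ck_on_decr)
qed (rule assms(1))

lemma Cinf_const [Cinf_intros]: "open U \<Longrightarrow> Cinf U (\<lambda>x. c)"
  by (simp add: Cinf_def Ck_on_const)

lemma Cinf_bounded_linear: "open U \<Longrightarrow> bounded_linear L \<Longrightarrow> Cinf U L"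
  by (simp add: Cinf_def Ck_on_bounded_linear)

lemma Cinf_ident [Cinf_intros]: "open U \<Longrightarrow> Cinf U (\<lambda>x. x)"
  by (simp add: Cinf_bounded_linear bounded_linear_ident)

lemma Cinf_bilinear: "bounded_bilinear p \<Longrightarrow> Cinf U f \<Longrightarrow> Cinf U g \<Longrightarrow> Cinf U (\<lambda>x. p (f x) (g x))"
  using Ck_on_bilinear(1)[of p U _ f g] by (simp add: Cinf_def)

lemma Cinf_compose: "Cinf V g \<Longrightarrow> Cinf U f \<Longrightarrow> f ` U \<subseteq> V \<Longrightarrow> Cinf U (\<lambda>x. g (f x))"
  using Ck_on_compose[of U V _ g f] by (simp add: Cinf_def)

lemma Cinf_linear_compose: "bounded_linear L \<Longrightarrow> Cinf U f \<Longrightarrow> Cinf U (\<lambda>x. L (f x))"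
  by (rule Cinf_compose[OF Cinf_bounded_linear[OF open_UNIV]]) auto

lemma Cinf_add [Cinf_intros]: "Cinf U f \<Longrightarrow> Cinf U g \<Longrightarrow> Cinf U (\<lambda>x. f x + g x)"
  using Ck_on_add[of U _ f g] by (simp add: Cinf_def)

lemmas Cinf_scaleR [Cinf_intros] = Cinf_bilinear[OF bounded_bilinear_scaleR]
lemmas Cinf_inner [Cinf_intros] = Cinf_bilinear[OF bounded_bilinear_inner]

lemma Cinf_mult [Cinf_intros]:
  fixes f g :: "'a::euclidean_space \<Rightarrow> 'b::{euclidean_space, real_normed_algebra}"
  shows "Cinf U f \<Longrightarrow> Cinf U g \<Longrightarrow> Cinf U (\<lambda>x. f x * g x)"
  by (rule Cinf_bilinear[OF bounded_bilinear_mult])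

lemma Cinf_minus [Cinf_intros]: "Cinf U f \<Longrightarrow> Cinf U (\<lambda>x. - f x)"
  by (rule Cinf_linear_compose[OF bounded_linear_minus[OF bounded_linear_ident]])

lemma Cinf_diff [Cinf_intros]: "Cinf U f \<Longrightarrow> Cinf U g \<Longrightarrow> Cinf U (\<lambda>x. f x - g x)"
  unfolding diff_conv_add_uminus by (intro Cinf_add Cinf_minus)

lemma Cinf_sum [Cinf_intros]:
  "open U \<Longrightarrow> (\<And>i. i \<in> I \<Longrightarrow> Cinf U (f i)) \<Longrightarrow> Cinf U (\<lambda>x. \<Sum>i\<in>I. f i x)"
  using Ck_on_sum[of U I _ f] by (simp add: Cinf_def)

lemma Cinf_power [Cinf_intros]:
  fixes f :: "'a::euclidean_space \<Rightarrow> 'b::{euclidean_space, real_normed_algebra_1}"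
  shows "Cinf U f \<Longrightarrow> Cinf U (\<lambda>x. f x ^ n)"
  by (induction n) (simp_all add: Cinf_const Cinf_open Cinf_mult)

lemma Cinf_inverse [Cinf_intros]:
  fixes f :: "'a::euclidean_space \<Rightarrow> real"
  assumes "Cinf U f" "\<And>x. x \<in> U \<Longrightarrow> f x \<noteq> 0"
  shows "Cinf U (\<lambda>x. inverse (f x))"
  by (rule Cinf_compose[where V = "- {0}"]) (use assms in \<open>auto simp: Cinf_def Ck_on_inverse open_Compl\<close>)

lemma Cinf_divide_real [Cinf_intros]:
  fixes f :: "'a::euclidean_space \<Rightarrow> real"
  assumes "Cinf U f" "Cinf U g" "\<And>x. x \<in> U \<Longrightarrow> g x \<noteq> 0"
  shows "Cinf U (\<lambda>x. f x / g x)"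
  unfolding divide_inverse by (intro Cinf_intros assms)

lemma Cinf_sqrt [Cinf_intros]:
  fixes f :: "'a::euclidean_space \<Rightarrow> real"
  assumes "Cinf U f" "\<And>x. x \<in> U \<Longrightarrow> f x > 0"
  shows "Cinf U (\<lambda>x. sqrt (f x))"
  by (rule Cinf_compose[where V = "{0<..}"]) (use assms in \<open>auto simp: Cinf_def Ck_on_sqrt\<close>)

lemmas Cinf_Re [Cinf_intros] = Cinf_linear_compose[OF bounded_linear_Re]
lemmas Cinf_Im [Cinf_intros] = Cinf_linear_compose[OF bounded_linear_Im]
lemmas Cinf_cnj [Cinf_intros] = Cinf_linear_compose[OF bounded_linear_cnj]
lemmas Cinf_vec_nth [Cinf_intros] = Cinf_linear_compose[OF bounded_linear_vec_nth]
lemmas Cinf_fst [Cinf_intros] = Cinf_linear_compose[OF bounded_linear_fst]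
lemmas Cinf_snd [Cinf_intros] = Cinf_linear_compose[OF bounded_linear_snd]

lemma Cinf_of_real [Cinf_intros]: "Cinf U f \<Longrightarrow> Cinf U (\<lambda>x. complex_of_real (f x))"
  by (rule Cinf_linear_compose[OF bounded_linear_of_real])

lemma Cinf_Complex [Cinf_intros]: "Cinf U f \<Longrightarrow> Cinf U g \<Longrightarrow> Cinf U (\<lambda>x. Complex (f x) (g x))"
  unfolding Complex_eq by (intro Cinf_add Cinf_mult Cinf_const Cinf_of_real Cinf_open)

lemma Cinf_Pair [Cinf_intros]: 
  assumes "Cinf U f" "Cinf U g" shows "Cinf U (\<lambda>x. (f x, g x))"
proof -
  have "Cinf U (\<lambda>x. (f x, 0) + (0, g x))"
    by (intro Cinf_add Cinf_linear_compose[OF _ assms(1), where L = "\<lambda>y. (y, 0)"]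
        Cinf_linear_compose[OF _ assms(2), where L = "\<lambda>y. (0, y)"] bounded_linear_Pair
        bounded_linear_ident bounded_linear_zero)
  then show ?thesis by simp
qed

lemma Cinf_sin_cos:
  shows "Cinf UNIV (sin :: real \<Rightarrow> real)" "Cinf UNIV (cos :: real \<Rightarrow> real)"
proof -
  have "Ck_on k UNIV (sin :: real \<Rightarrow> real) \<and> Ck_on k UNIV (cos :: real \<Rightarrow> real)" for k
  proof (induction k)
    case 0
    then show ?case by (auto intro!: continuous_intros)
  next
    case (Suc k)
    have "Ck_on (Suc k) UNIV (sin :: real \<Rightarrow> real)"
    proof (rule Ck_on_Suc)
      show "(sin has_derivative (\<lambda>v. v *\<^sub>R cos x)) (at x)" for x :: real
        by (auto intro!: derivative_eq_intros)
      show "Ck_on k UNIV (\<lambda>x::real. v *\<^sub>R cos x)" for v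
        by (rule Ck_on_scaleR[OF open_UNIV Ck_on_const]) (use Suc in simp)
    qed simp
    moreover have "Ck_on (Suc k) UNIV (cos :: real \<Rightarrow> real)"
    proof (rule Ck_on_Suc)
      show "(cos has_derivative (\<lambda>v. (- v) *\<^sub>R sin x)) (at x)" for x :: real
        by (auto intro!: derivative_eq_intros)
      show "Ck_on k UNIV (\<lambda>x::real. (- v) *\<^sub>R sin x)" for v
        by (rule Ck_on_scaleR[OF open_UNIV Ck_on_const]) (use Suc in simp)
    qed simp
    ultimately show ?case by simp
  qed
  then show "Cinf UNIV (sin :: real \<Rightarrow> real)" "Cinf UNIV (cos :: real \<Rightarrow> real)"
    by (auto simp: Cinf_def)
qed

lemma Cinf_sin [Cinf_intros]: "Cinf U f \<Longrightarrow> Cinf U (\<lambda>x. sin (f x :: real))"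
  by (rule Cinf_compose[OF Cinf_sin_cos(1)]) auto

lemma Cinf_cos [Cinf_intros]: "Cinf U f \<Longrightarrow> Cinf U (\<lambda>x. cos (f x :: real))"
  by (rule Cinf_compose[OF Cinf_sin_cos(2)]) auto

section \<open>Smoothness on arbitrary sets and diffeomorphisms\<close>

lemma Cinf_imp_smooth_on: "Cinf U f \<Longrightarrow> S \<subseteq> U \<Longrightarrow> smooth_on S f"
  unfolding smooth_on_def Cinf_def by blast

lemma smooth_on_cong: "smooth_on S f \<Longrightarrow> (\<And>x. x \<in> S \<Longrightarrow> f x = g x) \<Longrightarrow> smooth_on S g"
  unfolding smooth_on_def by (metis IntE)

text \<open>On an open set each local extension coincides with the function near the point in
  question, and \<open>Ck_on\<close> is a local condition.\<close>

lemma smooth_on_open_iff: "open U \<Longrightarrow> smooth_on U f \<longleftrightarrow> Cinf U f"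
proof
  assume U: "open U" and sm: "smooth_on U f"
  show "Cinf U f"
    unfolding Cinf_def
  proof (intro conjI allI U Ck_on_local)
    fix k x assume "x \<in> U"
    then obtain V g where V: "open V" "x \<in> V" "\<forall>k. Ck_on k V g" "\<forall>y\<in>U \<inter> V. g y = f y"
      using sm unfolding smooth_on_def by meson
    have "Ck_on k (U \<inter> V) f"
      by (rule Ck_on_cong_imp[where f = g]) (use U V in \<open>auto intro: Ck_on_subset\<close>)
    then show "\<exists>V. open V \<and> x \<in> V \<and> Ck_on k V f"
      using U V \<open>x \<in> U\<close> by (intro exI[of _ "U \<inter> V"]) auto
  qed
qed (auto intro: Cinf_imp_smooth_on)

lemma smooth_on_compose:
  assumes f: "smooth_on S f" and g: "smooth_on T g" and "f ` S \<subseteq> T"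
  shows "smooth_on S (\<lambda>x. g (f x))"
  unfolding smooth_on_def
proof
  fix x assume x: "x \<in> S"
  then obtain U f1 where U: "Cinf U f1" "x \<in> U" "\<forall>y\<in>S \<inter> U. f1 y = f y"
    using f unfolding smooth_on_def Cinf_def by meson
  have "f x \<in> T" using x assms(3) by auto
  then obtain V g1 where V: "Cinf V g1" "f x \<in> V" "\<forall>y\<in>T \<inter> V. g1 y = g y"
    using g unfolding smooth_on_def Cinf_def by meson
  define O1 where "O1 = U \<inter> f1 -` V"
  have O1: "open O1"
    unfolding O1_def
    by (rule continuous_open_preimage[OF Cinf_continuous_on[OF U(1)] Cinf_open[OF U(1)] Cinf_open[OF V(1)]])
  have "Cinf O1 (\<lambda>y. g1 (f1 y))"
    by (rule Cinf_compose[OF V(1) Cinf_subset[OF U(1) _ O1]]) (auto simp: O1_def)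
  then show "\<exists>U h. open U \<and> x \<in> U \<and> (\<forall>k. Ck_on k U h) \<and> (\<forall>y\<in>S \<inter> U. h y = g (f y))"
    using x U V assms(3)
    unfolding Cinf_def using x U V assms(3)
    by (intro exI[of _ O1] exI[of _ "\<lambda>y. g1 (f1 y)"] conjI ballI) (auto simp: O1_def)
qed

lemma smooth_on_subset: "smooth_on S f \<Longrightarrow> T \<subseteq> S \<Longrightarrow> smooth_on T f"
  unfolding smooth_on_def
proof
  fix x assume S: "\<forall>x\<in>S. \<exists>U g. open U \<and> x \<in> U \<and> (\<forall>k. Ck_on k U g) \<and> (\<forall>y\<in>S \<inter> U. g y = f y)" "T \<subseteq> S" "x \<in> T"
  then obtain U g where U: "open U" "x \<in> U" "\<forall>k. Ck_on k U g" "\<forall>y\<in>S \<inter> U. g y = f y" by (meson subsetD)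
  moreover have "\<forall>y\<in>T \<inter> U. g y = f y" using U(4) S(2) by blast
  ultimately show "\<exists>U g. open U \<and> x \<in> U \<and> (\<forall>k. Ck_on k U g) \<and> (\<forall>y\<in>T \<inter> U. g y = f y)"
    by (intro exI[of _ U] exI[of _ g] conjI)
qed

lemma diffeomorphicI:
  "homeomorphism S T f g \<Longrightarrow> smooth_on S f \<Longrightarrow> smooth_on T g \<Longrightarrow> diffeomorphic S T"
  unfolding diffeomorphic_def diffeomorphism_def by (rule exI, rule exI) simp

lemma diffeomorphic_sym: "diffeomorphic S T \<Longrightarrow> diffeomorphic T S"
proof -
  assume "diffeomorphic S T"
  then obtain f g where "diffeomorphism S T f g" unfolding diffeomorphic_def by blast
  then have "diffeomorphism T S g f" unfolding diffeomorphism_def using homeomorphism_symD by blast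
  then show ?thesis unfolding diffeomorphic_def by (intro exI)
qed

lemma diffeomorphic_trans: "diffeomorphic S T \<Longrightarrow> diffeomorphic T V \<Longrightarrow> diffeomorphic S V"
proof -
  assume "diffeomorphic S T" "diffeomorphic T V"
  then obtain f g f' g' where h: "homeomorphism S T f g" "homeomorphism T V f' g'"
    and s: "smooth_on S f" "smooth_on T g" "smooth_on T f'" "smooth_on V g'"
    by (auto simp: diffeomorphic_def diffeomorphism_def)
  have "smooth_on S (f' \<circ> f)" "smooth_on V (g \<circ> g')"
    using smooth_on_compose[OF s(1,3)] smooth_on_compose[OF s(4,2)] h
    by (auto simp: homeomorphism_def o_def)
  with homeomorphism_compose[OF h] show ?thesis
    unfolding diffeomorphic_def diffeomorphism_def by blast
qed

text \<open>Two radial maps, acting on squared norms as s / (1 + s) and s / (1 - s), which are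
  mutually inverse.\<close>

lemma diffeomorphic_UNIV_ball: "diffeomorphic (UNIV :: 'a::euclidean_space set) (ball (0 :: 'a) 1)"
proof -
  define f :: "'a \<Rightarrow> 'a" where "f x = inverse (sqrt (1 + x \<bullet> x)) *\<^sub>R x" for x
  define g :: "'a \<Rightarrow> 'a" where "g x = inverse (sqrt (1 - x \<bullet> x)) *\<^sub>R x" for x
  have pos: "1 + x \<bullet> x > 0" for x :: 'a by (simp add: add_pos_nonneg)
  have pos': "1 - x \<bullet> x > 0" if "x \<in> ball 0 1" for x :: 'a
    using that by (simp add: dot_square_norm abs_square_less_1)
  have Cf: "Cinf UNIV f"
    unfolding f_def using pos by (intro Cinf_intros) (auto simp: less_imp_neq[symmetric])
  have Cg: "Cinf (ball 0 1) g"
    unfolding g_def using pos' by (intro Cinf_intros) (auto simp: less_imp_neq[symmetric])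
  have ff: "f x \<bullet> f x = (x \<bullet> x) / (1 + x \<bullet> x)" for x
    using pos[of x] by (simp add: f_def field_simps power2_eq_square[symmetric] real_sqrt_pow2)
  have gg: "g x \<bullet> g x = (x \<bullet> x) / (1 - x \<bullet> x)" if "x \<in> ball 0 1" for x
    using pos'[OF that] by (simp add: g_def field_simps power2_eq_square[symmetric] real_sqrt_pow2)
  have fball: "f x \<in> ball 0 1" for x
  proof -
    have "f x \<bullet> f x < 1" using pos[of x] by (simp add: ff)
    then show ?thesis by (simp add: dot_square_norm abs_square_less_1)
  qed
  have gf: "g (f x) = x" for x
  proof -
    have "1 - f x \<bullet> f x = inverse (1 + x \<bullet> x)" using pos[of x] by (simp add: ff field_simps)
    then have "inverse (sqrt (1 - f x \<bullet> f x)) = sqrt (1 + x \<bullet> x)" by (simp only: real_sqrt_inverse inverse_inverse_eq)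
    then have "g (f x) = sqrt (1 + x \<bullet> x) *\<^sub>R f x" by (simp only: g_def[of "f x"])
    also have "\<dots> = x" using pos[of x] by (simp add: f_def less_imp_neq[symmetric])
    finally show ?thesis .
  qed
  have fg: "f (g x) = x" if "x \<in> ball 0 1" for x
  proof -
    have "1 + g x \<bullet> g x = inverse (1 - x \<bullet> x)" using pos'[OF that] by (simp add: gg[OF that] field_simps)
    then have "inverse (sqrt (1 + g x \<bullet> g x)) = sqrt (1 - x \<bullet> x)" by (simp only: real_sqrt_inverse inverse_inverse_eq)
    then have "f (g x) = sqrt (1 - x \<bullet> x) *\<^sub>R g x" by (simp only: f_def[of "g x"])
    also have "\<dots> = x" using pos'[OF that] by (simp add: g_def less_imp_neq[symmetric])
    finally show ?thesis .
  qed
  have "homeomorphism UNIV (ball 0 1) f g"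
    by (rule homeomorphismI) (use Cinf_continuous_on[OF Cf] Cinf_continuous_on[OF Cg] fball gf fg in auto)
  then show ?thesis
    by (rule diffeomorphicI) (rule Cinf_imp_smooth_on[OF Cf order_refl] Cinf_imp_smooth_on[OF Cg order_refl])+
qed

section \<open>Tangent spaces of straightened sets\<close>

lemma Cinf_real_curve:
  assumes "open (T :: real set)"
  shows "Cinf T (\<lambda>t. a + t *\<^sub>R b)"
  using assms by (intro Cinf_intros)

text \<open>The difference quotients lie in the subspace, which is closed.\<close>

lemma has_vector_derivative_in_subspace:
  fixes g :: "real \<Rightarrow> 'a::euclidean_space"
  assumes g: "(g has_vector_derivative w) (at 0)" and L: "subspace L"
    and e: "0 < e" "\<And>t. \<bar>t\<bar> < e \<Longrightarrow> g t \<in> L"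
  shows "w \<in> L"
proof (rule Lim_in_closed_set)
  show "closed L" using L by (rule closed_subspace)
  have "(g has_derivative (\<lambda>h. h *\<^sub>R w)) (at 0)" using g by (simp add: has_vector_derivative_def)
  then have "((\<lambda>h. norm (g (0 + h) - g 0 - h *\<^sub>R w) / norm h) \<longlongrightarrow> 0) (at 0)"
    by (simp add: has_derivative_at)
  then have "((\<lambda>h. norm ((g h - g 0) /\<^sub>R h - w)) \<longlongrightarrow> 0) (at 0)"
  proof (rule Lim_transform_eventually)
    show "\<forall>\<^sub>F h in at 0. norm (g (0 + h) - g 0 - h *\<^sub>R w) / norm h = norm ((g h - g 0) /\<^sub>R h - w)"
      unfolding eventually_at_filter
    proof (rule always_eventually, intro allI impI)
      fix h :: real assume "h \<noteq> 0"
      then have "(g h - g 0) /\<^sub>R h - w = (g h - g 0 - h *\<^sub>R w) /\<^sub>R h" by (simp add: algebra_simps)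
      then show "norm (g (0 + h) - g 0 - h *\<^sub>R w) / norm h = norm ((g h - g 0) /\<^sub>R h - w)"
        by (simp add: divide_inverse_commute)
    qed
  qed
  then show "((\<lambda>h. (g h - g 0) /\<^sub>R h) \<longlongrightarrow> w) (at 0)"
    using tendsto_norm_zero_iff LIM_zero_iff by blast
  show "\<forall>\<^sub>F h in at 0. (g h - g 0) /\<^sub>R h \<in> L"
    unfolding eventually_at
  proof (intro exI[of _ e] conjI e ballI impI)
    fix h :: real assume "h \<noteq> 0 \<and> dist h 0 < e"
    then have "g h \<in> L" "g 0 \<in> L" using e by (auto simp: dist_real_def)
    then show "(g h - g 0) /\<^sub>R h \<in> L" using L by (simp add: subspace_diff subspace_mul)
  qed
qed (rule trivial_limit_at)

text \<open>Bounds a tangent space from above by a defining function, and permits tangency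
  conditions on vector fields to be differentiated along the set.\<close>

lemma tangent_space_const:
  assumes "v \<in> tangent_space S p" "(f has_derivative f') (at p)" "\<And>x. x \<in> S \<Longrightarrow> f x = (0 :: 'b::euclidean_space)"
  shows "f' v = 0"
proof -
  obtain \<gamma> e where \<gamma>: "0 < e" "\<gamma> ` {-e<..<e} \<subseteq> S" "\<gamma> 0 = p" "(\<gamma> has_vector_derivative v) (at 0)"
    using assms(1) unfolding tangent_space_def by blast
  have "((\<lambda>t. f (\<gamma> t)) has_vector_derivative f' v) (at 0)"
    using vector_derivative_diff_chain_within[of \<gamma> v 0 UNIV f f'] \<gamma>(3,4) assms(2)
    by (simp add: o_def has_derivative_at_withinI)
  then have "f' v \<in> {0}"
  proof (rule has_vector_derivative_in_subspace)
    show "f (\<gamma> t) \<in> {0}" if "\<bar>t\<bar> < e" for t using that \<gamma>(2) assms(3) by (simp add: image_subset_iff abs_less_iff)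
  qed (use \<gamma>(1) in auto)
  then show ?thesis by simp
qed

lemma tangent_space_curve:
  assumes "0 < e" "Cinf {-e<..<e} \<gamma>" "\<gamma> ` {-e<..<e} \<subseteq> S" "\<gamma> 0 = p" "(\<gamma> has_vector_derivative v) (at 0)"
  shows "v \<in> tangent_space S p"
proof -
  have "smooth_on {-e<..<e} \<gamma>" by (rule Cinf_imp_smooth_on[OF assms(2) order_refl])
  then show ?thesis unfolding tangent_space_def using assms by blast
qed

lemma tangent_space_mono: "S \<subseteq> T \<Longrightarrow> tangent_space S p \<subseteq> tangent_space T p"
  unfolding tangent_space_def by blast

lemma tangent_space_open_Int:
  assumes U: "open U" "p \<in> U"
  shows "tangent_space (S \<inter> U) p = tangent_space S p"
proof
  show "tangent_space (S \<inter> U) p \<subseteq> tangent_space S p" by (rule tangent_space_mono) auto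
  show "tangent_space S p \<subseteq> tangent_space (S \<inter> U) p"
  proof
    fix v assume "v \<in> tangent_space S p"
    then obtain \<gamma> e where \<gamma>: "0 < e" "smooth_on {-e<..<e} \<gamma>" "\<gamma> ` {-e<..<e} \<subseteq> S" "\<gamma> 0 = p" "(\<gamma> has_vector_derivative v) (at 0)"
      unfolding tangent_space_def by blast
    have "continuous (at 0) \<gamma>" using \<gamma>(5) has_vector_derivative_continuous by blast
    then obtain O1 where O1: "open O1" "0 \<in> O1" "\<forall>t\<in>O1. \<gamma> t \<in> U"
      using U \<gamma>(4) unfolding continuous_at_open by metis
    then obtain d where "0 < d" "ball 0 d \<subseteq> O1" using openE by blast
    then have d: "0 < d" "\<And>t. dist t 0 < d \<Longrightarrow> \<gamma> t \<in> U" using O1(3) by (auto simp: subset_eq dist_commute)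
    define r where "r = min d e"
    have r: "0 < r" "r \<le> e" using d \<gamma> by (auto simp: r_def)
    have "smooth_on {-r<..<r} \<gamma>" by (rule smooth_on_subset[OF \<gamma>(2)]) (use r in auto)
    moreover have "\<gamma> ` {-r<..<r} \<subseteq> S \<inter> U"
    proof
      fix y assume "y \<in> \<gamma> ` {-r<..<r}"
      then obtain t where t: "y = \<gamma> t" "-r < t" "t < r" by auto
      then have "t \<in> {-e<..<e}" "dist t 0 < d" by (auto simp: r_def dist_real_def)
      then show "y \<in> S \<inter> U" using t d(2) \<gamma>(3) by blast
    qed
    ultimately show "v \<in> tangent_space (S \<inter> U) p"
      unfolding tangent_space_def using r \<gamma>(4,5) by blast
  qed
qed

text \<open>One global chart instead of the pointwise charts of \<open>smooth_submanifold\<close>: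
  both manifolds are graphs, so a single map straightens each of them.\<close>

locale straightening =
  fixes U V :: "'a::euclidean_space set" and \<phi> \<psi> :: "'a \<Rightarrow> 'a" and L S :: "'a set"
  assumes diffeo: "Cinf U \<phi>" "Cinf V \<psi>" "\<phi> ` U \<subseteq> V" "\<psi> ` V \<subseteq> U"
      "\<And>x. x \<in> U \<Longrightarrow> \<psi> (\<phi> x) = x" "\<And>y. y \<in> V \<Longrightarrow> \<phi> (\<psi> y) = y"
    and L: "subspace L" and S: "S = {x \<in> U. \<phi> x \<in> L}"
begin

lemma diffeomorphism_UV: "diffeomorphism U V \<phi> \<psi>"
  unfolding diffeomorphism_def
proof (intro conjI homeomorphismI)
  show "smooth_on U \<phi>" "smooth_on V \<psi>" using diffeo by (auto intro: Cinf_imp_smooth_on)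
qed (use diffeo Cinf_continuous_on in auto)

lemma submanifold: "smooth_submanifold (dim L) S"
  unfolding smooth_submanifold_def
proof
  fix p assume "p \<in> S"
  then have p: "p \<in> U" by (simp add: S)
  have im: "\<phi> ` (S \<inter> U) = L \<inter> V"
  proof
    show "L \<inter> V \<subseteq> \<phi> ` (S \<inter> U)"
    proof
      fix y assume y: "y \<in> L \<inter> V"
      then have "\<psi> y \<in> S \<inter> U" "y = \<phi> (\<psi> y)" using diffeo S by auto
      then show "y \<in> \<phi> ` (S \<inter> U)" by blast
    qed
  qed (use S diffeo in auto)
  show "\<exists>U V \<phi> \<psi> L'. open U \<and> p \<in> U \<and> open (V :: 'a set) \<and> diffeomorphism U V \<phi> \<psi> \<and> subspace L' \<and>
      dim L' = dim L \<and> \<phi> ` (S \<inter> U) = L' \<inter> V"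
    by (rule exI[of _ U], rule exI[of _ V], rule exI[of _ \<phi>], rule exI[of _ \<psi>], rule exI[of _ L])
      (simp only: diffeomorphism_UV L Cinf_open[OF diffeo(1)] Cinf_open[OF diffeo(2)] p im simp_thms)
qed

lemma inverse_derivative:
  assumes "p \<in> U" "(\<phi> has_derivative \<phi>') (at p)" "(\<psi> has_derivative \<psi>') (at (\<phi> p))"
  shows "\<psi>' (\<phi>' v) = v" "\<phi>' (\<psi>' v) = v"
proof -
  have U: "open U" "open V" "\<phi> p \<in> V" using diffeo assms(1) Cinf_open by auto
  have "((\<lambda>x. \<psi> (\<phi> x)) has_derivative (\<lambda>v. \<psi>' (\<phi>' v))) (at p)"
    by (rule has_derivative_compose[OF assms(2,3)])
  then have "((\<lambda>x. x) has_derivative (\<lambda>v. \<psi>' (\<phi>' v))) (at p)"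
    by (rule has_derivative_transform_within_open[OF _ U(1) assms(1)]) (use diffeo in auto)
  then have "(\<lambda>v. \<psi>' (\<phi>' v)) = (\<lambda>x. x)" by (rule has_derivative_unique[OF _ has_derivative_ident])
  from fun_cong[OF this, of v] show "\<psi>' (\<phi>' v) = v" by simp
  have "((\<lambda>x. \<phi> (\<psi> x)) has_derivative (\<lambda>v. \<phi>' (\<psi>' v))) (at (\<phi> p))"
    by (rule has_derivative_compose[OF assms(3)]) (use assms diffeo in auto)
  then have "((\<lambda>x. x) has_derivative (\<lambda>v. \<phi>' (\<psi>' v))) (at (\<phi> p))"
    by (rule has_derivative_transform_within_open[OF _ U(2,3)]) (use diffeo in auto)
  then have "(\<lambda>v. \<phi>' (\<psi>' v)) = (\<lambda>x. x)" by (rule has_derivative_unique[OF _ has_derivative_ident])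
  from fun_cong[OF this, of v] show "\<phi>' (\<psi>' v) = v" by simp
qed

text \<open>The chart maps curves in \<open>S\<close> into \<open>L\<close>; conversely,
  \<open>\<psi>\<close> carries straight segments of \<open>L\<close> back to curves in
  \<open>S\<close>.\<close>

lemma tangent_space_eq:
  assumes p: "p \<in> S" and der: "(\<phi> has_derivative \<phi>') (at p)"
  shows "tangent_space S p = {v. \<phi>' v \<in> L}"
proof (intro equalityI subsetI CollectI)
  fix v assume "v \<in> tangent_space S p"
  then obtain \<gamma> e where \<gamma>: "0 < e" "\<gamma> ` {-e<..<e} \<subseteq> S" "\<gamma> 0 = p" "(\<gamma> has_vector_derivative v) (at 0)"
    unfolding tangent_space_def by blast
  have "((\<lambda>t. \<phi> (\<gamma> t)) has_vector_derivative \<phi>' v) (at 0)"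
    using vector_derivative_diff_chain_within[of \<gamma> v 0 UNIV \<phi> \<phi>'] \<gamma>(3,4) der
    by (simp add: o_def has_derivative_at_withinI)
  then show "\<phi>' v \<in> L"
  proof (rule has_vector_derivative_in_subspace[OF _ L \<gamma>(1)])
    show "\<phi> (\<gamma> t) \<in> L" if "\<bar>t\<bar> < e" for t
    proof -
      have "t \<in> {-e<..<e}" using that by auto
      then show ?thesis using \<gamma>(2) S by blast
    qed
  qed
next
  fix v assume "v \<in> {v. \<phi>' v \<in> L}"
  then have v: "\<phi>' v \<in> L" by simp
  have U: "open U" "open V" "p \<in> U" "\<phi> p \<in> V" "\<phi> p \<in> L" using diffeo p S Cinf_open by auto
  obtain \<psi>' where \<psi>': "(\<psi> has_derivative \<psi>') (at (\<phi> p))" using Cinf_has_derivative[OF diffeo(2) U(4)] by blast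
  define l where "l t = \<phi> p + t *\<^sub>R \<phi>' v" for t :: real
  have lc: "Cinf UNIV l" unfolding l_def by (rule Cinf_real_curve) simp
  have lop: "open (l -` V)" using open_vimage[OF U(2)] Cinf_continuous_on[OF lc] by blast
  have "0 \<in> l -` V" using U by (simp add: l_def)
  then obtain e where e: "e > 0" "ball 0 e \<subseteq> l -` V" using lop openE by blast
  show "v \<in> tangent_space S p"
  proof (rule tangent_space_curve[OF e(1)])
    show "Cinf {-e<..<e} (\<lambda>t. \<psi> (l t))"
      by (rule Cinf_compose[OF diffeo(2) Cinf_subset[OF lc]]) (use e in \<open>auto simp: dist_real_def subset_eq\<close>)
    show "(\<lambda>t. \<psi> (l t)) ` {-e<..<e} \<subseteq> S"
    proof clarsimp
      fix t assume "- e < t" "t < e"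
      then have t: "l t \<in> V" using e(2) by (auto simp: subset_eq dist_real_def)
      moreover have "l t \<in> L" unfolding l_def using U(5) v L by (simp add: subspace_add subspace_mul)
      ultimately show "\<psi> (l t) \<in> S" using diffeo by (auto simp: S)
    qed
    show "\<psi> (l 0) = p" using diffeo(5) U by (simp add: l_def)
    have "(l has_vector_derivative \<phi>' v) (at 0)" unfolding l_def by (auto intro!: derivative_eq_intros)
    moreover have "l 0 = \<phi> p" by (simp add: l_def)
    ultimately have "((\<lambda>t. \<psi> (l t)) has_vector_derivative \<psi>' (\<phi>' v)) (at 0)"
      using vector_derivative_diff_chain_within[of l "\<phi>' v" 0 UNIV \<psi> \<psi>'] \<psi>'
      by (simp add: o_def has_derivative_at_withinI)
    then show "((\<lambda>t. \<psi> (l t)) has_vector_derivative v) (at 0)"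
      using inverse_derivative(1)[OF U(3) der \<psi>'] by simp
  qed
qed

lemma tangent_space_subspace:
  assumes p: "p \<in> S"
  shows "subspace (tangent_space S p)" "dim (tangent_space S p) = dim L"
proof -
  have U: "p \<in> U" "\<phi> p \<in> V" using p S diffeo by auto
  obtain \<phi>' \<psi>' where der: "(\<phi> has_derivative \<phi>') (at p)" "(\<psi> has_derivative \<psi>') (at (\<phi> p))"
    using Cinf_has_derivative[OF diffeo(1) U(1)] Cinf_has_derivative[OF diffeo(2) U(2)] by blast
  note inv = inverse_derivative[OF U(1) der]
  have lin: "linear \<phi>'" "linear \<psi>'" using der has_derivative_linear by blast+
  have eq: "tangent_space S p = \<psi>' ` L"
    unfolding tangent_space_eq[OF p der(1)] using inv by (auto simp: image_iff) metis
  show "subspace (tangent_space S p)" unfolding eq by (rule linear_subspace_image[OF lin(2) L])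
  have "inj \<psi>'" using inv(2) by (rule inj_on_inverseI)
  then show "dim (tangent_space S p) = dim L"
    unfolding eq by (intro dim_image_eq[OF lin(2)]) (auto intro: inj_on_subset)
qed

end

section \<open>Strict differentiability\<close>

text \<open>The mean value inequality for \<open>f\<close> minus its linear part at
  \<open>x0\<close>: the finitely many partial derivatives are continuous, so the operator norm of
  the difference of the derivatives is small near \<open>x0\<close>.\<close>

lemma Cinf_strict:
  fixes f :: "'a::euclidean_space \<Rightarrow> 'b::euclidean_space"
  assumes f: "Cinf U f" and x0: "x0 \<in> U" and der: "(f has_derivative f') (at x0)" and e: "0 < e"
  obtains d where "0 < d" "ball x0 d \<subseteq> U"
    "\<And>x y. x \<in> ball x0 d \<Longrightarrow> y \<in> ball x0 d \<Longrightarrow> norm (f x - f y - f' (x - y)) \<le> e * norm (x - y)"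
proof -
  define D where "D x = frechet_derivative f (at x)" for x
  have D: "(f has_derivative D x) (at x)" if "x \<in> U" for x
    unfolding D_def by (rule Cinf_has_derivative[OF f that])
  have f': "f' = D x0" using has_derivative_unique[OF der D[OF x0]] .
  have linD: "linear (D x)" if "x \<in> U" for x using D[OF that] by (rule has_derivative_linear)
  define n where "n = real DIM('a)"
  have n: "n > 0" by (simp add: n_def)
  have "continuous_on U (\<lambda>x. D x b)" for b unfolding D_def by (rule Cinf_continuous_on[OF Cinf_frechet[OF f]])
  then have "continuous_on U (\<lambda>x. \<Sum>b\<in>Basis. norm (D x b - D x0 b))"
    by (intro continuous_intros)
  then have "isCont (\<lambda>x. \<Sum>b\<in>Basis. norm (D x b - D x0 b)) x0"
    using Cinf_open[OF f] x0 continuous_on_eq_continuous_at by blast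
  then obtain d1 where d1: "d1 > 0" "\<And>x. dist x x0 < d1 \<Longrightarrow> (\<Sum>b\<in>Basis. norm (D x b - D x0 b)) < e"
    using e unfolding continuous_at_eps_delta by (fastforce simp: dist_real_def)
  obtain d2 where d2: "d2 > 0" "ball x0 d2 \<subseteq> U" using Cinf_open[OF f] x0 openE by blast
  define d where "d = min d1 d2"
  show thesis
  proof (rule that[of d])
    show "0 < d" "ball x0 d \<subseteq> U" using d1 d2 by (auto simp: d_def)
    fix x y assume xy: "x \<in> ball x0 d" "y \<in> ball x0 d"
    have "norm ((f x - D x0 x) - (f y - D x0 y)) \<le> e * norm (x - y)"
    proof (rule differentiable_bound[OF convex_ball _ _ xy])
      fix z assume z: "z \<in> ball x0 d"
      then have zU: "z \<in> U" using d2 by (auto simp: d_def)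
      show "((\<lambda>x. f x - D x0 x) has_derivative (\<lambda>v. D z v - D x0 v)) (at z within ball x0 d)"
        by (rule has_derivative_at_withinI[OF has_derivative_diff[OF D[OF zU]
              bounded_linear_imp_has_derivative[OF has_derivative_bounded_linear[OF D[OF x0]]]]])
      show "onorm (\<lambda>v. D z v - D x0 v) \<le> e"
      proof (rule onorm_le)
        fix v
        have "(D z - D x0) v = (D z - D x0) (\<Sum>b\<in>Basis. (v \<bullet> b) *\<^sub>R b)" by (simp add: euclidean_representation)
        also have "\<dots> = (\<Sum>b\<in>Basis. (v \<bullet> b) *\<^sub>R (D z - D x0) b)"
          by (simp add: linear_sum[OF linD[OF zU]] linear_sum[OF linD[OF x0]] linear_scale[OF linD[OF zU]]
              linear_scale[OF linD[OF x0]] sum_subtractf scaleR_diff_right)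
        finally have "D z v - D x0 v = (\<Sum>b\<in>Basis. (v \<bullet> b) *\<^sub>R (D z b - D x0 b))" by simp
        then have "norm (D z v - D x0 v) \<le> (\<Sum>b\<in>Basis. norm ((v \<bullet> b) *\<^sub>R (D z b - D x0 b)))"
          by (simp only: norm_sum)
        also have "\<dots> \<le> (\<Sum>b\<in>Basis. norm v * norm (D z b - D x0 b))"
          by (intro sum_mono) (simp add: Basis_le_norm mult_right_mono)
        also have "\<dots> = norm v * (\<Sum>b\<in>Basis. norm (D z b - D x0 b))" by (simp add: sum_distrib_left)
        also have "\<dots> \<le> norm v * e"
          using d1(2)[of z] z by (intro mult_left_mono) (auto simp: d_def dist_commute)
        finally show "norm (D z v - D x0 v) \<le> e * norm v" by (simp add: mult.commute)
      qed
    qed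
    moreover have "(f x - D x0 x) - (f y - D x0 y) = f x - f y - f' (x - y)"
      unfolding f' linear_diff[OF linD[OF x0]] by simp
    ultimately show "norm (f x - f y - f' (x - y)) \<le> e * norm (x - y)" by simp
  qed
qed

section \<open>Holomorphic functions of several variables\<close>

lemma affine_smult_has_derivative:
  "((\<lambda>l. a + l *s b :: complex ^ 'n) has_derivative (\<lambda>l. l *s b)) (at l)"
proof -
  have "bounded_linear (\<lambda>l. l *s b)"
    by (intro linear_conv_bounded_linear[THEN iffD1] linearI)
      (auto simp: vec_eq_iff algebra_simps scaleR_conv_of_real[where 'a = complex])
  then show ?thesis
    using has_derivative_add[OF has_derivative_const bounded_linear_imp_has_derivative] by simp
qed

lemma open_affine_smult:
  assumes "open W"
  shows "open {l. a + l *s b \<in> (W :: (complex ^ 'n) set)}"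
proof -
  have "continuous_on UNIV (\<lambda>l. a + l *s b)"
    using has_derivative_continuous[OF affine_smult_has_derivative] continuous_at_imp_continuous_on by blast
  from open_vimage[OF assms this] show ?thesis by (simp add: vimage_def)
qed

lemma holomorphic_several_line:
  fixes f :: "complex ^ 'n \<Rightarrow> complex"
  assumes "holomorphic_several W f" "open W"
  shows "(\<lambda>l. f (a + l *s b)) holomorphic_on {l. a + l *s b \<in> W}"
  unfolding holomorphic_on_open[OF open_affine_smult[OF assms(2)]]
proof clarify
  fix l assume "a + l *s b \<in> W"
  then obtain D where D: "(f has_derivative D) (at (a + l *s b))" "\<And>c v. D (c *s v) = c * D v"
    using assms unfolding holomorphic_several_def by blast
  have "((\<lambda>l. f (a + l *s b)) has_derivative (\<lambda>m. D (m *s b))) (at l)"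
    by (rule has_derivative_compose[OF affine_smult_has_derivative D(1)])
  also have "(\<lambda>m. D (m *s b)) = (*) (D b)" by (auto simp: D(2) mult.commute)
  finally show "\<exists>f'. ((\<lambda>l. f (a + l *s b)) has_field_derivative f') (at l)"
    unfolding has_field_derivative_def by blast
qed

text \<open>Restriction to the complex line through \<open>a\<close> and \<open>b\<close> reduces
  this to one variable; the slice of the ball is convex, hence connected.\<close>

lemma holomorphic_several_identity_ball:
  fixes f :: "complex ^ 'n \<Rightarrow> complex"
  assumes f: "holomorphic_several (ball c r) f" and a: "a \<in> ball c r"
    and z: "\<forall>\<^sub>F x in nhds a. f x = 0" and b: "b \<in> ball c r"
  shows "f b = 0"
proof -
  define v where "v = b - a"
  define D where "D = {l. a + l *s v \<in> ball c r}"
  have hol: "(\<lambda>l. f (a + l *s v)) holomorphic_on D"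
    unfolding D_def by (rule holomorphic_several_line[OF f open_ball])
  have opD: "open D" unfolding D_def by (rule open_affine_smult[OF open_ball])
  have conv: "(1 - u) *\<^sub>R (a + x *s v) + u *\<^sub>R (a + y *s v) = a + ((1 - u) *\<^sub>R x + u *\<^sub>R y) *s v" for u x y
    by (simp add: vec_eq_iff scaleR_conv_of_real[where 'a = complex] algebra_simps)
  have "convex D"
    unfolding convex_alt
  proof (intro ballI allI impI)
    fix x y u assume xy: "x \<in> D" "y \<in> D" and u: "0 \<le> u \<and> u \<le> (1::real)"
    have "(1 - u) *\<^sub>R (a + x *s v) + u *\<^sub>R (a + y *s v) \<in> ball c r"
      using convex_ball[of c r] xy u unfolding convex_alt D_def by blast
    then show "(1 - u) *\<^sub>R x + u *\<^sub>R y \<in> D" unfolding conv D_def by simp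
  qed
  obtain O1 where O1: "open O1" "a \<in> O1" "\<forall>x\<in>O1. f x = 0" using z unfolding eventually_nhds by blast
  have 0: "0 \<in> D" and 1: "1 \<in> D" using a b by (auto simp: D_def v_def)
  let ?U = "{l. a + l *s v \<in> O1} \<inter> D"
  have opU: "open ?U" by (intro open_Int opD open_affine_smult O1)
  have "f (a + 1 *s v) = 0"
  proof (rule analytic_continuation[OF hol opD convex_connected[OF \<open>convex D\<close>] _ 0 _ _ 1, where U = ?U])
    show "0 islimpt ?U"
      by (rule interior_limit_point, subst interior_open[OF opU]) (use O1(2) 0 in simp)
    show "f (a + l *s v) = 0" if "l \<in> ?U" for l using that O1(3) by blast
  qed auto
  then show ?thesis by (simp add: v_def)
qed

text \<open>The set of points near which \<open>f\<close> vanishes is open, and closed in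
  \<open>W\<close> by the result for balls.\<close>

lemma holomorphic_several_identity:
  fixes f :: "complex ^ 'n \<Rightarrow> complex"
  assumes f: "holomorphic_several W f" and W: "open W" "connected W"
    and a: "a \<in> W" "\<forall>\<^sub>F x in nhds a. f x = 0" and b: "b \<in> W"
  shows "f b = 0"
proof -
  define Z where "Z = {x \<in> W. \<forall>\<^sub>F y in nhds x. f y = 0}"
  have near: "\<forall>\<^sub>F y in nhds x. f y = 0" if "x \<in> W" "ball x r \<subseteq> W" "r > 0" "z \<in> ball x r" "z \<in> Z" for x r z
  proof -
    have "holomorphic_several (ball x r) f" using f that(2) unfolding holomorphic_several_def by blast
    then have "f y = 0" if "y \<in> ball x r" for y
      using holomorphic_several_identity_ball[of x r f z y] that \<open>z \<in> ball x r\<close> \<open>z \<in> Z\<close> by (auto simp: Z_def)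
    then show ?thesis using \<open>r > 0\<close> unfolding eventually_nhds by (intro exI[of _ "ball x r"]) auto
  qed
  have "openin (top_of_set W) Z"
  proof (subst openin_open_eq[OF W(1)], intro conjI)
    show "Z \<subseteq> W" by (auto simp: Z_def)
    show "open Z"
    proof (subst open_subopen, intro ballI)
      fix x assume x: "x \<in> Z"
      then obtain O1 where O1: "open O1" "x \<in> O1" "\<forall>y\<in>O1. f y = 0" unfolding Z_def eventually_nhds by blast
      have "O1 \<inter> W \<subseteq> Z" unfolding Z_def eventually_nhds using O1 by blast
      then show "\<exists>T. open T \<and> x \<in> T \<and> T \<subseteq> Z" using O1 W x by (intro exI[of _ "O1 \<inter> W"]) (auto simp: Z_def)
    qed
  qed
  moreover have "closedin (top_of_set W) Z"
    unfolding closedin_limpt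
  proof (intro conjI allI impI)
    fix x assume x: "x islimpt Z \<and> x \<in> W"
    then obtain r where r: "r > 0" "ball x r \<subseteq> W" using W(1) openE by blast
    obtain z where "z \<in> Z" "z \<in> ball x r" using x r islimpt_approachable[of x Z] by (auto simp: dist_commute)
    then show "x \<in> Z" using near[of x r z] r x by (auto simp: Z_def)
  qed (auto simp: Z_def)
  ultimately have "Z = {} \<or> Z = W" using W(2) connected_clopen by blast
  then have "b \<in> Z" using a b by (auto simp: Z_def)
  then show ?thesis by (auto simp: Z_def dest: eventually_nhds_x_imp_x)
qed

section \<open>Graphs over the punctured three-sphere\<close>

definition vec3 :: "complex \<Rightarrow> complex \<Rightarrow> complex \<Rightarrow> complex ^ 3" where
  "vec3 a b c = vector [a, b, c]"

lemma vec3_nth [simp]: "vec3 a b c $ 1 = a" "vec3 a b c $ 2 = b" "vec3 a b c $ 3 = c"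
  by (simp_all add: vec3_def)

lemma vec3_eq_iff: "x = y \<longleftrightarrow> x $ 1 = y $ 1 \<and> x $ 2 = y $ 2 \<and> x $ 3 = (y :: complex ^ 3) $ 3"
  by (simp add: vec_eq_iff forall_3)

lemma vec3_axis: "vec3 a b c = axis 1 a + axis 2 b + axis 3 c"
  by (simp add: vec3_eq_iff axis_def)

lemma bounded_linear_axis: "bounded_linear (axis i :: complex \<Rightarrow> complex ^ 'n)"
  by (intro linear_conv_bounded_linear[THEN iffD1] linearI) (auto simp: vec_eq_iff axis_def)

lemma Cinf_vec3 [Cinf_intros]:
  "Cinf U f \<Longrightarrow> Cinf U g \<Longrightarrow> Cinf U h \<Longrightarrow> Cinf U (\<lambda>x. vec3 (f x) (g x) (h x))"
  unfolding vec3_axis by (intro Cinf_intros Cinf_linear_compose[OF bounded_linear_axis])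

lemma has_derivative_vec3 [derivative_intros]:
  assumes "(f has_derivative f') F" "(g has_derivative g') F" "(h has_derivative h') F"
  shows "((\<lambda>x. vec3 (f x) (g x) (h x)) has_derivative (\<lambda>v. vec3 (f' v) (g' v) (h' v))) F"
  unfolding vec3_axis
  by (intro has_derivative_add bounded_linear.has_derivative[OF bounded_linear_axis] assms)

lemma has_vector_derivative_vec3 [derivative_intros]:
  assumes "(f has_vector_derivative f') F" "(g has_vector_derivative g') F" "(h has_vector_derivative h') F"
  shows "((\<lambda>x. vec3 (f x) (g x) (h x)) has_vector_derivative vec3 f' g' h') F"
  unfolding vec3_axis
  by (intro has_vector_derivative_add bounded_linear.has_vector_derivative[OF bounded_linear_axis] assms)

lemma has_derivative_vec_nth [derivative_intros]:
  "(f has_derivative f') F \<Longrightarrow> ((\<lambda>x. f x $ i) has_derivative (\<lambda>v. f' v $ i)) F"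
  by (rule bounded_linear.has_derivative[OF bounded_linear_vec_nth])

lemma J_vec3 [simp]: "J v $ i = \<i> * v $ i"
  by (simp add: J_def)

definition sqn :: "complex ^ 3 \<Rightarrow> real" where
  "sqn p = (Re (p $ 1))\<^sup>2 + (Im (p $ 1))\<^sup>2 + (Re (p $ 2))\<^sup>2 + (Im (p $ 2))\<^sup>2"

definition dist_pole :: "complex ^ 3 \<Rightarrow> real" where
  "dist_pole p = (Re (p $ 1) - 1)\<^sup>2 + (Im (p $ 1))\<^sup>2 + (Re (p $ 2))\<^sup>2 + (Im (p $ 2))\<^sup>2"

definition off_pole :: "(complex ^ 3) set" where
  "off_pole = {p. dist_pole p \<noteq> 0}"

text \<open>Inversion centred at the pole \<open>(1, 0)\<close>, which exchanges the punctured sphere with the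
  hyperplane \<open>Re z = 0\<close>.\<close>

definition inv1 :: "complex ^ 3 \<Rightarrow> complex" where
  "inv1 p = 1 + (2 * inverse (dist_pole p)) *\<^sub>R (p $ 1 - 1)"

definition inv2 :: "complex ^ 3 \<Rightarrow> complex" where
  "inv2 p = (2 * inverse (dist_pole p)) *\<^sub>R p $ 2"

definition straighten :: "(complex ^ 3 \<Rightarrow> complex) \<Rightarrow> complex ^ 3 \<Rightarrow> complex ^ 3" where
  "straighten G p = vec3 (inv1 p) (inv2 p) (p $ 3 - G p)"

text \<open>The inversion is an involution, so it is applied again; \<open>G\<close> is evaluated at
  the inverted point because that is where the first two coordinates of the preimage lie.\<close>

definition unstraighten :: "(complex ^ 3 \<Rightarrow> complex) \<Rightarrow> complex ^ 3 \<Rightarrow> complex ^ 3" where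
  "unstraighten G p = vec3 (inv1 p) (inv2 p) (p $ 3 + G (vec3 (inv1 p) (inv2 p) 0))"

definition punctured_sphere :: "(complex ^ 3) set" where
  "punctured_sphere = {p. sqn p = 1 \<and> p $ 1 \<noteq> 1}"

lemma dist_pole_eq_0: "dist_pole p = 0 \<longleftrightarrow> p $ 1 = 1 \<and> p $ 2 = 0"
proof -
  have "dist_pole p = 0 \<longleftrightarrow> (Re (p $ 1) - 1)\<^sup>2 + (Im (p $ 1))\<^sup>2 = 0 \<and> (Re (p $ 2))\<^sup>2 + (Im (p $ 2))\<^sup>2 = 0"
    unfolding dist_pole_def by (smt (verit) zero_le_power2)
  then show ?thesis by (auto simp: complex_eq_iff)
qed

lemma punctured_sphere_iff: "p \<in> punctured_sphere \<longleftrightarrow> p \<in> off_pole \<and> sqn p = 1"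
proof -
  have "p $ 2 = 0" if "sqn p = 1" "p $ 1 = 1"
    using that by (simp add: sqn_def complex_eq_iff)
  then show ?thesis by (auto simp: punctured_sphere_def off_pole_def dist_pole_eq_0)
qed

text \<open>The numerator vanishes exactly on the sphere: this is why the inversion flattens
  it.\<close>

lemma Re_inv1: "p \<in> off_pole \<Longrightarrow> Re (inv1 p) = (sqn p - 1) / dist_pole p"
  by (simp add: inv1_def off_pole_def field_simps) (simp add: dist_pole_def sqn_def power2_eq_square algebra_simps)

lemma open_off_pole: "open off_pole"
proof -
  have "continuous_on UNIV dist_pole" unfolding dist_pole_def by (intro continuous_intros)
  then have "open (dist_pole -` (- {0}))" by (rule open_vimage[rotated]) auto
  then show ?thesis by (simp add: off_pole_def vimage_def Compl_eq)
qed

lemma Cinf_dist_pole: "Cinf off_pole dist_pole"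
  unfolding dist_pole_def by (intro Cinf_intros open_off_pole)

lemma Cinf_inv: "Cinf off_pole inv1" "Cinf off_pole inv2"
  unfolding inv1_def inv2_def
  by (intro Cinf_intros open_off_pole Cinf_dist_pole; simp add: off_pole_def)+

lemma dist_pole_inv: "p \<in> off_pole \<Longrightarrow> dist_pole (vec3 (inv1 p) (inv2 p) c) = 4 / dist_pole p"
proof -
  assume p: "p \<in> off_pole"
  let ?k = "2 * inverse (dist_pole p)"
  have "dist_pole (vec3 (inv1 p) (inv2 p) c) = ?k\<^sup>2 * dist_pole p"
    by (subst (1 3) dist_pole_def) (simp add: inv1_def inv2_def power_mult_distrib algebra_simps power2_eq_square)
  also have "\<dots> = 4 / dist_pole p" using p by (simp add: off_pole_def power2_eq_square field_simps)
  finally show ?thesis .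
qed

lemma inv_inv:
  assumes p: "p \<in> off_pole"
  shows "inv1 (vec3 (inv1 p) (inv2 p) c) = p $ 1" "inv2 (vec3 (inv1 p) (inv2 p) c) = p $ 2"
proof -
  have "2 * inverse (dist_pole (vec3 (inv1 p) (inv2 p) c)) * (2 * inverse (dist_pole p)) = 1"
    using p by (simp add: dist_pole_inv[OF p] off_pole_def)
  then show "inv1 (vec3 (inv1 p) (inv2 p) c) = p $ 1" "inv2 (vec3 (inv1 p) (inv2 p) c) = p $ 2"
    by (simp_all add: inv1_def[of "vec3 _ _ _"] inv2_def[of "vec3 _ _ _"]) (simp_all add: inv1_def[of p] inv2_def[of p])
qed

lemma off_pole_inv: "p \<in> off_pole \<Longrightarrow> vec3 (inv1 p) (inv2 p) c \<in> off_pole"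
  using dist_pole_inv[of p c] by (simp add: off_pole_def)

locale sphere_graph =
  fixes G :: "complex ^ 3 \<Rightarrow> complex"
  assumes G: "Cinf UNIV G" and G_third: "\<And>p q. p $ 1 = q $ 1 \<Longrightarrow> p $ 2 = q $ 2 \<Longrightarrow> G p = G q"
begin

lemma straightening:
  assumes "subspace L"
  shows "straightening off_pole off_pole (straighten G) (unstraighten G) L {p \<in> off_pole. straighten G p \<in> L}"
proof
  have G': "Cinf off_pole G" by (rule Cinf_subset[OF G]) (auto intro: open_off_pole)
  show "Cinf off_pole (straighten G)"
    unfolding straighten_def by (intro Cinf_intros Cinf_inv open_off_pole G')
  show "Cinf off_pole (unstraighten G)"
    unfolding unstraighten_def
    by (intro Cinf_intros Cinf_inv open_off_pole Cinf_compose[OF G]) auto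
  show "straighten G ` off_pole \<subseteq> off_pole" "unstraighten G ` off_pole \<subseteq> off_pole"
    by (auto simp: straighten_def unstraighten_def intro: off_pole_inv)
  show "unstraighten G (straighten G p) = p" if p: "p \<in> off_pole" for p
    using G_third[of "vec3 (p $ 1) (p $ 2) 0" p]
    by (simp add: vec3_eq_iff unstraighten_def straighten_def inv_inv[OF p])
  show "straighten G (unstraighten G p) = p" if p: "p \<in> off_pole" for p
    using G_third[of "vec3 (inv1 p) (inv2 p) 0" "vec3 (inv1 p) (inv2 p) (p $ 3 + G (vec3 (inv1 p) (inv2 p) 0))"]
    by (simp add: vec3_eq_iff unstraighten_def straighten_def inv_inv[OF p])
qed (use assms in auto)

text \<open>By \<open>Re_inv1\<close> the flattened coordinate is a quotient whose numerator
  vanishes at \<open>p\<close>, so only the derivative of \<open>sqn\<close> contributes to its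
  derivative.\<close>

lemma tangent_condition:
  assumes p: "p \<in> punctured_sphere" and G': "(G has_derivative G') (at p)"
    and \<phi>': "(straighten G has_derivative \<phi>') (at p)"
  shows "Re (\<phi>' v $ 1) = 0 \<longleftrightarrow> Re (cnj (p $ 1) * v $ 1 + cnj (p $ 2) * v $ 2) = 0"
    and "\<phi>' v $ 3 = v $ 3 - G' v"
proof -
  have off: "p \<in> off_pole" and s: "sqn p = 1" using p by (auto simp: punctured_sphere_iff)
  have D: "dist_pole p \<noteq> 0" using off by (simp add: off_pole_def)
  have 1: "((\<lambda>p. Re (straighten G p $ 1)) has_derivative (\<lambda>v. Re (\<phi>' v $ 1))) (at p)"
    by (intro derivative_intros \<phi>')
  obtain d' where d': "(dist_pole has_derivative d') (at p)" using Cinf_has_derivative[OF Cinf_dist_pole off] by blast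
  let ?s' = "\<lambda>v. 2 * Re (cnj (p $ 1) * v $ 1 + cnj (p $ 2) * v $ 2)"
  have s': "(sqn has_derivative ?s') (at p)"
    unfolding sqn_def by (auto intro!: derivative_eq_intros simp: algebra_simps)
  have "((\<lambda>p. (sqn p - 1) / dist_pole p) has_derivative (\<lambda>v. ?s' v / dist_pole p)) (at p)"
    using D s by (auto intro!: derivative_eq_intros s' d' simp: field_simps)
  then have "((\<lambda>p. Re (straighten G p $ 1)) has_derivative (\<lambda>v. ?s' v / dist_pole p)) (at p)"
    by (rule has_derivative_transform_within_open[OF _ open_off_pole off]) (simp add: straighten_def Re_inv1)
  from has_derivative_unique[OF 1 this] have "Re (\<phi>' v $ 1) = ?s' v / dist_pole p" by (rule fun_cong)
  then show "Re (\<phi>' v $ 1) = 0 \<longleftrightarrow> Re (cnj (p $ 1) * v $ 1 + cnj (p $ 2) * v $ 2) = 0"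
    using D by (simp only: divide_eq_0_iff mult_eq_0_iff) simp
  have "((\<lambda>p. straighten G p $ 3) has_derivative (\<lambda>v. \<phi>' v $ 3)) (at p)"
    by (intro derivative_intros \<phi>')
  moreover have "((\<lambda>p. straighten G p $ 3) has_derivative (\<lambda>v. v $ 3 - G' v)) (at p)"
    unfolding straighten_def by (auto intro!: derivative_eq_intros G')
  ultimately show "\<phi>' v $ 3 = v $ 3 - G' v" using has_derivative_unique by metis
qed

end

definition lin4 :: "(complex ^ 3) set" where "lin4 = {v. Re (v $ 1) = 0 \<and> Im (v $ 3) = 0}"
definition lin3 :: "(complex ^ 3) set" where "lin3 = {v. Re (v $ 1) = 0 \<and> v $ 3 = 0}"

definition embed4 :: "real ^ 4 \<Rightarrow> complex ^ 3" where
  "embed4 y = vec3 (Complex 0 (y $ 1)) (Complex (y $ 2) (y $ 3)) (complex_of_real (y $ 4))"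
definition embed3 :: "real ^ 3 \<Rightarrow> complex ^ 3" where
  "embed3 y = vec3 (Complex 0 (y $ 1)) (Complex (y $ 2) (y $ 3)) 0"
definition coords4 :: "complex ^ 3 \<Rightarrow> real ^ 4" where
  "coords4 v = axis 1 (Im (v $ 1)) + axis 2 (Re (v $ 2)) + axis 3 (Im (v $ 2)) + axis 4 (Re (v $ 3))"
definition coords3 :: "complex ^ 3 \<Rightarrow> real ^ 3" where
  "coords3 v = axis 1 (Im (v $ 1)) + axis 2 (Re (v $ 2)) + axis 3 (Im (v $ 2))"

lemma linear_embed: "linear embed4" "linear embed3" "linear coords4" "linear coords3"
  by (auto intro!: linearI simp: vec_eq_iff forall_3 forall_4 embed4_def embed3_def coords4_def coords3_def axis_def complex_eq_iff)

lemma embed_coords: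
  "coords4 (embed4 y) = y" "coords3 (embed3 x) = x"
  "v \<in> lin4 \<Longrightarrow> embed4 (coords4 v) = v" "v \<in> lin3 \<Longrightarrow> embed3 (coords3 v) = v"
  "embed4 y \<in> lin4" "embed3 x \<in> lin3"
  by (auto simp: vec_eq_iff forall_3 forall_4 embed4_def embed3_def coords4_def coords3_def axis_def
      lin4_def lin3_def complex_eq_iff)

lemma subspace_lin: "subspace lin4" "subspace lin3"
  by (auto simp: subspace_def lin4_def lin3_def)

lemma dim_lin: "dim lin4 = 4" "dim lin3 = 3"
proof -
  have "lin4 = range embed4" "lin3 = range embed3"
    by (auto simp: embed_coords image_iff intro: embed_coords(3,4)[symmetric])
  moreover have "inj embed4" "inj embed3"
    by (rule inj_on_inverseI[of _ coords4], simp add: embed_coords, rule inj_on_inverseI[of _ coords3], simp add: embed_coords)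
  ultimately show "dim lin4 = 4" "dim lin3 = 3"
    using dim_image_eq[OF linear_embed(1), of UNIV] dim_image_eq[OF linear_embed(2), of UNIV]
    by (simp_all add: dim_UNIV)
qed

lemma off_pole_lin: "Re (v $ 1) = 0 \<Longrightarrow> v \<in> off_pole"
  by (auto simp: off_pole_def dist_pole_eq_0)

context straightening
begin

lemma diffeomorphism_param:
  fixes e :: "'b::euclidean_space \<Rightarrow> 'a" and c :: "'a \<Rightarrow> 'b"
  assumes e: "linear e" "linear c" "\<And>y. c (e y) = y" "\<And>v. v \<in> L \<Longrightarrow> e (c v) = v" "range e \<subseteq> L" "L \<subseteq> V"
  shows "diffeomorphism UNIV S (\<lambda>y. \<psi> (e y)) (\<lambda>x. c (\<phi> x))"
  unfolding diffeomorphism_def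
proof (intro conjI)
  have bl: "bounded_linear e" "bounded_linear c" using e(1,2) unfolding linear_conv_bounded_linear by auto
  have f: "Cinf U (\<lambda>x. c (\<phi> x))" by (rule Cinf_linear_compose[OF bl(2) diffeo(1)])
  have g: "Cinf UNIV (\<lambda>y. \<psi> (e y))"
    by (rule Cinf_compose[OF diffeo(2) Cinf_bounded_linear[OF open_UNIV bl(1)]]) (use e(5,6) in blast)
  show "smooth_on S (\<lambda>x. c (\<phi> x))" by (rule Cinf_imp_smooth_on[OF f]) (auto simp: S)
  show "smooth_on UNIV (\<lambda>y. \<psi> (e y))" by (rule Cinf_imp_smooth_on[OF g]) auto
  show "homeomorphism UNIV S (\<lambda>y. \<psi> (e y)) (\<lambda>x. c (\<phi> x))"
  proof (rule homeomorphismI)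
    show "continuous_on S (\<lambda>x. c (\<phi> x))" by (rule continuous_on_subset[OF Cinf_continuous_on[OF f]]) (auto simp: S)
    show "continuous_on UNIV (\<lambda>y. \<psi> (e y))" by (rule Cinf_continuous_on[OF g])
    have "e y \<in> L" "e y \<in> V" for y using e(5,6) by blast+
    then show "(\<lambda>y. \<psi> (e y)) ` UNIV \<subseteq> S" "\<And>y. c (\<phi> (\<psi> (e y))) = y"
      using diffeo(4,6) e(3) by (auto simp: S)
    show "\<psi> (e (c (\<phi> x))) = x" if "x \<in> S" for x using that diffeo(5) e(4) by (auto simp: S)
  qed auto
qed


end

section \<open>The manifolds\<close>

definition xi :: "complex ^ 3 \<Rightarrow> complex" where "xi p = (p $ 1)\<^sup>2 - (p $ 2)\<^sup>2"
definition mu :: "complex ^ 3 \<Rightarrow> real" where "mu p = 2 * Re (p $ 1 * cnj (p $ 2))"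
definition qf :: "complex ^ 3 \<Rightarrow> real" where "qf p = Re (xi p) - Im (xi p) * mu p / 2"
definition ef :: "complex ^ 3 \<Rightarrow> real" where "ef p = Re (xi p) * mu p * (qf p)\<^sup>2 / 4"

lemma xi_mu_cong:
  assumes "p $ 1 = p' $ 1" "p $ 2 = p' $ 2"
  shows "xi p = xi p'" "mu p = mu p'" "qf p = qf p'" "ef p = ef p'"
  using assms by (simp_all add: xi_def mu_def qf_def ef_def)

definition MM :: "(complex ^ 3) set" where
  "MM = {p \<in> punctured_sphere. Im (p $ 3) = qf p}"
definition MM1 :: "(complex ^ 3) set" where
  "MM1 = {p \<in> punctured_sphere. p $ 3 = Complex (ef p) (qf p)}"
definition CC :: "(complex ^ 3) set" where
  "CC = {p \<in> punctured_sphere. p $ 3 = 0 \<and> qf p = 0}"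

lemma CC_eq: "CC = {p \<in> MM. p $ 3 = 0}" "CC = {p \<in> MM1. qf p = 0}"
  by (auto simp: CC_def MM_def MM1_def ef_def complex_eq_iff)

lemma MM1_subset: "MM1 \<subseteq> MM" by (auto simp: MM_def MM1_def)
lemma CC_subset: "CC \<subseteq> MM1" "CC \<subseteq> MM" using CC_eq by auto

lemma Cinf_xi: "open U \<Longrightarrow> Cinf U xi" "open U \<Longrightarrow> Cinf U mu"
  unfolding xi_def mu_def by (intro Cinf_intros; assumption)+

lemma Cinf_qf: "open U \<Longrightarrow> Cinf U qf"
  unfolding qf_def divide_inverse by (intro Cinf_intros Cinf_xi) auto

lemma Cinf_ef: "open U \<Longrightarrow> Cinf U ef"
  unfolding ef_def divide_inverse by (intro Cinf_intros Cinf_xi Cinf_qf) auto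

interpretation gM: sphere_graph "\<lambda>p. \<i> * qf p"
proof
  show "Cinf UNIV (\<lambda>p. \<i> * complex_of_real (qf p))"
    by (intro Cinf_mult Cinf_const Cinf_of_real Cinf_qf open_UNIV)
  show "\<i> * complex_of_real (qf p) = \<i> * complex_of_real (qf p')"
    if "p $ 1 = p' $ 1" "p $ 2 = p' $ 2" for p p'
    by (simp only: xi_mu_cong(3)[OF that])
qed

interpretation gM1: sphere_graph "\<lambda>p. Complex (ef p) (qf p)"
proof
  show "Cinf UNIV (\<lambda>p. Complex (ef p) (qf p))"
    by (intro Cinf_Complex Cinf_ef Cinf_qf open_UNIV)
  show "Complex (ef p) (qf p) = Complex (ef p') (qf p')"
    if "p $ 1 = p' $ 1" "p $ 2 = p' $ 2" for p p'
    by (simp only: xi_mu_cong(3,4)[OF that])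
qed

lemma MM_straight: "MM = {p \<in> off_pole. straighten (\<lambda>p. \<i> * qf p) p \<in> lin4}"
  by (auto simp: MM_def punctured_sphere_iff lin4_def straighten_def Re_inv1 off_pole_def)

lemma MM1_straight: "MM1 = {p \<in> off_pole. straighten (\<lambda>p. Complex (ef p) (qf p)) p \<in> lin3}"
  by (auto simp: MM1_def punctured_sphere_iff lin3_def straighten_def Re_inv1 off_pole_def)

interpretation sM: straightening off_pole off_pole "straighten (\<lambda>p. \<i> * qf p)" "unstraighten (\<lambda>p. \<i> * qf p)" lin4 MM
  unfolding MM_straight by (rule gM.straightening[OF subspace_lin(1)])

interpretation sM1: straightening off_pole off_pole "straighten (\<lambda>p. Complex (ef p) (qf p))"
    "unstraighten (\<lambda>p. Complex (ef p) (qf p))" lin3 MM1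
  unfolding MM1_straight by (rule gM1.straightening[OF subspace_lin(2)])

lemmas straightening_MM = sM.straightening_axioms
lemmas straightening_MM1 = sM1.straightening_axioms

lemma submanifold_MM: "smooth_submanifold 4 MM" "smooth_submanifold 3 MM1"
  using sM.submanifold sM1.submanifold by (simp_all add: dim_lin)

lemma diffeomorphic_MM: "diffeomorphic MM (ball (0 :: real ^ 4) 1)" "diffeomorphic MM1 (ball (0 :: real ^ 3) 1)"
proof -
  have "diffeomorphic (UNIV :: (real ^ 4) set) MM"
    unfolding diffeomorphic_def
    by (rule exI, rule exI, rule sM.diffeomorphism_param[OF linear_embed(1,3) embed_coords(1,3)])
      (auto simp: lin4_def embed4_def intro: off_pole_lin)
  then show "diffeomorphic MM (ball (0 :: real ^ 4) 1)" using diffeomorphic_trans[OF diffeomorphic_sym diffeomorphic_UNIV_ball] by blast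
  have "diffeomorphic (UNIV :: (real ^ 3) set) MM1"
    unfolding diffeomorphic_def
    by (rule exI, rule exI, rule sM1.diffeomorphism_param[OF linear_embed(2,4) embed_coords(2,4)])
      (auto simp: lin3_def embed3_def intro: off_pole_lin)
  then show "diffeomorphic MM1 (ball (0 :: real ^ 3) 1)" using diffeomorphic_trans[OF diffeomorphic_sym diffeomorphic_UNIV_ball] by blast
qed

section \<open>Differentials of the defining functions and tangent spaces\<close>

definition dxi :: "complex ^ 3 \<Rightarrow> complex ^ 3 \<Rightarrow> complex" where
  "dxi p v = 2 * p $ 1 * v $ 1 - 2 * p $ 2 * v $ 2"
definition dmu :: "complex ^ 3 \<Rightarrow> complex ^ 3 \<Rightarrow> real" where
  "dmu p v = 2 * Re (v $ 1 * cnj (p $ 2) + p $ 1 * cnj (v $ 2))"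
definition dqf :: "complex ^ 3 \<Rightarrow> complex ^ 3 \<Rightarrow> real" where
  "dqf p v = Re (dxi p v) - (Im (dxi p v) * mu p + Im (xi p) * dmu p v) / 2"
text \<open>The differential of \<open>ef\<close>; the name is \<open>d\<close> followed by
  \<open>ef\<close>.\<close>

definition def' :: "complex ^ 3 \<Rightarrow> complex ^ 3 \<Rightarrow> real" where
  "def' p v = ((Re (dxi p v) * mu p + Re (xi p) * dmu p v) * (qf p)\<^sup>2 + 2 * Re (xi p) * mu p * qf p * dqf p v) / 4"

lemma has_derivative_xi: "(xi has_derivative dxi p) (at p)"
  unfolding xi_def dxi_def by (auto intro!: derivative_eq_intros simp: algebra_simps)

lemma has_derivative_mu: "(mu has_derivative dmu p) (at p)"
  unfolding mu_def dmu_def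
  by (rule derivative_eq_intros bounded_linear.has_derivative[OF bounded_linear_cnj] refl)+ (simp add: algebra_simps)

lemma has_derivative_qf: "(qf has_derivative dqf p) (at p)"
  unfolding qf_def dqf_def
  by (auto intro!: derivative_eq_intros has_derivative_xi has_derivative_mu simp: algebra_simps)

lemma has_derivative_ef: "(ef has_derivative def' p) (at p)"
  unfolding ef_def def'_def
  by (auto intro!: derivative_eq_intros has_derivative_xi has_derivative_mu has_derivative_qf simp: algebra_simps)

lemma tangent_MM:
  assumes "p \<in> MM"
  shows "tangent_space MM p = {v. Re (cnj (p $ 1) * v $ 1 + cnj (p $ 2) * v $ 2) = 0 \<and> Im (v $ 3) = dqf p v}"
proof -
  have p: "p \<in> punctured_sphere" "p \<in> off_pole" using assms by (auto simp: MM_def punctured_sphere_iff)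
  obtain \<phi>' where \<phi>': "(straighten (\<lambda>p. \<i> * qf p) has_derivative \<phi>') (at p)"
    using Cinf_has_derivative[OF sM.diffeo(1) p(2)] by blast
  have G': "((\<lambda>p. \<i> * complex_of_real (qf p)) has_derivative (\<lambda>v. \<i> * dqf p v)) (at p)"
    by (intro derivative_intros has_derivative_qf)
  show ?thesis
    unfolding sM.tangent_space_eq[OF assms \<phi>'] lin4_def
    using gM.tangent_condition[OF p(1) G' \<phi>'] by simp
qed

lemma tangent_MM1:
  assumes "p \<in> MM1"
  shows "tangent_space MM1 p = {v. Re (cnj (p $ 1) * v $ 1 + cnj (p $ 2) * v $ 2) = 0 \<and> v $ 3 = Complex (def' p v) (dqf p v)}"
proof -
  have p: "p \<in> punctured_sphere" "p \<in> off_pole" using assms by (auto simp: MM1_def punctured_sphere_iff)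
  obtain \<phi>' where \<phi>': "(straighten (\<lambda>p. Complex (ef p) (qf p)) has_derivative \<phi>') (at p)"
    using Cinf_has_derivative[OF sM1.diffeo(1) p(2)] by blast
  have G': "((\<lambda>p. Complex (ef p) (qf p)) has_derivative (\<lambda>v. Complex (def' p v) (dqf p v))) (at p)"
    unfolding Complex_eq by (intro derivative_intros has_derivative_qf has_derivative_ef)
  show ?thesis
    unfolding sM1.tangent_space_eq[OF assms \<phi>'] lin3_def
    using gM1.tangent_condition[OF p(1) G' \<phi>'] by simp
qed

section \<open>The CR structure\<close>

lemma xi_mu_sphere: "p \<in> punctured_sphere \<Longrightarrow> (Re (xi p))\<^sup>2 + (Im (xi p))\<^sup>2 + (mu p)\<^sup>2 = 1"
proof -
  have "(Re (xi p))\<^sup>2 + (Im (xi p))\<^sup>2 + (mu p)\<^sup>2 = (sqn p)\<^sup>2"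
    by (simp add: xi_def mu_def sqn_def power2_eq_square algebra_simps)
  moreover assume "p \<in> punctured_sphere"
  ultimately show ?thesis by (simp add: punctured_sphere_def)
qed

text \<open>\<open>2 \<i>\<close> times the (1,0)-derivative of \<open>qf\<close> along the first
  two entries of \<open>zt\<close>. It is the third entry for which all complex multiples of
  \<open>zt\<close> are tangent to \<open>MM\<close>, see \<open>dqf_zt\<close>.\<close>

definition cc :: "complex ^ 3 \<Rightarrow> complex" where
  "cc p = Complex ((mu p)\<^sup>2 - (Im (xi p))\<^sup>2) (- 2 * mu p - Re (xi p) * Im (xi p))"

definition zt :: "complex ^ 3 \<Rightarrow> complex ^ 3" where
  "zt p = vec3 (- cnj (p $ 2)) (cnj (p $ 1)) (cc p)"

lemma dqf_cong: "u $ 1 = v $ 1 \<Longrightarrow> u $ 2 = v $ 2 \<Longrightarrow> dqf p u = dqf p v"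
  by (simp add: dqf_def dxi_def dmu_def)

lemma dxi_zt: "dxi p (\<zeta> *s zt p) = - 2 * \<zeta> * mu p"
  by (simp add: dxi_def zt_def mu_def complex_eq_iff algebra_simps)

lemma dmu_zt: "dmu p (\<zeta> *s zt p) = 2 * Re (cnj \<zeta> * xi p)"
  by (simp add: dmu_def zt_def xi_def power2_eq_square algebra_simps)

lemma dqf_zt: "dqf p (\<zeta> *s zt p) = Im (\<zeta> * cc p)"
  by (simp add: dqf_def dxi_zt dmu_zt cc_def power2_eq_square field_simps)

lemma def'_zt:
  "def' p (\<zeta> *s zt p) = ((- 2 * Re \<zeta> * (mu p)\<^sup>2 + 2 * Re (xi p) * Re (cnj \<zeta> * xi p)) * (qf p)\<^sup>2
     + 2 * Re (xi p) * mu p * qf p * Im (\<zeta> * cc p)) / 4"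
  unfolding def'_def dxi_zt dmu_zt dqf_zt by (simp add: power2_eq_square algebra_simps)

text \<open>The vectors \<open>(z, w)\<close> and \<open>(- cnj w, cnj z)\<close> form a unitary
  basis at the point \<open>(z, w)\<close> of the sphere; \<open>H\<close> and \<open>Z\<close> are
  the coordinates in it.\<close>

lemma sphere_decomp:
  assumes "p \<in> punctured_sphere"
  defines "H \<equiv> \<lambda>u. cnj (p $ 1) * u $ 1 + cnj (p $ 2) * u $ 2" and "Z \<equiv> \<lambda>u. p $ 1 * u $ 2 - p $ 2 * u $ 1"
  shows "u $ 1 = H u * p $ 1 - Z u * cnj (p $ 2)" "u $ 2 = H u * p $ 2 + Z u * cnj (p $ 1)"
proof -
  have 1: "p $ 1 * cnj (p $ 1) + p $ 2 * cnj (p $ 2) = 1"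
    using assms(1) by (simp add: punctured_sphere_def sqn_def complex_mult_cnj of_real_add[symmetric] add.assoc del: of_real_add)
  have "H u * p $ 1 - Z u * cnj (p $ 2) = (p $ 1 * cnj (p $ 1) + p $ 2 * cnj (p $ 2)) * u $ 1"
    by (simp add: H_def Z_def algebra_simps)
  then show "u $ 1 = H u * p $ 1 - Z u * cnj (p $ 2)" by (simp add: 1)
  have "H u * p $ 2 + Z u * cnj (p $ 1) = (p $ 1 * cnj (p $ 1) + p $ 2 * cnj (p $ 2)) * u $ 2"
    by (simp add: H_def Z_def algebra_simps)
  then show "u $ 2 = H u * p $ 2 + Z u * cnj (p $ 1)" by (simp add: 1)
qed

lemma MM_sphere: "p \<in> MM \<Longrightarrow> p \<in> punctured_sphere" by (simp add: MM_def)
lemma MM1_sphere: "p \<in> MM1 \<Longrightarrow> p \<in> punctured_sphere" by (simp add: MM1_def)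

lemma zt_tangent: "p \<in> MM \<Longrightarrow> \<zeta> *s zt p \<in> tangent_space MM p"
  by (simp add: tangent_MM dqf_zt) (simp add: zt_def algebra_simps)

text \<open>If \<open>u\<close> and \<open>J u\<close> are both tangent, the real and the imaginary
  part of the component along \<open>p\<close> vanish, which leaves a multiple of \<open>zt\<close>
  in the first two entries. The two conditions on imaginary parts then determine the full third
  entry.\<close>

lemma complex_tangent_MM:
  assumes p: "p \<in> MM"
  shows "complex_tangent MM p = {\<zeta> *s zt p | \<zeta>. True}"
proof (intro equalityI subsetI)
  fix v assume "v \<in> {\<zeta> *s zt p | \<zeta>. True}"
  then obtain \<zeta> where v: "v = \<zeta> *s zt p" by auto
  then have "v = J ((- \<i> * \<zeta>) *s zt p)" by (simp add: vec3_eq_iff mult.assoc[symmetric])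
  then show "v \<in> complex_tangent MM p"
    unfolding complex_tangent_def using zt_tangent[OF p, of \<zeta>] imageI[OF zt_tangent[OF p, of "- \<i> * \<zeta>"], of J] v
    by simp
next
  fix v assume "v \<in> complex_tangent MM p"
  then obtain u where v: "v \<in> tangent_space MM p" "v = J u" and u: "u \<in> tangent_space MM p"
    unfolding complex_tangent_def by blast
  define H where "H = cnj (p $ 1) * u $ 1 + cnj (p $ 2) * u $ 2"
  define \<zeta> where "\<zeta> = p $ 1 * u $ 2 - p $ 2 * u $ 1"
  have "Re H = 0" using u by (simp add: tangent_MM[OF p] H_def)
  moreover have "Im H = 0" using v by (simp add: tangent_MM[OF p] H_def algebra_simps)
  ultimately have "H = 0" by (simp add: complex_eq_iff)
  then have u12: "u $ 1 = (\<zeta> *s zt p) $ 1" "u $ 2 = (\<zeta> *s zt p) $ 2"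
    using sphere_decomp[OF MM_sphere[OF p], of u, folded H_def \<zeta>_def] by (simp_all add: zt_def)
  have v12: "v $ 1 = ((\<i> * \<zeta>) *s zt p) $ 1" "v $ 2 = ((\<i> * \<zeta>) *s zt p) $ 2" using u12 v(2) by simp_all
  have "Im (u $ 3) = Im (\<zeta> * cc p)"
    using u dqf_cong[OF u12, of p] by (simp add: tangent_MM[OF p] dqf_zt)
  moreover have "Im (v $ 3) = Im (\<i> * \<zeta> * cc p)"
    using v(1) dqf_cong[OF v12, of p] by (simp only: tangent_MM[OF p] dqf_zt mem_Collect_eq)
  ultimately have "v $ 3 = \<i> * \<zeta> * cc p" using v(2) by (simp add: complex_eq_iff)
  then have "v = (\<i> * \<zeta>) *s zt p" using v12 by (simp add: vec3_eq_iff) (simp add: zt_def)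
  then show "v \<in> {\<zeta> *s zt p | \<zeta>. True}" by blast
qed

lemma zt_nonzero: "p \<in> MM \<Longrightarrow> zt p \<noteq> 0"
  by (auto simp: vec3_eq_iff zt_def MM_def punctured_sphere_def sqn_def)

lemma CR_dimension_MM: "CR_dimension MM 1"
  unfolding CR_dimension_def
proof
  fix p assume p: "p \<in> MM"
  have "complex_tangent MM p = vec.span {zt p}"
    unfolding complex_tangent_MM[OF p] vec.span_singleton by auto
  then show "vec.dim (complex_tangent MM p) = 1"
    using zt_nonzero[OF p] by (simp add: vec.dim_span vec.dim_singleton)
qed

lemma generic_MM: "generic MM"
  unfolding generic_def
proof (intro ballI equalityI subsetI UNIV_I)
  fix p u :: "complex ^ 3" assume p: "p \<in> MM"
  define H where "H = cnj (p $ 1) * u $ 1 + cnj (p $ 2) * u $ 2"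
  define Z where "Z = p $ 1 * u $ 2 - p $ 2 * u $ 1"
  \<comment> \<open>\<open>a\<close> carries the tangential part of \<open>u\<close>, while
    \<open>J b\<close> carries the remaining part \<open>Re H\<close> times \<open>p\<close>. The
    imaginary parts of the third entries of \<open>t1\<close> and \<open>t2\<close> are forced by
    tangency, and their real parts are adjusted so that \<open>t1 + J t2\<close> has third entry
    \<open>u $ 3\<close>.\<close>
  define a where "a = vec3 (\<i> * Im H * p $ 1 - Z * cnj (p $ 2)) (\<i> * Im H * p $ 2 + Z * cnj (p $ 1)) 0"
  define b where "b = vec3 (- \<i> * Re H * p $ 1) (- \<i> * Re H * p $ 2) 0"
  define t1 where "t1 = vec3 (a $ 1) (a $ 2) (Complex (Re (u $ 3) + dqf p b) (dqf p a))"
  define t2 where "t2 = vec3 (b $ 1) (b $ 2) (Complex (Im (u $ 3) - dqf p a) (dqf p b))"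
  have s: "Re (cnj (p $ 1) * p $ 1 + cnj (p $ 2) * p $ 2) = 1"
    using MM_sphere[OF p] by (simp add: punctured_sphere_def sqn_def power2_eq_square)
  have "Re (cnj (p $ 1) * a $ 1 + cnj (p $ 2) * a $ 2) = 0"
    by (simp add: a_def algebra_simps)
  then have "t1 \<in> tangent_space MM p"
    using dqf_cong[of t1 a p] by (simp add: tangent_MM[OF p] t1_def)
  moreover have "Re (cnj (p $ 1) * b $ 1 + cnj (p $ 2) * b $ 2) = 0"
    by (simp add: b_def algebra_simps)
  then have "t2 \<in> tangent_space MM p"
    using dqf_cong[of t2 b p] by (simp add: tangent_MM[OF p] t2_def)
  moreover have "u = t1 + J t2"
  proof -
    have H: "H = \<i> * Im H + Re H" by (simp add: complex_eq_iff)
    have "u $ 1 = H * p $ 1 - Z * cnj (p $ 2)" "u $ 2 = H * p $ 2 + Z * cnj (p $ 1)"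
      using sphere_decomp[OF MM_sphere[OF p], of u] by (simp_all add: H_def Z_def)
    then have "u $ 1 = t1 $ 1 + J t2 $ 1" "u $ 2 = t1 $ 2 + J t2 $ 2"
      by (simp_all add: t1_def t2_def a_def b_def) (simp_all add: complex_eq_iff algebra_simps)
    then show ?thesis by (simp add: vec3_eq_iff) (simp add: t1_def t2_def complex_eq_iff)
  qed
  ultimately show "u \<in> tangent_space MM p + J ` tangent_space MM p" by (auto intro: set_plus_intro)
qed

text \<open>Here \<open>c1 + \<i> c2\<close> stands for \<open>cc\<close>, and \<open>e1\<close>,
  \<open>e2\<close> say that the derivative of \<open>ef\<close> along the complex tangent line
  cancels it. Solved for \<open>c1\<close> and \<open>c2\<close>, the equations make
  \<open>m\<close> small compared with \<open>n1\<close> and \<open>n2\<close>, and then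
  \<open>c1\<close> nonnegative. Since \<open>c1 = m^2 - n2^2\<close>, this forces
  \<open>n2 = 0\<close> and \<open>m = 0\<close>, where \<open>e1\<close> reads
  \<open>0 = 1 / 2\<close>.\<close>

lemma no_characteristic_point:
  fixes n1 n2 m q c1 c2 :: real
  assumes s: "n1\<^sup>2 + n2\<^sup>2 + m\<^sup>2 = 1" and q: "q = n1 - n2 * m / 2"
    and c: "c1 = m\<^sup>2 - n2\<^sup>2" "c2 = - 2 * m - n1 * n2"
    and e1: "c1 = ((n1\<^sup>2 - m\<^sup>2) * q\<^sup>2 + n1 * m * q * c2) / 2"
    and e2: "- c2 = (n1 * n2 * q\<^sup>2 + n1 * m * q * c1) / 2"
  shows False
proof -
  have n1sq: "n1\<^sup>2 \<le> 1" "m\<^sup>2 \<le> 1" "n2\<^sup>2 \<le> 1"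
    using s zero_le_power2[of n1] zero_le_power2[of n2] zero_le_power2[of m] by linarith+
  then have le1: "\<bar>n1\<bar> \<le> 1" "\<bar>n2\<bar> \<le> 1" "\<bar>m\<bar> \<le> 1" by (simp_all add: abs_square_le_1)
  \<comment> \<open>Cauchy-Schwarz for the vectors \<open>(n1, n2)\<close> and
    \<open>(1, - m / 2)\<close>.\<close>
  have "q\<^sup>2 \<le> (n1\<^sup>2 + n2\<^sup>2) * (1 + m\<^sup>2 / 4)"
  proof -
    have "(n1\<^sup>2 + n2\<^sup>2) * (1 + m\<^sup>2 / 4) - q\<^sup>2 = (n1 * m / 2 + n2)\<^sup>2"
      by (simp add: q power2_eq_square field_simps)
    then show ?thesis by (metis diff_ge_0_iff_ge zero_le_power2)
  qed
  also have "\<dots> = 1 - m\<^sup>2 * (3 + m\<^sup>2) / 4"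
  proof -
    have eq: "n1\<^sup>2 + n2\<^sup>2 = 1 - m\<^sup>2" using s by simp
    show ?thesis unfolding eq by (simp add: power2_eq_square field_simps)
  qed
  also have "\<dots> \<le> 1" by simp
  finally have q2: "q\<^sup>2 \<le> 1" .
  then have q1: "\<bar>q\<bar> \<le> 1" by (simp add: abs_square_le_1)
  define \<epsilon> where "\<epsilon> = n1 * m * q / 2"
  \<comment> \<open>The pair of equations is a linear system for \<open>c1\<close>,
    \<open>c2\<close> with determinant \<open>1 + \<epsilon>^2\<close>; \<open>k\<close> is the
    common factor of its solution.\<close>
  define k where "k = q\<^sup>2 / 2 / (1 + \<epsilon>\<^sup>2)"
  have pos: "1 + \<epsilon>\<^sup>2 > 0" by (simp add: add_pos_nonneg)
  have "q\<^sup>2 \<le> 1 + \<epsilon>\<^sup>2" using q2 zero_le_power2[of \<epsilon>] by linarith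
  then have k: "0 \<le> k" "k \<le> 1 / 2"
    using pos by (simp_all add: k_def divide_le_eq)
  have E1: "c1 = (n1\<^sup>2 - m\<^sup>2) * q\<^sup>2 / 2 + \<epsilon> * c2" and E2: "- c2 = n1 * n2 * q\<^sup>2 / 2 + \<epsilon> * c1"
    using e1 e2 by (simp_all add: \<epsilon>_def field_simps)
  have "c1 * (1 + \<epsilon>\<^sup>2) = c1 + \<epsilon> * (\<epsilon> * c1)" by (simp add: power2_eq_square algebra_simps)
  also have "\<dots> = (n1\<^sup>2 - m\<^sup>2) * q\<^sup>2 / 2 + \<epsilon> * (c2 + \<epsilon> * c1)"
    unfolding distrib_left using E1 by linarith
  also have "c2 + \<epsilon> * c1 = - (n1 * n2 * q\<^sup>2 / 2)" using E2 by linarith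
  also have "(n1\<^sup>2 - m\<^sup>2) * q\<^sup>2 / 2 + \<epsilon> * - (n1 * n2 * q\<^sup>2 / 2) = (n1\<^sup>2 - m\<^sup>2 - \<epsilon> * n1 * n2) * (q\<^sup>2 / 2)"
    by (simp add: field_simps)
  finally have C1: "c1 = k * (n1\<^sup>2 - m\<^sup>2 - \<epsilon> * n1 * n2)"
    using pos unfolding k_def by (simp add: field_simps)
  have "(- c2) * (1 + \<epsilon>\<^sup>2) = - c2 - \<epsilon> * (\<epsilon> * c2)" by (simp add: power2_eq_square algebra_simps)
  also have "\<dots> = n1 * n2 * q\<^sup>2 / 2 + \<epsilon> * (c1 - \<epsilon> * c2)"
    unfolding right_diff_distrib using E2 by linarith
  also have "c1 - \<epsilon> * c2 = (n1\<^sup>2 - m\<^sup>2) * q\<^sup>2 / 2" using E1 by linarith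
  also have "n1 * n2 * q\<^sup>2 / 2 + \<epsilon> * ((n1\<^sup>2 - m\<^sup>2) * q\<^sup>2 / 2) = (n1 * n2 + \<epsilon> * (n1\<^sup>2 - m\<^sup>2)) * (q\<^sup>2 / 2)"
    by (simp add: field_simps)
  finally have C2: "- c2 = k * (n1 * n2 + \<epsilon> * (n1\<^sup>2 - m\<^sup>2))"
    using pos unfolding k_def by (simp add: field_simps)
  \<comment> \<open>Inserting \<open>c2 = - 2 * m - n1 * n2\<close> into \<open>C2\<close> gives an
    equation for \<open>m\<close> whose coefficient is a perturbation of 2 by \<open>t\<close>, with
    \<open>t\<close> at most 1 / 4 in absolute value.\<close>
  define t where "t = k * n1 * q * (n1\<^sup>2 - m\<^sup>2) / 2"
  have "m * (2 - t) = - (1 - k) * (n1 * n2)"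
    using C2 by (simp add: c t_def \<epsilon>_def field_simps)
  then have mt: "\<bar>m\<bar> * \<bar>2 - t\<bar> = \<bar>1 - k\<bar> * \<bar>n1 * n2\<bar>" by (metis abs_minus_cancel abs_mult mult_minus_left)
  have "\<bar>n1\<^sup>2 - m\<^sup>2\<bar> \<le> 1" using n1sq by (simp add: abs_le_iff) (smt (verit) zero_le_power2)
  then have "k * \<bar>n1\<bar> * \<bar>q\<bar> * \<bar>n1\<^sup>2 - m\<^sup>2\<bar> \<le> (1 / 2) * 1 * 1 * 1"
    using k le1 q1 by (intro mult_mono) auto
  then have "\<bar>t\<bar> \<le> 1 / 4" using k by (simp add: t_def abs_mult)
  then have "7 / 4 \<le> \<bar>2 - t\<bar>" by linarith
  then have "\<bar>m\<bar> * (7 / 4) \<le> \<bar>m\<bar> * \<bar>2 - t\<bar>" by (intro mult_left_mono) auto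
  also have "\<dots> \<le> 1 * \<bar>n1 * n2\<bar>" unfolding mt using k by (intro mult_right_mono) auto
  finally have m: "\<bar>m\<bar> \<le> 4 / 7 * (\<bar>n1\<bar> * \<bar>n2\<bar>)" by (simp add: abs_mult)
  have m1: "\<bar>m\<bar> \<le> 4 / 7 * \<bar>n1\<bar>" and m2: "\<bar>m\<bar> \<le> 4 / 7 * \<bar>n2\<bar>"
    using m mult_left_le[OF le1(2), of "\<bar>n1\<bar>"] mult_left_le[OF le1(1), of "\<bar>n2\<bar>"] by (simp_all add: mult.commute)
  have sq: "m\<^sup>2 \<le> 16 / 49 * n1\<^sup>2" "m\<^sup>2 \<le> 16 / 49 * n2\<^sup>2"
    using power_mono[OF m1 abs_ge_zero, of 2] power_mono[OF m2 abs_ge_zero, of 2] by (simp_all add: power_mult_distrib power2_eq_square)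
  have "\<bar>\<epsilon> * n1 * n2\<bar> = (n1\<^sup>2 / 2) * (\<bar>m\<bar> * \<bar>q\<bar> * \<bar>n2\<bar>)" by (simp add: \<epsilon>_def abs_mult power2_eq_square)
  also have "\<bar>m\<bar> * \<bar>q\<bar> * \<bar>n2\<bar> \<le> (4 / 7) * 1 * 1"
    using m1 le1 q1 by (intro mult_mono) auto
  then have "(n1\<^sup>2 / 2) * (\<bar>m\<bar> * \<bar>q\<bar> * \<bar>n2\<bar>) \<le> (n1\<^sup>2 / 2) * (4 / 7)" by (intro mult_left_mono) auto
  \<comment> \<open>The constant is 1 - 16/49 - 2/7 = 19/49.\<close>
  finally have b: "n1\<^sup>2 - m\<^sup>2 - \<epsilon> * n1 * n2 \<ge> 19 / 49 * n1\<^sup>2" using sq(1) by (simp add: abs_le_iff)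
  then have "c1 \<ge> 0" unfolding C1 using k zero_le_power2[of n1] by (intro mult_nonneg_nonneg) linarith+
  then have "n2\<^sup>2 \<le> 0" using sq(2) c(1) zero_le_power2[of n2] by linarith
  then have n2: "n2 = 0" by simp
  then have "m = 0" using m2 by simp
  then show False using n2 s e1 c q by simp
qed

lemma maximally_real_MM1: "maximally_real MM1"
  unfolding maximally_real_def
proof (intro conjI ballI)
  show "smooth_submanifold CARD(3) MM1" using submanifold_MM by simp
  fix p assume p: "p \<in> MM1"
  have pM: "p \<in> MM" using p MM1_subset by auto
  note ps = MM1_sphere[OF p]
  show "complex_tangent MM1 p = {0}"
  proof (intro equalityI subsetI)
    have "0 \<in> tangent_space MM1 p" "0 = J (0 :: complex ^ 3)"
      by (simp_all add: tangent_MM1[OF p] def'_def dqf_def dxi_def dmu_def J_def complex_eq_iff)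
    then show "v \<in> {0} \<Longrightarrow> v \<in> complex_tangent MM1 p" for v unfolding complex_tangent_def by blast
  next
    fix v assume v: "v \<in> complex_tangent MM1 p"
    then obtain u where u: "u \<in> tangent_space MM1 p" "v = J u" unfolding complex_tangent_def by blast
    have v1: "v \<in> tangent_space MM1 p" using v unfolding complex_tangent_def by blast
    have "u \<in> complex_tangent MM p"
    proof -
      have "v \<in> complex_tangent MM p" using v tangent_space_mono[OF MM1_subset] unfolding complex_tangent_def by blast
      then obtain \<zeta> where "v = \<zeta> *s zt p" unfolding complex_tangent_MM[OF pM] by auto
      moreover have "u $ k = - \<i> * v $ k" for k using u(2) by simp
      ultimately have "u = (- \<i> * \<zeta>) *s zt p" by (simp add: vec_eq_iff mult.assoc)
      then show ?thesis unfolding complex_tangent_MM[OF pM] by blast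
    qed
    then obtain \<zeta> where \<zeta>: "u = \<zeta> *s zt p" unfolding complex_tangent_MM[OF pM] by auto
    have v\<zeta>: "v = (\<i> * \<zeta>) *s zt p" using u(2) \<zeta> by (simp add: vec3_eq_iff)
    \<comment> \<open>\<open>a\<close> and \<open>b\<close> are the derivatives of \<open>ef\<close>
      along \<open>zt\<close> and \<open>\<i> *s zt\<close>.\<close>
    define a where "a = ((- 2 * (mu p)\<^sup>2 + 2 * (Re (xi p))\<^sup>2) * (qf p)\<^sup>2 + 2 * Re (xi p) * mu p * qf p * Im (cc p)) / 4"
    define b where "b = (2 * Re (xi p) * Im (xi p) * (qf p)\<^sup>2 + 2 * Re (xi p) * mu p * qf p * Re (cc p)) / 4"
    have def'_eq: "def' p (\<eta> *s zt p) = Re \<eta> * a + Im \<eta> * b" for \<eta>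
      unfolding def'_zt a_def b_def by (simp add: power2_eq_square field_simps)
    have zt3: "(\<eta> *s zt p) $ 3 = \<eta> * cc p" for \<eta> by (simp add: zt_def)
    have A: "Re (\<zeta> * cc p) = Re \<zeta> * a + Im \<zeta> * b"
      using u(1) unfolding \<zeta> tangent_MM1[OF p] by (simp only: mem_Collect_eq def'_eq zt3 complex.sel complex_eq_iff)
    have B: "Re (\<i> * \<zeta> * cc p) = - Im \<zeta> * a + Re \<zeta> * b"
      using v1 unfolding v\<zeta> tangent_MM1[OF p] by (simp only: mem_Collect_eq def'_eq zt3 complex.sel complex_eq_iff) simp
    have "\<zeta> = 0"
    proof (rule ccontr)
      assume "\<zeta> \<noteq> 0"
      then have n: "(Re \<zeta>)\<^sup>2 + (Im \<zeta>)\<^sup>2 \<noteq> 0" by (simp add: complex_eq_iff sum_power2_eq_zero_iff)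
      \<comment> \<open>\<open>A\<close> and \<open>B\<close> form a homogeneous linear system for
        \<open>Re (cc p) - a\<close> and \<open>Im (cc p) + b\<close>, whose determinant is the
        squared modulus of \<zeta>.\<close>
      have A': "Re \<zeta> * (Re (cc p) - a) = Im \<zeta> * (Im (cc p) + b)" using A by (simp add: algebra_simps)
      have B': "Im \<zeta> * (Re (cc p) - a) = - (Re \<zeta> * (Im (cc p) + b))" using B by (simp add: algebra_simps)
      have "((Re \<zeta>)\<^sup>2 + (Im \<zeta>)\<^sup>2) * (Re (cc p) - a) = Re \<zeta> * (Re \<zeta> * (Re (cc p) - a)) + Im \<zeta> * (Im \<zeta> * (Re (cc p) - a))"
        by (simp add: power2_eq_square algebra_simps)
      also have "\<dots> = 0" unfolding A' B' by simp
      finally have "Re (cc p) - a = 0" using n mult_eq_0_iff by blast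
      then have a: "Re (cc p) = a" by simp
      have "((Re \<zeta>)\<^sup>2 + (Im \<zeta>)\<^sup>2) * (Im (cc p) + b) = Im \<zeta> * (Im \<zeta> * (Im (cc p) + b)) + Re \<zeta> * (Re \<zeta> * (Im (cc p) + b))"
        by (simp add: power2_eq_square algebra_simps)
      also have "\<dots> = 0"
      proof -
        have B2: "Re \<zeta> * (Im (cc p) + b) = - (Im \<zeta> * (Re (cc p) - a))" using B' by simp
        show ?thesis unfolding A'[symmetric] B2 by (simp add: algebra_simps)
      qed
      finally have "Im (cc p) + b = 0" using n mult_eq_0_iff by blast
      then have b: "- Im (cc p) = b" by simp
      have e: "Re (cc p) = (((Re (xi p))\<^sup>2 - (mu p)\<^sup>2) * (qf p)\<^sup>2 + Re (xi p) * mu p * qf p * Im (cc p)) / 2"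
        unfolding a a_def by (simp add: field_simps)
      have f: "- Im (cc p) = (Re (xi p) * Im (xi p) * (qf p)\<^sup>2 + Re (xi p) * mu p * qf p * Re (cc p)) / 2"
        unfolding b b_def by (simp add: field_simps)
      show False
        by (rule no_characteristic_point[OF xi_mu_sphere[OF ps] _ _ _ e f]) (simp_all add: qf_def cc_def)
    qed
    then show "v \<in> {0}" by (simp add: v\<zeta> vec3_eq_iff)
  qed
qed

section \<open>Transversality to the characteristic foliation\<close>

lemma CC_sphere: "p \<in> CC \<Longrightarrow> p \<in> punctured_sphere" by (simp add: CC_def)

text \<open>At a zero of \<open>cc\<close> both \<open>mu\<close> and \<open>Im xi\<close> vanish,
  so that \<open>qf = Re xi\<close> has modulus 1 there.\<close>

lemma cc_nonzero:
  assumes "p \<in> CC"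
  shows "cc p \<noteq> 0"
proof
  assume "cc p = 0"
  then have m: "(mu p)\<^sup>2 = (Im (xi p))\<^sup>2" "2 * mu p = - (Re (xi p) * Im (xi p))" by (auto simp: cc_def complex_eq_iff)
  have s: "(Re (xi p))\<^sup>2 + (Im (xi p))\<^sup>2 + (mu p)\<^sup>2 = 1" by (rule xi_mu_sphere[OF CC_sphere[OF assms]])
  have "4 * (mu p)\<^sup>2 = (Re (xi p))\<^sup>2 * (mu p)\<^sup>2"
    using arg_cong[OF m(2), of "\<lambda>x. x\<^sup>2"] m(1) by (simp add: power_mult_distrib)
  moreover have "(Re (xi p))\<^sup>2 \<le> 1" using s by (smt (verit) zero_le_power2)
  ultimately have "mu p = 0" by (auto simp: power2_eq_square)
  then show False using m s assms by (auto simp: CC_def qf_def)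
qed

lemma def'_CC: "p \<in> CC \<Longrightarrow> def' p v = 0"
  by (simp add: CC_def def'_def)

text \<open>On the torus the differential of \<open>ef\<close> is zero, so only the real part of the
  third entry is constrained.\<close>

lemma char_line_CC:
  assumes p: "p \<in> CC"
  shows "char_line MM MM1 p = {\<zeta> *s zt p | \<zeta>. Re (\<zeta> * cc p) = 0}"
proof -
  have pM: "p \<in> MM1" "p \<in> MM" using p CC_subset by auto
  have "\<zeta> *s zt p \<in> tangent_space MM1 p \<longleftrightarrow> Re (\<zeta> * cc p) = 0" for \<zeta>
    by (simp add: tangent_MM1[OF pM(1)] def'_CC[OF p] dqf_zt) (simp add: zt_def complex_eq_iff algebra_simps)
  then show ?thesis unfolding char_line_def complex_tangent_MM[OF pM(2)] by auto
qed

lemma dqf_char_line: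
  assumes p: "p \<in> CC" and v: "v \<in> char_line MM MM1 p - {0}"
  shows "dqf p v \<noteq> 0"
proof -
  obtain \<zeta> where \<zeta>: "v = \<zeta> *s zt p" "Re (\<zeta> * cc p) = 0" using v unfolding char_line_CC[OF p] by auto
  have "\<zeta> \<noteq> 0" using v \<zeta> by auto
  then have "\<zeta> * cc p \<noteq> 0" using cc_nonzero[OF p] by simp
  then show ?thesis using \<zeta> by (simp add: dqf_zt complex_eq_iff)
qed

lemma CC_nonempty: "CC \<noteq> {}"
proof -
  have "vec3 (1 / sqrt 2) (1 / sqrt 2) 0 \<in> CC"
    by (simp add: CC_def punctured_sphere_def sqn_def qf_def xi_def power_divide complex_eq_iff)
  then show ?thesis by blast
qed

lemma not_nontransversality: "\<not> nontransversality \<alpha> MM MM1 CC"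
proof
  assume "nontransversality \<alpha> MM MM1 CC"
  then obtain \<gamma> R V \<pi> where g0: "\<gamma> 0 \<in> CC" "\<gamma> 0 \<in> R" and sl: "semilocal_projection MM MM1 R V \<pi>"
    and fr: "\<gamma> (0::real) \<in> top_of_set R frontier_of (\<pi> ` (CC \<inter> V))"
    unfolding nontransversality_def using CC_nonempty closedin_topspace[of "top_of_set CC"]
    by (metis topspace_euclidean_subtopology)
  define p where "p = \<gamma> 0"
  obtain a b \<Phi> \<Psi> where ab: "a < 0" "0 < b" and di: "diffeomorphism (R \<times> {a<..<b}) V \<Phi> \<Psi>"
    and \<Phi>: "\<And>r. r \<in> R \<Longrightarrow> \<Phi> (r, 0) = r" "\<And>r. r \<in> R \<Longrightarrow> char_integral_curve MM MM1 a b (\<lambda>t. \<Phi> (r, t))"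
      "\<And>r t. r \<in> R \<Longrightarrow> t \<in> {a<..<b} \<Longrightarrow> \<pi> (\<Phi> (r, t)) = r"
    using sl unfolding semilocal_projection_def by blast
  have pR: "p \<in> R" "p \<in> CC" using g0 by (auto simp: p_def)
  have cont: "continuous_on (R \<times> {a<..<b}) \<Phi>" and img: "\<Phi> ` (R \<times> {a<..<b}) = V"
    using di unfolding diffeomorphism_def homeomorphism_def by auto
  have inM1: "\<Phi> (r, t) \<in> MM1" if "r \<in> R" "t \<in> {a<..<b}" for r t
    using \<Phi>(2)[OF that(1)] that(2) unfolding char_integral_curve_def by blast
  let ?c = "\<lambda>t. \<Phi> (p, t)"
  have "smooth_on {a<..<b} ?c" using \<Phi>(2)[OF pR(1)] unfolding char_integral_curve_def by blast
  then have "?c differentiable (at 0)"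
    using ab by (intro Cinf_differentiable[of "{a<..<b}"]) (auto simp: smooth_on_open_iff)
  then obtain d where d: "(?c has_vector_derivative d) (at 0)" "d = vector_derivative ?c (at 0)"
    using vector_derivative_works by blast
  have "d \<in> char_line MM MM1 (?c 0) - {0}"
    using \<Phi>(2)[OF pR(1)] ab unfolding char_integral_curve_def d(2) by (meson greaterThanLessThan_iff)
  then have dq: "dqf p d \<noteq> 0" using dqf_char_line pR \<Phi>(1) by simp
  \<comment> \<open>With this sign, \<open>s * qf\<close> increases along the plaque through
    \<open>p\<close>.\<close>
  define s where "s = sgn (dqf p d)"
  have "((\<lambda>t. qf (?c t)) has_vector_derivative dqf p d) (at 0)"
    using vector_derivative_diff_chain_within[of ?c d 0 UNIV qf "dqf p"] d(1) \<Phi>(1)[OF pR(1)] has_derivative_qf[of p]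
    by (simp add: o_def has_derivative_at_withinI)
  then have "((\<lambda>t. s * qf (?c t)) has_real_derivative s * dqf p d) (at 0)"
    by (intro DERIV_cmult) (simp add: has_real_derivative_iff_has_vector_derivative)
  moreover have "s * dqf p d > 0" using dq by (simp add: s_def sgn_if)
  moreover have q0: "qf (?c 0) = 0" using \<Phi>(1)[OF pR(1)] pR(2) by (simp add: CC_def)
  ultimately obtain e1 e2 where e: "e1 > 0" "\<And>h. 0 < h \<Longrightarrow> h < e1 \<Longrightarrow> 0 < s * qf (?c (0 + h))"
    "e2 > 0" "\<And>h. 0 < h \<Longrightarrow> h < e2 \<Longrightarrow> s * qf (?c (0 - h)) < 0"
    using DERIV_pos_inc_right[of "\<lambda>t. s * qf (?c t)" "s * dqf p d" 0]
      DERIV_pos_inc_left[of "\<lambda>t. s * qf (?c t)" "s * dqf p d" 0] by auto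
  define h where "h = Min {e1 / 2, e2 / 2, - a / 2, b / 2}"
  have h: "0 < h" "h < e1" "h < e2" "a < - h" "h < b"
    using e ab by (auto simp: h_def min_less_iff_disj)
  have contr: "continuous_on R (\<lambda>r. s * qf (\<Phi> (r, t)))" if "t \<in> {a<..<b}" for t
    using that by (intro continuous_intros continuous_on_compose2[OF Cinf_continuous_on[OF Cinf_qf[OF open_UNIV]]]
      continuous_on_compose2[OF cont]) auto
  \<comment> \<open>The plaques on which \<open>qf\<close> has opposite signs at the times
    \<open>h\<close> and \<open>- h\<close>. They form an open set by continuity, and each of them
    meets the torus by the intermediate value theorem.\<close>
  define O1 where "O1 = {r \<in> R. s * qf (\<Phi> (r, h)) \<in> {0<..}} \<inter> {r \<in> R. s * qf (\<Phi> (r, - h)) \<in> {..<0}}"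
  have "openin (top_of_set R) O1"
    unfolding O1_def using h ab
    by (intro openin_Int continuous_openin_preimage_gen[unfolded vimage_def Int_def mem_Collect_eq, simplified] contr) auto
  moreover have "p \<in> O1" using e(2)[OF h(1,2)] e(4)[OF h(1,3)] pR by (simp add: O1_def)
  moreover have "O1 \<subseteq> \<pi> ` (CC \<inter> V)"
  proof
    fix r assume r: "r \<in> O1"
    then have rR: "r \<in> R" by (simp add: O1_def)
    have "continuous_on {-h..h} (\<lambda>t. s * qf (\<Phi> (r, t)))"
      using rR h by (intro continuous_intros continuous_on_compose2[OF Cinf_continuous_on[OF Cinf_qf[OF open_UNIV]]]
        continuous_on_compose2[OF cont]) auto
    then obtain t where t: "- h \<le> t" "t \<le> h" "s * qf (\<Phi> (r, t)) = 0"
      using IVT'[of "\<lambda>t. s * qf (\<Phi> (r, t))" "- h" 0 h] r h by (auto simp: O1_def)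
    then have tab: "t \<in> {a<..<b}" using h by auto
    have "\<Phi> (r, t) \<in> CC" using t(3) dq inM1[OF rR tab] by (auto simp: CC_eq(2) s_def sgn_if split: if_splits)
    moreover have "\<Phi> (r, t) \<in> V" using img rR tab by blast
    ultimately show "r \<in> \<pi> ` (CC \<inter> V)" using \<Phi>(3)[OF rR tab] by (metis IntI imageI)
  qed
  ultimately have "p \<in> top_of_set R interior_of (\<pi> ` (CC \<inter> V))" unfolding interior_of_def by blast
  then show False using fr unfolding frontier_of_def p_def by blast
qed

section \<open>The torus\<close>

text \<open>On the sphere \<open>|z|\<^sup>2 + |w|\<^sup>2 = 1\<close> put \<open>P = z + w\<close>, \<open>P' = z - w\<close>, so that \<open>\<xi> = P P'\<close> and
  \<open>\<mu> = (|P|\<^sup>2 - |P'|\<^sup>2) / 2\<close>. The torus is given by \<open>Re (P P' (1 + i \<mu> / 2)) = 0\<close>; rotating \<open>P\<close> by the argument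
  of \<open>1 + i \<mu> / 2\<close> turns it into \<open>Re (Q P') = 0\<close>, that is \<open>|Q \<plusminus> cnj P'|\<^sup>2 = 2\<close>.\<close>

definition twist :: "real \<Rightarrow> complex" where
  "twist m = inverse (sqrt (1 + m\<^sup>2 / 4)) *\<^sub>R Complex 1 (m / 2)"

definition rt :: real where "rt = inverse (sqrt 2)"

lemma rt_simps: "rt * rt = 1 / 2" "rt * (rt * x) = x / 2"
    "complex_of_real rt * complex_of_real rt = 1 / 2" "complex_of_real rt * (complex_of_real rt * c) = c / 2"
proof -
  show 1: "rt * rt = 1 / 2" by (simp add: rt_def field_simps)
  then show "rt * (rt * x) = x / 2" by (simp add: mult.assoc[symmetric])
  show 2: "complex_of_real rt * complex_of_real rt = 1 / 2"
    using 1 by (metis of_real_1 of_real_divide of_real_mult of_real_numeral)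
  then show "complex_of_real rt * (complex_of_real rt * c) = c / 2" by (simp add: mult.assoc[symmetric])
qed

definition torus_coords :: "complex ^ 3 \<Rightarrow> complex \<times> complex" where
  "torus_coords p = (let Q = twist (mu p) * (p $ 1 + p $ 2); P' = cnj (p $ 1 - p $ 2)
     in (rt *\<^sub>R (Q + P'), rt *\<^sub>R (Q - P')))"

text \<open>Undoing \<open>torus_coords\<close> requires the angle of the rotation, hence
  \<open>mu\<close>, in terms of the image point \<open>(a, b)\<close>; it is
  \<open>Re (a * cnj b)\<close>.\<close>

definition torus_map :: "complex \<times> complex \<Rightarrow> complex ^ 3" where
  "torus_map c = (let P = cnj (twist (Re (fst c * cnj (snd c)))) * (rt *\<^sub>R (fst c + snd c));
       P' = rt *\<^sub>R cnj (fst c - snd c)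
     in vec3 ((1 / 2) *\<^sub>R (P + P')) ((1 / 2) *\<^sub>R (P - P')) 0)"

lemma twist_pos: "1 + m\<^sup>2 / 4 > (0::real)"
  by (simp add: add_pos_nonneg)

lemma twist_norm: "twist m * cnj (twist m) = 1"
proof -
  let ?r = "1 + m\<^sup>2 / 4"
  have "Complex 1 (m / 2) * cnj (Complex 1 (m / 2)) = complex_of_real ?r"
    by (simp add: complex_eq_iff power2_eq_square)
  then have "twist m * cnj (twist m) = complex_of_real (inverse (sqrt ?r) * inverse (sqrt ?r) * ?r)"
    by (simp add: twist_def scaleR_conv_of_real)
  also have "inverse (sqrt ?r) * inverse (sqrt ?r) * ?r = 1"
    using twist_pos[of m] by (simp add: field_simps)
  finally show ?thesis by simp
qed

lemma twist_Complex: "Complex 1 (m / 2) = sqrt (1 + m\<^sup>2 / 4) *\<^sub>R twist m"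
  using twist_pos[of m] by (simp add: twist_def)

lemma Cinf_twist:
  assumes "Cinf U f"
  shows "Cinf U (\<lambda>x. twist (f x))"
proof -
  have "sqrt (1 + (f x)\<^sup>2 / 4) \<noteq> 0" for x using twist_pos[of "f x"] by simp
  then show ?thesis
    unfolding twist_def by (intro Cinf_intros assms Cinf_open[OF assms]) (simp_all add: twist_pos)
qed

lemma Cinf_torus: "Cinf UNIV torus_coords" "Cinf UNIV torus_map"
  unfolding torus_coords_def torus_map_def Let_def
  by (intro Cinf_intros Cinf_twist Cinf_xi open_UNIV)+

lemma qf_factor: "qf p = Re ((p $ 1 + p $ 2) * (p $ 1 - p $ 2) * Complex 1 (mu p / 2))"
  by (simp add: qf_def xi_def power2_eq_square field_simps)

lemma sqn_factor: "complex_of_real (2 * sqn p) =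
    (p $ 1 + p $ 2) * cnj (p $ 1 + p $ 2) + (p $ 1 - p $ 2) * cnj (p $ 1 - p $ 2)"
  by (simp add: complex_eq_iff sqn_def power2_eq_square algebra_simps)

lemma mu_factor: "complex_of_real (2 * mu p) =
    (p $ 1 + p $ 2) * cnj (p $ 1 + p $ 2) - (p $ 1 - p $ 2) * cnj (p $ 1 - p $ 2)"
  by (simp add: complex_eq_iff mu_def algebra_simps)

lemma unit_circle_iff: "a \<in> sphere (0 :: complex) 1 \<longleftrightarrow> a * cnj a = 1"
proof -
  have "a * cnj a = 1 \<longleftrightarrow> (cmod a)\<^sup>2 = 1"
    unfolding complex_norm_square[symmetric] by (metis of_real_1 of_real_eq_iff)
  also have "\<dots> \<longleftrightarrow> cmod a = 1" using abs_square_eq_1[of "cmod a"] by simp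
  finally show ?thesis by simp
qed

text \<open>At the pole \<open>qf\<close> equals 1, so the puncture removes nothing from the zero
  set of \<open>qf\<close>.\<close>

lemma CC_point_not_pole: "qf p = 0 \<Longrightarrow> sqn p = 1 \<Longrightarrow> p $ 1 \<noteq> 1"
proof
  assume q: "qf p = 0" "sqn p = 1" "p $ 1 = 1"
  then have "p $ 2 = 0" by (simp add: sqn_def complex_eq_iff)
  then show False using q by (simp add: qf_def xi_def mu_def)
qed

lemma CC_iff: "p \<in> CC \<longleftrightarrow> sqn p = 1 \<and> qf p = 0 \<and> p $ 3 = 0"
  using CC_point_not_pole[of p] by (auto simp: CC_def punctured_sphere_def)

lemma torus_coords_in:
  assumes p: "p \<in> CC"
  shows "torus_coords p \<in> sphere 0 1 \<times> sphere 0 1"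
proof -
  define T where "T = twist (mu p)"
  define P where "P = p $ 1 + p $ 2"
  define P' where "P' = p $ 1 - p $ 2"
  have s: "P * cnj P + P' * cnj P' = 2"
    using sqn_factor[of p] p by (simp add: P_def P'_def CC_iff)
  have T: "T * cnj T = 1" by (simp add: T_def twist_norm)
  have "sqrt (1 + (mu p)\<^sup>2 / 4) * Re (P * P' * T) = 0"
    using p unfolding CC_iff qf_factor P_def P'_def T_def twist_Complex by simp
  then have "Re (P * P' * T) = 0" using twist_pos[of "mu p"] by simp
  then have re: "T * P * P' + cnj (T * P * P') = 0" unfolding complex_add_cnj by (simp add: mult_ac)
  have TT: "T * P * cnj (T * P) = P * cnj P" using T by (simp add: algebra_simps)
  have "(T * P + cnj P') * cnj (T * P + cnj P') = T * P * cnj (T * P) + P' * cnj P' + (T * P * P' + cnj (T * P * P'))"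
    by (simp add: algebra_simps)
  then have 1: "(T * P + cnj P') * cnj (T * P + cnj P') = 2" by (simp only: re TT s add_0_right)
  have "(T * P - cnj P') * cnj (T * P - cnj P') = T * P * cnj (T * P) + P' * cnj P' - (T * P * P' + cnj (T * P * P'))"
    by (simp add: algebra_simps)
  then have 2: "(T * P - cnj P') * cnj (T * P - cnj P') = 2" by (simp only: re TT s diff_0_right)
  have sc: "(rt *\<^sub>R x) * cnj (rt *\<^sub>R x) = (1 / 2) *\<^sub>R (x * cnj x)" for x :: complex
    by (simp add: scaleR_conv_of_real rt_simps mult_ac)
  show ?thesis
    unfolding torus_coords_def Let_def mem_Times_iff unit_circle_iff fst_conv snd_conv sc
      P_def[symmetric] P'_def[symmetric] T_def[symmetric] 1 2
    by (simp add: scaleR_conv_of_real)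
qed

lemma torus_map_in:
  assumes c: "c \<in> sphere 0 1 \<times> sphere 0 1"
  shows "torus_map c \<in> CC" "torus_coords (torus_map c) = c"
proof -
  obtain a b where ab: "c = (a, b)" "a * cnj a = 1" "b * cnj b = 1"
    using c by (cases c) (simp only: mem_Times_iff unit_circle_iff fst_conv snd_conv)
  define m where "m = Re (a * cnj b)"
  define T where "T = twist m"
  define Q where "Q = rt *\<^sub>R (a + b)"
  define P' where "P' = rt *\<^sub>R cnj (a - b)"
  define p where "p = torus_map c"
  have T: "T * cnj T = 1" by (simp add: T_def twist_norm)
  have p12: "p $ 1 + p $ 2 = cnj T * Q" "p $ 1 - p $ 2 = P'" "p $ 3 = 0"
    by (simp_all add: p_def torus_map_def Let_def ab(1) Q_def P'_def T_def m_def scaleR_conv_of_real field_simps)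
  have QQ: "Q * cnj Q = (1 / 2) *\<^sub>R ((a + b) * cnj (a + b))" "P' * cnj P' = (1 / 2) *\<^sub>R ((a - b) * cnj (a - b))"
    by (simp_all add: Q_def P'_def scaleR_conv_of_real rt_simps mult_ac)
  have TQ: "cnj T * Q * cnj (cnj T * Q) = Q * cnj Q"
  proof -
    have "cnj T * Q * cnj (cnj T * Q) = (T * cnj T) * (Q * cnj Q)" by (simp add: mult_ac)
    then show ?thesis by (simp add: T)
  qed
  have re: "a * cnj b + b * cnj a = complex_of_real (2 * m)"
    using complex_add_cnj[of "a * cnj b"] by (simp add: m_def mult.commute)
  have sq: "(a + b) * cnj (a + b) = 2 + (a * cnj b + b * cnj a)" "(a - b) * cnj (a - b) = 2 - (a * cnj b + b * cnj a)"
    using ab by (simp_all add: algebra_simps)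
  have "complex_of_real (2 * sqn p) = 2"
    unfolding sqn_factor p12 TQ QQ sq by (simp add: scaleR_conv_of_real algebra_simps)
  then have s: "sqn p = 1" by (metis of_real_eq_iff of_real_numeral mult_cancel_left1 numeral_neq_zero zero_neq_numeral mult.right_neutral mult_cancel_left)
  have "complex_of_real (2 * mu p) = complex_of_real (2 * m)"
    unfolding mu_factor p12 TQ QQ sq re by (simp add: scaleR_conv_of_real algebra_simps)
  then have m: "mu p = m" by (metis mult_cancel_left of_real_eq_iff zero_neq_numeral)
  have "(cnj T * Q) * P' * Complex 1 (m / 2) = sqrt (1 + m\<^sup>2 / 4) *\<^sub>R ((T * cnj T) * (Q * P'))"
    unfolding twist_Complex T_def[symmetric] by (simp add: mult_ac)
  then have "qf p = sqrt (1 + m\<^sup>2 / 4) * Re (Q * P')" unfolding qf_factor p12 m T by simp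
  also have "Q * P' = (1 / 2) *\<^sub>R ((a + b) * cnj (a - b))" by (simp add: Q_def P'_def scaleR_conv_of_real rt_simps mult_ac)
  also have "(a + b) * cnj (a - b) = a * cnj a - b * cnj b + (b * cnj a - cnj (b * cnj a))" by (simp add: algebra_simps)
  also have "Re ((1 / 2) *\<^sub>R (a * cnj a - b * cnj b + (b * cnj a - cnj (b * cnj a)))) = 0" unfolding ab by simp
  finally have "qf p = 0" by simp
  then show "torus_map c \<in> CC" unfolding CC_iff using s p12 by (simp add: p_def)
  have TTQ: "T * (cnj T * Q) = Q" using T by (simp add: mult.assoc[symmetric])
  have "Q + cnj P' = rt *\<^sub>R (2 * a)" "Q - cnj P' = rt *\<^sub>R (2 * b)"
    by (simp_all add: Q_def P'_def scaleR_conv_of_real algebra_simps)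
  then show "torus_coords (torus_map c) = c"
    unfolding p_def[symmetric] torus_coords_def Let_def p12 m T_def[symmetric] TTQ
    by (simp add: ab(1) scaleR_conv_of_real rt_simps)
qed

lemma torus_map_coords:
  assumes p: "p \<in> CC"
  shows "torus_map (torus_coords p) = p"
proof -
  define T where "T = twist (mu p)"
  define Q where "Q = T * (p $ 1 + p $ 2)"
  define P' where "P' = p $ 1 - p $ 2"
  obtain a b where ab: "torus_coords p = (a, b)" by (cases "torus_coords p")
  have a: "a = rt *\<^sub>R (Q + cnj P')" and b: "b = rt *\<^sub>R (Q - cnj P')"
    using ab by (simp_all add: torus_coords_def Let_def Q_def P'_def T_def)
  have T: "T * cnj T = 1" by (simp add: T_def twist_norm)
  have "a + b = rt *\<^sub>R (2 * Q)" "cnj (a - b) = rt *\<^sub>R (2 * P')"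
    unfolding a b by (simp_all add: scaleR_conv_of_real algebra_simps)
  then have Q: "rt *\<^sub>R (a + b) = Q" and P': "rt *\<^sub>R cnj (a - b) = P'"
    by (simp_all add: scaleR_conv_of_real rt_simps)
  have "a * cnj b = (1 / 2) *\<^sub>R (Q * cnj Q - P' * cnj P' + (cnj P' * cnj Q - cnj (cnj P' * cnj Q)))"
    unfolding a b by (simp add: scaleR_conv_of_real algebra_simps rt_simps)
  then have "Re (a * cnj b) = Re (Q * cnj Q - P' * cnj P') / 2" by simp
  also have "Q * cnj Q = (p $ 1 + p $ 2) * cnj (p $ 1 + p $ 2)"
  proof -
    have "Q * cnj Q = (T * cnj T) * ((p $ 1 + p $ 2) * cnj (p $ 1 + p $ 2))" by (simp add: Q_def mult_ac)
    then show ?thesis by (simp add: T)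
  qed
  finally have m: "Re (a * cnj b) = mu p" unfolding P'_def mu_factor[symmetric] by simp
  have TQ: "cnj T * Q = p $ 1 + p $ 2"
    unfolding Q_def using T by (simp add: mult.assoc[symmetric] mult.commute)
  show ?thesis
    unfolding torus_map_def Let_def ab fst_conv snd_conv Q P' m T_def[symmetric] TQ
    using p by (simp add: vec3_eq_iff P'_def CC_iff)
qed

lemma diffeomorphic_CC: "diffeomorphic CC (sphere (0 :: complex) 1 \<times> sphere (0 :: complex) 1)"
proof (rule diffeomorphicI)
  show "smooth_on CC torus_coords" "smooth_on (sphere 0 1 \<times> sphere 0 1) torus_map"
    by (auto intro: Cinf_imp_smooth_on[OF Cinf_torus(1)] Cinf_imp_smooth_on[OF Cinf_torus(2)])
  show "homeomorphism CC (sphere 0 1 \<times> sphere 0 1) torus_coords torus_map"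
  proof (rule homeomorphismI)
    show "continuous_on CC torus_coords" "continuous_on (sphere 0 1 \<times> sphere 0 1) torus_map"
      by (auto intro: continuous_on_subset[OF Cinf_continuous_on[OF Cinf_torus(1)]]
          continuous_on_subset[OF Cinf_continuous_on[OF Cinf_torus(2)]])
  qed (use torus_coords_in torus_map_in torus_map_coords in blast)+
qed

lemma compact_CC: "compact CC"
proof -
  have eq: "CC = torus_map ` (sphere 0 1 \<times> sphere 0 1)"
  proof (intro equalityI subsetI)
    show "p \<in> torus_map ` (sphere 0 1 \<times> sphere 0 1)" if "p \<in> CC" for p
      using torus_map_coords[OF that] torus_coords_in[OF that] by (metis imageI)
    show "p \<in> CC" if "p \<in> torus_map ` (sphere 0 1 \<times> sphere 0 1)" for p
      using that torus_map_in(1) by blast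
  qed
  show ?thesis
    unfolding eq
    by (intro compact_continuous_image continuous_on_subset[OF Cinf_continuous_on[OF Cinf_torus(2)]] compact_Times) auto
qed

lemma cis_derivative: "((\<lambda>t. cis (t * a)) has_vector_derivative \<i> * a) (at 0)"
proof -
  have "((\<lambda>t. Complex (cos (t * a)) (sin (t * a))) has_vector_derivative Complex 0 a) (at 0)"
    unfolding has_vector_derivative_complex_iff by (auto intro!: derivative_eq_intros simp: complex_eq_iff)
  then show ?thesis by (simp add: cis_conv_exp[symmetric] cis.ctr Complex_eq)
qed

text \<open>Rotating the two circle factors gives curves in the torus whose velocities
  \<open>h x\<close> depend linearly on \<open>x\<close>. The derivative of
  \<open>torus_coords\<close> is a left inverse on these velocities, so they span a plane.\<close>

lemma torus_tangent:
  assumes p: "p \<in> CC"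
  obtains V where "subspace V" "dim V = 2" "V \<subseteq> tangent_space CC p"
proof -
  obtain a b where ab: "torus_coords p = (a, b)" by (cases "torus_coords p")
  have unit: "a * cnj a = 1" "b * cnj b = 1"
    using torus_coords_in[OF p] unfolding ab by (simp_all only: mem_Times_iff unit_circle_iff fst_conv snd_conv)
  have pab: "torus_map (a, b) = p" using torus_map_coords[OF p] ab by simp
  obtain g' where g': "(torus_map has_derivative g') (at (a, b))" using Cinf_has_derivative[OF Cinf_torus(2)] by blast
  obtain f' where f': "(torus_coords has_derivative f') (at p)" using Cinf_has_derivative[OF Cinf_torus(1)] by blast
  define E where "E x = (a * (\<i> * complex_of_real (fst x)), b * (\<i> * complex_of_real (snd x)))" for x :: "real \<times> real"
  define h where "h x = g' (E x)" for x
  have lin_g: "linear g'" using g' by (rule has_derivative_linear)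
  have "linear E" by (rule linearI) (simp_all add: E_def algebra_simps scaleR_conv_of_real)
  then have lin: "linear h" unfolding h_def using lin_g by (rule linear_compose[unfolded o_def])
  define c where "c x t = (a * cis (t * fst x), b * cis (t * snd x))" for x :: "real \<times> real" and t
  have c_der: "(c x has_vector_derivative E x) (at 0)" for x
    unfolding c_def E_def
    by (intro has_vector_derivative_Pair has_vector_derivative_mult_right cis_derivative)
  have c0: "c x 0 = (a, b)" for x by (simp add: c_def)
  have c_in: "c x t \<in> sphere 0 1 \<times> sphere 0 1" for x t
  proof -
    have "y * cis u * cnj (y * cis u) = (y * cnj y) * (cis u * cnj (cis u))" for y u by (simp add: mult_ac)
    then have e: "y * cis u * cnj (y * cis u) = y * cnj y" for y u
      by (simp only: cis_cnj cis_mult) simp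
    show ?thesis unfolding c_def mem_Times_iff fst_conv snd_conv unit_circle_iff e unit by simp
  qed
  have mc: "((\<lambda>t. torus_map (c x t)) has_vector_derivative h x) (at 0)" for x
    using vector_derivative_diff_chain_within[of "c x" "E x" 0 UNIV torus_map g'] c_der g' c0
    by (simp add: o_def has_derivative_at_withinI h_def)
  have in_T: "h x \<in> tangent_space CC p" for x
  proof (rule tangent_space_curve[of 1])
    have "Cinf {-1<..<1} (c x)"
      unfolding c_def cis.ctr by (intro Cinf_intros) auto
    then show "Cinf {-1<..<1} (\<lambda>t. torus_map (c x t))"
      by (rule Cinf_compose[OF Cinf_torus(2)]) auto
    show "(\<lambda>t. torus_map (c x t)) ` {-1<..<1} \<subseteq> CC" using torus_map_in(1)[OF c_in[of x]] by blast
  qed (use mc c0 pab in auto)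
  have fh: "f' (h x) = E x" for x
  proof -
    have "((\<lambda>t. torus_coords (torus_map (c x t))) has_vector_derivative f' (h x)) (at 0)"
      using vector_derivative_diff_chain_within[of "\<lambda>t. torus_map (c x t)" "h x" 0 UNIV torus_coords f'] mc f' c0 pab
      by (simp add: o_def has_derivative_at_withinI)
    then have "(c x has_vector_derivative f' (h x)) (at 0)" by (simp add: torus_map_in(2)[OF c_in])
    then show ?thesis using c_der vector_derivative_unique_at by blast
  qed
  have "a \<noteq> 0" "b \<noteq> 0" using unit by auto
  then have "inj E" by (auto simp: inj_def E_def prod_eq_iff)
  moreover have "f' \<circ> h = E" using fh by auto
  ultimately have "inj h" by (metis inj_on_imageI2)
  then have "dim (range h) = 2"
    using dim_image_eq[OF lin, of UNIV] by (simp add: dim_UNIV)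
  moreover have "subspace (range h)" by (rule linear_subspace_image[OF lin subspace_UNIV])
  ultimately show thesis using that[of "range h"] in_T by blast
qed

lemma tangent_MM1_subspace:
  assumes "p \<in> MM1"
  shows "subspace (tangent_space MM1 p)" "dim (tangent_space MM1 p) = 3"
  using straightening.tangent_space_subspace[OF straightening_MM1 assms] by (simp_all add: dim_lin)

text \<open>A dimension count in the three-dimensional tangent space of \<open>MM1\<close>: the
  torus contributes a plane, and the characteristic direction \<open>X\<close> lies outside it
  because \<open>qf\<close> is constant on the torus but not along \<open>X\<close>.\<close>

lemma transversal_CC: "transversal_to_char_foliation MM MM1 CC"
  unfolding transversal_to_char_foliation_def
proof (intro conjI ballI CC_subset)
  fix p assume p: "p \<in> CC"
  have pM: "p \<in> MM1" using p CC_subset by auto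
  note T1 = tangent_MM1_subspace[OF pM]
  have CT: "tangent_space CC p \<subseteq> tangent_space MM1 p" by (rule tangent_space_mono[OF CC_subset(1)])
  have chT: "char_line MM MM1 p \<subseteq> tangent_space MM1 p" by (auto simp: char_line_def)
  obtain V where V: "subspace V" "dim V = 2" "V \<subseteq> tangent_space CC p" by (rule torus_tangent[OF p])
  \<comment> \<open>With this factor \<zeta>, the product of \<zeta> and \<open>cc p\<close> is
    \<open>\<i>\<close> times the squared modulus of \<open>cc p\<close>: its real part vanishes, as
    \<open>char_line_CC\<close> demands, and its imaginary part is \<open>dqf p X\<close>.\<close>
  define X where "X = (\<i> * cnj (cc p)) *s zt p"
  have ccc: "cnj (cc p) * cc p = complex_of_real ((cmod (cc p))\<^sup>2)"
    by (metis complex_norm_square mult.commute)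
  have X: "t *\<^sub>R X \<in> char_line MM MM1 p" for t
  proof -
    have "t *\<^sub>R X = (t *\<^sub>R (\<i> * cnj (cc p))) *s zt p" by (simp add: X_def vec_eq_iff)
    moreover have "Re (t *\<^sub>R (\<i> * cnj (cc p)) * cc p) = 0" using ccc by (simp add: mult.assoc)
    ultimately show ?thesis unfolding char_line_CC[OF p] by blast
  qed
  have "dqf p X = (cmod (cc p))\<^sup>2" unfolding X_def dqf_zt using ccc by (simp add: mult.assoc)
  then have dX: "dqf p X \<noteq> 0" using cc_nonzero[OF p] by simp
  have "X \<notin> V"
  proof
    assume "X \<in> V"
    then have "X \<in> tangent_space CC p" using V by auto
    then have "dqf p X = 0" by (rule tangent_space_const[OF _ has_derivative_qf]) (simp add: CC_def)
    then show False using dX by simp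
  qed
  moreover have spV: "span V = V" using V(1) by (simp add: span_eq_iff)
  ultimately have "X \<notin> span V" by metis
  then have d3: "dim (insert X V) = 3" by (simp add: dim_insert V(2))
  have "insert X V \<subseteq> tangent_space MM1 p" using X[of 1] chT V CT by auto
  then have sp: "span (insert X V) = tangent_space MM1 p"
    by (intro subspace_dim_equal subspace_span T1(1) span_minimal) (simp_all add: dim_span d3 T1(2))
  show "tangent_space CC p + char_line MM MM1 p = tangent_space MM1 p"
  proof (intro equalityI subsetI)
    fix v assume "v \<in> tangent_space CC p + char_line MM MM1 p"
    then show "v \<in> tangent_space MM1 p"
      using CT chT subspace_add[OF T1(1)] by (auto elim!: set_plus_elim)
  next
    fix v assume "v \<in> tangent_space MM1 p"
    then have "v \<in> span (insert X V)" by (simp add: sp)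
    then obtain k where k: "v - k *\<^sub>R X \<in> span V" by (auto simp: span_insert)
    then have "v - k *\<^sub>R X \<in> tangent_space CC p" using V(3) unfolding spV by blast
    then have "(v - k *\<^sub>R X) + k *\<^sub>R X \<in> tangent_space CC p + char_line MM MM1 p"
      using X by (rule set_plus_intro)
    then show "v \<in> tangent_space CC p + char_line MM MM1 p" by simp
  qed
qed

section \<open>Finite type\<close>

lemma lie_bracket_eq:
  assumes "(X has_derivative X') (at p)" "(Y has_derivative Y') (at p)"
  shows "lie_bracket X Y p = Y' (X p) - X' (Y p)"
  unfolding lie_bracket_def frechet_derivative_at[OF assms(1), symmetric] frechet_derivative_at[OF assms(2), symmetric] ..

lemma Cinf_frechet_apply:
  fixes X :: "'a::euclidean_space \<Rightarrow> 'a" and Y :: "'a \<Rightarrow> 'b::euclidean_space"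
  assumes "Cinf U X" "Cinf U Y"
  shows "Cinf U (\<lambda>x. frechet_derivative Y (at x) (X x))"
proof (rule Cinf_cong)
  show "Cinf U (\<lambda>x. \<Sum>b\<in>Basis. (X x \<bullet> b) *\<^sub>R frechet_derivative Y (at x) b)"
    by (intro Cinf_intros Cinf_frechet assms Cinf_open[OF assms(1)])
  fix x assume "x \<in> U"
  then have lin: "linear (frechet_derivative Y (at x))"
    using Cinf_has_derivative[OF assms(2)] has_derivative_linear by blast
  show "(\<Sum>b\<in>Basis. (X x \<bullet> b) *\<^sub>R frechet_derivative Y (at x) b) = frechet_derivative Y (at x) (X x)"
    unfolding linear_scale[OF lin, symmetric] linear_sum[OF lin, symmetric] euclidean_representation ..
qed

lemma Cinf_lie_bracket: "Cinf U X \<Longrightarrow> Cinf U Y \<Longrightarrow> Cinf U (lie_bracket X Y)"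
  unfolding lie_bracket_def by (intro Cinf_diff Cinf_frechet_apply)

text \<open>The two defining one-forms of the tangent spaces, differentiated along a tangent vector field: the
  terms containing second derivatives of the defining functions are symmetric, hence cancel in the
  bracket.\<close>

definition hess1 :: "complex ^ 3 \<Rightarrow> complex ^ 3 \<Rightarrow> real" where
  "hess1 v w = Re (cnj (v $ 1) * w $ 1 + cnj (v $ 2) * w $ 2)"

definition hess2 :: "complex ^ 3 \<Rightarrow> complex ^ 3 \<Rightarrow> complex ^ 3 \<Rightarrow> real" where
  "hess2 p v w = Re (2 * v $ 1 * w $ 1 - 2 * v $ 2 * w $ 2)
     - (Im (2 * v $ 1 * w $ 1 - 2 * v $ 2 * w $ 2) * mu p + Im (dxi p w) * dmu p v + Im (dxi p v) * dmu p w
        + Im (xi p) * (2 * Re (w $ 1 * cnj (v $ 2) + v $ 1 * cnj (w $ 2)))) / 2"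

lemma hess_sym: "hess1 v w = hess1 w v" "hess2 p v w = hess2 p w v"
  by (simp_all add: hess1_def hess2_def algebra_simps)

lemma has_derivative_dqf_field:
  assumes X: "(X has_derivative X') (at p)"
  shows "((\<lambda>q. dqf q (X q)) has_derivative (\<lambda>v. hess2 p v (X p) + dqf p (X' v))) (at p)"
proof -
  have xi: "((\<lambda>q. dxi q (X q)) has_derivative
      (\<lambda>v. (2 * v $ 1 * X p $ 1 - 2 * v $ 2 * X p $ 2) + dxi p (X' v))) (at p)"
    unfolding dxi_def by (auto intro!: derivative_eq_intros X simp: algebra_simps)
  have mu: "((\<lambda>q. dmu q (X q)) has_derivative
      (\<lambda>v. 2 * Re (X p $ 1 * cnj (v $ 2) + v $ 1 * cnj (X p $ 2)) + dmu p (X' v))) (at p)"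
    unfolding dmu_def
    by (rule derivative_eq_intros bounded_linear.has_derivative[OF bounded_linear_cnj] X refl)+ (simp add: algebra_simps)
  show ?thesis
    unfolding dqf_def[abs_def] hess2_def
    by (rule derivative_eq_intros xi mu has_derivative_xi has_derivative_mu refl | simp)+
      (simp add: field_simps)
qed

lemma tangent_field_derivative:
  assumes U: "open U" "p \<in> U" "p \<in> MM" and X: "(X has_derivative X') (at p)"
    and tan: "\<forall>q\<in>MM \<inter> U. X q \<in> tangent_space MM q" and v: "v \<in> tangent_space MM p"
  shows "hess1 v (X p) + Re (cnj (p $ 1) * X' v $ 1 + cnj (p $ 2) * X' v $ 2) = 0"
    and "Im (X' v $ 3) = hess2 p v (X p) + dqf p (X' v)"
proof -
  have v': "v \<in> tangent_space (MM \<inter> U) p" using v tangent_space_open_Int[OF U(1,2)] by simp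
  have "((\<lambda>q. Re (cnj (q $ 1) * X q $ 1 + cnj (q $ 2) * X q $ 2)) has_derivative
     (\<lambda>v. hess1 v (X p) + Re (cnj (p $ 1) * X' v $ 1 + cnj (p $ 2) * X' v $ 2))) (at p)"
    unfolding hess1_def
    by (rule derivative_eq_intros bounded_linear.has_derivative[OF bounded_linear_cnj] X refl)+ (simp add: algebra_simps)
  then show "hess1 v (X p) + Re (cnj (p $ 1) * X' v $ 1 + cnj (p $ 2) * X' v $ 2) = 0"
    by (rule tangent_space_const[OF v']) (use tan in \<open>auto simp: tangent_MM\<close>)
  have "((\<lambda>q. Im (X q $ 3) - dqf q (X q)) has_derivative
     (\<lambda>v. Im (X' v $ 3) - (hess2 p v (X p) + dqf p (X' v)))) (at p)"
    by (intro derivative_intros has_derivative_dqf_field X)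
  then have "Im (X' v $ 3) - (hess2 p v (X p) + dqf p (X' v)) = 0"
    by (rule tangent_space_const[OF v']) (use tan in \<open>auto simp: tangent_MM\<close>)
  then show "Im (X' v $ 3) = hess2 p v (X p) + dqf p (X' v)" by simp
qed

lemma dqf_diff: "dqf p (u - v) = dqf p u - dqf p v"
  by (simp add: dqf_def dxi_def dmu_def field_simps)

lemma lie_bracket_tangent:
  assumes U: "open U" and X: "Cinf U X" "\<forall>q\<in>MM \<inter> U. X q \<in> tangent_space MM q"
    and Y: "Cinf U Y" "\<forall>q\<in>MM \<inter> U. Y q \<in> tangent_space MM q" and p: "p \<in> MM \<inter> U"
  shows "lie_bracket X Y p \<in> tangent_space MM p"
proof -
  have p': "p \<in> U" "p \<in> MM" using p by auto
  obtain X' Y' where d: "(X has_derivative X') (at p)" "(Y has_derivative Y') (at p)"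
    using Cinf_has_derivative[OF X(1) p'(1)] Cinf_has_derivative[OF Y(1) p'(1)] by blast
  have t: "X p \<in> tangent_space MM p" "Y p \<in> tangent_space MM p" using X Y p by auto
  note dX = tangent_field_derivative[OF U p' d(1) X(2) t(2)]
  note dY = tangent_field_derivative[OF U p' d(2) Y(2) t(1)]
  show ?thesis
    unfolding lie_bracket_eq[OF d] tangent_MM[OF p'(2)] mem_Collect_eq dqf_diff
    using dX dY hess_sym(2)[of p "X p" "Y p"] hess_sym(1)[of "X p" "Y p"]
    by (simp add: algebra_simps)
qed

lemma CR_bracket_tangent:
  assumes "CR_bracket MM U j Z" "open U"
  shows "Cinf U Z \<and> (\<forall>q\<in>MM \<inter> U. Z q \<in> tangent_space MM q)"
  using assms
proof (induction rule: CR_bracket.induct)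
  case (CR_section X)
  then show ?case by (auto simp: smooth_on_open_iff complex_tangent_def)
next
  case (CR_Lie j X k Y)
  then show ?case using lie_bracket_tangent[OF CR_Lie.prems] Cinf_lie_bracket by blast
qed

section \<open>Explicit brackets of the complex tangential frame\<close>

definition dcc :: "complex ^ 3 \<Rightarrow> complex ^ 3 \<Rightarrow> complex" where
  "dcc p v = Complex (2 * mu p * dmu p v - 2 * Im (xi p) * Im (dxi p v))
     (- 2 * dmu p v - Re (dxi p v) * Im (xi p) - Re (xi p) * Im (dxi p v))"

definition dzt :: "complex ^ 3 \<Rightarrow> complex ^ 3 \<Rightarrow> complex ^ 3" where
  "dzt p v = vec3 (- cnj (v $ 2)) (cnj (v $ 1)) (dcc p v)"

definition ee :: "complex ^ 3 \<Rightarrow> complex" where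
  "ee p = - 2 * xi p + \<i> * (2 * cnj (xi p) * mu p - 3 * xi p * mu p)"

definition dee :: "complex ^ 3 \<Rightarrow> complex ^ 3 \<Rightarrow> complex" where
  "dee p v = - 2 * dxi p v + \<i> * (2 * (cnj (dxi p v) * mu p + cnj (xi p) * dmu p v)
     - 3 * (dxi p v * mu p + xi p * dmu p v))"

text \<open>The generator of the Hopf rotation, lifted to \<open>MM\<close>; it is the bracket of
  \<open>zt\<close> and \<open>\<i> *s zt\<close> divided by -2.\<close>

definition yy :: "complex ^ 3 \<Rightarrow> complex ^ 3" where
  "yy p = vec3 (\<i> * p $ 1) (\<i> * p $ 2) (ee p)"

definition dyy :: "complex ^ 3 \<Rightarrow> complex ^ 3 \<Rightarrow> complex ^ 3" where
  "dyy p v = vec3 (\<i> * v $ 1) (\<i> * v $ 2) (dee p v)"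

text \<open>The vertical part of the bracket of \<open>\<i> *s zt\<close> with
  \<open>yy\<close>.\<close>

definition kk :: "complex ^ 3 \<Rightarrow> real" where
  "kk p = 4 * (Re (xi p))\<^sup>2 + 4 * (Im (xi p))\<^sup>2 - 8 * (mu p)\<^sup>2 - 6 * Re ((xi p)\<^sup>2)"

definition dkk :: "complex ^ 3 \<Rightarrow> complex ^ 3 \<Rightarrow> real" where
  "dkk p v = 8 * Re (xi p) * Re (dxi p v) + 8 * Im (xi p) * Im (dxi p v) - 16 * mu p * dmu p v
     - 12 * Re (xi p * dxi p v)"

abbreviation vert :: "complex ^ 3" where "vert \<equiv> vec3 0 0 1"

lemma has_derivative_cc: "(cc has_derivative dcc p) (at p)"
  unfolding cc_def[abs_def] dcc_def Complex_eq
  by (rule derivative_eq_intros has_derivative_xi has_derivative_mu refl | simp)+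
    (simp add: complex_eq_iff algebra_simps power2_eq_square)

lemma has_derivative_zt: "(zt has_derivative dzt p) (at p)"
  unfolding zt_def[abs_def] dzt_def
  by (rule has_derivative_vec3 derivative_eq_intros bounded_linear.has_derivative[OF bounded_linear_cnj] has_derivative_cc refl)+

lemma has_derivative_smult:
  assumes "(X has_derivative X') (at (p :: complex ^ 3))"
  shows "((\<lambda>q. c *s (X q :: complex ^ 3)) has_derivative (\<lambda>v. c *s X' v)) (at p)"
proof -
  have "bounded_linear (\<lambda>x :: complex ^ 3. c *s x)"
    by (intro linear_conv_bounded_linear[THEN iffD1] linearI) (auto simp: vec_eq_iff algebra_simps)
  then show ?thesis using assms by (rule bounded_linear.has_derivative)
qed

lemma has_derivative_ee: "(ee has_derivative dee p) (at p)"
  unfolding ee_def[abs_def] dee_def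
  by (rule derivative_eq_intros bounded_linear.has_derivative[OF bounded_linear_cnj] has_derivative_xi has_derivative_mu refl | simp)+
    (simp add: algebra_simps)

lemma has_derivative_yy: "(yy has_derivative dyy p) (at p)"
  unfolding yy_def[abs_def] dyy_def
  by (rule has_derivative_vec3 derivative_eq_intros has_derivative_ee refl | simp)+

lemma has_derivative_kk: "(kk has_derivative dkk p) (at p)"
  unfolding kk_def[abs_def] dkk_def
  by (rule derivative_eq_intros has_derivative_xi has_derivative_mu refl | simp)+
    (simp add: algebra_simps)

lemma dxi_yy: "dxi p (yy p) = 2 * \<i> * xi p" and dmu_yy: "dmu p (yy p) = 0"
  by (simp_all add: dxi_def dmu_def yy_def xi_def power2_eq_square algebra_simps)

lemma linear_dzt: "linear (dzt p)"
  using has_derivative_zt has_derivative_linear by blast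

lemma dzt_vert: "dzt p (c *\<^sub>R vert) = 0"
  by (simp add: dzt_def dcc_def dxi_def dmu_def vec3_eq_iff complex_eq_iff)

lemma zt_nth: "zt p $ 1 = - cnj (p $ 2)" "zt p $ 2 = cnj (p $ 1)" "zt p $ 3 = cc p"
  by (simp_all add: zt_def)

lemma at_zt:
  "dxi p (zt p) = - 2 * mu p" "dmu p (zt p) = 2 * Re (xi p)"
  "dxi p (\<i> *s zt p) = - 2 * \<i> * mu p" "dmu p (\<i> *s zt p) = 2 * Im (xi p)"
  using dxi_zt[of p 1] dmu_zt[of p 1] dxi_zt[of p \<i>] dmu_zt[of p \<i>] by simp_all

lemma bracket_2: "lie_bracket zt (\<lambda>p. \<i> *s zt p) = (\<lambda>p. - 2 *\<^sub>R yy p)"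
proof
  fix p
  have "\<i> * dcc p (zt p) - dcc p (\<i> *s zt p) = - 2 * ee p"
    unfolding dcc_def ee_def at_zt by (simp add: complex_eq_iff power2_eq_square algebra_simps)
  then show "lie_bracket zt (\<lambda>p. \<i> *s zt p) p = - 2 *\<^sub>R yy p"
    unfolding lie_bracket_eq[OF has_derivative_zt has_derivative_smult[OF has_derivative_zt]]
    by (simp add: vec3_eq_iff dzt_def yy_def zt_nth) (simp add: complex_eq_iff)
qed

text \<open>In the sphere directions \<open>zt\<close>, \<open>\<i> *s zt\<close> and
  \<open>yy\<close> satisfy the relations of the Lie algebra su(2). The information on the type sits
  in the additional multiples of \<open>vert\<close>.\<close>

lemma bracket_3:
  "lie_bracket zt (\<lambda>p. - 2 *\<^sub>R yy p) = (\<lambda>p. - 2 *\<^sub>R ((2 * \<i>) *s zt p + (6 * Im ((xi p)\<^sup>2)) *\<^sub>R vert))"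
  "lie_bracket (\<lambda>p. \<i> *s zt p) (\<lambda>p. - 2 *\<^sub>R yy p) = (\<lambda>p. - 2 *\<^sub>R ((- 2) *s zt p + kk p *\<^sub>R vert))"
proof -
  have yy2: "((\<lambda>p. - 2 *\<^sub>R yy p) has_derivative (\<lambda>v. - 2 *\<^sub>R dyy p v)) (at p)" for p
    by (intro derivative_intros has_derivative_yy)
  have lin: "dzt p (- 2 *\<^sub>R v) = - 2 *\<^sub>R dzt p v" for p v by (rule linear_scale[OF linear_dzt])
  have 1: "dee p (zt p) - dcc p (yy p) = 2 * \<i> * cc p + 6 * Im ((xi p)\<^sup>2)" for p
    unfolding dcc_def dee_def at_zt dxi_yy dmu_yy cc_def by (simp add: complex_eq_iff power2_eq_square algebra_simps)
  have 2: "dee p (\<i> *s zt p) - \<i> * dcc p (yy p) = - 2 * cc p + kk p" for p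
    unfolding dcc_def dee_def at_zt dxi_yy dmu_yy cc_def kk_def by (simp add: complex_eq_iff power2_eq_square algebra_simps)
  have "dyy p (zt p) - dzt p (yy p) = (2 * \<i>) *s zt p + (6 * Im ((xi p)\<^sup>2)) *\<^sub>R vert" for p
    using 1[of p] by (simp add: vec3_eq_iff dyy_def dzt_def zt_nth scaleR_conv_of_real[where 'a = complex]) (simp add: yy_def)
  then show "lie_bracket zt (\<lambda>p. - 2 *\<^sub>R yy p) = (\<lambda>p. - 2 *\<^sub>R ((2 * \<i>) *s zt p + (6 * Im ((xi p)\<^sup>2)) *\<^sub>R vert))"
    unfolding fun_eq_iff lie_bracket_eq[OF has_derivative_zt yy2] lin scaleR_diff_right[symmetric] by simp
  have "dyy p (\<i> *s zt p) - \<i> *s dzt p (yy p) = (- 2) *s zt p + kk p *\<^sub>R vert" for p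
    using 2[of p] by (simp add: vec3_eq_iff dyy_def dzt_def zt_nth scaleR_conv_of_real[where 'a = complex]) (simp add: yy_def)
  moreover have "\<i> *s (- 2 *\<^sub>R v) = - 2 *\<^sub>R (\<i> *s v)" for v :: "complex ^ 3" by (simp add: vec_eq_iff)
  ultimately show "lie_bracket (\<lambda>p. \<i> *s zt p) (\<lambda>p. - 2 *\<^sub>R yy p) = (\<lambda>p. - 2 *\<^sub>R ((- 2) *s zt p + kk p *\<^sub>R vert))"
    unfolding fun_eq_iff lie_bracket_eq[OF has_derivative_smult[OF has_derivative_zt] yy2] lin
    by (metis scaleR_diff_right)
qed

lemma bracket_4:
  "lie_bracket zt (\<lambda>p. - 2 *\<^sub>R ((- 2) *s zt p + kk p *\<^sub>R vert)) = (\<lambda>p. - 2 *\<^sub>R (dkk p (zt p) *\<^sub>R vert))"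
  "lie_bracket (\<lambda>p. \<i> *s zt p) (\<lambda>p. - 2 *\<^sub>R ((- 2) *s zt p + kk p *\<^sub>R vert)) =
     (\<lambda>p. - 2 *\<^sub>R (- 4 *\<^sub>R yy p + dkk p (\<i> *s zt p) *\<^sub>R vert))"
proof -
  let ?b = "\<lambda>p. - 2 *\<^sub>R ((- 2) *s zt p + kk p *\<^sub>R vert)"
  have b: "(?b has_derivative (\<lambda>v. - 2 *\<^sub>R ((- 2) *s dzt p v + dkk p v *\<^sub>R vert))) (at p)" for p
    by (intro derivative_intros has_derivative_smult has_derivative_zt has_derivative_scaleR_left has_derivative_kk)
  have m2: "(- 2) *s v = - 2 *\<^sub>R v" for v :: "complex ^ 3" by (simp add: vec_eq_iff scaleR_conv_of_real)
  have db: "dzt p (4 *\<^sub>R zt p - (kk p * 2) *\<^sub>R vert) = 4 *\<^sub>R dzt p (zt p)" for p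
  proof -
    have "dzt p vert = 0" using dzt_vert[of p 1] by simp
    then show ?thesis by (simp add: linear_scale[OF linear_dzt] linear_diff[OF linear_dzt])
  qed
  show "lie_bracket zt ?b = (\<lambda>p. - 2 *\<^sub>R (dkk p (zt p) *\<^sub>R vert))"
  proof
    fix p
    show "lie_bracket zt ?b p = - 2 *\<^sub>R (dkk p (zt p) *\<^sub>R vert)"
      by (subst lie_bracket_eq[OF has_derivative_zt b], unfold m2) (simp add: algebra_simps db)
  qed
  have "dzt p (\<i> *s zt p) - \<i> *s dzt p (zt p) = 2 *\<^sub>R yy p" for p
    using fun_cong[OF bracket_2, of p]
    unfolding lie_bracket_eq[OF has_derivative_zt has_derivative_smult[OF has_derivative_zt]] by (simp add: algebra_simps)
  then have y: "dzt p (\<i> *s zt p) = 2 *\<^sub>R yy p + \<i> *s dzt p (zt p)" for p by (simp add: algebra_simps)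
  have i4: "\<i> *s (4 *\<^sub>R v) = 4 *\<^sub>R (\<i> *s v)" for v :: "complex ^ 3" by (simp add: vec_eq_iff)
  show "lie_bracket (\<lambda>p. \<i> *s zt p) ?b = (\<lambda>p. - 2 *\<^sub>R (- 4 *\<^sub>R yy p + dkk p (\<i> *s zt p) *\<^sub>R vert))"
  proof
    fix p
    show "lie_bracket (\<lambda>p. \<i> *s zt p) ?b p = - 2 *\<^sub>R (- 4 *\<^sub>R yy p + dkk p (\<i> *s zt p) *\<^sub>R vert)"
      by (subst lie_bracket_eq[OF has_derivative_smult[OF has_derivative_zt] b], unfold m2)
        (simp add: algebra_simps db y i4)
  qed
qed

lemma Cinf_zt: "Cinf UNIV zt"
proof -
  have "Cinf UNIV cc" unfolding cc_def[abs_def] by (intro Cinf_intros Cinf_xi open_UNIV)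
  then show ?thesis unfolding zt_def[abs_def] by (intro Cinf_intros open_UNIV)
qed

lemma CR_sections: "CR_bracket MM UNIV 1 zt" "CR_bracket MM UNIV 1 (\<lambda>p. \<i> *s zt p)"
proof -
  have "bounded_linear (\<lambda>x :: complex ^ 3. \<i> *s x)"
    by (intro linear_conv_bounded_linear[THEN iffD1] linearI) (auto simp: vec_eq_iff algebra_simps)
  then have "Cinf UNIV (\<lambda>p. \<i> *s zt p)" by (rule Cinf_linear_compose[OF _ Cinf_zt])
  then have "smooth_on UNIV zt" "smooth_on UNIV (\<lambda>p. \<i> *s zt p)"
    using Cinf_zt by (simp_all add: smooth_on_open_iff)
  moreover have "zt q = 1 *s zt q" for q by simp
  then have "q \<in> MM \<Longrightarrow> zt q \<in> complex_tangent MM q" for q unfolding complex_tangent_MM by blast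
  moreover have "q \<in> MM \<Longrightarrow> \<i> *s zt q \<in> complex_tangent MM q" for q unfolding complex_tangent_MM by blast
  ultimately show "CR_bracket MM UNIV 1 zt" "CR_bracket MM UNIV 1 (\<lambda>p. \<i> *s zt p)"
    by - (rule CR_section, assumption, simp)+
qed

lemma finite_type_MM:
  assumes p: "p \<in> MM"
  shows "finite_type_at 4 MM p"
proof -
  let ?B = "{Z p | Z U j. open U \<and> p \<in> U \<and> j \<le> 4 \<and> CR_bracket MM U j Z}"
  define S where "S = span ?B"
  have S: "subspace S" by (simp add: S_def)
  have T: "subspace (tangent_space MM p)"
    using straightening.tangent_space_subspace[OF straightening_MM p] by simp
  have B: "Z p \<in> S" if "CR_bracket MM UNIV j Z" "j \<le> 4" for Z j
    unfolding S_def by (rule span_base) (use that open_UNIV in blast)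
  note b1 = CR_sections
  note b2 = CR_Lie[OF b1(1) b1(2), unfolded bracket_2]
  note b3 = CR_Lie[OF b1(1) b2, unfolded bracket_3] CR_Lie[OF b1(2) b2, unfolded bracket_3]
  note b4 = CR_Lie[OF b1(1) b3(2), unfolded bracket_4] CR_Lie[OF b1(2) b3(2), unfolded bracket_4]
  have in_S: "zt p \<in> S" "\<i> *s zt p \<in> S" "- 2 *\<^sub>R yy p \<in> S"
      "- 2 *\<^sub>R ((2 * \<i>) *s zt p + (6 * Im ((xi p)\<^sup>2)) *\<^sub>R vert) \<in> S"
      "- 2 *\<^sub>R ((- 2) *s zt p + kk p *\<^sub>R vert) \<in> S"
      "- 2 *\<^sub>R (dkk p (zt p) *\<^sub>R vert) \<in> S"
      "- 2 *\<^sub>R (- 4 *\<^sub>R yy p + dkk p (\<i> *s zt p) *\<^sub>R vert) \<in> S"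
    using B[OF b1(1)] B[OF b1(2)] B[OF b2] B[OF b3(1)] B[OF b3(2)] B[OF b4(1)] B[OF b4(2)] by simp_all
  have half: "v \<in> S" if "- 2 *\<^sub>R v \<in> S" for v
    using subspace_mul[OF S that, of "- 1 / 2"] by simp
  have yS: "yy p \<in> S" by (rule half) (rule in_S)
  have ztS: "c *s zt p \<in> S" for c
  proof -
    have "c *s zt p = Re c *\<^sub>R zt p + Im c *\<^sub>R (\<i> *s zt p)"
      by (simp add: vec_eq_iff complex_eq_iff algebra_simps)
    then show ?thesis using in_S(1,2) S by (simp add: subspace_add subspace_mul)
  qed
  have vS: "vert \<in> S" if "r *\<^sub>R vert \<in> S" "r \<noteq> 0" for r
    using subspace_mul[OF S that(1), of "inverse r"] that(2) by simp
  have vS2: "vert \<in> S" if "u + r *\<^sub>R vert \<in> S" "u \<in> S" "r \<noteq> 0" for u r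
    using vS[of r] subspace_diff[OF S that(1,2)] that(3) by simp
  have vert: "vert \<in> S"
  \<comment> \<open>A nonzero vertical part in a bracket of length 3 gives \<open>vert\<close> at
    once. Otherwise \<open>a * b = 0\<close> and \<open>5 * b^2 = a^2 + 4 * m^2\<close>; this makes
    \<open>m\<close> and \<open>b\<close> nonzero, and so is the derivative
    \<open>- 72 * m * b\<close> of \<open>kk\<close> along \<open>\<i> *s zt\<close>, which appears
    in a bracket of length 4.\<close>
  proof (cases "6 * Im ((xi p)\<^sup>2) = 0 \<and> kk p = 0")
    case False
    then show ?thesis using vS2[OF half[OF in_S(4)] ztS] vS2[OF half[OF in_S(5)] ztS] by blast
  next
    case True
    define a where "a = Re (xi p)"
    define b where "b = Im (xi p)"
    define m where "m = mu p"
    have s: "a\<^sup>2 + b\<^sup>2 + m\<^sup>2 = 1" using xi_mu_sphere[OF MM_sphere[OF p]] by (simp add: a_def b_def m_def)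
    have ab: "a * b = 0" and k: "10 * b\<^sup>2 = 2 * a\<^sup>2 + 8 * m\<^sup>2"
      using True by (auto simp: kk_def a_def b_def m_def power2_eq_square algebra_simps)
    have "m \<noteq> 0"
    proof
      assume "m = 0"
      then have "10 * b\<^sup>2 = 2 * a\<^sup>2" using k by simp
      then have "a = 0" "b = 0" using ab by auto
      then show False using s \<open>m = 0\<close> by simp
    qed
    moreover have "b \<noteq> 0" using k \<open>m \<noteq> 0\<close> by (auto simp: power2_eq_square add_nonneg_eq_0_iff)
    moreover have "dkk p (\<i> *s zt p) = - 72 * m * b"
      unfolding dkk_def at_zt by (simp add: a_def b_def m_def algebra_simps)
    ultimately have "dkk p (\<i> *s zt p) \<noteq> 0" by simp
    moreover have "- 4 *\<^sub>R yy p \<in> S" by (rule subspace_mul[OF S yS])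
    ultimately show ?thesis using vS2[OF half[OF in_S(7)]] by blast
  qed
  have "tangent_space MM p \<subseteq> S"
  proof
    fix v assume v: "v \<in> tangent_space MM p"
    define H where "H = cnj (p $ 1) * v $ 1 + cnj (p $ 2) * v $ 2"
    define Z where "Z = p $ 1 * v $ 2 - p $ 2 * v $ 1"
    have "Re H = 0" using v by (simp add: tangent_MM[OF p] H_def)
    then have H: "H = \<i> * Im H" by (simp add: complex_eq_iff)
    \<comment> \<open>Without its components along \<open>zt\<close> and \<open>yy\<close>, the
      tangent vector has vanishing first two entries and is a real multiple of
      \<open>vert\<close>.\<close>
    define d where "d = v - Z *s zt p - Im H *\<^sub>R yy p"
    have "- 2 *\<^sub>R yy p \<in> tangent_space MM p"
      using CR_bracket_tangent[OF b2 open_UNIV] p by auto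
    from subspace_mul[OF T this, of "- Im H / 2"] have "Im H *\<^sub>R yy p \<in> tangent_space MM p" by simp
    then have dT: "d \<in> tangent_space MM p"
      unfolding d_def using v zt_tangent[OF p] T by (simp add: subspace_diff)
    have "v $ 1 = H * p $ 1 - Z * cnj (p $ 2)" "v $ 2 = H * p $ 2 + Z * cnj (p $ 1)"
      using sphere_decomp[OF MM_sphere[OF p], of v] by (simp_all add: H_def Z_def)
    then have d12: "d $ 1 = 0" "d $ 2 = 0"
      by (simp_all add: d_def zt_nth yy_def scaleR_conv_of_real[where 'a = complex])
        (use H in \<open>simp_all add: mult.assoc[symmetric] mult.commute\<close>)
    then have "dqf p d = 0" by (simp add: dqf_def dxi_def dmu_def)
    then have "Im (d $ 3) = 0" using dT by (simp add: tangent_MM[OF p])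
    then have "d = Re (d $ 3) *\<^sub>R vert" using d12 by (simp add: vec3_eq_iff complex_eq_iff)
    then have "d \<in> S" using subspace_mul[OF S vert, of "Re (d $ 3)"] by simp
    moreover have "v = d + Z *s zt p + Im H *\<^sub>R yy p" by (simp add: d_def)
    ultimately show "v \<in> S" by (simp only: subspace_add[OF S] subspace_mul[OF S] ztS yS)
  qed
  moreover have "S \<subseteq> tangent_space MM p"
    unfolding S_def
  proof (rule span_minimal[OF _ T])
    show "?B \<subseteq> tangent_space MM p" using CR_bracket_tangent p by blast
  qed
  ultimately show ?thesis unfolding finite_type_at_def S_def by blast
qed

section \<open>Global minimality\<close>

text \<open>A single smooth piece defined on the whole line, with two-sided derivatives; one-sided
  ones occur only when arcs are spliced into a \<open>CR_curve\<close>.\<close>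

definition CR_arc :: "complex ^ 3 \<Rightarrow> complex ^ 3 \<Rightarrow> bool" where
  "CR_arc p q \<longleftrightarrow> (\<exists>\<gamma> \<delta>. Cinf UNIV \<gamma> \<and> \<gamma> (0::real) = p \<and> \<gamma> 1 = q \<and>
     (\<forall>t\<in>{0..1}. \<gamma> t \<in> MM \<and> (\<gamma> has_vector_derivative \<delta> t) (at t) \<and> \<delta> t \<in> complex_tangent MM (\<gamma> t) - {0}))"

lemma vector_derivative_within_Icc:
  fixes f :: "real \<Rightarrow> 'a::real_normed_vector"
  assumes "(f has_vector_derivative d) (at t within {a..b})" "a < b" "t \<in> {a..b}"
  shows "vector_derivative f (at t within {a..b}) = d"
  using vector_derivative_within_cbox[of a b t f d] assms by (simp add: cbox_interval)

lemma smooth_on_differentiable_within: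
  fixes \<gamma> :: "real \<Rightarrow> 'a::euclidean_space"
  assumes "smooth_on S \<gamma>" "t \<in> S"
  shows "(\<gamma> has_vector_derivative vector_derivative \<gamma> (at t within S)) (at t within S)"
proof -
  obtain U g where U: "Cinf U g" "t \<in> U" "\<forall>y\<in>S \<inter> U. g y = \<gamma> y"
    using assms unfolding smooth_on_def Cinf_def by meson
  have "(g has_derivative frechet_derivative g (at t)) (at t within S)"
    using Cinf_has_derivative[OF U(1,2)] by (rule has_derivative_at_withinI)
  then have "(\<gamma> has_derivative frechet_derivative g (at t)) (at t within S)"
  proof (rule has_derivative_transform_eventually)
    show "\<forall>\<^sub>F x in at t within S. g x = \<gamma> x"
      unfolding eventually_at_topological using U(2,3) Cinf_open[OF U(1)] by (intro exI[of _ U]) auto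
  qed (use U assms in auto)
  then have "\<gamma> differentiable (at t within S)" by (auto simp: differentiable_def)
  then show ?thesis using vector_derivative_works by blast
qed

lemma complex_tangent_scale:
  assumes "p \<in> MM" "v \<in> complex_tangent MM p - {0}" "r \<noteq> (0::real)"
  shows "r *\<^sub>R v \<in> complex_tangent MM p - {0}"
proof -
  obtain \<zeta> where "v = \<zeta> *s zt p" using assms(2) unfolding complex_tangent_MM[OF assms(1)] by auto
  then have "r *\<^sub>R v = (r *\<^sub>R \<zeta>) *s zt p" by (simp add: vec_eq_iff)
  then show ?thesis using assms(2,3) unfolding complex_tangent_MM[OF assms(1)] by auto
qed

lemma CR_arc_orbit:
  assumes "CR_arc p q"
  shows "q \<in> CR_orbit MM p"
proof -
  obtain \<gamma> \<delta> where g: "Cinf UNIV \<gamma>" "\<gamma> (0::real) = p" "\<gamma> 1 = q"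
    "\<And>t. t \<in> {0..1} \<Longrightarrow> \<gamma> t \<in> MM \<and> (\<gamma> has_vector_derivative \<delta> t) (at t) \<and> \<delta> t \<in> complex_tangent MM (\<gamma> t) - {0}"
    using assms unfolding CR_arc_def by blast
  have "CR_curve MM \<gamma>"
    unfolding CR_curve_def
  proof (intro exI[of _ 1] exI[of _ real] conjI allI impI ballI)
    fix i :: nat assume "i < 1"
    then have i: "i = 0" by simp
    show "smooth_on {real i..real (Suc i)} \<gamma>" by (rule Cinf_imp_smooth_on[OF g(1)]) auto
    fix t assume t: "t \<in> {real i..real (Suc i)}"
    then have t': "t \<in> {0..1}" by (simp add: i)
    show "\<gamma> t \<in> MM" using g(4)[OF t'] by simp
    have "vector_derivative \<gamma> (at t within {real i..real (Suc i)}) = \<delta> t"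
      by (rule vector_derivative_within_Icc[OF _ _ t]) (use g(4)[OF t'] in \<open>auto intro: has_vector_derivative_at_within\<close>)
    then show "vector_derivative \<gamma> (at t within {real i..real (Suc i)}) \<in> complex_tangent MM (\<gamma> t) - {0}"
      using g(4)[OF t'] by simp
  qed auto
  then show ?thesis unfolding CR_orbit_def using g by blast
qed

text \<open>Concatenation at double speed: the given curve runs on the first half of the unit
  interval, the arc on the second. Doubling the velocity keeps it nonzero and complex
  tangential.\<close>

lemma CR_orbit_arc:
  assumes q: "q \<in> CR_orbit MM p" and arc: "CR_arc q r"
  shows "r \<in> CR_orbit MM p"
proof -
  obtain \<gamma>1 where c1: "CR_curve MM \<gamma>1" "\<gamma>1 0 = p" "\<gamma>1 1 = q" using q unfolding CR_orbit_def by blast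
  obtain n \<tau> where \<tau>: "\<tau> 0 = 0" "\<tau> n = 1"
    "\<And>i. i < n \<Longrightarrow> \<tau> i < \<tau> (Suc i) \<and> smooth_on {\<tau> i..\<tau> (Suc i)} \<gamma>1 \<and>
        (\<forall>t\<in>{\<tau> i..\<tau> (Suc i)}. \<gamma>1 t \<in> MM \<and>
              vector_derivative \<gamma>1 (at t within {\<tau> i..\<tau> (Suc i)}) \<in> complex_tangent MM (\<gamma>1 t) - {0})"
    using c1(1) unfolding CR_curve_def by blast
  obtain \<gamma>2 \<delta> where g: "Cinf UNIV \<gamma>2" "\<gamma>2 (0::real) = q" "\<gamma>2 1 = r"
    "\<And>t. t \<in> {0..1} \<Longrightarrow> \<gamma>2 t \<in> MM \<and> (\<gamma>2 has_vector_derivative \<delta> t) (at t) \<and> \<delta> t \<in> complex_tangent MM (\<gamma>2 t) - {0}"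
    using arc unfolding CR_arc_def by blast
  have mono: "\<tau> i \<le> 1" if "i \<le> n" for i
    using that
  proof (induction rule: inc_induct)
    case (step i)
    then show ?case using \<tau>(3)[of i] by simp
  qed (simp add: \<tau>)
  define \<gamma> where "\<gamma> t = (if t \<le> 1 / 2 then \<gamma>1 (2 * t) else \<gamma>2 (2 * t - 1))" for t
  have \<gamma>2': "\<gamma> t = \<gamma>2 (2 * t - 1)" if "1 / 2 \<le> t" for t
  proof (cases "t = 1 / 2")
    case True
    then have "2 * t = 1" "2 * t - 1 = 0" by simp_all
    then show ?thesis using c1(3) g(2) unfolding \<gamma>_def True[symmetric] by simp
  qed (use that in \<open>auto simp: \<gamma>_def\<close>)
  \<comment> \<open>The halved nodes end with 1 / 2 at index \<open>n\<close>; one further node 1 at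
    index \<open>Suc n\<close> closes the interval of the new arc.\<close>
  define \<tau>' where "\<tau>' i = (if i \<le> n then \<tau> i / 2 else 1)" for i
  have "CR_curve MM \<gamma>"
    unfolding CR_curve_def
  proof (rule exI[of _ "Suc n"], rule exI[of _ \<tau>'], intro conjI allI impI)
    fix i assume i: "i < Suc n"
    show "\<tau>' i < \<tau>' (Suc i)" using i \<tau>(2) \<tau>(3)[of i] by (auto simp: \<tau>'_def less_Suc_eq)
    have "smooth_on {\<tau>' i..\<tau>' (Suc i)} \<gamma> \<and>
       (\<forall>t\<in>{\<tau>' i..\<tau>' (Suc i)}. \<gamma> t \<in> MM \<and>
              vector_derivative \<gamma> (at t within {\<tau>' i..\<tau>' (Suc i)}) \<in> complex_tangent MM (\<gamma> t) - {0})"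
    proof (cases "i < n")
      case True
      then have e: "\<tau>' i = \<tau> i / 2" "\<tau>' (Suc i) = \<tau> (Suc i) / 2" by (auto simp: \<tau>'_def)
      let ?I = "{\<tau> i / 2..\<tau> (Suc i) / 2}"
      have eq: "\<gamma> t = \<gamma>1 (2 * t)" if "t \<in> ?I" for t
        using that mono[of "Suc i"] True by (auto simp: \<gamma>_def)
      have dbl: "2 * t \<in> {\<tau> i..\<tau> (Suc i)}" if "t \<in> ?I" for t using that by auto
      have "smooth_on ?I (\<lambda>t. 2 * t)"
        by (rule Cinf_imp_smooth_on[of UNIV]) (auto intro!: Cinf_mult Cinf_const Cinf_ident)
      then have "smooth_on ?I (\<lambda>t. \<gamma>1 (2 * t))"
        by (rule smooth_on_compose) (use \<tau>(3)[OF True] dbl in auto)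
      then have "smooth_on ?I \<gamma>" by (rule smooth_on_cong) (simp add: eq)
      moreover have "\<gamma> t \<in> MM \<and> vector_derivative \<gamma> (at t within ?I) \<in> complex_tangent MM (\<gamma> t) - {0}" if t: "t \<in> ?I" for t
      proof
        let ?d = "vector_derivative \<gamma>1 (at (2 * t) within {\<tau> i..\<tau> (Suc i)})"
        have M: "\<gamma>1 (2 * t) \<in> MM" and d: "?d \<in> complex_tangent MM (\<gamma>1 (2 * t)) - {0}"
          using \<tau>(3)[OF True] dbl[OF t] by auto
        show "\<gamma> t \<in> MM" using M eq[OF t] by simp
        have "(\<gamma>1 has_vector_derivative ?d) (at (2 * t) within {\<tau> i..\<tau> (Suc i)})"
          by (rule smooth_on_differentiable_within[OF _ dbl[OF t]]) (use \<tau>(3)[OF True] in auto)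
        then have "(\<gamma>1 has_vector_derivative ?d) (at (2 * t) within (\<lambda>t. 2 * t) ` ?I)"
          by (rule has_vector_derivative_within_subset) (use dbl in auto)
        moreover have "((\<lambda>t. 2 * t) has_vector_derivative 2) (at t within ?I)"
          by (auto intro!: derivative_eq_intros)
        ultimately have "((\<lambda>t. \<gamma>1 (2 * t)) has_vector_derivative 2 *\<^sub>R ?d) (at t within ?I)"
          using vector_diff_chain_within[of "\<lambda>t. 2 * t" 2 t ?I \<gamma>1 ?d] by (simp add: o_def)
        then have "(\<gamma> has_vector_derivative 2 *\<^sub>R ?d) (at t within ?I)"
          by (rule has_vector_derivative_transform[rotated 2]) (use t eq in auto)
        then have "vector_derivative \<gamma> (at t within ?I) = 2 *\<^sub>R ?d"
          by (rule vector_derivative_within_Icc[OF _ _ t]) (use \<tau>(3)[OF True] in auto)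
        then show "vector_derivative \<gamma> (at t within ?I) \<in> complex_tangent MM (\<gamma> t) - {0}"
          using complex_tangent_scale[OF M d, of 2] eq[OF t] by simp
      qed
      ultimately show ?thesis unfolding e by blast
    next
      case False
      then have "i = n" using i by simp
      then have e: "\<tau>' i = 1 / 2" "\<tau>' (Suc i) = 1" using \<tau>(2) by (simp_all add: \<tau>'_def)
      have C: "Cinf UNIV (\<lambda>t. \<gamma>2 (2 * t - 1))"
        by (rule Cinf_compose[OF g(1)]) (auto intro!: Cinf_diff Cinf_mult Cinf_const Cinf_ident)
      have "smooth_on {1 / 2..1} \<gamma>"
        by (rule smooth_on_cong[OF Cinf_imp_smooth_on[OF C]]) (auto simp: \<gamma>2')
      moreover have "\<gamma> t \<in> MM \<and> vector_derivative \<gamma> (at t within {1 / 2..1}) \<in> complex_tangent MM (\<gamma> t) - {0}"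
        if t: "t \<in> {1 / 2..1}" for t
      proof
        have t': "2 * t - 1 \<in> {0..1}" and eq: "\<gamma> t = \<gamma>2 (2 * t - 1)" using t \<gamma>2' by auto
        show M: "\<gamma> t \<in> MM" using g(4)[OF t'] eq by simp
        have "((\<lambda>t. 2 * t - 1) has_vector_derivative 2) (at t)" by (auto intro!: derivative_eq_intros)
        then have "((\<lambda>t. \<gamma>2 (2 * t - 1)) has_vector_derivative 2 *\<^sub>R \<delta> (2 * t - 1)) (at t)"
          using vector_diff_chain_at[of "\<lambda>t. 2 * t - 1" 2 t \<gamma>2 "\<delta> (2 * t - 1)"] g(4)[OF t'] by (simp add: o_def)
        then have "((\<lambda>t. \<gamma>2 (2 * t - 1)) has_vector_derivative 2 *\<^sub>R \<delta> (2 * t - 1)) (at t within {1 / 2..1})"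
          by (rule has_vector_derivative_at_within)
        then have "(\<gamma> has_vector_derivative 2 *\<^sub>R \<delta> (2 * t - 1)) (at t within {1 / 2..1})"
          by (rule has_vector_derivative_transform[rotated 2]) (use t \<gamma>2' in auto)
        then have "vector_derivative \<gamma> (at t within {1 / 2..1}) = 2 *\<^sub>R \<delta> (2 * t - 1)"
          by (rule vector_derivative_within_Icc[OF _ _ t]) auto
        then show "vector_derivative \<gamma> (at t within {1 / 2..1}) \<in> complex_tangent MM (\<gamma> t) - {0}"
          using complex_tangent_scale[OF M, of "\<delta> (2 * t - 1)" 2] g(4)[OF t'] eq by simp
      qed
      ultimately show ?thesis unfolding e by blast
    qed
    then show "smooth_on {\<tau>' i..\<tau>' (Suc i)} \<gamma>" "\<forall>t\<in>{\<tau>' i..\<tau>' (Suc i)}. \<gamma> t \<in> MM \<and>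
              vector_derivative \<gamma> (at t within {\<tau>' i..\<tau>' (Suc i)}) \<in> complex_tangent MM (\<gamma> t) - {0}" by simp_all
  qed (auto simp: \<tau>'_def \<tau>)
  moreover have "\<gamma> 0 = p" "\<gamma> 1 = r" using c1 g by (auto simp: \<gamma>_def)
  ultimately show ?thesis unfolding CR_orbit_def by blast
qed

definition CR_arcs :: "((complex ^ 3) \<times> (complex ^ 3)) set" where
  "CR_arcs = {(p, q). CR_arc p q}"

lemma CR_arcs_orbit: "(p, q) \<in> CR_arcs\<^sup>+ \<Longrightarrow> q \<in> CR_orbit MM p"
  by (induction rule: trancl_induct) (auto simp: CR_arcs_def intro: CR_arc_orbit CR_orbit_arc)

section \<open>Lifts of great circles to complex tangential curves\<close>

definition herm :: "complex ^ 3 \<Rightarrow> complex ^ 3 \<Rightarrow> complex" where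
  "herm p q = cnj (p $ 1) * q $ 1 + cnj (p $ 2) * q $ 2"

definition lift :: "complex ^ 3 \<Rightarrow> real \<Rightarrow> complex ^ 3" where
  "lift p x = vec3 (p $ 1) (p $ 2) (Complex x (qf p))"

lemma lift_MM: "lift p x \<in> MM \<longleftrightarrow> p \<in> punctured_sphere"
  using xi_mu_cong(3)[of "lift p x" p] by (simp add: lift_def MM_def punctured_sphere_def sqn_def)

lemma MM_lift: "p \<in> MM \<Longrightarrow> p = lift p (Re (p $ 3))"
  by (simp add: lift_def MM_def vec3_eq_iff complex_eq_iff)

lemma sqn_herm: "complex_of_real (sqn p) = herm p p"
  by (simp add: sqn_def herm_def complex_eq_iff power2_eq_square)

lemma herm_cnj: "herm q p = cnj (herm p q)"
  by (simp add: herm_def)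

definition circ :: "complex ^ 3 \<Rightarrow> complex ^ 3 \<Rightarrow> real \<Rightarrow> complex ^ 3" where
  "circ p e t = cos t *\<^sub>R p + sin t *\<^sub>R e"

definition speed :: "complex ^ 3 \<Rightarrow> complex ^ 3 \<Rightarrow> complex" where
  "speed p e = p $ 1 * e $ 2 - p $ 2 * e $ 1"

text \<open>Great circles in directions hermitian orthogonal to the base point are complex tangential; their
  velocity in the frame of the complex tangent spaces is the constant \<open>speed\<close>.\<close>

lemma circ_sqn:
  assumes "sqn p = 1" "sqn e = 1" "herm p e = 0"
  shows "herm (circ p e t) (circ p e u) = cos (t - u)"
proof -
  have 1: "herm p p = 1" "herm e e = 1" "herm e p = 0"
    using assms sqn_herm[of p] sqn_herm[of e] herm_cnj[of e p] by simp_all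
  have "herm (circ p e t) (circ p e u) = cos t * cos u * herm p p + sin t * sin u * herm e e
      + cos t * sin u * herm p e + sin t * cos u * herm e p"
    by (simp add: herm_def circ_def scaleR_conv_of_real[where 'a = complex] algebra_simps)
  then show ?thesis using 1 assms by (simp add: cos_diff)
qed

text \<open>\<open>X\<close> integrates the real part of the third entry of the velocity
  \<open>speed p e *s zt\<close>. The imaginary part takes care of itself: by \<open>dqf_zt\<close>
  it is the derivative of \<open>qf\<close> along the circle.\<close>

lemma CR_arc_circ:
  assumes pe: "sqn p = 1" "sqn e = 1" "herm p e = 0"
    and X: "\<And>t. (X has_real_derivative Re (speed p e * cc (circ p e t))) (at t)"
    and s: "s \<noteq> 0" and pole: "\<And>t. t \<in> {0..1} \<Longrightarrow> circ p e (s * t) $ 1 \<noteq> 1"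
  shows "CR_arc (lift p (X 0)) (lift (circ p e s) (X s))"
proof -
  define g where "g t = lift (circ p e t) (X t)" for t
  have cC: "Cinf UNIV (circ p e)" unfolding circ_def[abs_def]
    by (intro Cinf_add Cinf_scaleR Cinf_cos Cinf_sin Cinf_const Cinf_ident open_UNIV)
  have ccC: "Cinf UNIV cc" unfolding cc_def[abs_def]
    by (intro Cinf_Complex Cinf_diff Cinf_mult Cinf_power Cinf_const Cinf_Re Cinf_Im Cinf_xi open_UNIV)
  have XC: "Cinf UNIV X"
  proof (rule CinfI_deriv[OF open_UNIV])
    show "(X has_derivative (\<lambda>v. v * Re (speed p e * cc (circ p e t)))) (at t)" for t
      using X[of t] by (simp only: has_field_derivative_def mult_commute_abs)
    have "Cinf UNIV (\<lambda>t. cc (circ p e t))" by (rule Cinf_compose[OF ccC cC]) simp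
    then show "Cinf UNIV (\<lambda>t. v * Re (speed p e * cc (circ p e t)))" for v
      by (intro Cinf_mult Cinf_const Cinf_Re open_UNIV)
  qed
  have gC: "Cinf UNIV g"
  proof -
    have "Cinf UNIV (\<lambda>t. qf (circ p e t))" by (rule Cinf_compose[OF Cinf_qf[OF open_UNIV] cC]) simp
    then show ?thesis
      unfolding g_def[abs_def] lift_def by (intro Cinf_vec3 Cinf_Complex Cinf_linear_compose[OF bounded_linear_vec_nth cC] XC open_UNIV)
  qed
  have unit: "sqn (circ p e t) = 1" for t
    using circ_sqn[OF pe, of t t] sqn_herm[of "circ p e t"] by (metis cos_zero diff_self of_real_eq_iff)
  have "(g has_vector_derivative speed p e *s zt (g t)) (at t)" for t
  proof -
    define c' where "c' = (- sin t) *\<^sub>R p + cos t *\<^sub>R e"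
    have c': "(circ p e has_vector_derivative c') (at t)"
      unfolding circ_def[abs_def] c'_def by (auto intro!: derivative_eq_intros)
    have nz: "cnj (p $ 1) * e $ 1 + cnj (p $ 2) * e $ 2 = 0" using pe(3) by (simp add: herm_def)
    have np: "cnj (p $ 1) * p $ 1 + cnj (p $ 2) * p $ 2 = 1" using pe(1) sqn_herm[of p] by (simp add: herm_def)
    have e12: "e $ 1 = - speed p e * cnj (p $ 2)" "e $ 2 = speed p e * cnj (p $ 1)"
    proof -
      have "- speed p e * cnj (p $ 2) = (cnj (p $ 1) * p $ 1 + cnj (p $ 2) * p $ 2) * e $ 1
          - p $ 1 * (cnj (p $ 1) * e $ 1 + cnj (p $ 2) * e $ 2)"
        by (simp add: speed_def algebra_simps)
      then show "e $ 1 = - speed p e * cnj (p $ 2)" by (simp add: nz np)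
      have "speed p e * cnj (p $ 1) = (cnj (p $ 1) * p $ 1 + cnj (p $ 2) * p $ 2) * e $ 2
          - p $ 2 * (cnj (p $ 1) * e $ 1 + cnj (p $ 2) * e $ 2)"
        by (simp add: speed_def algebra_simps)
      then show "e $ 2 = speed p e * cnj (p $ 1)" by (simp add: nz np)
    qed
    have sp: "speed p e * cnj (speed p e) = 1"
    proof -
      have "speed p e * cnj (speed p e) = speed p e * cnj (speed p e) * (cnj (p $ 1) * p $ 1 + cnj (p $ 2) * p $ 2)"
        by (simp add: np)
      also have "\<dots> = herm e e" unfolding herm_def e12 by (simp add: algebra_simps)
      also have "\<dots> = 1" using pe(2) sqn_herm[of e] by simp
      finally show ?thesis .
    qed
    have sp': "speed p e * (cnj (speed p e) * x) = x" for x using sp by (simp add: mult.assoc[symmetric])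
    have c12: "c' $ 1 = - speed p e * cnj (circ p e t $ 2)" "c' $ 2 = speed p e * cnj (circ p e t $ 1)"
      unfolding c'_def circ_def
      by (simp_all add: e12 scaleR_conv_of_real[where 'a = complex] algebra_simps sp sp' del: minus_mult_left)
    have cd: "((\<lambda>t. circ p e t $ i) has_vector_derivative c' $ i) (at t)" for i
      using c' by (rule bounded_linear.has_vector_derivative[OF bounded_linear_vec_nth])
    have q': "((\<lambda>t. qf (circ p e t)) has_vector_derivative dqf (circ p e t) c') (at t)"
      using vector_derivative_diff_chain_within[of "circ p e" c' t UNIV qf "dqf (circ p e t)"] c' has_derivative_qf
      by (simp add: o_def has_derivative_at_withinI)
    have "dqf (circ p e t) c' = dqf (circ p e t) (speed p e *s zt (circ p e t))"
      by (rule dqf_cong) (simp_all add: c12 zt_nth)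
    then have q'': "((\<lambda>t. qf (circ p e t)) has_vector_derivative Im (speed p e * cc (circ p e t))) (at t)"
      using q' by (simp add: dqf_zt)
    have "((\<lambda>t. Complex (X t) (qf (circ p e t))) has_vector_derivative speed p e * cc (circ p e t)) (at t)"
      unfolding has_vector_derivative_complex_iff
      using X[of t] q'' by (simp add: has_real_derivative_iff_has_vector_derivative)
    from has_vector_derivative_vec3[OF cd[of 1] cd[of 2] this]
    have "(g has_vector_derivative vec3 (c' $ 1) (c' $ 2) (speed p e * cc (circ p e t))) (at t)"
      by (simp add: g_def[abs_def] lift_def)
    moreover have "cc (g t) = cc (circ p e t)"
      using xi_mu_cong(1,2)[of "g t" "circ p e t"] by (simp add: cc_def g_def lift_def)
    then have "vec3 (c' $ 1) (c' $ 2) (speed p e * cc (circ p e t)) = speed p e *s zt (g t)"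
      by (simp add: vec3_eq_iff zt_nth c12) (simp add: g_def lift_def)
    ultimately show ?thesis by simp
  qed
  note g' = this
  have sp0: "speed p e \<noteq> 0"
  proof
    assume 0: "speed p e = 0"
    have "e $ 1 = herm p e * p $ 1 - speed p e * cnj (p $ 2)" "e $ 2 = herm p e * p $ 2 + speed p e * cnj (p $ 1)"
      if "p \<in> punctured_sphere"
      using sphere_decomp[OF that, of e] by (simp_all add: herm_def speed_def)
    moreover have "p \<in> punctured_sphere" using pe(1) pole[of 0] by (simp add: punctured_sphere_def circ_def)
    ultimately have "e $ 1 = 0" "e $ 2 = 0" using 0 pe(3) by auto
    then show False using pe(2) by (simp add: sqn_def)
  qed
  show ?thesis
    unfolding CR_arc_def
  proof (rule exI[of _ "\<lambda>t. g (s * t)"], rule exI[of _ "\<lambda>t. s *\<^sub>R (speed p e *s zt (g (s * t)))"], intro conjI ballI)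
    show "Cinf UNIV (\<lambda>t. g (s * t))"
      by (rule Cinf_compose[OF gC]) (auto intro!: Cinf_mult Cinf_const Cinf_ident)
    show "g (s * 0) = lift p (X 0)" by (simp add: g_def circ_def)
    show "g (s * 1) = lift (circ p e s) (X s)" by (simp add: g_def)
    fix t :: real assume t: "t \<in> {0..1}"
    show M: "g (s * t) \<in> MM"
      unfolding g_def lift_MM using unit pole[OF t] by (simp add: punctured_sphere_def)
    have "((\<lambda>t. s * t) has_vector_derivative s) (at t)" by (auto intro!: derivative_eq_intros)
    then show "((\<lambda>t. g (s * t)) has_vector_derivative s *\<^sub>R (speed p e *s zt (g (s * t)))) (at t)"
      using vector_diff_chain_at[of "\<lambda>t. s * t" s t g] g' by (simp add: o_def)
    have "speed p e *s zt (g (s * t)) \<in> complex_tangent MM (g (s * t)) - {0}"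
      unfolding complex_tangent_MM[OF M] using zt_nonzero[OF M] sp0 by auto
    then show "s *\<^sub>R (speed p e *s zt (g (s * t))) \<in> complex_tangent MM (g (s * t)) - {0}"
      by (rule complex_tangent_scale[OF M _ s])
  qed
qed

lemma antiderivative_exists:
  fixes f :: "real \<Rightarrow> real"
  assumes "continuous_on UNIV f"
  obtains F where "\<And>t. (F has_real_derivative f t) (at t)" "F 0 = 0"
proof -
  have "\<exists>F. \<forall>x. -\<infinity> < ereal x \<longrightarrow> ereal x < \<infinity> \<longrightarrow> (F has_vector_derivative f x) (at x)"
    by (rule einterval_antiderivative) (use assms continuous_on_eq_continuous_at in auto)
  then obtain F where F: "\<And>x. (F has_vector_derivative f x) (at x)" by auto
  show thesis
    by (rule that[of "\<lambda>x. F x - F 0"])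
      (use F in \<open>auto simp: has_real_derivative_iff_has_vector_derivative intro!: derivative_eq_intros\<close>)
qed

lemma sphere_pole_iff: "sqn p = 1 \<Longrightarrow> p $ 1 = 1 \<Longrightarrow> p $ 2 = 0"
  by (simp add: sqn_def complex_eq_iff)

text \<open>Gram-Schmidt turns \<open>r\<close> into a direction \<open>e\<close>; because the
  product is real, \<open>e\<close> is hermitian orthogonal to \<open>p\<close> and the great circle
  in direction \<open>e\<close> passes through \<open>r\<close>. The shift \<open>d\<close> is
  independent of \<open>x\<close> since \<open>cc\<close> does not see the third coordinate.\<close>

lemma CR_arc_real_product:
  assumes p: "p \<in> punctured_sphere" and r: "r \<in> punctured_sphere" and im: "Im (herm p r) = 0"
    and ne: "\<bar>Re (herm p r)\<bar> \<noteq> 1"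
  obtains d where "\<And>x. CR_arc (lift p x) (lift r (x + d))"
proof -
  define s where "s = Re (herm p r)"
  have h: "herm p r = s" "herm r p = s" using im herm_cnj[of r p] by (simp_all add: s_def complex_eq_iff)
  have n: "herm p p = 1" "herm r r = 1" using p r sqn_herm[of p] sqn_herm[of r] by (simp_all add: punctured_sphere_def)
  have "herm (r - s *\<^sub>R p) (r - s *\<^sub>R p) = herm r r - s * herm r p - s * herm p r + s * s * herm p p"
    by (simp add: herm_def scaleR_conv_of_real[where 'a = complex] algebra_simps)
  then have hn: "herm (r - s *\<^sub>R p) (r - s *\<^sub>R p) = complex_of_real (1 - s\<^sup>2)" using h n by (simp add: power2_eq_square)
  then have sq: "sqn (r - s *\<^sub>R p) = 1 - s\<^sup>2" using sqn_herm of_real_eq_iff by metis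
  moreover have "sqn (r - s *\<^sub>R p) \<ge> 0" by (simp add: sqn_def)
  ultimately have "s\<^sup>2 \<le> 1" by simp
  then have "\<bar>s\<bar> \<le> 1" using abs_square_le_1 by blast
  then have s1: "\<bar>s\<bar> < 1" using ne by (simp add: s_def)
  define k where "k = sqrt (1 - s\<^sup>2)"
  have "s\<^sup>2 < 1" using s1 abs_square_less_1 by blast
  then have k: "k > 0" "k * k = 1 - s\<^sup>2" by (simp_all add: k_def)
  define e where "e = inverse k *\<^sub>R (r - s *\<^sub>R p)"
  have "herm e e = inverse k * inverse k * herm (r - s *\<^sub>R p) (r - s *\<^sub>R p)"
    by (simp add: e_def herm_def scaleR_conv_of_real[where 'a = complex] algebra_simps)
  also have "\<dots> = complex_of_real (inverse k * inverse k * (k * k))" unfolding hn k(2) by simp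
  also have "inverse k * inverse k * (k * k) = 1" using k by (simp add: field_simps)
  finally have e1: "sqn e = 1" using sqn_herm[of e] of_real_eq_1_iff by metis
  have "herm p e = inverse k * (herm p r - s * herm p p)"
    by (simp add: e_def herm_def scaleR_conv_of_real[where 'a = complex] algebra_simps)
  then have pe: "herm p e = 0" using h n by simp
  have p1: "sqn p = 1" using p by (simp add: punctured_sphere_def)
  define t0 where "t0 = arccos s"
  have t0: "0 < t0" "t0 < pi" "cos t0 = s" using s1 arccos_lt_bounded[of s] by (auto simp: t0_def)
  have "sin t0 = k" using s1 sin_arccos_abs[of s] by (simp add: t0_def k_def)
  then have cr: "circ p e t0 = r" using t0 k by (simp add: circ_def e_def)
  have per: "circ p e (t0 - 2 * pi) = r" using cr by (simp add: circ_def cos_diff sin_diff)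
  have pole2: "cos (t - u) = 1" if "circ p e t $ 1 = 1" "circ p e u $ 1 = 1" for t u
  proof -
    have u: "sqn (circ p e t) = 1" for t
      using circ_sqn[OF p1 e1 pe, of t t] sqn_herm[of "circ p e t"] by (metis cos_zero diff_self of_real_eq_iff)
    have "herm (circ p e t) (circ p e u) = 1"
      using that sphere_pole_iff[OF u that(1)] by (simp add: herm_def)
    then show ?thesis using circ_sqn[OF p1 e1 pe, of t u] by (metis of_real_eq_1_iff)
  qed
  have endp: "circ p e 0 $ 1 \<noteq> 1" "circ p e t0 $ 1 \<noteq> 1" "circ p e (t0 - 2 * pi) $ 1 \<noteq> 1"
    unfolding cr per using p r by (simp_all add: circ_def punctured_sphere_def)
  \<comment> \<open>The circle meets the pole for at most one parameter modulo 2 pi. If this happens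
    on the arc of length \<open>t0\<close> to \<open>r\<close>, the complementary arc is taken, in
    the opposite direction.\<close>
  obtain s' where s': "s' \<noteq> 0" "circ p e s' = r" "\<And>t. t \<in> {0..1} \<Longrightarrow> circ p e (s' * t) $ 1 \<noteq> 1"
  proof (cases "\<exists>t\<in>{0..1}. circ p e (t0 * t) $ 1 = 1")
    case False
    then show thesis using that[of t0] t0 cr by auto
  next
    case True
    then obtain t where t: "t \<in> {0..1}" "circ p e (t0 * t) $ 1 = 1" by auto
    have "circ p e ((t0 - 2 * pi) * u) $ 1 \<noteq> 1" if u: "u \<in> {0..1}" for u
    proof
      assume pu: "circ p e ((t0 - 2 * pi) * u) $ 1 = 1"
      define y where "y = t0 * t - (t0 - 2 * pi) * u"
      have "cos y = 1" unfolding y_def by (rule pole2[OF t(2) pu])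
      have a: "0 \<le> t0 * t" "t0 * t \<le> t0" using t t0 by (auto simp: mult_left_le)
      have b: "0 \<le> (2 * pi - t0) * u" "(2 * pi - t0) * u \<le> 2 * pi - t0" using u t0 by (auto simp: mult_left_le)
      have y: "y = t0 * t + (2 * pi - t0) * u" by (simp add: y_def algebra_simps)
      have "t0 * t \<noteq> 0" using t(2) endp(1) by auto
      moreover have "t0 * t \<noteq> t0" using t(2) endp(2) by auto
      ultimately have y0: "0 < y" "y < 2 * pi" using a b y by linarith+
      show False
      proof (cases "y \<le> pi")
        case True
        then have "cos y < cos 0" using y0 by (intro cos_monotone_0_pi) auto
        then show False using \<open>cos y = 1\<close> by simp
      next
        case False
        then have "cos (2 * pi - y) < cos 0" using y0 by (intro cos_monotone_0_pi) auto
        then show False using \<open>cos y = 1\<close> by (simp add: cos_diff)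
      qed
    qed
    then show thesis using that[of "t0 - 2 * pi"] t0 per by auto
  qed
  have "continuous_on UNIV (\<lambda>t. Re (speed p e * cc (circ p e t)))"
  proof -
    have 1: "Cinf UNIV (circ p e)" unfolding circ_def[abs_def]
      by (intro Cinf_add Cinf_scaleR Cinf_cos Cinf_sin Cinf_const Cinf_ident open_UNIV)
    have 2: "Cinf UNIV cc" unfolding cc_def[abs_def]
      by (intro Cinf_Complex Cinf_diff Cinf_mult Cinf_power Cinf_const Cinf_Re Cinf_Im Cinf_xi open_UNIV)
    have "Cinf UNIV (\<lambda>t. cc (circ p e t))" by (rule Cinf_compose[OF 2 1]) simp
    then have "Cinf UNIV (\<lambda>t. Re (speed p e * cc (circ p e t)))"
      by (intro Cinf_Re Cinf_mult Cinf_const open_UNIV)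
    then show ?thesis by (rule Cinf_continuous_on)
  qed
  then have "\<exists>F. (\<forall>t. (F has_real_derivative Re (speed p e * cc (circ p e t))) (at t)) \<and> F 0 = 0"
  proof (rule antiderivative_exists)
    show ?thesis if "\<And>t. (F has_real_derivative Re (speed p e * cc (circ p e t))) (at t)" "F 0 = 0" for F
      by (intro exI[of _ F] conjI allI that)
  qed
  then obtain F where F: "\<forall>t. (F has_real_derivative Re (speed p e * cc (circ p e t))) (at t)" "F 0 = 0"
    by (elim exE conjE)
  show thesis
  proof (rule that[of "F s'"])
    fix x
    have "((\<lambda>t. x + F t) has_real_derivative Re (speed p e * cc (circ p e t))) (at t)" for t
      using DERIV_add[OF DERIV_const F(1)[rule_format]] by simp
    from CR_arc_circ[OF p1 e1 pe this s'(1,3)] show "CR_arc (lift p x) (lift r (x + F s'))"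
      by (simp add: F(2) s'(2))
  qed
qed

text \<open>The shift is uniform in \<open>x\<close>, so that links compose and the total shift can
  be corrected by loops over one base point.\<close>

definition linked :: "complex ^ 3 \<Rightarrow> complex ^ 3 \<Rightarrow> bool" where
  "linked p q \<longleftrightarrow> (\<exists>d. \<forall>x. (lift p x, lift q (x + d)) \<in> CR_arcs\<^sup>+)"

lemma linked_trans: "linked p q \<Longrightarrow> linked q r \<Longrightarrow> linked p r"
proof -
  assume "linked p q" "linked q r"
  then obtain d d' where "\<And>x. (lift p x, lift q (x + d)) \<in> CR_arcs\<^sup>+" "\<And>x. (lift q x, lift r (x + d')) \<in> CR_arcs\<^sup>+"
    unfolding linked_def by blast
  then have "(lift p x, lift r (x + (d + d'))) \<in> CR_arcs\<^sup>+" for x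
    unfolding add.assoc[symmetric] by (meson trancl_trans)
  then show ?thesis unfolding linked_def by blast
qed

lemma linked_real:
  assumes "p \<in> punctured_sphere" "r \<in> punctured_sphere" "Im (herm p r) = 0" "\<bar>Re (herm p r)\<bar> \<noteq> 1"
  shows "linked p r"
  using CR_arc_real_product[OF assms] unfolding linked_def CR_arcs_def by (metis case_prodI mem_Collect_eq trancl.r_into_trancl)

lemma avoid_pole:
  assumes "sqn r = 1"
  obtains r' where "r' = r \<or> r' = - r" "r' \<in> punctured_sphere"
proof (cases "r $ 1 = 1")
  case True
  then show thesis using assms that[of "- r"] by (simp add: punctured_sphere_def sqn_def)
next
  case False
  then show thesis using assms that[of r] by (simp add: punctured_sphere_def)
qed

text \<open>The equality case of the Cauchy-Schwarz inequality: the difference vector has norm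
  0.\<close>

lemma real_product_one:
  assumes "sqn p = 1" "sqn q = 1" "Im (herm p q) = 0" "\<bar>Re (herm p q)\<bar> = 1"
  shows "q $ 1 = Re (herm p q) *\<^sub>R p $ 1" "q $ 2 = Re (herm p q) *\<^sub>R p $ 2"
proof -
  define s where "s = Re (herm p q)"
  have h: "herm p q = s" "herm q p = s" using assms herm_cnj[of q p] by (simp_all add: s_def complex_eq_iff)
  have n: "herm p p = 1" "herm q q = 1" using assms sqn_herm[of p] sqn_herm[of q] by simp_all
  have ss: "s * s = 1" using assms(4) unfolding s_def by (metis abs_mult_self_eq mult_1)
  have "herm (q - s *\<^sub>R p) (q - s *\<^sub>R p) = herm q q - s * herm q p - s * herm p q + s * s * herm p p"
    by (simp add: herm_def scaleR_conv_of_real[where 'a = complex] algebra_simps)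
  also have "\<dots> = complex_of_real (1 - s * s)" using h n by simp
  finally have "sqn (q - s *\<^sub>R p) = 0" using sqn_herm ss by (metis diff_self of_real_0 of_real_eq_iff)
  then have "Re ((q - s *\<^sub>R p) $ 1) = 0 \<and> Im ((q - s *\<^sub>R p) $ 1) = 0 \<and> Re ((q - s *\<^sub>R p) $ 2) = 0 \<and> Im ((q - s *\<^sub>R p) $ 2) = 0"
    unfolding sqn_def by (smt (verit) power2_eq_iff_nonneg zero_eq_power2 zero_le_power2)
  then show "q $ 1 = Re (herm p q) *\<^sub>R p $ 1" "q $ 2 = Re (herm p q) *\<^sub>R p $ 2"
    by (simp_all add: s_def[symmetric] complex_eq_iff)
qed

text \<open>Two arcs suffice, through an intermediate point whose hermitian products with both ends
  are real. Its sign is free, which allows the pole to be avoided.\<close>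

lemma linked_any:
  assumes p: "p \<in> punctured_sphere" and q: "q \<in> punctured_sphere"
  shows "linked p q"
proof -
  have p1: "sqn p = 1" and q1: "sqn q = 1" using p q by (simp_all add: punctured_sphere_def)
  show ?thesis
  proof (cases "Im (herm p q) = 0")
    case False
    \<comment> \<open>\<open>a\<close> and \<open>b\<close> are the phases of the entries of
      \<open>p\<close>. For any real coefficients, a point with entries proportional to
      \<open>a\<close> and \<open>b\<close> has a real product with \<open>p\<close>; the
      coefficients \<open>B / k\<close> and \<open>- (A / k)\<close> cancel the imaginary part of
      the product with \<open>q\<close>.\<close>
    define a where "a = (if p $ 1 = 0 then 1 else sgn (p $ 1))"
    define b where "b = (if p $ 2 = 0 then 1 else sgn (p $ 2))"
    define A where "A = Im (cnj a * q $ 1)"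
    define B where "B = Im (cnj b * q $ 2)"
    have ab: "a * cnj a = 1" "b * cnj b = 1"
      unfolding a_def b_def complex_norm_square[symmetric] by (simp_all add: norm_sgn)
    have pa: "cnj (p $ 1) * a = cmod (p $ 1)" "cnj (p $ 2) * b = cmod (p $ 2)"
      unfolding a_def b_def sgn_eq
      using complex_norm_square[of "p $ 1"] complex_norm_square[of "p $ 2"]
      by (auto simp: field_simps power2_eq_square)
    have AB: "A \<noteq> 0 \<or> B \<noteq> 0"
    proof (rule ccontr)
      assume "\<not> (A \<noteq> 0 \<or> B \<noteq> 0)"
      then have AB0: "A = 0" "B = 0" by auto
      have "p $ 1 = cmod (p $ 1) * a" "p $ 2 = cmod (p $ 2) * b"
        by (simp_all add: a_def b_def sgn_eq)
      then have "herm p q = cmod (p $ 1) * (cnj a * q $ 1) + cmod (p $ 2) * (cnj b * q $ 2)"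
        unfolding herm_def by (metis complex_cnj_complex_of_real complex_cnj_mult mult.assoc)
      then show False using False AB0 by (simp add: A_def B_def)
    qed
    define k where "k = sqrt (A\<^sup>2 + B\<^sup>2)"
    have k: "k > 0" "k\<^sup>2 = A\<^sup>2 + B\<^sup>2" using AB by (auto simp: k_def add_nonneg_eq_0_iff sum_power2_gt_zero_iff)
    define r where "r = vec3 ((B / k) *\<^sub>R a) (- (A / k) *\<^sub>R b) 0"
    have "herm r r = complex_of_real ((B / k)\<^sup>2) * (a * cnj a) + complex_of_real ((A / k)\<^sup>2) * (b * cnj b)"
      by (simp add: herm_def r_def scaleR_conv_of_real power2_eq_square algebra_simps)
    also have "\<dots> = complex_of_real ((A\<^sup>2 + B\<^sup>2) / k\<^sup>2)" by (simp add: ab power_divide add_divide_distrib)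
    also have "(A\<^sup>2 + B\<^sup>2) / k\<^sup>2 = 1" unfolding k(2)[symmetric] using k(1) by simp
    finally have r1: "sqn r = 1" using sqn_herm[of r] of_real_eq_1_iff by metis
    have "herm p r = complex_of_real (B / k) * (cnj (p $ 1) * a) - complex_of_real (A / k) * (cnj (p $ 2) * b)"
      by (simp add: herm_def r_def scaleR_conv_of_real algebra_simps)
    then have pr: "Im (herm p r) = 0" unfolding pa by simp
    have "herm r q = complex_of_real (B / k) * (cnj a * q $ 1) - complex_of_real (A / k) * (cnj b * q $ 2)"
      by (simp add: herm_def r_def scaleR_conv_of_real algebra_simps)
    from arg_cong[OF this, of Im]
    have "Im (herm r q) = (B / k) * Im (cnj a * q $ 1) - (A / k) * Im (cnj b * q $ 2)" by (simp del: of_real_divide)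
    then have rq: "Im (herm r q) = 0" unfolding A_def[symmetric] B_def[symmetric] by simp
    obtain r' where r': "r' = r \<or> r' = - r" "r' \<in> punctured_sphere" using avoid_pole[OF r1] .
    have r'1: "sqn r' = 1" using r' by (simp add: punctured_sphere_def)
    have pr': "Im (herm p r') = 0" and rq': "Im (herm r' q) = 0" using r'(1) pr rq by (auto simp: herm_def)
    \<comment> \<open>Otherwise the first two entries of \<open>r'\<close> would be those of
      \<open>p\<close> or of \<open>- p\<close>, and \<open>herm p q\<close> would be real.\<close>
    have "\<bar>Re (herm p r')\<bar> \<noteq> 1"
    proof
      assume 1: "\<bar>Re (herm p r')\<bar> = 1"
      define s where "s = Re (herm p r')"
      note e = real_product_one[OF p1 r'1 pr' 1]
      have "herm r' q = s * herm p q"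
        by (simp add: herm_def[of r'] e herm_def[of p q] s_def[symmetric] scaleR_conv_of_real algebra_simps)
      then show False using rq' False 1 by (auto simp: s_def)
    qed
    moreover have "\<bar>Re (herm r' q)\<bar> \<noteq> 1"
    proof
      assume 1: "\<bar>Re (herm r' q)\<bar> = 1"
      define s where "s = Re (herm r' q)"
      note e = real_product_one[OF r'1 q1 rq' 1]
      have "herm p q = s * herm p r'"
        by (simp add: herm_def[of p] e s_def[symmetric] scaleR_conv_of_real algebra_simps)
      then show False using pr' False by simp
    qed
    ultimately show ?thesis
      using linked_trans[OF linked_real[OF p r'(2) pr'] linked_real[OF r'(2) q rq']] by blast
  next
    case im: True
    show ?thesis
    proof (cases "\<bar>Re (herm p q)\<bar> = 1")
      case False
      then show ?thesis using linked_real[OF p q im] by blast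
    next
      case True
      \<comment> \<open>Over the sphere \<open>q\<close> is \<open>p\<close> or its antipode. A
        hermitian orthogonal point serves as intermediate point; this also provides a nonconstant
        closed path when \<open>q\<close> lies over \<open>p\<close>.\<close>
      define r where "r = vec3 (- cnj (p $ 2)) (cnj (p $ 1)) 0"
      have "sqn r = 1" using p1 by (simp add: sqn_def r_def)
      then obtain r' where r': "r' = r \<or> r' = - r" "r' \<in> punctured_sphere" using avoid_pole by blast
      have pr: "herm p r' = 0" using r'(1) by (auto simp: herm_def r_def algebra_simps)
      have "herm r' q = Re (herm p q) * herm r' p"
        by (simp add: herm_def[of r'] real_product_one[OF p1 q1 im True] scaleR_conv_of_real algebra_simps)
      then have rq: "herm r' q = 0" using pr herm_cnj[of r' p] by simp
      show ?thesis
        using linked_trans[OF linked_real[OF p r'(2)] linked_real[OF r'(2) q]] pr rq by simp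
    qed
  qed
qed

definition base_point :: "complex ^ 3" where
  "base_point = vec3 rt rt 0"

lemma base_point_sphere: "base_point \<in> punctured_sphere"
proof -
  have "rt \<noteq> 1" using rt_simps(1) by auto
  then show ?thesis by (simp add: base_point_def punctured_sphere_def sqn_def power2_eq_square rt_simps)
qed

text \<open>Around a full complex tangential circle through the base point the third coordinate changes by
  \<open>\<pi> cos \<theta>\<close>, where \<open>\<theta>\<close> is the direction of the circle.\<close>

lemma base_loop_small:
  assumes "\<bar>d\<bar> < pi"
  shows "CR_arc (lift base_point x) (lift base_point (x + d))"
proof -
  \<comment> \<open>The holonomy pi times cos \<theta> becomes \<open>d\<close>. The strict bound on
    \<open>d\<close> gives a nonzero sin \<theta>, which keeps the circle away from the pole: a zero
    of the second coordinate would force both sine and cosine of the parameter to vanish.\<close>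
  define \<theta> where "\<theta> = arccos (d / pi)"
  have dp: "- 1 < d / pi" "d / pi < 1" using assms pi_gt_zero by (auto simp: field_simps abs_less_iff)
  then have \<theta>: "cos \<theta> = d / pi" "sin \<theta> \<noteq> 0"
    using sin_arccos_nonzero[of "d / pi"] by (auto simp: \<theta>_def cos_arccos_abs abs_less_iff)
  define u where "u = cis \<theta>"
  define e where "e = vec3 (- u * rt) (u * rt) 0"
  have uu: "u * cnj u = 1" by (simp add: u_def cis_cnj cis_mult)
  have p1: "sqn base_point = 1" using base_point_sphere by (simp add: punctured_sphere_def)
  have "herm e e = (u * cnj u) * (of_real rt * of_real rt) + (u * cnj u) * (of_real rt * of_real rt)"
    by (simp add: herm_def e_def algebra_simps)
  then have "herm e e = 1" unfolding uu rt_simps by simp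
  then have e1: "sqn e = 1" using sqn_herm[of e] by simp
  have pe: "herm base_point e = 0" by (simp add: herm_def base_point_def e_def)
  have sp: "speed base_point e = u" by (simp add: speed_def base_point_def e_def rt_simps mult_ac)
  let ?c = "circ base_point e"
  define C where "C t = complex_of_real (cos t)" for t
  define S where "S t = complex_of_real (sin t)" for t
  have c12: "?c t $ 1 = complex_of_real rt * (C t - u * S t)" "?c t $ 2 = complex_of_real rt * (C t + u * S t)" for t
    by (simp_all add: circ_def base_point_def e_def scaleR_conv_of_real[where 'a = complex] C_def S_def algebra_simps)
  have xi: "xi (?c t) = - u * complex_of_real (sin (2 * t))" for t
  proof -
    have "xi (?c t) = (complex_of_real rt * complex_of_real rt) * ((C t - u * S t)\<^sup>2 - (C t + u * S t)\<^sup>2)"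
      unfolding xi_def c12 by (simp add: power2_eq_square algebra_simps)
    also have "\<dots> = - u * (2 * S t * C t)" unfolding rt_simps by (simp add: power2_eq_square algebra_simps)
    finally show ?thesis by (simp add: sin_double S_def C_def)
  qed
  have mu: "mu (?c t) = cos (2 * t)" for t
  proof -
    have "?c t $ 1 * cnj (?c t $ 2) = (complex_of_real rt * complex_of_real rt) * ((C t - u * S t) * (C t + cnj u * S t))"
      unfolding c12 by (simp add: C_def S_def algebra_simps)
    also have "(C t - u * S t) * (C t + cnj u * S t) = C t * C t - (u * cnj u) * (S t * S t) + (C t * S t) * (cnj u - u)"
      by (simp add: algebra_simps)
    finally have "?c t $ 1 * cnj (?c t $ 2) = (1 / 2) * (C t * C t - S t * S t + (C t * S t) * (cnj u - u))"
      unfolding rt_simps uu by simp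
    from arg_cong[OF this, of Re] have "Re (?c t $ 1 * cnj (?c t $ 2)) = (cos t * cos t - sin t * sin t) / 2"
      by (simp add: C_def S_def)
    then show ?thesis unfolding mu_def by (simp add: cos_double power2_eq_square)
  qed
  have cc: "Re (u * cc (?c t)) = cos \<theta> * (cos (2 * t))\<^sup>2 + 2 * sin \<theta> * cos (2 * t)" for t
    unfolding cc_def xi mu by (simp add: u_def power2_eq_square algebra_simps)
  \<comment> \<open>A primitive of the expression in \<open>cc\<close>. Over a full turn the
    periodic terms cancel and only the term \<open>t / 2\<close>, from the mean of the squared
    cosine, survives.\<close>
  define X where "X t = x + cos \<theta> * (t / 2 + sin (4 * t) / 8) + sin \<theta> * sin (2 * t)" for t
  have "(X has_real_derivative Re (speed base_point e * cc (?c t))) (at t)" for t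
  proof -
    have "(X has_real_derivative cos \<theta> * (1 / 2 + cos (4 * t) / 2) + sin \<theta> * (2 * cos (2 * t))) (at t)"
      unfolding X_def by (auto intro!: derivative_eq_intros simp: field_simps)
    moreover have "1 / 2 + cos (4 * t) / 2 = (cos (2 * t))\<^sup>2"
      using cos_double_cos[of "2 * t"] by (simp add: diff_divide_distrib)
    ultimately show ?thesis unfolding sp cc by (simp add: mult_ac)
  qed
  moreover have "?c (2 * pi * t) $ 1 \<noteq> 1" for t
  proof
    assume 1: "?c (2 * pi * t) $ 1 = 1"
    let ?t = "2 * pi * t"
    have "sqn (?c ?t) = 1"
      using circ_sqn[OF p1 e1 pe, of ?t ?t] sqn_herm[of "?c ?t"] by (metis cos_zero diff_self of_real_eq_iff)
    then have "?c ?t $ 2 = 0" using 1 sphere_pole_iff by blast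
    then have "complex_of_real (cos ?t) + u * complex_of_real (sin ?t) = 0" using rt_simps(1) unfolding c12 C_def S_def by auto
    then have "cos ?t + cos \<theta> * sin ?t = 0" "sin \<theta> * sin ?t = 0" by (simp_all add: complex_eq_iff u_def)
    then have "sin ?t = 0" "cos ?t = 0" using \<theta>(2) by auto
    then show False using sin_cos_squared_add[of ?t] by simp
  qed
  ultimately have "CR_arc (lift base_point (X 0)) (lift (?c (2 * pi)) (X (2 * pi)))"
    by (intro CR_arc_circ[OF p1 e1 pe]) auto
  moreover have "X 0 = x" by (simp add: X_def)
  moreover have "sin (4 * (2 * pi)) = 0" "sin (2 * (2 * pi)) = 0"
    using sin_npi[of 8] sin_npi[of 4] by (simp_all add: mult.commute)
  then have "X (2 * pi) = x + d" by (simp add: X_def \<theta>(1))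
  moreover have "?c (2 * pi) = base_point" by (simp add: circ_def)
  ultimately show ?thesis by simp
qed

text \<open>A shift of any size is cut into equal parts below pi. Taking \<open>Suc n\<close> parts
  ensures at least one arc, even for \<open>d = 0\<close>, since the relation is not
  reflexive.\<close>

lemma base_loop: "(lift base_point x, lift base_point (x + d)) \<in> CR_arcs\<^sup>+"
proof -
  obtain n :: nat where n: "\<bar>d\<bar> / pi < real n" using reals_Archimedean2 by blast
  define d' where "d' = d / Suc n"
  have "\<bar>d\<bar> < pi * real n" using n pi_gt_zero by (simp add: field_simps)
  then have "\<bar>d\<bar> < pi + pi * real n" using pi_gt_zero by linarith
  then have "\<bar>d\<bar> < pi * real (Suc n)" by (simp add: distrib_left)
  then have d': "\<bar>d'\<bar> < pi" by (simp add: d'_def field_simps)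
  have "(lift base_point x, lift base_point (x + real (Suc m) * d')) \<in> CR_arcs\<^sup>+" for m
  proof (induction m)
    case 0
    then show ?case using base_loop_small[OF d', of x] by (auto simp: CR_arcs_def)
  next
    case (Suc m)
    have "(lift base_point (x + real (Suc m) * d'), lift base_point (x + real (Suc (Suc m)) * d')) \<in> CR_arcs"
      using base_loop_small[OF d', of "x + real (Suc m) * d'"] by (simp add: CR_arcs_def algebra_simps)
    then show ?case using Suc by (rule trancl_into_trancl[rotated])
  qed
  from this[of n] show ?thesis by (simp add: d'_def)
qed

lemma CR_orbit_subset: "p \<in> MM \<Longrightarrow> CR_orbit MM p \<subseteq> MM"
proof
  fix q assume "q \<in> CR_orbit MM p"
  then obtain \<gamma> where g: "CR_curve MM \<gamma>" "q = \<gamma> 1" unfolding CR_orbit_def by blast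
  then obtain n \<tau> where \<tau>: "\<tau> 0 = (0::real)" "\<tau> n = 1" "\<And>i. i < n \<Longrightarrow> \<tau> i < \<tau> (Suc i) \<and> (\<forall>t\<in>{\<tau> i..\<tau> (Suc i)}. \<gamma> t \<in> MM)"
    unfolding CR_curve_def by blast
  then obtain m where "n = Suc m" by (cases n) auto
  then show "q \<in> MM" using \<tau>(2) \<tau>(3)[of m] g(2) by auto
qed

lemma globally_minimal_MM: "globally_minimal MM"
  unfolding globally_minimal_def
proof (intro ballI equalityI)
  fix p assume p: "p \<in> MM"
  show "CR_orbit MM p \<subseteq> MM" by (rule CR_orbit_subset[OF p])
  show "MM \<subseteq> CR_orbit MM p"
  proof
    fix q assume q: "q \<in> MM"
    obtain d where d: "\<And>x. (lift p x, lift base_point (x + d)) \<in> CR_arcs\<^sup>+"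
      using linked_any[OF MM_sphere[OF p] base_point_sphere] unfolding linked_def by blast
    obtain d' where d': "\<And>x. (lift base_point x, lift q (x + d')) \<in> CR_arcs\<^sup>+"
      using linked_any[OF base_point_sphere MM_sphere[OF q]] unfolding linked_def by blast
    define x where "x = Re (p $ 3)"
    define y where "y = Re (q $ 3)"
    have "(lift base_point (x + d), lift base_point (y - d')) \<in> CR_arcs\<^sup>+"
      using base_loop[of "x + d" "y - d' - (x + d)"] by simp
    then have "(lift p x, lift q y) \<in> CR_arcs\<^sup>+"
      using trancl_trans[OF trancl_trans[OF d[of x]] d'[of "y - d'"]] by simp
    then have "lift q y \<in> CR_orbit MM (lift p x)" by (rule CR_arcs_orbit)
    then show "q \<in> CR_orbit MM p"
      unfolding x_def y_def MM_lift[OF p, symmetric] MM_lift[OF q, symmetric] .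
  qed
qed

section \<open>Wedges\<close>

lemma complement_projection:
  fixes N T :: "'a::euclidean_space set"
  assumes N: "subspace N" and T: "subspace T" and NT: "N \<inter> T = {0}" "N + T = UNIV"
  obtains \<pi> where "linear \<pi>" "\<And>u. \<pi> u \<in> T" "\<And>u. u - \<pi> u \<in> N" "\<And>t. t \<in> T \<Longrightarrow> \<pi> t = t" "\<And>n. n \<in> N \<Longrightarrow> \<pi> n = 0"
proof -
  have uniq: "t = t'" if "t \<in> T" "t' \<in> T" "u - t \<in> N" "u - t' \<in> N" for t t' u
  proof -
    have "t - t' \<in> T" using T that by (simp add: subspace_diff)
    moreover have "(u - t') - (u - t) \<in> N" by (rule subspace_diff[OF N that(4,3)])
    then have "t - t' \<in> N" by simp
    ultimately have "t - t' \<in> N \<inter> T" by simp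
    then show ?thesis by (simp add: NT(1))
  qed
  have "\<exists>t. t \<in> T \<and> u - t \<in> N" for u
  proof -
    have "u \<in> N + T" using NT(2) by simp
    then obtain n t where "n \<in> N" "t \<in> T" "u = n + t" by (rule set_plus_elim)
    then show ?thesis by (intro exI[of _ t]) simp
  qed
  then obtain \<pi> where \<pi>: "\<And>u. \<pi> u \<in> T" "\<And>u. u - \<pi> u \<in> N" by metis
  have eq: "\<pi> u = t" if "t \<in> T" "u - t \<in> N" for u t using uniq[OF \<pi>(1) that(1) \<pi>(2) that(2)] .
  show thesis
  proof (rule that[OF _ \<pi>])
    show "linear \<pi>"
    proof (rule linearI)
      fix u w
      have "(u - \<pi> u) + (w - \<pi> w) \<in> N" using N \<pi>(2) by (simp add: subspace_add)
      then have "u + w - (\<pi> u + \<pi> w) \<in> N" by (simp add: algebra_simps)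
      then show "\<pi> (u + w) = \<pi> u + \<pi> w" using T \<pi>(1) by (intro eq) (simp_all add: subspace_add)
    next
      fix r :: real and u
      have "r *\<^sub>R (u - \<pi> u) \<in> N" using N \<pi>(2) by (simp add: subspace_scale)
      then have "r *\<^sub>R u - r *\<^sub>R \<pi> u \<in> N" by (simp add: algebra_simps)
      then show "\<pi> (r *\<^sub>R u) = r *\<^sub>R \<pi> u" using T \<pi>(1) by (intro eq) (simp_all add: subspace_scale)
    qed
    show "\<pi> t = t" if "t \<in> T" for t using that N by (intro eq) (simp_all add: subspace_0)
    show "\<pi> n = 0" if "n \<in> N" for n using that T by (intro eq) (simp_all add: subspace_0)
  qed
qed

context straightening
begin

text \<open>Near \<open>p\<close>, the map \<open>G\<close> below is an almost isometric parametrization which splits the ambient space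
  into \<open>S\<close> and the complement \<open>N\<close>; hence the \<open>N\<close>-component of a displacement by approximately \<open>t v\<close>
  is approximately \<open>t c\<close>.\<close>

lemma near_edge:
  assumes p: "p \<in> S" and N: "subspace N" "N \<inter> tangent_space S p = {0}" "N + tangent_space S p = UNIV"
    and K: "openin (top_of_set N) K" "c \<in> K" "\<And>n t. n \<in> K \<Longrightarrow> (0::real) < t \<Longrightarrow> t *\<^sub>R n \<in> K"
    and v: "v - c \<in> tangent_space S p"
  shows "\<exists>e>0. \<exists>r>0. \<forall>x0\<in>S. \<forall>t x. dist x0 p < r \<and> 0 < t \<and> t < r \<and> norm (x - x0 - t *\<^sub>R v) \<le> e * t \<longrightarrow> x \<in> S + K"
proof -
  define T where "T = tangent_space S p"
  have U: "p \<in> U" "\<phi> p \<in> V" "\<phi> p \<in> L" "open V" using p S diffeo Cinf_open by auto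
  obtain \<phi>' \<psi>' where der: "(\<phi> has_derivative \<phi>') (at p)" "(\<psi> has_derivative \<psi>') (at (\<phi> p))"
    using Cinf_has_derivative[OF diffeo(1) U(1)] Cinf_has_derivative[OF diffeo(2) U(2)] by blast
  note inv = inverse_derivative[OF U(1) der]
  have T: "T = {v. \<phi>' v \<in> L}" unfolding T_def by (rule tangent_space_eq[OF p der(1)])
  have bl: "bounded_linear \<phi>'" "bounded_linear \<psi>'" using der has_derivative_bounded_linear by blast+
  have sT: "subspace T" unfolding T_def by (rule tangent_space_subspace(1)[OF p])
  obtain \<pi> where \<pi>: "linear \<pi>" "\<And>u. \<pi> u \<in> T" "\<And>u. u - \<pi> u \<in> N" "\<And>t. t \<in> T \<Longrightarrow> \<pi> t = t" "\<And>n. n \<in> N \<Longrightarrow> \<pi> n = 0"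
    using complement_projection[OF N(1) sT] N(2,3) unfolding T_def by metis
  have bl\<pi>: "bounded_linear \<pi>" using \<pi>(1) by (simp add: linear_conv_bounded_linear)
  have blA: "bounded_linear (\<lambda>u. \<phi>' (\<pi> u))" by (rule bounded_linear_compose[OF bl(1) bl\<pi>])
  \<comment> \<open>An affine map that sends the \<open>T\<close>-component of \<open>u\<close> into
    \<open>L\<close>, so that \<open>\<psi> (A u)\<close> stays in \<open>S\<close> and has
    derivative \<open>\<pi>\<close> at 0; adding \<open>u - \<pi> u\<close> makes the derivative of
    \<open>G\<close> the identity.\<close>
  define A where "A u = \<phi> p + \<phi>' (\<pi> u)" for u
  have AC: "Cinf UNIV A"
    unfolding A_def[abs_def] by (intro Cinf_add Cinf_const Cinf_bounded_linear[OF open_UNIV blA] open_UNIV)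
  have A0: "A 0 = \<phi> p" unfolding A_def using linear_0[OF bounded_linear.linear[OF blA]] by simp
  define D where "D = A -` V"
  have D: "open D" unfolding D_def by (rule open_vimage[OF U(4) Cinf_continuous_on[OF AC]])
  have D0: "0 \<in> D" by (simp add: D_def A0 U)
  define G where "G u = \<psi> (A u) + (u - \<pi> u)" for u
  have "Cinf D (\<lambda>u. \<psi> (A u))"
    by (rule Cinf_compose[OF diffeo(2) Cinf_subset[OF AC subset_UNIV D]]) (auto simp: D_def)
  then have GC: "Cinf D G"
    unfolding G_def[abs_def] by (intro Cinf_add Cinf_diff Cinf_ident D Cinf_bounded_linear[OF D bl\<pi>])
  have G0: "G 0 = p" using diffeo(5)[OF U(1)] linear_0[OF \<pi>(1)] by (simp add: G_def A0)
  have derG: "(G has_derivative (\<lambda>u. u)) (at 0)"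
  proof -
    have "(A has_derivative (\<lambda>u. \<phi>' (\<pi> u))) (at 0)"
      unfolding A_def[abs_def] using has_derivative_add[OF has_derivative_const bounded_linear_imp_has_derivative[OF blA]] by simp
    from has_derivative_compose[OF this, of \<psi> \<psi>'] have "((\<lambda>u. \<psi> (A u)) has_derivative (\<lambda>u. \<psi>' (\<phi>' (\<pi> u)))) (at 0)"
      using der(2) by (simp add: A0)
    from has_derivative_add[OF this has_derivative_diff[OF has_derivative_ident bounded_linear_imp_has_derivative[OF bl\<pi>]]]
    show ?thesis by (simp add: G_def[abs_def] inv)
  qed
  have "bounded_linear (\<lambda>u. u - \<pi> u)" by (rule bounded_linear_sub[OF bounded_linear_ident bl\<pi>])
  then obtain M where M: "M > 0" "\<And>u. norm (u - \<pi> u) \<le> norm u * M" using bounded_linear.pos_bounded by blast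
  obtain \<rho> where \<rho>: "\<rho> > 0" "\<And>n. n \<in> N \<Longrightarrow> norm (n - c) < \<rho> \<Longrightarrow> n \<in> K"
    using K(1,2) unfolding openin_euclidean_subtopology_iff dist_norm by blast
  define B where "B = norm v + 1"
  have B: "B \<ge> 1" by (simp add: B_def)
  \<comment> \<open>The hypothesis on \<open>x\<close> and the strict differentiability of
    \<open>G\<close> each contribute an error of at most \<open>t * \<rho> / (4 * M)\<close>. The
    map taking \<open>u\<close> to \<open>u - \<pi> u\<close> enlarges the sum by the factor
    \<open>M\<close> at most, so the \<open>N\<close>-component stays within
    \<open>t * \<rho>\<close> of \<open>t *\<^sub>R c\<close>.\<close>
  define e where "e = min 1 (\<rho> / (4 * M))"
  define \<eta> where "\<eta> = min (1 / 2) (\<rho> / (8 * M * B))"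
  have e: "0 < e" "e \<le> 1" "e \<le> \<rho> / (4 * M)" using \<rho> M by (auto simp: e_def)
  have \<eta>: "0 < \<eta>" "\<eta> \<le> 1 / 2" "\<eta> \<le> \<rho> / (8 * M * B)" using \<rho> M B by (auto simp: \<eta>_def)
  obtain d where d: "0 < d" "ball 0 d \<subseteq> D"
    "\<And>x y. x \<in> ball 0 d \<Longrightarrow> y \<in> ball 0 d \<Longrightarrow> norm (G x - G y - (x - y)) \<le> \<eta> * norm (x - y)"
    using Cinf_strict[OF GC D0 derG \<eta>(1)] by blast
  \<comment> \<open>By the open mapping theorem every point near \<open>p\<close> has the form
    \<open>G u\<close> with small \<open>u\<close>.\<close>
  have "G 0 \<in> interior (G ` ball 0 d)"
    by (rule sussmann_open_mapping[OF D Cinf_continuous_on[OF GC] D0 derG bounded_linear_ident _ d(2)])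
      (use d(1) in \<open>auto simp: o_def id_def interior_open\<close>)
  then obtain r1 where r1: "r1 > 0" "ball p r1 \<subseteq> G ` ball 0 d" unfolding mem_interior G0 by blast
  have "((\<lambda>x. \<psi>' (\<phi> x - \<phi> p)) has_derivative (\<lambda>h. \<psi>' (\<phi>' h - 0))) (at p)"
    by (intro bounded_linear.has_derivative[OF bl(2)] has_derivative_diff der(1) has_derivative_const)
  from has_derivative_continuous[OF this] obtain r2 where
    r2: "r2 > 0" "\<And>x. dist x p < r2 \<Longrightarrow> dist (\<psi>' (\<phi> x - \<phi> p)) (\<psi>' (\<phi> p - \<phi> p)) < d"
    unfolding continuous_at_eps_delta using d(1) by blast
  define r where "r = min r2 (r1 / (B + 2))"
  have r: "0 < r" "r \<le> r2" "r \<le> r1 / (B + 2)" using r1 r2 B by (auto simp: r_def)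
  then have rB: "r * (B + 2) \<le> r1" using pos_le_divide_eq[of "B + 2" r r1] B by simp
  have "x \<in> S + K"
    if x0: "x0 \<in> S" "dist x0 p < r" and t: "0 < t" "t < r" and x: "norm (x - x0 - t *\<^sub>R v) \<le> e * t" for x0 t x
  proof -
    \<comment> \<open>The vector of \<open>T\<close> with \<open>G u0 = x0\<close>; it is small
      because \<open>x0\<close> is close to \<open>p\<close>.\<close>
    define u0 where "u0 = \<psi>' (\<phi> x0 - \<phi> p)"
    have x0L: "\<phi> x0 \<in> L" "x0 \<in> U" using x0 S by auto
    have "\<phi>' u0 = \<phi> x0 - \<phi> p" by (simp add: u0_def inv)
    then have u0: "u0 \<in> T" "A u0 = \<phi> x0"
      using x0L U(3) L \<pi>(4)[of u0] by (auto simp: T A_def subspace_diff)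
    have G0': "G u0 = x0" using \<pi>(4)[OF u0(1)] diffeo(5)[OF x0L(2)] by (simp add: G_def u0)
    have u0d: "u0 \<in> ball 0 d" using r2(2)[of x0] x0 r(2) linear_0[OF bounded_linear.linear[OF bl(2)]] by (simp add: u0_def)
    have nv: "norm (x - x0) \<le> e * t + t * norm v"
      using x norm_triangle_sub[of "x - x0" "t *\<^sub>R v"] t by simp
    have "norm (x - p) \<le> norm (x - x0) + norm (x0 - p)" using norm_triangle_ineq[of "x - x0" "x0 - p"] by simp
    also have "\<dots> < (e * t + t * norm v) + r" using nv x0 by (simp add: dist_norm)
    also have "\<dots> \<le> r * (B + 2)"
    proof -
      have "e * t \<le> 1 * r" using e t by (intro mult_mono) auto
      moreover have "t * norm v \<le> r * norm v" using t by (intro mult_right_mono) auto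
      ultimately show ?thesis using r(1) by (simp add: B_def algebra_simps)
    qed
    finally have "x \<in> ball p r1" using rB by (simp add: dist_norm norm_minus_commute)
    then obtain u where u: "u \<in> ball 0 d" "G u = x" using r1(2) by blast
    define w where "w = u - u0"
    have w: "norm (x - x0 - w) \<le> \<eta> * norm w" using d(3)[OF u(1) u0d] by (simp add: u G0' w_def)
    have "norm w \<le> norm (x - x0) + norm (x - x0 - w)" using norm_triangle_sub[of w "x - x0"] by (simp add: norm_minus_commute)
    moreover have "\<eta> * norm w \<le> 1 / 2 * norm w" using \<eta> by (intro mult_right_mono) auto
    moreover have "e * t + t * norm v \<le> t * B"
      using mult_right_mono[OF e(2), of t] t by (simp add: B_def algebra_simps)
    ultimately have wB: "norm w \<le> 2 * t * B" using w nv by linarith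
    have "norm (w - t *\<^sub>R v) \<le> norm (x - x0 - t *\<^sub>R v) + norm (x - x0 - w)"
      using norm_triangle_ineq[of "x - x0 - t *\<^sub>R v" "- (x - x0 - w)"] by (simp add: norm_minus_commute algebra_simps)
    also have "\<dots> \<le> e * t + \<eta> * (2 * t * B)" using x w mult_left_mono[OF wB, of \<eta>] \<eta> by linarith
    also have "\<dots> \<le> \<rho> / (4 * M) * t + \<rho> / (8 * M * B) * (2 * t * B)"
      using e \<eta> t B by (intro add_mono mult_right_mono) auto
    also have "\<dots> = t * \<rho> / (2 * M)" using M B by (simp add: field_simps)
    finally have wt: "norm (w - t *\<^sub>R v) \<le> t * \<rho> / (2 * M)" .
    define n where "n = u - \<pi> u"
    have "\<pi> v = \<pi> (v - c) + \<pi> c" using linear_add[OF \<pi>(1), of "v - c" c] by simp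
    moreover have cN: "c \<in> N" using K(1,2) openin_imp_subset by blast
    ultimately have \<pi>v: "\<pi> v = v - c" using \<pi>(4,5) v by (simp add: T_def)
    have "\<pi> (w - t *\<^sub>R v) = (\<pi> u - u0) - t *\<^sub>R (v - c)"
      by (simp add: w_def linear_diff[OF \<pi>(1)] linear_scale[OF \<pi>(1)] \<pi>v \<pi>(4)[OF u0(1)])
    then have nc: "n - t *\<^sub>R c = (w - t *\<^sub>R v) - \<pi> (w - t *\<^sub>R v)"
      by (simp add: n_def w_def algebra_simps)
    have "norm (n - t *\<^sub>R c) \<le> t * \<rho> / (2 * M) * M"
      unfolding nc by (rule order_trans[OF M(2)]) (use wt M in \<open>intro mult_right_mono, auto\<close>)
    also have "\<dots> < t * \<rho>" using M t \<rho> by simp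
    finally have nt: "norm (n - t *\<^sub>R c) < t * \<rho>" .
    have "inverse t *\<^sub>R n - c = inverse t *\<^sub>R (n - t *\<^sub>R c)" using t by (simp add: algebra_simps)
    then have "norm (inverse t *\<^sub>R n - c) = inverse t * norm (n - t *\<^sub>R c)" using t by simp
    also have "\<dots> < \<rho>" using nt t by (simp add: field_simps)
    finally have "inverse t *\<^sub>R n \<in> K" using \<rho>(2) N(1) \<pi>(3)[of u] by (simp add: n_def subspace_scale)
    then have "t *\<^sub>R (inverse t *\<^sub>R n) \<in> K" using K(3) t by blast
    then have nK: "n \<in> K" using t by simp
    have "A u \<in> V" using d(2) u(1) by (auto simp: D_def)
    moreover have "A u \<in> L" unfolding A_def using \<pi>(2)[of u] U(3) L by (auto simp: T subspace_add)
    ultimately have "\<psi> (A u) \<in> S" using diffeo(4,6) by (auto simp: S)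
    then have "\<psi> (A u) + n \<in> S + K" using nK by (rule set_plus_intro)
    then show ?thesis using u(2) by (simp add: G_def n_def)
  qed
  then show ?thesis using e(1) r(1) by blast
qed

end

text \<open>\<open>c\<close> is a vector of the cone, and \<open>v\<close> may be any representative
  of it modulo the tangent space. This freedom later permits a direction that is imaginary in a
  totally real chart.\<close>

lemma local_wedge_near_edge:
  assumes p: "p \<in> MM" and W: "local_wedge MM p W"
  shows "\<exists>c. \<forall>v. v - c \<in> tangent_space MM p \<longrightarrow> (\<exists>e>0. \<exists>r>0. \<forall>x0\<in>MM. \<forall>t x.
     dist x0 p < r \<and> 0 < t \<and> t < r \<and> norm (x - x0 - t *\<^sub>R v) \<le> e * t \<longrightarrow> x \<in> W)"
proof -
  obtain N K \<delta> where N: "subspace N" "N \<inter> tangent_space MM p = {0}" "N + tangent_space MM p = UNIV"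
    and K: "openin (top_of_set N) K" "K \<noteq> {}" "\<forall>c\<in>K. \<forall>t>0. t *\<^sub>R c \<in> K"
    and \<delta>: "0 < \<delta>" "W = (MM + K) \<inter> polydisc p \<delta>"
    using W unfolding local_wedge_def by blast
  obtain c where c: "c \<in> K" using K(2) by blast
  show ?thesis
  proof (intro exI[of _ c] allI impI)
    fix v assume v: "v - c \<in> tangent_space MM p"
    obtain e r where e: "e > 0" "r > 0" "\<And>x0 t x. x0 \<in> MM \<Longrightarrow> dist x0 p < r \<and> 0 < t \<and> t < r \<and> norm (x - x0 - t *\<^sub>R v) \<le> e * t \<Longrightarrow> x \<in> MM + K"
      using straightening.near_edge[OF straightening_MM p N K(1) c _ v] K(3) by blast
    define e' where "e' = min e 1"
    define r' where "r' = min r (\<delta> / (norm v + 2))"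
    have v2: "0 < norm v + 2" using norm_ge_zero[of v] by linarith
    have r': "0 < r'" "r' \<le> r" "r' \<le> \<delta> / (norm v + 2)"
      using e(2) \<delta>(1) v2 by (auto simp: r'_def)
    then have rv: "r' * (norm v + 2) \<le> \<delta>" using pos_le_divide_eq[OF v2] by simp
    have "x \<in> W" if x: "x0 \<in> MM" "dist x0 p < r'" "0 < t" "t < r'" "norm (x - x0 - t *\<^sub>R v) \<le> e' * t" for x0 t x
    proof -
      have "e' * t \<le> e * t" "e' * t \<le> 1 * t" using x(3) by (auto intro!: mult_right_mono simp: e'_def)
      then have 1: "norm (x - x0 - t *\<^sub>R v) \<le> e * t" "norm (x - x0 - t *\<^sub>R v) \<le> t" using x(5) by linarith+
      then have "x \<in> MM + K" using e(3)[OF x(1), of t x] x r'(2) by auto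
      moreover have "norm (x $ i - p $ i) < \<delta>" for i
      proof -
        have "norm (x $ i - p $ i) \<le> norm (x - p)" using Finite_Cartesian_Product.norm_nth_le[of "x - p" i] by simp
        also have "\<dots> \<le> norm (x - x0 - t *\<^sub>R v) + norm (t *\<^sub>R v) + norm (x0 - p)"
          using norm_triangle_ineq[of "x - x0 - t *\<^sub>R v + t *\<^sub>R v" "x0 - p"] norm_triangle_ineq[of "x - x0 - t *\<^sub>R v" "t *\<^sub>R v"] by simp
        also have "\<dots> < r' + r' * norm v + r'"
          using 1 x mult_right_mono[of t r' "norm v"] by (simp add: dist_norm)
        also have "\<dots> \<le> \<delta>" using rv by (simp add: algebra_simps)
        finally show ?thesis .
      qed
      ultimately show ?thesis by (simp add: \<delta>(2) polydisc_def)
    qed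
    moreover have "e' > 0" using e(1) by (simp add: e'_def)
    ultimately show "\<exists>e>0. \<exists>r>0. \<forall>x0\<in>MM. \<forall>t x.
     dist x0 p < r \<and> 0 < t \<and> t < r \<and> norm (x - x0 - t *\<^sub>R v) \<le> e * t \<longrightarrow> x \<in> W" using r'(1) by blast
  qed
qed

text \<open>Along a complex tangential circle through a point of the torus \<open>qf\<close> changes its sign, so that small
  displacements of \<open>M\<close> in a direction of the wedge meet the zero set of the third coordinate.\<close>

lemma local_wedge_CC:
  assumes p: "p \<in> CC" and W: "local_wedge MM p W"
  shows "\<exists>z\<in>W. z $ 3 = 0"
proof -
  have pM: "p \<in> MM" and p3: "p $ 3 = 0" "qf p = 0" and ps: "p \<in> punctured_sphere" "sqn p = 1" "p $ 1 \<noteq> 1"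
    using p CC_subset by (auto simp: CC_def punctured_sphere_def)
  obtain c where "\<forall>v. v - c \<in> tangent_space MM p \<longrightarrow> (\<exists>e>0. \<exists>r>0. \<forall>x0\<in>MM. \<forall>t x.
     dist x0 p < r \<and> 0 < t \<and> t < r \<and> norm (x - x0 - t *\<^sub>R v) \<le> e * t \<longrightarrow> x \<in> W)"
    using local_wedge_near_edge[OF pM W] by (elim exE)
  moreover have "c - c \<in> tangent_space MM p"
    using straightening.tangent_space_subspace(1)[OF straightening_MM pM] by (simp add: subspace_0)
  ultimately obtain e r where r: "e > 0" "r > 0" "\<forall>x0\<in>MM. \<forall>t x.
     dist x0 p < r \<and> 0 < t \<and> t < r \<and> norm (x - x0 - t *\<^sub>R c) \<le> e * t \<longrightarrow> x \<in> W"
    by blast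
  have inW: "x0 + t *\<^sub>R c \<in> W" if "x0 \<in> MM" "dist x0 p < r" "0 < t" "t < r" for x0 t
    using r(3)[rule_format, OF that(1), of t "x0 + t *\<^sub>R c"] that r(1) by simp
  \<comment> \<open>The unit factor that makes the product of \<zeta> and \<open>cc p\<close> equal
    to \<open>\<i>\<close> times the modulus of \<open>cc p\<close>: in this complex tangential
    direction \<open>qf\<close> grows at the rate \<open>cmod (cc p)\<close>.\<close>
  define \<zeta> where "\<zeta> = \<i> * sgn (cnj (cc p))"
  have z1: "\<zeta> * cnj \<zeta> = 1" and zc: "\<zeta> * cc p = \<i> * cmod (cc p)"
  proof -
    have n0: "complex_of_real (cmod (cc p)) \<noteq> 0" using cc_nonzero[OF p] by simp
    have s: "sgn (cnj (cc p)) = cnj (cc p) / cmod (cc p)" by (simp add: sgn_eq)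
    have 1: "cc p * cnj (cc p) = complex_of_real (cmod (cc p)) * complex_of_real (cmod (cc p))"
      using complex_norm_square[of "cc p"] by (simp add: power2_eq_square)
    show "\<zeta> * cnj \<zeta> = 1" unfolding \<zeta>_def s using 1 n0 by (simp add: field_simps)
    show "\<zeta> * cc p = \<i> * cmod (cc p)" unfolding \<zeta>_def s using 1 n0 by (simp add: field_simps)
  qed
  define e0 where "e0 = vec3 (- \<zeta> * cnj (p $ 2)) (\<zeta> * cnj (p $ 1)) 0"
  have "herm e0 e0 = (\<zeta> * cnj \<zeta>) * herm p p" by (simp add: herm_def e0_def algebra_simps)
  then have e0: "sqn e0 = 1" using z1 sqn_herm[of e0] sqn_herm[of p] ps by simp
  have pe: "herm p e0 = 0" by (simp add: herm_def e0_def)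
  let ?g = "circ p e0"
  have sq: "sqn (?g s) = 1" for s
    using circ_sqn[OF ps(2) e0 pe, of s s] sqn_herm[of "?g s"] by simp
  have gd: "(?g has_derivative (\<lambda>h. - (h * sin s) *\<^sub>R p + (h * cos s) *\<^sub>R e0)) (at s)" for s
    unfolding circ_def[abs_def] by (auto intro!: derivative_eq_intros simp: mult.commute)
  have q': "((\<lambda>s. qf (?g s)) has_real_derivative cmod (cc p)) (at 0)"
  proof -
    have "((\<lambda>s. qf (?g s)) has_derivative (\<lambda>h. dqf (?g 0) (- (h * sin 0) *\<^sub>R p + (h * cos 0) *\<^sub>R e0))) (at 0)"
      by (rule has_derivative_compose[OF gd has_derivative_qf])
    moreover have "dqf (?g 0) (- (h * sin 0) *\<^sub>R p + (h * cos 0) *\<^sub>R e0) = cmod (cc p) * h" for h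
    proof -
      have "dqf p (h *\<^sub>R e0) = dqf p ((h * \<zeta>) *s zt p)"
        by (rule dqf_cong) (simp_all add: e0_def zt_nth scaleR_conv_of_real[where 'a = complex])
      also have "\<dots> = Im (h * (\<zeta> * cc p))" by (simp add: dqf_zt mult.assoc del: Im_complex_of_real)
      also have "\<dots> = cmod (cc p) * h" by (simp add: zc)
      finally show ?thesis by (simp add: circ_def)
    qed
    ultimately show ?thesis by (simp add: has_field_derivative_def)
  qed
  have g0: "?g 0 = p" by (simp add: circ_def)
  obtain d1 where d1: "d1 > 0" "\<And>h. 0 < h \<Longrightarrow> h < d1 \<Longrightarrow> 0 < qf (?g h)"
    using DERIV_pos_inc_right[OF q'] cc_nonzero[OF p] p3 g0 by auto
  obtain d2 where d2: "d2 > 0" "\<And>h. 0 < h \<Longrightarrow> h < d2 \<Longrightarrow> qf (?g (- h)) < 0"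
    using DERIV_pos_inc_left[OF q'] cc_nonzero[OF p] p3 g0 by auto
  have gc: "continuous_on UNIV ?g" using gd has_derivative_continuous by (blast intro: continuous_at_imp_continuous_on)
  have qc: "continuous_on UNIV (\<lambda>s. qf (?g s))"
    using continuous_on_compose2[OF Cinf_continuous_on[OF Cinf_qf[OF open_UNIV]] gc] by simp
  \<comment> \<open>Two parameters: the position on the circle changes \<open>qf\<close>, the height
    changes the real part. Together they can compensate the third entry of a small multiple of
    \<open>c\<close>.\<close>
  define m where "m y = lift (?g (fst y)) (snd y)" for y
  have "continuous_on UNIV m"
    unfolding m_def lift_def vec3_axis Complex_eq
    by (intro continuous_intros bounded_linear.continuous_on[OF bounded_linear_axis]
        continuous_on_compose2[OF gc] continuous_on_compose2[OF qc]) auto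
  then have "continuous (at (0, 0)) m" by (simp add: continuous_on_eq_continuous_at)
  moreover have m0: "m (0, 0) = p" by (simp add: m_def g0 lift_def vec3_eq_iff p3 complex_eq_iff)
  moreover define r0 where "r0 = min r (cmod (p $ 1 - 1))"
  have r0: "r0 > 0" using r(2) ps(3) by (simp add: r0_def)
  ultimately obtain d where d: "d > 0" "\<And>y. dist y (0, 0) < d \<Longrightarrow> dist (m y) p < r0"
    unfolding continuous_at_eps_delta by metis
  define s0 where "s0 = min (d / 4) (min (d1 / 2) (d2 / 2))"
  have s0: "s0 > 0" "s0 \<le> d / 4" "s0 < d1" "s0 < d2" using d(1) d1(1) d2(1) by (auto simp: s0_def)
  define mm where "mm = min (qf (?g s0)) (- qf (?g (- s0)))"
  have mm: "mm > 0" using d1(2) d2(2) s0 by (simp add: mm_def)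
  define b where "b = cmod (c $ 3) + 1"
  have b: "b > 0" "\<bar>Re (c $ 3)\<bar> \<le> b" "\<bar>Im (c $ 3)\<bar> \<le> b"
    using abs_Re_le_cmod[of "c $ 3"] abs_Im_le_cmod[of "c $ 3"] norm_ge_zero[of "c $ 3"] unfolding b_def by linarith+
  \<comment> \<open>\<open>t\<close> is so small that the imaginary part of the third entry of
    \<open>t *\<^sub>R c\<close> lies within the range of \<open>qf\<close> between
    \<open>- s0\<close> and \<open>s0\<close>, and that the compensating height stays below
    \<open>d / 4\<close>.\<close>
  define t where "t = min (r / 2) (min (d / 4) mm / b)"
  have t: "0 < t" "t < r" "t * b \<le> d / 4" "t * b \<le> mm"
    using r(2) d(1) mm b(1) by (auto simp: t_def min_def field_simps)
  have tc: "\<bar>t * Re (c $ 3)\<bar> \<le> d / 4" "\<bar>t * Im (c $ 3)\<bar> \<le> mm"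
    unfolding abs_mult using t mult_left_mono[OF b(2), of t] mult_left_mono[OF b(3), of t] by linarith+
  obtain s where s: "- s0 \<le> s" "s \<le> s0" "qf (?g s) = - (t * Im (c $ 3))"
  proof -
    have "qf (?g (- s0)) \<le> - (t * Im (c $ 3))" "- (t * Im (c $ 3)) \<le> qf (?g s0)" "- s0 \<le> s0"
      using tc(2) s0(1) unfolding mm_def by linarith+
    then show thesis using IVT'[of "\<lambda>s. qf (?g s)"] continuous_on_subset[OF qc] that by blast
  qed
  define x0 where "x0 = m (s, - (t * Re (c $ 3)))"
  have "dist (s, - (t * Re (c $ 3))) (0, 0) \<le> \<bar>s\<bar> + \<bar>t * Re (c $ 3)\<bar>"
    using norm_Pair_le[of s "- (t * Re (c $ 3))"] by (simp add: dist_norm zero_prod_def)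
  also have "\<dots> < d" using s s0 tc d(1) by linarith
  finally have x0: "dist x0 p < r0" unfolding x0_def by (rule d(2))
  have "x0 $ 1 \<noteq> 1"
  proof
    assume "x0 $ 1 = 1"
    then have "cmod (p $ 1 - 1) \<le> dist x0 p"
      using Finite_Cartesian_Product.norm_nth_le[of "p - x0" 1] by (simp add: dist_norm norm_minus_commute[of p])
    then show False using x0 by (simp add: r0_def)
  qed
  then have "x0 \<in> MM" unfolding x0_def m_def lift_MM using sq by (simp add: punctured_sphere_def lift_def)
  then have "x0 + t *\<^sub>R c \<in> W" using inW x0 t by (simp add: r0_def)
  moreover have "(x0 + t *\<^sub>R c) $ 3 = 0" by (simp add: x0_def m_def lift_def s(3) complex_eq_iff)
  ultimately show ?thesis by blast
qed

lemma wedgelike_zero_third: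
  assumes "wedgelike_domain MM W"
  shows "\<exists>z\<in>W. z $ 3 = 0"
proof -
  obtain p where p: "p \<in> CC" using CC_nonempty by blast
  then obtain W' where "local_wedge MM p W'" "W' \<subseteq> W"
    using assms CC_subset unfolding wedgelike_domain_def by blast
  then show ?thesis using local_wedge_CC[OF p] by blast
qed

section \<open>The reciprocal of the third coordinate and wedgelike domains\<close>

lemma holomorphic_several_reciprocal: "holomorphic_several {z. z $ 3 \<noteq> 0} (\<lambda>z :: complex ^ 3. inverse (z $ 3))"
  unfolding holomorphic_several_def
proof
  fix z :: "complex ^ 3" assume "z \<in> {z. z $ 3 \<noteq> 0}"
  then have z: "z $ 3 \<noteq> 0" by simp
  have "((\<lambda>z. z $ 3) has_derivative (\<lambda>v. v $ 3)) (at z)"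
    by (rule bounded_linear_imp_has_derivative[OF bounded_linear_vec_nth])
  note 1 = Deriv.has_derivative_inverse[OF z this]
  show "\<exists>D. ((\<lambda>z. inverse (z $ 3)) has_derivative D) (at z) \<and> (\<forall>c v. D (c *s v) = c * D v)"
    by (intro exI conjI, rule 1) (simp add: algebra_simps)
qed

lemma holomorphic_several_mult_third:
  assumes "holomorphic_several W F"
  shows "holomorphic_several W (\<lambda>z :: complex ^ 3. F z * z $ 3 - 1)"
  unfolding holomorphic_several_def
proof
  fix z assume "z \<in> W"
  then obtain D where D: "(F has_derivative D) (at z)" "\<And>c v. D (c *s v) = c * D v"
    using assms unfolding holomorphic_several_def by blast
  have "((\<lambda>z. z $ 3) has_derivative (\<lambda>v. v $ 3)) (at z)"
    by (rule bounded_linear_imp_has_derivative[OF bounded_linear_vec_nth])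
  note 1 = has_derivative_diff[OF has_derivative_mult[OF D(1) this] has_derivative_const]
  show "\<exists>D. ((\<lambda>z. F z * z $ 3 - 1) has_derivative D) (at z) \<and> (\<forall>c v. D (c *s v) = c * D v)"
    by (intro exI conjI, rule 1) (simp add: D(2) algebra_simps)
qed

lemma no_reciprocal_extension:
  assumes W: "wedgelike_domain MM W" and F: "holomorphic_several W F"
    and a: "a \<in> W" "\<forall>\<^sub>F z in nhds a. F z * z $ 3 = 1"
  shows False
proof -
  obtain b where b: "b \<in> W" "b $ 3 = 0" using wedgelike_zero_third[OF W] by blast
  have "F b * b $ 3 - 1 = 0"
    by (rule holomorphic_several_identity[OF holomorphic_several_mult_third[OF F] _ _ a(1) _ b(1)])
      (use W a(2) in \<open>auto simp: wedgelike_domain_def\<close>)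
  then show False using b(2) by simp
qed

lemma connected_third_nonzero: "connected {z :: complex ^ 3. z $ 3 \<noteq> 0}"
proof -
  have c: "connected ((UNIV :: complex set) \<times> (UNIV :: complex set) \<times> - {0 :: complex})"
    by (intro connected_Times connected_UNIV connected_punctured_universe) simp
  have "continuous_on (UNIV \<times> UNIV \<times> - {0}) (\<lambda>y. vec3 (fst y) (fst (snd y)) (snd (snd y)))"
    unfolding vec3_axis by (intro continuous_intros bounded_linear.continuous_on[OF bounded_linear_axis])
  from connected_continuous_image[OF this c]
  have "connected ((\<lambda>y. vec3 (fst y) (fst (snd y)) (snd (snd y))) ` (UNIV \<times> UNIV \<times> - {0}))" .
  moreover have "(\<lambda>y. vec3 (fst y) (fst (snd y)) (snd (snd y))) ` (UNIV \<times> UNIV \<times> - {0}) = {z :: complex ^ 3. z $ 3 \<noteq> 0}"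
  proof (intro equalityI subsetI)
    fix z :: "complex ^ 3" assume "z \<in> {z. z $ 3 \<noteq> 0}"
    then show "z \<in> (\<lambda>y. vec3 (fst y) (fst (snd y)) (snd (snd y))) ` (UNIV \<times> UNIV \<times> - {0})"
      by (intro image_eqI[of _ _ "(z $ 1, z $ 2, z $ 3)"]) (simp_all add: vec3_eq_iff)
  qed auto
  ultimately show ?thesis by simp
qed

lemma open_third_nonzero: "open {z :: complex ^ 3. z $ 3 \<noteq> 0}"
  by (intro open_Collect_neq continuous_intros)

text \<open>The cone is the full orthogonal complement of the tangent space, and the polydisc has
  radius \<open>cmod (p $ 3)\<close>, so that it misses the zero set of the third
  coordinate.\<close>

lemma wedgelike_third_nonzero: "wedgelike_domain (MM - CC) {z. z $ 3 \<noteq> 0}"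
  unfolding wedgelike_domain_def
proof (intro conjI ballI)
  show "{z :: complex ^ 3. z $ 3 \<noteq> 0} \<noteq> {}" by (auto intro!: exI[of _ "vec3 0 0 1"])
  fix p assume "p \<in> MM - CC"
  then have p: "p \<in> MM" "p $ 3 \<noteq> 0" by (auto simp: CC_eq)
  define T where "T = tangent_space (MM - CC) p"
  have "MM - CC = MM \<inter> {z. z $ 3 \<noteq> 0}" by (auto simp: CC_eq)
  then have "T = tangent_space MM p" unfolding T_def using tangent_space_open_Int[OF open_third_nonzero] p(2) by auto
  then have T: "subspace T" using straightening.tangent_space_subspace(1)[OF straightening_MM p(1)] by simp
  have "T \<inter> orthogonal_comp T = {0}" using T orthogonal_Int_0 by blast
  moreover have "orthogonal_comp T + T = UNIV"
    using subspace_sum_orthogonal_comp[OF T] by (simp add: add.commute)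
  ultimately have "local_wedge (MM - CC) p ((MM - CC + orthogonal_comp T) \<inter> polydisc p (cmod (p $ 3)))"
    unfolding local_wedge_def T_def[symmetric]
    by (intro exI[of _ "orthogonal_comp T"] exI[of _ "cmod (p $ 3)"] conjI)
      (use p(2) subspace_orthogonal_comp[of T] in \<open>auto simp: Int_commute subspace_scale subspace_0\<close>)
  moreover have "polydisc p (cmod (p $ 3)) \<subseteq> {z. z $ 3 \<noteq> 0}"
    unfolding polydisc_def by (auto dest!: spec[of _ 3])
  ultimately show "\<exists>W'. local_wedge (MM - CC) p W' \<and> W' \<subseteq> {z. z $ 3 \<noteq> 0}" by blast
qed (rule open_third_nonzero connected_third_nonzero)+

lemma not_W_removable: "\<not> W_removable MM CC"
proof
  assume "W_removable MM CC"
  then obtain W2 W3 where W: "wedgelike_domain MM W2" "wedgelike_domain (MM - CC) W3" "W3 \<subseteq> {z. z $ 3 \<noteq> 0} \<inter> W2"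
    and ext: "\<And>f. holomorphic_several {z. z $ 3 \<noteq> 0} f \<Longrightarrow> \<exists>F. holomorphic_several W2 F \<and> (\<forall>z\<in>W3. F z = f z)"
    using wedgelike_third_nonzero unfolding W_removable_def by blast
  obtain F where F: "holomorphic_several W2 F" "\<And>z. z \<in> W3 \<Longrightarrow> F z = inverse (z $ 3)"
    using ext[OF holomorphic_several_reciprocal] by blast
  have W3: "open W3" "W3 \<noteq> {}" using W(2) by (auto simp: wedgelike_domain_def)
  then obtain a where a: "a \<in> W3" by blast
  have "\<forall>\<^sub>F z in nhds a. F z * z $ 3 = 1"
    unfolding eventually_nhds using W3 a F(2) W(3) by (intro exI[of _ W3]) auto
  then show False using no_reciprocal_extension[OF W(1) F(1)] a W(3) by blast
qed

section \<open>A totally real chart and boundary uniqueness\<close>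

text \<open>The value of \<open>qf\<close> at \<open>\<i> exp (\<i> b) (cos a, sin a)\<close>, where
  \<xi> is \<open>- exp (2 \<i> b) cos (2 a)\<close> and \<mu> is \<open>sin (2 a)\<close>,
  continued to complex \<open>a\<close> and \<open>b\<close>.\<close>

definition QQ :: "complex ^ 3 \<Rightarrow> complex" where
  "QQ s = sin (4 * s $ 1) * sin (2 * s $ 2) / 4 - cos (2 * s $ 1) * cos (2 * s $ 2)"

text \<open>The complexification of a parametrization of a maximally real submanifold of \<open>M\<close>.\<close>

definition HH :: "complex ^ 3 \<Rightarrow> complex ^ 3" where
  "HH s = vec3 (\<i> * cos (s $ 1) * exp (\<i> * s $ 2)) (\<i> * sin (s $ 1) * exp (\<i> * s $ 2)) (s $ 3 + \<i> * QQ s)"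

definition dQQ :: "complex ^ 3 \<Rightarrow> complex ^ 3 \<Rightarrow> complex" where
  "dQQ s v = (2 * sin (2 * s $ 1) * cos (2 * s $ 2) + cos (4 * s $ 1) * sin (2 * s $ 2)) * v $ 1
    + (2 * cos (2 * s $ 1) * sin (2 * s $ 2) + sin (4 * s $ 1) * cos (2 * s $ 2) / 2) * v $ 2"

definition dHH :: "complex ^ 3 \<Rightarrow> complex ^ 3 \<Rightarrow> complex ^ 3" where
  "dHH s v = vec3 (- (\<i> * sin (s $ 1) * exp (\<i> * s $ 2)) * v $ 1 - cos (s $ 1) * exp (\<i> * s $ 2) * v $ 2)
     (\<i> * cos (s $ 1) * exp (\<i> * s $ 2) * v $ 1 - sin (s $ 1) * exp (\<i> * s $ 2) * v $ 2) (v $ 3 + \<i> * dQQ s v)"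

definition real_vectors :: "(complex ^ 3) set" where
  "real_vectors = {s. \<forall>i. Im (s $ i) = 0}"

lemma real_vectors_combine: "a \<in> real_vectors \<Longrightarrow> b \<in> real_vectors \<Longrightarrow> a + complex_of_real t *s b \<in> real_vectors"
  by (simp add: real_vectors_def)

lemma has_derivative_complex_chain:
  fixes f :: "'a::real_normed_vector \<Rightarrow> complex"
  assumes "(f has_derivative f') (at s)"
  shows "((\<lambda>s. sin (f s)) has_derivative (\<lambda>v. cos (f s) * f' v)) (at s)"
    "((\<lambda>s. cos (f s)) has_derivative (\<lambda>v. - sin (f s) * f' v)) (at s)"
    "((\<lambda>s. exp (f s)) has_derivative (\<lambda>v. exp (f s) * f' v)) (at s)"
  using has_derivative_compose[OF assms DERIV_sin[unfolded has_field_derivative_def]]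
    has_derivative_compose[OF assms DERIV_cos[unfolded has_field_derivative_def]]
    has_derivative_compose[OF assms DERIV_exp[unfolded has_field_derivative_def]] by simp_all

lemma has_derivative_HH: "(HH has_derivative dHH s) (at s)"
proof -
  have n: "((\<lambda>s. s $ i) has_derivative (\<lambda>v. v $ i)) (at s)" for i :: 3
    by (rule bounded_linear_imp_has_derivative[OF bounded_linear_vec_nth])
  note s = has_derivative_complex_chain(1)[OF has_derivative_mult_right[OF n]]
    and c = has_derivative_complex_chain(2)[OF has_derivative_mult_right[OF n]]
    and ex = has_derivative_complex_chain(3)[OF has_derivative_mult_right[OF n]]
    and s' = has_derivative_complex_chain(1)[OF n] and c' = has_derivative_complex_chain(2)[OF n]
  have Q: "(QQ has_derivative dQQ s) (at s)"
    unfolding QQ_def[abs_def] divide_inverse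
    by (rule has_derivative_eq_rhs[OF has_derivative_diff[OF has_derivative_mult[OF has_derivative_mult[OF
          s[of 4 1] s[of 2 2]] has_derivative_const] has_derivative_mult[OF c[of 2 1] c[of 2 2]]]])
      (simp add: fun_eq_iff dQQ_def field_simps)
  have 1: "((\<lambda>s. \<i> * cos (s $ 1) * exp (\<i> * s $ 2)) has_derivative
      (\<lambda>v. - (\<i> * sin (s $ 1) * exp (\<i> * s $ 2)) * v $ 1 - cos (s $ 1) * exp (\<i> * s $ 2) * v $ 2)) (at s)"
    by (rule has_derivative_eq_rhs[OF has_derivative_mult[OF has_derivative_mult_right[OF c'] ex]])
      (simp add: fun_eq_iff algebra_simps)
  have 2: "((\<lambda>s. \<i> * sin (s $ 1) * exp (\<i> * s $ 2)) has_derivative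
      (\<lambda>v. \<i> * cos (s $ 1) * exp (\<i> * s $ 2) * v $ 1 - sin (s $ 1) * exp (\<i> * s $ 2) * v $ 2)) (at s)"
    by (rule has_derivative_eq_rhs[OF has_derivative_mult[OF has_derivative_mult_right[OF s'] ex]])
      (simp add: fun_eq_iff algebra_simps)
  show ?thesis
    unfolding HH_def[abs_def] dHH_def[abs_def]
    by (intro has_derivative_vec3 1 2 has_derivative_add n has_derivative_mult_right Q)
qed

lemma continuous_HH: "continuous_on UNIV HH"
  using has_derivative_HH has_derivative_continuous by (blast intro: continuous_at_imp_continuous_on)

lemma continuous_dHH: "continuous_on UNIV (\<lambda>s. dHH s v)"
  unfolding dHH_def dQQ_def vec3_axis
  by (intro continuous_intros bounded_linear.continuous_on[OF bounded_linear_axis]) auto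

lemma dHH_smult: "dHH s (l *s v) = l *s dHH s v"
  by (simp add: dHH_def dQQ_def vec3_eq_iff algebra_simps)

text \<open>Makes \<open>HH\<close> an open map near every point. The block for the first two
  coordinates has determinant \<open>\<i> * E * E\<close>, which never vanishes.\<close>

lemma dHH_right_inverse: "\<exists>g. bounded_linear g \<and> dHH s \<circ> g = id"
proof -
  define E where "E = exp (\<i> * s $ 2)"
  define D where "D = inverse (\<i> * E * E)"
  define C where "C = cos (s $ 1)"
  define S where "S = sin (s $ 1)"
  have E0: "E \<noteq> 0" by (simp add: E_def)
  have CS: "S * S = 1 - C * C" unfolding S_def C_def using sin_cos_squared_add[of "s $ 1"] by (simp add: power2_eq_square algebra_simps)
  have D: "D * (\<i> * E * E) = 1" unfolding D_def by (rule left_inverse) (simp add: E0)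
  define a where "a u = D * (C * E * u $ 2 - S * E * u $ 1)" for u :: "complex ^ 3"
  define b where "b u = - (D * (\<i> * E * (S * u $ 2 + C * u $ 1)))" for u :: "complex ^ 3"
  define P where "P = 2 * sin (2 * s $ 1) * cos (2 * s $ 2) + cos (4 * s $ 1) * sin (2 * s $ 2)"
  define P' where "P' = 2 * cos (2 * s $ 1) * sin (2 * s $ 2) + sin (4 * s $ 1) * cos (2 * s $ 2) / 2"
  define g where "g u = vec3 (a u) (b u) (u $ 3 - \<i> * (P * a u + P' * b u))" for u
  have lin: "linear g"
    by (rule linearI) (simp_all add: g_def a_def b_def vec3_eq_iff algebra_simps scaleR_conv_of_real[where 'a = complex])
  have 1: "- (\<i> * S * E) * a u - C * E * b u = u $ 1" for u
  proof -
    have "- (\<i> * S * E) * a u - C * E * b u = (D * (\<i> * E * E)) * ((S * S + C * C) * u $ 1)"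
      unfolding a_def b_def by (simp add: algebra_simps)
    then show ?thesis unfolding D CS by simp
  qed
  have 2: "\<i> * C * E * a u - S * E * b u = u $ 2" for u
  proof -
    have "\<i> * C * E * a u - S * E * b u = (D * (\<i> * E * E)) * ((S * S + C * C) * u $ 2)"
      unfolding a_def b_def by (simp add: algebra_simps)
    then show ?thesis unfolding D CS by simp
  qed
  have "dHH s (g u) = u" for u
    using 1[of u] 2[of u]
    by (simp add: dHH_def dQQ_def vec3_eq_iff g_def E_def[symmetric] C_def[symmetric] S_def[symmetric]
        P_def[symmetric] P'_def[symmetric])
  then have "bounded_linear g \<and> dHH s \<circ> g = id" using lin by (auto simp: linear_conv_bounded_linear)
  then show ?thesis by blast
qed

lemma HH_MM:
  assumes s: "s \<in> real_vectors" and 1: "HH s $ 1 \<noteq> 1"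
  shows "HH s \<in> MM"
proof -
  define a where "a = Re (s $ 1)"
  define b where "b = Re (s $ 2)"
  define t where "t = Re (s $ 3)"
  have sc: "s $ 1 = complex_of_real a" "s $ 2 = complex_of_real b" "s $ 3 = complex_of_real t"
    using s by (simp_all add: real_vectors_def complex_eq_iff a_def b_def t_def)
  define ca sa cb sb where d: "ca = cos a" "sa = sin a" "cb = cos b" "sb = sin b"
  have cs: "cb * cb + sb * sb = 1" "ca * ca + sa * sa = 1"
    unfolding d using sin_cos_squared_add2[of b] sin_cos_squared_add2[of a] by (simp_all add: power2_eq_square)
  have dbl: "cos (2 * a) = ca * ca - sa * sa" "sin (2 * a) = 2 * sa * ca"
      "cos (2 * b) = cb * cb - sb * sb" "sin (2 * b) = 2 * sb * cb"
    unfolding d by (simp_all add: cos_double sin_double power2_eq_square)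
  have E: "exp (\<i> * complex_of_real b) = Complex cb sb" by (simp add: cis_conv_exp[symmetric] complex_eq_iff d)
  have c12: "HH s $ 1 = Complex (- ca * sb) (ca * cb)" "HH s $ 2 = Complex (- sa * sb) (sa * cb)"
    by (simp_all add: HH_def sc E cos_of_real sin_of_real complex_eq_iff d)
  have "QQ s = complex_of_real (sin (4 * a) * sin (2 * b) / 4 - cos (2 * a) * cos (2 * b))"
    unfolding QQ_def sc by (simp add: cos_of_real[symmetric] sin_of_real[symmetric])
  then have c3: "HH s $ 3 = Complex t (sin (4 * a) * sin (2 * b) / 4 - cos (2 * a) * cos (2 * b))"
    by (simp add: HH_def sc complex_eq_iff)
  have "sqn (HH s) = (ca * ca + sa * sa) * (cb * cb + sb * sb)"
    unfolding sqn_def c12 by (simp add: power2_eq_square algebra_simps)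
  then have sq: "sqn (HH s) = 1" by (simp add: cs)
  have xi: "xi (HH s) = Complex (- cos (2 * a) * cos (2 * b)) (- cos (2 * a) * sin (2 * b))"
    unfolding xi_def c12 dbl by (simp add: complex_eq_iff power2_eq_square algebra_simps)
  have "mu (HH s) = 2 * (ca * sa) * (cb * cb + sb * sb)"
    unfolding mu_def c12 by (simp add: algebra_simps)
  then have mu: "mu (HH s) = sin (2 * a)" by (simp add: cs dbl)
  have "sin (4 * a) = 2 * sin (2 * a) * cos (2 * a)" using sin_double[of "2 * a"] by simp
  then have "Im (HH s $ 3) = qf (HH s)" unfolding qf_def xi mu c3 by (simp add: algebra_simps)
  then show ?thesis using sq 1 by (simp add: MM_def punctured_sphere_def)
qed

lemma holomorphic_several_HH:
  assumes "holomorphic_several W f"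
  shows "holomorphic_several {s. HH s \<in> W} (\<lambda>s. f (HH s))"
  unfolding holomorphic_several_def
proof clarify
  fix s assume "HH s \<in> W"
  then obtain D where D: "(f has_derivative D) (at (HH s))" "\<And>c v. D (c *s v) = c * D v"
    using assms unfolding holomorphic_several_def by blast
  note 1 = has_derivative_compose[OF has_derivative_HH D(1)]
  show "\<exists>D. ((\<lambda>s. f (HH s)) has_derivative D) (at s) \<and> (\<forall>c v. D (c *s v) = c * D v)"
    by (intro exI conjI, rule 1) (simp add: dHH_smult D(2))
qed

lemma islimpt_real_ball:
  assumes "r > 0"
  shows "(0 :: complex) islimpt {l \<in> ball 0 r. Im l = 0}"
  unfolding islimpt_approachable
proof (intro allI impI)
  fix e :: real assume "e > 0"
  then show "\<exists>x'\<in>{l \<in> ball 0 r. Im l = 0}. x' \<noteq> 0 \<and> dist x' 0 < e"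
    using assms by (intro bexI[of _ "complex_of_real (min (e / 2) (r / 2))"]) (auto simp: min_def)
qed

text \<open>Schwarz reflection applies because the boundary values 0 are real; the reflected
  function vanishes on the diameter, hence on the disc.\<close>

lemma zero_of_real_boundary:
  assumes r: "r > 0" and hol: "g holomorphic_on (ball 0 r \<inter> {z. 0 < Im z})"
    and cont: "continuous_on (ball 0 r \<inter> {z. 0 \<le> Im z}) g"
    and zero: "\<And>z. z \<in> ball 0 r \<Longrightarrow> Im z = 0 \<Longrightarrow> g z = 0"
    and z: "z \<in> ball 0 r" "0 < Im z"
  shows "g z = 0"
proof -
  define h where "h z = (if 0 \<le> Im z then g z else cnj (g (cnj z)))" for z
  have "h holomorphic_on ball 0 r"
    unfolding h_def
  proof (rule Schwarz_reflection[OF open_ball _ hol cont])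
    show "g z \<in> \<real>" if "z \<in> ball 0 r" "z \<in> \<real>" for z using zero[OF that(1)] that(2) by (simp add: complex_is_Real_iff)
  qed auto
  then have "h z = 0"
    by (rule analytic_continuation[OF _ open_ball connected_ball _ _ islimpt_real_ball[OF r]])
      (use r z zero in \<open>auto simp: h_def\<close>)
  then show ?thesis using z by (simp add: h_def)
qed

text \<open>Agreement with the reciprocal is known only on the edge of the wedge, where the identity
  theorem cannot start. Reflection in the chart \<open>HH\<close> moves the agreement to an open
  subset of \<open>W\<close>.\<close>

lemma no_boundary_extension:
  assumes W: "wedgelike_domain MM W" and F: "holomorphic_several W F"
    and cont: "continuous_on (W \<union> (MM - CC)) F" and bd: "\<And>z. z \<in> MM - CC \<Longrightarrow> F z = inverse (z $ 3)"
  shows False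
proof -
  have Wo: "open W" using W by (simp add: wedgelike_domain_def)
  define p where "p = HH 0"
  have p: "p = vec3 \<i> 0 (- \<i>)" by (simp add: p_def HH_def QQ_def)
  have pM: "p \<in> MM"
  proof -
    have "0 \<in> real_vectors" by (simp add: real_vectors_def)
    moreover have "HH 0 $ 1 \<noteq> 1" unfolding p_def[symmetric] p by (simp add: complex_eq_iff)
    ultimately show ?thesis unfolding p_def by (rule HH_MM)
  qed
  obtain W' where W': "local_wedge MM p W'" "W' \<subseteq> W" using W pM unfolding wedgelike_domain_def by blast
  obtain c where c: "\<forall>v. v - c \<in> tangent_space MM p \<longrightarrow> (\<exists>e>0. \<exists>r>0. \<forall>x0\<in>MM. \<forall>t x.
     dist x0 p < r \<and> 0 < t \<and> t < r \<and> norm (x - x0 - t *\<^sub>R v) \<le> e * t \<longrightarrow> x \<in> W')"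
    using local_wedge_near_edge[OF pM W'(1)] by (elim exE)
  \<comment> \<open>At \<open>p = (\<i>, 0, - \<i>)\<close> a vector is tangent iff its first and
    third entries are real. The real vector \<open>y\<close> is chosen so that
    \<open>dHH 0 (\<i> *s y)\<close> represents \<open>c\<close> modulo the tangent space.\<close>
  define y where "y = vec3 0 (- complex_of_real (Im (c $ 1))) (complex_of_real (Im (c $ 3)))"
  have yr: "y \<in> real_vectors" by (simp add: real_vectors_def forall_3 y_def)
  define v where "v = dHH 0 (\<i> *s y)"
  have v: "v = vec3 (\<i> * Im (c $ 1)) 0 (\<i> * Im (c $ 3))"
    by (simp add: v_def dHH_def dQQ_def y_def vec3_eq_iff)
  have "v - c \<in> tangent_space MM p"
    unfolding tangent_MM[OF pM] by (simp add: v p dqf_def dxi_def xi_def mu_def)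
  then obtain e r where er: "e > 0" "r > 0" "\<forall>x0\<in>MM. \<forall>t x.
     dist x0 p < r \<and> 0 < t \<and> t < r \<and> norm (x - x0 - t *\<^sub>R v) \<le> e * t \<longrightarrow> x \<in> W'"
    using c by blast
  have "continuous (at 0) HH" "continuous (at 0) (\<lambda>s. dHH s (\<i> *s y))"
    using continuous_HH continuous_dHH by (simp_all add: continuous_on_eq_continuous_at)
  moreover have "0 < min r 1" using er(2) by simp
  ultimately have ex: "\<exists>d>0. \<forall>s. dist s 0 < d \<longrightarrow> dist (HH s) (HH 0) < min r 1"
      "\<exists>d>0. \<forall>s. dist s 0 < d \<longrightarrow> dist (dHH s (\<i> *s y)) (dHH 0 (\<i> *s y)) < e"
    using er(1) unfolding continuous_at_eps_delta by (simp_all del: min_less_iff_conj)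
  obtain d1 where d1: "d1 > 0" "\<And>s. dist s 0 < d1 \<Longrightarrow> dist (HH s) (HH 0) < min r 1" using ex(1) by blast
  obtain d2 where d2: "d2 > 0" "\<And>s. dist s 0 < d2 \<Longrightarrow> dist (dHH s (\<i> *s y)) (dHH 0 (\<i> *s y)) < e" using ex(2) by blast
  \<comment> \<open>Within distance 1 of \<open>p\<close> the first entry differs from 1 and the
    third from 0, so the point avoids the pole and the torus.\<close>
  have inM: "HH a \<in> MM - CC \<and> dist (HH a) p < r" if "a \<in> real_vectors" "norm a < d1" for a
  proof -
    have d: "dist (HH a) p < r" "norm (HH a - p) < 1" using d1(2)[of a] that by (simp_all add: p_def dist_norm)
    have "cmod (HH a $ 1 - \<i>) < 1" "cmod (HH a $ 3 + \<i>) < 1"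
      using d(2) Finite_Cartesian_Product.norm_nth_le[of "HH a - p" 1] Finite_Cartesian_Product.norm_nth_le[of "HH a - p" 3] by (simp_all add: p)
    then have "HH a $ 1 \<noteq> 1" "HH a $ 3 \<noteq> 0" by (auto simp: cmod_def)
    then show ?thesis using HH_MM[OF that(1)] d(1) by (auto simp: CC_eq)
  qed
  define \<rho> where "\<rho> = min r (min d1 (d2 / (2 + norm y)))"
  have y2: "0 < 2 + norm y" using norm_ge_zero[of y] by linarith
  have \<rho>: "\<rho> > 0" "\<rho> \<le> r" "\<rho> \<le> d1" "\<rho> \<le> d2 / (2 + norm y)" using er(2) d1(1) d2(1) y2 by (auto simp: \<rho>_def)
  then have \<rho>d: "\<rho> * (2 + norm y) \<le> d2" using pos_le_divide_eq[OF y2] by simp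
  \<comment> \<open>A first-order expansion in the imaginary direction: by the mean value theorem
    for \<open>f\<close>, the point differs from \<open>HH a + t *\<^sub>R v\<close> by at most
    \<open>e * t\<close>, so it lies in the wedge.\<close>
  have wedge: "HH (a + (\<i> * complex_of_real t) *s y) \<in> W" if a: "a \<in> real_vectors" "norm a < \<rho>" and t: "0 < t" "t < \<rho>" for a t
  proof -
    define f where "f \<tau> = HH (a + \<tau> *\<^sub>R (\<i> *s y)) - \<tau> *\<^sub>R v" for \<tau> :: real
    have f': "(f has_derivative (\<lambda>h. dHH (a + \<tau> *\<^sub>R (\<i> *s y)) (h *\<^sub>R (\<i> *s y)) - h *\<^sub>R v)) (at \<tau>)" for \<tau>
      unfolding f_def[abs_def]
      by (intro has_derivative_diff has_derivative_compose[OF _ has_derivative_HH])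
        (auto intro!: derivative_eq_intros)
    have "\<exists>\<tau>\<in>{0<..<t}. norm (f t - f 0) \<le> norm (dHH (a + \<tau> *\<^sub>R (\<i> *s y)) ((t - 0) *\<^sub>R (\<i> *s y)) - (t - 0) *\<^sub>R v)"
      by (rule mvt_general[OF t(1) _ f'])
        (use f' has_derivative_continuous in \<open>blast intro: continuous_at_imp_continuous_on\<close>)
    then obtain \<tau> where \<tau>: "0 < \<tau>" "\<tau> < t"
      "norm (f t - f 0) \<le> norm (dHH (a + \<tau> *\<^sub>R (\<i> *s y)) (t *\<^sub>R (\<i> *s y)) - t *\<^sub>R v)" by auto
    have ny: "norm (\<i> *s y) = norm y" by (simp add: norm_vec_def norm_mult)
    have "norm (a + \<tau> *\<^sub>R (\<i> *s y)) \<le> norm a + \<tau> * norm y"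
      using norm_triangle_ineq[of a "\<tau> *\<^sub>R (\<i> *s y)"] \<tau>(1) by (simp add: ny)
    also have "\<dots> < \<rho> + \<rho> * norm y"
      using a(2) mult_right_mono[of \<tau> \<rho> "norm y"] \<tau> t by simp
    also have "\<dots> \<le> d2" using \<rho>d \<rho>(1) by (simp add: algebra_simps)
    finally have "norm (dHH (a + \<tau> *\<^sub>R (\<i> *s y)) (\<i> *s y) - v) < e"
      using d2(2)[of "a + \<tau> *\<^sub>R (\<i> *s y)"] by (simp add: dist_norm v_def)
    moreover have "t *\<^sub>R w = complex_of_real t *s w" for w :: "complex ^ 3"
      by (simp add: vec_eq_iff scaleR_conv_of_real[where 'a = complex])
    then have "dHH (a + \<tau> *\<^sub>R (\<i> *s y)) (t *\<^sub>R (\<i> *s y)) - t *\<^sub>R v = t *\<^sub>R (dHH (a + \<tau> *\<^sub>R (\<i> *s y)) (\<i> *s y) - v)"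
      by (simp only: dHH_smult scaleR_diff_right)
    ultimately have "norm (f t - f 0) \<le> t * norm (dHH (a + \<tau> *\<^sub>R (\<i> *s y)) (\<i> *s y) - v)" using \<tau>(3) t(1) by simp
    moreover note \<open>norm (dHH (a + \<tau> *\<^sub>R (\<i> *s y)) (\<i> *s y) - v) < e\<close>
    ultimately have "norm (f t - f 0) \<le> t * e"
      using t(1) by (meson less_imp_le mult_left_mono order_trans)
    moreover have "f t - f 0 = HH (a + t *\<^sub>R (\<i> *s y)) - HH a - t *\<^sub>R v" by (simp add: f_def)
    ultimately have "HH (a + t *\<^sub>R (\<i> *s y)) \<in> W'"
      using er(3)[rule_format, of "HH a" t "HH (a + t *\<^sub>R (\<i> *s y))"] inM[OF a(1)] a t \<rho> by (simp add: mult.commute)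
    moreover have "t *\<^sub>R (\<i> *s y) = (\<i> * complex_of_real t) *s y"
      by (simp add: vec_eq_iff scaleR_conv_of_real[where 'a = complex])
    ultimately show ?thesis using W'(2) by auto
  qed
  define k where "k s = F (HH s) * HH s $ 3 - 1" for s
  define \<Omega> where "\<Omega> = {s. HH s \<in> W}"
  have \<Omega>: "open \<Omega>" unfolding \<Omega>_def using open_vimage[OF Wo continuous_HH] by (simp add: vimage_def)
  have k: "holomorphic_several \<Omega> k"
    unfolding k_def[abs_def] \<Omega>_def by (rule holomorphic_several_HH[OF holomorphic_several_mult_third[OF F]])
  have k0: "k a = 0" if "a \<in> real_vectors" "norm a < d1" for a
    using inM[OF that] bd[of "HH a"] by (auto simp: k_def CC_eq)
  define \<rho>' where "\<rho>' = \<rho> / (2 * (1 + norm y))"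
  have y1: "0 < 2 * (1 + norm y)" "0 < 1 + norm y" by (simp_all add: add_pos_nonneg)
  have \<rho>': "\<rho>' > 0" "\<rho>' * (2 * (1 + norm y)) = \<rho>" using \<rho>(1) y1 by (simp_all add: \<rho>'_def)
  have \<rho>'': "\<rho>' * norm y \<le> \<rho> / 2" "\<rho>' \<le> \<rho> / 2" 
  proof -
    have "2 * \<rho>' + 2 * (\<rho>' * norm y) = \<rho>" using \<rho>'(2) by (simp add: algebra_simps)
    moreover have "0 \<le> \<rho>' * norm y" using \<rho>'(1) by simp
    ultimately show "\<rho>' * norm y \<le> \<rho> / 2" "\<rho>' \<le> \<rho> / 2" using \<rho>'(1) by linarith+
  qed
  \<comment> \<open>On each complex line in the direction \<open>y\<close>, the function
    \<open>k\<close> is holomorphic on an upper half disc, continuous up to the diameter, and zero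
    there.\<close>
  have half: "k (a + l *s y) = 0 \<and> a + l *s y \<in> \<Omega>"
    if a: "a \<in> real_vectors" "norm a < \<rho> / 2" and l: "l \<in> ball 0 \<rho>'" "0 < Im l" for a l
  proof -
    have split: "a + z *s y = (a + complex_of_real (Re z) *s y) + (\<i> * complex_of_real (Im z)) *s y" for z
      by (simp add: vec_eq_iff complex_eq_iff algebra_simps)
    have ar: "a + complex_of_real (Re z) *s y \<in> real_vectors" "norm (a + complex_of_real (Re z) *s y) < \<rho>"
      if "z \<in> ball 0 \<rho>'" for z
    proof -
      show "a + complex_of_real (Re z) *s y \<in> real_vectors" by (rule real_vectors_combine[OF a(1) yr])
      have "complex_of_real (Re z) *s y = Re z *\<^sub>R y" by (simp add: vec_eq_iff scaleR_conv_of_real[where 'a = complex])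
      then have "norm (a + complex_of_real (Re z) *s y) \<le> norm a + \<bar>Re z\<bar> * norm y"
        using norm_triangle_ineq[of a "Re z *\<^sub>R y"] by simp
      also have "\<bar>Re z\<bar> * norm y \<le> \<rho>' * norm y"
        using that abs_Re_le_cmod[of z] by (intro mult_right_mono) auto
      finally show "norm (a + complex_of_real (Re z) *s y) < \<rho>" using a(2) \<rho>''(1) by linarith
    qed
    have up: "HH (a + z *s y) \<in> W" if "z \<in> ball 0 \<rho>'" "0 < Im z" for z
    proof -
      have "Im z < \<rho>" using that abs_Im_le_cmod[of z] \<rho>''(2) \<rho>(1) by simp
      from wedge[OF ar[OF that(1)] that(2) this] show ?thesis by (simp only: split[of z])
    qed
    have re: "HH (a + z *s y) \<in> MM - CC" "k (a + z *s y) = 0" if "z \<in> ball 0 \<rho>'" "Im z = 0" for z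
    proof -
      have "a + z *s y = a + complex_of_real (Re z) *s y" using that(2) by (simp add: vec_eq_iff complex_eq_iff)
      then show "HH (a + z *s y) \<in> MM - CC" "k (a + z *s y) = 0" using ar[OF that(1)] inM k0 \<rho>(3) by auto
    qed
    have "k (a + l *s y) = 0"
    proof (rule zero_of_real_boundary[OF \<rho>'(1) _ _ _ l])
      show "(\<lambda>l. k (a + l *s y)) holomorphic_on ball 0 \<rho>' \<inter> {z. 0 < Im z}"
        by (rule holomorphic_on_subset[OF holomorphic_several_line[OF k \<Omega>]]) (auto simp: \<Omega>_def up)
      have line: "continuous_on UNIV (\<lambda>l. a + l *s y)"
        using has_derivative_continuous[OF affine_smult_has_derivative] continuous_at_imp_continuous_on by blast
      have H: "continuous_on X (\<lambda>l. HH (a + l *s y))" for X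
        by (rule continuous_on_subset[OF continuous_on_compose2[OF continuous_HH line]]) auto
      have in1: "HH (a + z *s y) \<in> W \<union> (MM - CC)" if "z \<in> ball 0 \<rho>'" "0 \<le> Im z" for z
        using up[OF that(1)] re(1)[OF that(1)] that(2) by (cases "Im z = 0") auto
      have "continuous_on (ball 0 \<rho>' \<inter> {z. 0 \<le> Im z}) (\<lambda>l. F (HH (a + l *s y)))"
        by (rule continuous_on_compose2[OF cont H], rule image_subsetI, rule in1) simp_all
      then show "continuous_on (ball 0 \<rho>' \<inter> {z. 0 \<le> Im z}) (\<lambda>l. k (a + l *s y))"
        unfolding k_def by (intro continuous_intros H)
    qed (use re in auto)
    then show ?thesis using up[OF l] by (simp add: \<Omega>_def)
  qed
  \<comment> \<open>The real slice is shifted by a fixed imaginary amount into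
    \<open>\<Omega>\<close>, where \<open>k\<close> is holomorphic and already known to vanish on
    the shifted slice.\<close>
  define b where "b = (\<i> * complex_of_real (\<rho>' / 2)) *s y"
  have kb: "k (b + a) = 0 \<and> b + a \<in> \<Omega>" if "a \<in> real_vectors" "norm a < \<rho> / 2" for a
    using half[OF that, of "\<i> * complex_of_real (\<rho>' / 2)"] \<rho>'(1) by (simp add: b_def norm_mult add.commute)
  have "b \<in> \<Omega>" using kb[of 0] \<rho>(1) by (simp add: real_vectors_def)
  then obtain \<eta>0 where \<eta>0: "\<eta>0 > 0" "ball b \<eta>0 \<subseteq> \<Omega>" using \<Omega> openE by blast
  define \<eta> where "\<eta> = min \<eta>0 (\<rho> / 2)"
  have \<eta>: "\<eta> > 0" "ball b \<eta> \<subseteq> \<Omega>" "\<eta> \<le> \<rho> / 2" using \<eta>0 \<rho>(1) by (auto simp: \<eta>_def)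
  have kx: "k x = 0" if x: "x \<in> ball b (\<eta> / 4)" for x
  proof -
    define u where "u = x - b"
    have u: "norm u < \<eta> / 4" using x by (simp add: u_def dist_norm norm_minus_commute)
    \<comment> \<open>With \<open>x = b + a + \<i> *s a'\<close> for real \<open>a\<close> and
      \<open>a'\<close>, the function vanishes at \<open>b + a + l *s a'\<close> for real
      \<open>l\<close>, hence by continuation also at \<open>l = \<i>\<close>.\<close>
    define a where "a = (\<chi> i. complex_of_real (Re (u $ i)))"
    define a' where "a' = (\<chi> i. complex_of_real (Im (u $ i)))"
    have ar: "a \<in> real_vectors" "a' \<in> real_vectors" by (simp_all add: real_vectors_def a_def a'_def)
    have "norm a \<le> norm u" by (rule norm_le_componentwise_cart) (simp add: a_def abs_Re_le_cmod)
    moreover have "norm a' \<le> norm u" by (rule norm_le_componentwise_cart) (simp add: a'_def abs_Im_le_cmod)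
    ultimately have n: "norm a < \<eta> / 4" "norm a' < \<eta> / 4" using u by auto
    have nl: "norm (a + l *s a') < \<eta>" if "cmod l < 2" for l
    proof -
      have "norm (l *s a') = cmod l * norm a'" by (simp add: norm_vec_def norm_mult L2_set_right_distrib)
      also have "\<dots> \<le> 2 * norm a'" using that by (intro mult_right_mono) auto
      finally show ?thesis using norm_triangle_ineq[of a "l *s a'"] n \<eta>(1) by linarith
    qed
    have "k ((b + a) + \<i> *s a') = 0"
    proof (rule analytic_continuation[where f = "\<lambda>l. k ((b + a) + l *s a')", OF _ open_ball connected_ball _ _ islimpt_real_ball[of 2]])
      show "(\<lambda>l. k ((b + a) + l *s a')) holomorphic_on ball 0 2"
      proof (rule holomorphic_on_subset[OF holomorphic_several_line[OF k \<Omega>]], clarify)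
        fix l :: complex assume "l \<in> ball 0 2"
        then have "(b + a) + l *s a' \<in> ball b \<eta>"
        proof -
          have "dist b (b + (a + l *s a')) = norm (a + l *s a')"
            by (metis add_diff_cancel_left' dist_commute dist_norm)
          then show ?thesis using nl[of l] \<open>l \<in> ball 0 2\<close> by (simp add: add.assoc)
        qed
        then show "(b + a) + l *s a' \<in> \<Omega>" using \<eta>(2) by blast
      qed
      show "k ((b + a) + l *s a') = 0" if "l \<in> {l \<in> ball 0 2. Im l = 0}" for l
      proof -
        have l: "l = complex_of_real (Re l)" "cmod l < 2" using that by (auto simp: complex_eq_iff)
        have "a + l *s a' \<in> real_vectors" by (subst l(1)) (rule real_vectors_combine[OF ar])
        moreover have "norm (a + l *s a') < \<rho> / 2" using nl[OF l(2)] \<eta>(3) by simp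
        ultimately have "k (b + (a + l *s a')) = 0" using kb by blast
        then show ?thesis by (simp add: add.assoc)
      qed
    qed auto
    moreover have "(b + a) + \<i> *s a' = x"
      by (simp add: vec_eq_iff a_def a'_def complex_eq_iff u_def)
    ultimately show ?thesis by simp
  qed
  obtain g where g: "bounded_linear g" "dHH b \<circ> g = id" using dHH_right_inverse by blast
  \<comment> \<open>Openness of \<open>HH\<close> turns vanishing near \<open>b\<close> into
    vanishing near \<open>HH b\<close> in the ambient space.\<close>
  have "HH b \<in> interior (HH ` ball b (\<eta> / 4))"
    by (rule sussmann_open_mapping[OF open_UNIV continuous_HH UNIV_I has_derivative_HH g subset_UNIV])
      (use \<eta>(1) in \<open>simp add: interior_open\<close>)
  moreover have "interior (HH ` ball b (\<eta> / 4)) \<subseteq> {z. F z * z $ 3 = 1}"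
  proof -
    have "HH ` ball b (\<eta> / 4) \<subseteq> {z. F z * z $ 3 = 1}" using kx by (auto simp: k_def)
    then show ?thesis using interior_subset by blast
  qed
  ultimately have "\<forall>\<^sub>F z in nhds (HH b). F z * z $ 3 = 1"
    unfolding eventually_nhds using open_interior by blast
  moreover have "HH b \<in> W" using \<open>b \<in> \<Omega>\<close> by (simp add: \<Omega>_def)
  ultimately show False using no_reciprocal_extension[OF W F] by blast
qed

lemma not_CR_removable:
  assumes "CR_function T (MM - CC) (\<lambda>z. inverse (z $ 3))"
  shows "\<not> CR_removable T MM CC"
proof
  assume "CR_removable T MM CC"
  then obtain W where W: "wedgelike_domain MM W" and ext: "\<And>f. continuous_on (MM - CC) f \<Longrightarrow> CR_function T (MM - CC) f \<Longrightarrow>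
      \<exists>F. holomorphic_several W F \<and> continuous_on (W \<union> (MM - CC)) F \<and> (\<forall>p\<in>MM - CC. F p = f p)"
    unfolding CR_removable_def by blast
  have "continuous_on (MM - CC) (\<lambda>z. inverse (z $ 3))"
    by (intro continuous_intros) (auto simp: CC_eq)
  from ext[OF this assms] show False using no_boundary_extension[OF W] by blast
qed

section \<open>Sublevel sets of complex-valued submersions\<close>

lemma sublevel_lmeasurable:
  fixes h :: "'a::euclidean_space \<Rightarrow> complex"
  assumes "open U" "U \<in> lmeasurable" "continuous_on U h"
  shows "{x \<in> U. cmod (h x) \<le> r} \<in> lmeasurable"
proof -
  have "open (U \<inter> h -` (- cball 0 r))"
    by (rule continuous_open_preimage[OF assms(3,1)]) (simp add: open_Compl)
  then have "U - (U \<inter> h -` (- cball 0 r)) \<in> lmeasurable" using assms(2) by (intro fmeasurable_Diff) auto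
  moreover have "U - (U \<inter> h -` (- cball 0 r)) = {x \<in> U. cmod (h x) \<le> r}" by auto
  ultimately show ?thesis by simp
qed

text \<open>\<open>u\<close> is meant as a linear right inverse of the derivative of
  \<open>h\<close> at \<open>x0\<close>. The condition \<open>near\<close> says that moving by
  \<open>u z\<close> changes the value by \<open>z\<close> up to a quarter of its modulus, so values
  can be steered within the plane \<open>range u\<close>.\<close>

locale near_submersion =
  fixes h :: "'a::euclidean_space \<Rightarrow> complex" and u :: "complex \<Rightarrow> 'a" and x0 :: 'a and d M :: real
  assumes d: "0 < d" and M: "0 < M" and u: "linear u" and uM: "\<And>z. norm (u z) \<le> M * cmod z"
    and cont: "continuous_on (ball x0 d) h"
    and near: "\<And>x z. x \<in> ball x0 d \<Longrightarrow> x + u z \<in> ball x0 d \<Longrightarrow> cmod (h (x + u z) - h x - z) \<le> cmod z / 4"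
begin

lemma ball_add: "x \<in> ball x0 a \<Longrightarrow> norm y \<le> b \<Longrightarrow> a + b \<le> c \<Longrightarrow> x + y \<in> ball x0 c"
  using norm_triangle_ineq[of "x - x0" y] by (simp add: dist_norm norm_minus_commute[of x0] algebra_simps)

text \<open>The translates of the sublevel set by the lattice points of mesh \<open>4 r\<close> are pairwise disjoint.\<close>

lemma sublevel_measure_upper:
  "\<exists>C. \<forall>r>0. measure lebesgue {x \<in> ball x0 (d / 2). cmod (h x) \<le> r} \<le> C * r\<^sup>2"
proof (intro exI allI impI)
  define v where "v = measure lebesgue (ball x0 d)"
  fix r :: real assume r: "0 < r"
  define S where "S = {x \<in> ball x0 (d / 2). cmod (h x) \<le> r}"
  have S: "S \<in> lmeasurable"
    unfolding S_def using d by (intro sublevel_lmeasurable open_ball lmeasurable_ball continuous_on_subset[OF cont]) auto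
  have Sb: "S \<subseteq> ball x0 d" using d by (auto simp: S_def)
  \<comment> \<open>The lattice points have modulus at most \<open>8 * r * N\<close>, so under this
    bound on \<open>N\<close> all translates by their images stay in the ball of radius
    \<open>d\<close>.\<close>
  have step: "(real N)\<^sup>2 * measure lebesgue S \<le> v" if N: "16 * M * r * real N \<le> d" for N
  proof -
    define z where "z = (\<lambda>(j, k). Complex (4 * r * real j) (4 * r * real k))"
    define T where "T jk = (+) (u (z jk)) ` S" for jk
    define I where "I = {..<N} \<times> {..<N}"
    have T: "T jk \<in> lmeasurable" "measure lebesgue (T jk) = measure lebesgue S" for jk
      unfolding T_def using S by (auto intro: measurable_translation measure_translation)
    have disj: "disjoint_family_on T I"
      unfolding disjoint_family_on_def
    proof (intro ballI impI equals0I)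
      fix jk jk' y assume ne: "jk \<noteq> jk'" and "y \<in> T jk \<inter> T jk'"
      then obtain x x' where x: "x \<in> S" "x' \<in> S" "u (z jk) + x = u (z jk') + x'" unfolding T_def by fastforce
      have x': "x + u (z jk - z jk') = x'" using x(3) by (simp add: linear_diff[OF u] algebra_simps)
      have n: "cmod (h x' - h x - (z jk - z jk')) \<le> cmod (z jk - z jk') / 4"
        using near[of x "z jk - z jk'"] x Sb unfolding x' by blast
      have "cmod (z jk - z jk') \<le> cmod (h x' - h x) + cmod (h x' - h x - (z jk - z jk'))"
        using norm_triangle_sub[of "z jk - z jk'" "h x' - h x"] by (simp add: norm_minus_commute)
      moreover have "cmod (h x' - h x) \<le> 2 * r" using x norm_triangle_ineq4[of "h x'" "h x"] by (simp add: S_def)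
      \<comment> \<open>Values on \<open>S\<close> differ by at most \<open>2 * r\<close>, and a
        quarter of the shift is the error; so the shift is at most \<open>8 * r / 3\<close>, which
        is below the mesh.\<close>
      ultimately have le: "cmod (z jk - z jk') \<le> 8 * r / 3" using n by linarith
      obtain j k j' k' where jk: "jk = (j, k)" "jk' = (j', k')" by (cases jk, cases jk')
      have ge1: "1 \<le> \<bar>real a - real b\<bar>" if "a \<noteq> b" for a b :: nat using that by linarith
      have "4 * r \<le> \<bar>Re (z jk - z jk')\<bar> \<or> 4 * r \<le> \<bar>Im (z jk - z jk')\<bar>"
      proof (cases "j = j'")
        case True
        then have "4 * r * 1 \<le> 4 * r * \<bar>real k - real k'\<bar>" using ne jk r by (intro mult_left_mono ge1) auto
        then show ?thesis using r by (simp add: z_def jk abs_mult right_diff_distrib[symmetric])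
      next
        case False
        then have "4 * r * 1 \<le> 4 * r * \<bar>real j - real j'\<bar>" using r by (intro mult_left_mono ge1) auto
        then show ?thesis using r by (simp add: z_def jk abs_mult right_diff_distrib[symmetric])
      qed
      then show False using le r abs_Re_le_cmod[of "z jk - z jk'"] abs_Im_le_cmod[of "z jk - z jk'"] by linarith
    qed
    have sub: "T jk \<subseteq> ball x0 d" if jk: "jk \<in> I" for jk
    proof -
      obtain j k where jk': "jk = (j, k)" "j < N" "k < N" using jk by (auto simp: I_def)
      have "cmod (z jk) \<le> 4 * r * real j + 4 * r * real k"
        using cmod_le[of "z jk"] r by (simp add: z_def jk')
      also have "\<dots> \<le> 4 * r * real N + 4 * r * real N" using jk' r by (intro add_mono mult_left_mono) auto
      finally have "M * cmod (z jk) \<le> M * (8 * r * real N)" using M by simp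
      also have "\<dots> \<le> d / 2" using N by (simp add: mult_ac)
      finally have "norm (u (z jk)) \<le> d / 2" using uM[of "z jk"] by linarith
      then have "x + u (z jk) \<in> ball x0 d" if "x \<in> S" for x using that by (intro ball_add[of x "d / 2" _ "d / 2"]) (auto simp: S_def)
      then show ?thesis by (auto simp: T_def add.commute)
    qed
    have "(\<Sum>jk\<in>I. measure lebesgue (T jk)) = measure lebesgue (\<Union>jk\<in>I. T jk)"
    proof (rule measure_finite_Union[symmetric])
      show "emeasure lebesgue (T jk) \<noteq> \<infinity>" for jk using fmeasurableD2[OF T(1)[of jk]] unfolding infinity_ennreal_def .
    qed (use T(1) disj in \<open>auto simp: I_def\<close>)
    also have "\<dots> \<le> v"
      unfolding v_def using sub T(1) by (intro measure_mono_fmeasurable lmeasurable_ball) (auto simp: I_def)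
    finally show ?thesis by (simp add: T(2) I_def power2_eq_square)
  qed
  have m: "measure lebesgue S \<le> v"
    unfolding v_def using S Sb by (intro measure_mono_fmeasurable lmeasurable_ball) (auto simp: fmeasurable_def)
  have v: "0 \<le> v" by (simp add: v_def)
  \<comment> \<open>The admissible number of translates in each lattice direction. If it is at least
    1, its floor is at least half of it; otherwise the trivial bound by \<open>v\<close>
    suffices.\<close>
  define X where "X = d / (16 * M * r)"
  have X: "X > 0" using d M r by (simp add: X_def)
  have Xe: "(32 * M / d)\<^sup>2 * r\<^sup>2 = inverse ((X / 2)\<^sup>2)" using d M r by (simp add: X_def field_simps power2_eq_square)
  have "measure lebesgue S \<le> v * inverse ((X / 2)\<^sup>2)"
  proof (cases "1 \<le> X")
    case True
    define N where "N = nat \<lfloor>X\<rfloor>"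
    have "real N = of_int \<lfloor>X\<rfloor>" "1 \<le> \<lfloor>X\<rfloor>" using True by (simp_all add: N_def)
    then have N: "real N \<le> X" "X / 2 \<le> real N" by linarith+
    have "16 * M * r * real N \<le> 16 * M * r * X" using N M r by (intro mult_left_mono) auto
    also have "\<dots> = d" using M r by (simp add: X_def)
    finally have "(real N)\<^sup>2 * measure lebesgue S \<le> v" by (rule step)
    moreover have "(X / 2)\<^sup>2 * measure lebesgue S \<le> (real N)\<^sup>2 * measure lebesgue S"
      using N X by (intro mult_right_mono power_mono) auto
    ultimately show ?thesis using X by (simp add: field_simps)
  next
    case False
    then have "(X / 2)\<^sup>2 \<le> 1" using X by (simp add: power_le_one_iff)
    then have "1 \<le> inverse ((X / 2)\<^sup>2)" using X by (intro one_le_inverse) auto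
    then have "v * 1 \<le> v * inverse ((X / 2)\<^sup>2)" using v by (intro mult_left_mono) auto
    then show ?thesis using m by linarith
  qed
  then show "measure lebesgue {x \<in> ball x0 (d / 2). cmod (h x) \<le> r} \<le> (v * (32 * M / d)\<^sup>2) * r\<^sup>2"
    unfolding S_def mult.assoc Xe .
qed

text \<open>Finitely many translates of the sublevel set, by lattice points of mesh \<open>r / 4\<close>, cover a fixed ball; a
  zero of \<open>h\<close> near each point is provided by Brouwer's theorem.\<close>

lemma sublevel_measure_lower:
  assumes h0: "h x0 = 0"
  shows "\<exists>c>0. \<exists>r0>0. \<forall>r. 0 < r \<and> r < r0 \<longrightarrow> c * r\<^sup>2 \<le> measure lebesgue {x \<in> ball x0 d. cmod (h x) \<le> r}"
proof -
  \<comment> \<open>Shifts by parameters of modulus at most \<open>3 * \<rho>\<close> have length at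
    most \<open>3 * d / 8\<close>, so they keep points of the half ball inside the ball.\<close>
  define \<rho> where "\<rho> = d / (8 * M)"
  have \<rho>: "\<rho> > 0" "8 * (M * \<rho>) = d" using d M by (simp_all add: \<rho>_def)
  have "isCont h x0" using cont d by (simp add: continuous_on_eq_continuous_at)
  then obtain d1 where d1: "d1 > 0" "\<And>x. dist x x0 < d1 \<Longrightarrow> dist (h x) (h x0) < \<rho>"
    using \<rho>(1) unfolding continuous_at_eps_delta by blast
  define d' where "d' = min d1 (d / 2)"
  have d': "d' > 0" "d' \<le> d / 2" "\<And>x. x \<in> ball x0 d' \<Longrightarrow> cmod (h x) < \<rho>"
    using d1 d h0 by (auto simp: d'_def dist_commute dist_norm)
  have in_ball: "x + u z \<in> ball x0 d" if "x \<in> ball x0 d'" "cmod z \<le> 3 * \<rho>" for x z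
  proof (rule ball_add[OF that(1), of _ "3 * (M * \<rho>)"])
    have "M * cmod z \<le> M * (3 * \<rho>)" using that(2) M by simp
    then show "norm (u z) \<le> 3 * (M * \<rho>)" using uM[of z] by simp
    show "d' + 3 * (M * \<rho>) \<le> d" using d'(2) \<rho>(2) d by linarith
  qed
  have zero: "\<exists>z. cmod z \<le> 2 * \<rho> \<and> h (x + u z) = 0" if x: "x \<in> ball x0 d'" for x
  proof -
    have xb: "x \<in> ball x0 d" using x d' d by auto
    have uc: "continuous_on X (\<lambda>z. x + u z)" for X
      using linear_continuous_on[of u] u by (intro continuous_intros) (simp add: linear_conv_bounded_linear)
    \<comment> \<open>Zeros are the fixed points of this map. By \<open>near\<close> its values are
      bounded by the modulus of \<open>h x\<close> plus a quarter of that of \<open>z\<close>, hence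
      by \<open>3 * \<rho> / 2\<close>.\<close>
    have "\<exists>z\<in>cball 0 (2 * \<rho>). z - h (x + u z) = z"
    proof (rule brouwer_ball[of "2 * \<rho>" 0 "\<lambda>z. z - h (x + u z)"])
      show "continuous_on (cball 0 (2 * \<rho>)) (\<lambda>z. z - h (x + u z))"
        by (intro continuous_intros continuous_on_compose2[OF cont uc])
          (use in_ball[OF x] \<rho>(1) in \<open>auto simp del: mem_ball\<close>)
      show "(\<lambda>z. z - h (x + u z)) \<in> cball 0 (2 * \<rho>) \<rightarrow> cball 0 (2 * \<rho>)"
      proof
        fix z :: complex assume "z \<in> cball 0 (2 * \<rho>)"
        then have z: "cmod z \<le> 2 * \<rho>" by simp
        have "cmod (h (x + u z) - h x - z) \<le> cmod z / 4"
          by (rule near[OF xb in_ball[OF x]]) (use z \<rho>(1) in simp)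
        moreover have "cmod (z - h (x + u z)) \<le> cmod (h x) + cmod (h (x + u z) - h x - z)"
          using norm_triangle_ineq[of "h x" "h (x + u z) - h x - z"] by (simp add: norm_minus_commute)
        ultimately show "z - h (x + u z) \<in> cball 0 (2 * \<rho>)" using z d'(3)[OF x] \<rho>(1) by simp
      qed
    qed (use \<rho>(1) in \<open>auto intro: that\<close>)
    then show ?thesis by auto
  qed
  define v where "v = measure lebesgue (ball x0 d')"
  have v: "v > 0" unfolding v_def using d'(1) by (simp add: content_ball_pos)
  \<comment> \<open>The covering uses \<open>(2 * n + 1)^2\<close> translates, and
    \<open>2 * n + 1\<close> is at most \<open>26 * \<rho> / r\<close>.\<close>
  define c where "c = v / (26 * \<rho>)\<^sup>2"
  have "c * r\<^sup>2 \<le> measure lebesgue {x \<in> ball x0 d. cmod (h x) \<le> r}" if r: "0 < r" "r < 2 * \<rho>" for r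
  proof -
    define S where "S = {x \<in> ball x0 d. cmod (h x) \<le> r}"
    have S: "S \<in> lmeasurable" unfolding S_def by (intro sublevel_lmeasurable open_ball lmeasurable_ball cont)
    define n where "n = \<lceil>8 * \<rho> / r\<rceil>"
    define y where "y = 2 * \<rho> / r"
    have y: "1 \<le> y" "8 * \<rho> / r = 4 * y" "26 * \<rho> / r = 13 * y" using r by (simp_all add: y_def)
    have n: "0 \<le> n" "of_int n \<le> 4 * y + 1" using y unfolding n_def by linarith+
    define I where "I = {- n..n} \<times> {- n..n}"
    define z where "z = (\<lambda>(j, k). Complex (r / 4 * of_int j) (r / 4 * of_int k))"
    define T where "T jk = (+) (- u (z jk)) ` S" for jk
    have T: "T jk \<in> lmeasurable" "measure lebesgue (T jk) = measure lebesgue S" for jk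
      unfolding T_def by (rule measurable_translation[OF S], rule measure_translation)
    have round: "\<exists>j. j \<in> {- n..n} \<and> \<bar>r / 4 * of_int j - y\<bar> \<le> r / 4" if y: "\<bar>y\<bar> \<le> 2 * \<rho>" for y
    proof -
      define t where "t = y / (r / 4)"
      have t: "\<bar>t\<bar> \<le> 8 * \<rho> / r" "y = r / 4 * t" using y r(1) by (simp_all add: t_def abs_divide field_simps)
      \<comment> \<open>Rounding towards 0 keeps the index within \<open>{- n..n}\<close>.\<close>
      define j where "j = (if 0 \<le> t then \<lfloor>t\<rfloor> else \<lceil>t\<rceil>)"
      have j: "\<bar>of_int j - t\<bar> \<le> 1" "\<bar>of_int j\<bar> \<le> \<bar>t\<bar>"
      proof (atomize (full), cases "0 \<le> t")
        case True
        then have "j = \<lfloor>t\<rfloor>" "0 \<le> \<lfloor>t\<rfloor>" by (simp_all add: j_def)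
        then show "\<bar>of_int j - t\<bar> \<le> 1 \<and> \<bar>of_int j\<bar> \<le> \<bar>t\<bar>" by linarith
      next
        case False
        then have "j = \<lceil>t\<rceil>" "\<lceil>t\<rceil> \<le> 0" by (simp_all add: j_def)
        then show "\<bar>of_int j - t\<bar> \<le> 1 \<and> \<bar>of_int j\<bar> \<le> \<bar>t\<bar>" using False by linarith
      qed
      then have "\<bar>real_of_int j\<bar> \<le> real_of_int n" using t(1) unfolding n_def by linarith
      then have "j \<in> {- n..n}" by (simp add: abs_le_iff)
      moreover have "r / 4 * of_int j - y = r / 4 * (of_int j - t)" unfolding t(2) by (simp add: algebra_simps)
      then have "\<bar>r / 4 * of_int j - y\<bar> = \<bar>r / 4\<bar> * \<bar>of_int j - t\<bar>" by (simp only: abs_mult)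
      then have "\<bar>r / 4 * of_int j - y\<bar> \<le> r / 4" using r(1) j(1) by simp
      ultimately show ?thesis by blast
    qed
    have cover: "ball x0 d' \<subseteq> (\<Union>jk\<in>I. T jk)"
    proof
      fix x assume x: "x \<in> ball x0 d'"
      obtain w where w: "cmod w \<le> 2 * \<rho>" "h (x + u w) = 0" using zero[OF x] by blast
      obtain j where j: "j \<in> {- n..n}" "\<bar>r / 4 * of_int j - Re w\<bar> \<le> r / 4"
        using round[of "Re w"] abs_Re_le_cmod[of w] w(1) by force
      obtain k where k: "k \<in> {- n..n}" "\<bar>r / 4 * of_int k - Im w\<bar> \<le> r / 4"
        using round[of "Im w"] abs_Im_le_cmod[of w] w(1) by force
      let ?z = "z (j, k)"
      \<comment> \<open>The rounding error \<open>r / 2\<close> changes the value of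
        \<open>h\<close> by at most 5/4 of it, which is below \<open>r\<close>.\<close>
      have zw: "cmod (?z - w) \<le> r / 2" using cmod_le[of "?z - w"] j(2) k(2) by (simp add: z_def)
      have "cmod ?z \<le> cmod w + cmod (?z - w)" by (rule norm_triangle_sub)
      then have z3: "cmod ?z \<le> 3 * \<rho>" using zw w(1) r by linarith
      have xw: "x + u w \<in> ball x0 d" by (rule in_ball[OF x]) (use w(1) \<rho>(1) in simp)
      have xz: "x + u ?z \<in> ball x0 d" by (rule in_ball[OF x z3])
      have e: "x + u w + u (?z - w) = x + u ?z" by (simp add: linear_diff[OF u])
      have "cmod (h (x + u ?z) - h (x + u w) - (?z - w)) \<le> cmod (?z - w) / 4"
        using near[OF xw, of "?z - w"] xz unfolding e by blast
      then have "cmod (h (x + u ?z)) \<le> cmod (?z - w) + cmod (?z - w) / 4"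
        using norm_triangle_sub[of "h (x + u ?z)" "?z - w"] by (simp add: w(2))
      then have "x + u ?z \<in> S" using zw xz r(1) by (simp add: S_def)
      then have "x \<in> T (j, k)" unfolding T_def by (intro image_eqI[of _ _ "x + u ?z"]) simp_all
      then show "x \<in> (\<Union>jk\<in>I. T jk)" using j(1) k(1) by (intro UN_I[of "(j, k)"]) (simp_all add: I_def)
    qed
    have "v \<le> measure lebesgue (\<Union>jk\<in>I. T jk)"
      unfolding v_def using T(1) by (intro measure_mono_fmeasurable[OF cover] fmeasurable.finite_UN) (auto simp: I_def)
    also have "\<dots> \<le> (\<Sum>jk\<in>I. measure lebesgue (T jk))"
      using T(1) by (intro measure_UNION_le) (auto simp: I_def)
    also have "\<dots> = real (card I) * measure lebesgue S" by (simp add: T(2))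
    also have "real (card I) = (2 * of_int n + 1)\<^sup>2"
      using n(1) by (simp add: I_def card_cartesian_product power2_eq_square)
    also have "(2 * real_of_int n + 1)\<^sup>2 * measure lebesgue S \<le> (26 * \<rho> / r)\<^sup>2 * measure lebesgue S"
    proof (intro mult_right_mono power_mono)
      show "2 * real_of_int n + 1 \<le> 26 * \<rho> / r" using n(2) y by linarith
      show "0 \<le> 2 * real_of_int n + 1" using n(1) by simp
    qed simp
    finally have "v \<le> (26 * \<rho> / r)\<^sup>2 * measure lebesgue S" .
    then show ?thesis using \<rho>(1) r(1) unfolding S_def[symmetric] c_def by (simp add: field_simps power_divide power_mult_distrib)
  qed
  moreover have "c > 0" "2 * \<rho> > 0" using v \<rho>(1) by (simp_all add: c_def)
  ultimately show ?thesis by blast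
qed

end

lemma near_submersionI:
  fixes h :: "'a::euclidean_space \<Rightarrow> complex"
  assumes h: "Cinf U h" "x0 \<in> U" "(h has_derivative L) (at x0)" and u: "linear u" "\<And>z. L (u z) = z"
  shows "\<exists>d M. ball x0 d \<subseteq> U \<and> near_submersion h u x0 d M"
proof -
  obtain M where M: "M > 0" "\<And>z. norm (u z) \<le> norm z * M"
    using bounded_linear.pos_bounded[of u] u(1) by (auto simp: linear_conv_bounded_linear)
  have "0 < inverse (4 * M)" using M by simp
  then obtain d where d: "0 < d" "ball x0 d \<subseteq> U" "\<And>x y. x \<in> ball x0 d \<Longrightarrow> y \<in> ball x0 d \<Longrightarrow>
      norm (h x - h y - L (x - y)) \<le> inverse (4 * M) * norm (x - y)"
    using Cinf_strict[OF h] by blast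
  have "near_submersion h u x0 d M"
  proof (rule near_submersion.intro)
    show "norm (u z) \<le> M * cmod z" for z using M(2)[of z] by (simp add: mult.commute)
    show "continuous_on (ball x0 d) h" using continuous_on_subset[OF Cinf_continuous_on[OF h(1)] d(2)] .
    fix x z assume "x \<in> ball x0 d" "x + u z \<in> ball x0 d"
    from d(3)[OF this(2,1)] have "cmod (h (x + u z) - h x - z) \<le> inverse (4 * M) * norm (u z)" by (simp add: u(2))
    also have "\<dots> \<le> inverse (4 * M) * (norm z * M)" using M by (intro mult_left_mono) auto
    also have "\<dots> = cmod z / 4" using M(1) by simp
    finally show "cmod (h (x + u z) - h x - z) \<le> cmod z / 4" .
  qed (use d M u in auto)
  then show ?thesis using d(2) by blast
qed

text \<open>Local bounds and compactness. Near a zero the bound comes from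
  \<open>near_submersion\<close>; near any other point small sublevel sets are empty, and for large
  \<open>r\<close> the measure of the ball suffices.\<close>

lemma sublevel_measure_compact:
  fixes h :: "'a::euclidean_space \<Rightarrow> complex"
  assumes h: "Cinf U h" and K: "compact K" "K \<subseteq> U"
    and sub: "\<And>x. x \<in> U \<Longrightarrow> h x = 0 \<Longrightarrow> \<exists>L u. (h has_derivative L) (at x) \<and> linear u \<and> (\<forall>z. L (u z) = z)"
  shows "\<exists>C. \<forall>r>0. measure lebesgue {x \<in> K. cmod (h x) \<le> r} \<le> C * r\<^sup>2"
proof -
  have loc: "\<exists>d C. 0 < d \<and> ball x d \<subseteq> U \<and> (\<forall>r>0. measure lebesgue {y \<in> ball x d. cmod (h y) \<le> r} \<le> C * r\<^sup>2)"
    if x: "x \<in> U" for x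
  proof (cases "h x = 0")
    case True
    then obtain L u where L: "(h has_derivative L) (at x)" "linear u" "\<And>z. L (u z) = z" using sub[OF x] by blast
    obtain d M where d: "ball x d \<subseteq> U" "near_submersion h u x d M" using near_submersionI[OF h x L] by blast
    have d0: "0 < d" by (rule near_submersion.d[OF d(2)])
    obtain C where C: "\<forall>r>0. measure lebesgue {y \<in> ball x (d / 2). cmod (h y) \<le> r} \<le> C * r\<^sup>2"
      using near_submersion.sublevel_measure_upper[OF d(2)] by blast
    have "ball x (d / 2) \<subseteq> ball x d" using d0 by auto
    then show ?thesis using C d(1) d0 by (intro exI[of _ "d / 2"] exI[of _ C]) auto
  next
    case False
    define m where "m = cmod (h x) / 2"
    have m: "m > 0" using False by (simp add: m_def)
    have "isCont h x" using Cinf_continuous_on[OF h] Cinf_open[OF h] x by (simp add: continuous_on_eq_continuous_at)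
    then obtain d1 where d1: "d1 > 0" "\<And>y. dist y x < d1 \<Longrightarrow> dist (h y) (h x) < m"
      using m unfolding continuous_at_eps_delta by blast
    obtain d2 where d2: "d2 > 0" "ball x d2 \<subseteq> U" using Cinf_open[OF h] x openE by blast
    define d where "d = min d1 d2"
    define v where "v = measure lebesgue (ball x d)"
    have "measure lebesgue {y \<in> ball x d. cmod (h y) \<le> r} \<le> v / m\<^sup>2 * r\<^sup>2" if r: "r > 0" for r
    proof (cases "r < m")
      case True
      have "cmod (h y) > r" if "y \<in> ball x d" for y
      proof -
        have "dist (h y) (h x) < m" using d1(2)[of y] that by (simp add: d_def dist_commute)
        then show ?thesis using norm_triangle_sub[of "h x" "h y"] True by (simp add: dist_norm norm_minus_commute m_def)
      qed
      then have e: "{y \<in> ball x d. cmod (h y) \<le> r} = {}" by fastforce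
      have "0 \<le> v / m\<^sup>2 * r\<^sup>2" by (simp add: v_def)
      then show ?thesis unfolding e by simp
    next
      case False
      have bU: "ball x d \<subseteq> U" using d2 by (auto simp: d_def)
      have "{y \<in> ball x d. cmod (h y) \<le> r} \<in> lmeasurable"
        by (intro sublevel_lmeasurable open_ball lmeasurable_ball continuous_on_subset[OF Cinf_continuous_on[OF h] bU])
      then have "measure lebesgue {y \<in> ball x d. cmod (h y) \<le> r} \<le> v"
        unfolding v_def by (intro measure_mono_fmeasurable lmeasurable_ball) (auto simp: fmeasurable_def)
      also have "v * 1 \<le> v * (r / m)\<^sup>2"
        using False m by (intro mult_left_mono one_le_power) (auto simp: v_def)
      then have "v \<le> v / m\<^sup>2 * r\<^sup>2" by (simp add: power_divide)
      finally show ?thesis .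
    qed
    moreover have "0 < d" "ball x d \<subseteq> U" using d1(1) d2 by (auto simp: d_def)
    ultimately show ?thesis by (intro exI[of _ d] exI[of _ "v / m\<^sup>2"] conjI allI impI)
  qed
  have "\<forall>x\<in>U. \<exists>dC. 0 < fst dC \<and> ball x (fst dC) \<subseteq> U \<and>
      (\<forall>r>0. measure lebesgue {y \<in> ball x (fst dC). cmod (h y) \<le> r} \<le> snd dC * r\<^sup>2)"
  proof
    fix x assume "x \<in> U"
    then obtain d C where "0 < d" "ball x d \<subseteq> U" "\<forall>r>0. measure lebesgue {y \<in> ball x d. cmod (h y) \<le> r} \<le> C * r\<^sup>2"
      using loc by blast
    then show "\<exists>dC. 0 < fst dC \<and> ball x (fst dC) \<subseteq> U \<and>
      (\<forall>r>0. measure lebesgue {y \<in> ball x (fst dC). cmod (h y) \<le> r} \<le> snd dC * r\<^sup>2)"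
      by (intro exI[of _ "(d, C)"]) simp
  qed
  from bchoice[OF this] obtain D where D: "\<forall>x\<in>U. 0 < fst (D x) \<and> ball x (fst (D x)) \<subseteq> U \<and>
      (\<forall>r>0. measure lebesgue {y \<in> ball x (fst (D x)). cmod (h y) \<le> r} \<le> snd (D x) * r\<^sup>2)" by (elim exE)
  define d where "d x = fst (D x)" for x
  define C where "C x = snd (D x)" for x
  have dC: "0 < d x" "ball x (d x) \<subseteq> U" "\<And>r. r > 0 \<Longrightarrow> measure lebesgue {y \<in> ball x (d x). cmod (h y) \<le> r} \<le> C x * r\<^sup>2"
    if "x \<in> U" for x
    using D that by (simp_all add: d_def C_def)
  have "K \<subseteq> (\<Union>x\<in>K. ball x (d x))" 
  proof
    fix x assume "x \<in> K"
    then show "x \<in> (\<Union>x\<in>K. ball x (d x))" using dC(1)[of x] K(2) by (intro UN_I[of x]) auto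
  qed
  then obtain F where F: "F \<subseteq> K" "finite F" "K \<subseteq> (\<Union>x\<in>F. ball x (d x))"
    using compactE_image[OF K(1), of K "\<lambda>x. ball x (d x)"] by blast
  have FU: "x \<in> U" if "x \<in> F" for x using that F(1) K(2) by blast
  have "measure lebesgue {x \<in> K. cmod (h x) \<le> r} \<le> (\<Sum>x\<in>F. C x) * r\<^sup>2" if r: "r > 0" for r
  proof -
    let ?S = "\<lambda>x. {y \<in> ball x (d x). cmod (h y) \<le> r}"
    have S: "?S x \<in> lmeasurable" if "x \<in> F" for x
      by (intro sublevel_lmeasurable open_ball lmeasurable_ball
          continuous_on_subset[OF Cinf_continuous_on[OF h] dC(2)[OF FU[OF that]]])
    have "closed (K \<inter> h -` cball 0 r)"
      using K continuous_on_subset[OF Cinf_continuous_on[OF h] K(2)] by (intro continuous_closed_preimage) (auto intro: compact_imp_closed)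
    then have m: "{x \<in> K. cmod (h x) \<le> r} \<in> sets lebesgue"
      using borel_closed[of "K \<inter> h -` cball 0 r"] by (auto simp: Int_def vimage_def)
    have "measure lebesgue {x \<in> K. cmod (h x) \<le> r} \<le> measure lebesgue (\<Union>x\<in>F. ?S x)"
    proof (rule measure_mono_fmeasurable[OF _ m])
      show "{x \<in> K. cmod (h x) \<le> r} \<subseteq> (\<Union>x\<in>F. ?S x)" using F(3) by blast
      show "(\<Union>x\<in>F. ?S x) \<in> lmeasurable" using F(2) S by (intro fmeasurable.finite_UN) auto
    qed
    also have "\<dots> \<le> (\<Sum>x\<in>F. measure lebesgue (?S x))" using F(2) S by (intro measure_UNION_le) auto
    also have "\<dots> \<le> (\<Sum>x\<in>F. C x * r\<^sup>2)" by (intro sum_mono dC(3) FU r)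
    finally show ?thesis by (simp add: sum_distrib_right)
  qed
  then show ?thesis by blast
qed

text \<open>Dyadic shells: where the modulus of \<open>h\<close> lies between
  \<open>(1 / 2)^(k + 1)\<close> and \<open>(1 / 2)^k\<close> the integrand is at most
  \<open>a^(k + 1)\<close> with \<open>a = 2 powr p\<close>, while the shell has measure at most
  \<open>C * (1 / 4)^k\<close>. The resulting series is geometric with ratio \<open>a / 4\<close>,
  and \<open>p < 2\<close> makes this less than 1.\<close>

lemma reciprocal_power_integrable:
  fixes h :: "'a::euclidean_space \<Rightarrow> complex"
  assumes K: "compact K" and cont: "continuous_on K h" and p: "0 < p" "p < 2"
    and C: "\<And>r. r > 0 \<Longrightarrow> measure lebesgue {x \<in> K. cmod (h x) \<le> r} \<le> C * r\<^sup>2"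
  shows "set_integrable lebesgue K (\<lambda>x. norm (inverse (h x)) powr p)"
  unfolding set_integrable_def
proof (rule integrableI_bounded)
  have Kb: "K \<in> sets borel" using K by (simp add: compact_imp_closed)
  have "(\<lambda>x. indicator K x *\<^sub>R h x) \<in> borel_measurable borel"
    by (rule borel_measurable_continuous_on_indicator[OF Kb cont])
  then have "(\<lambda>x. norm (inverse (indicator K x *\<^sub>R h x)) powr p) \<in> borel_measurable lborel" by simp
  moreover have "(\<lambda>x. norm (inverse (indicator K x *\<^sub>R h x)) powr p) = (\<lambda>x. indicator K x *\<^sub>R (norm (inverse (h x)) powr p))"
    by (auto simp: fun_eq_iff indicator_def)
  ultimately show "(\<lambda>x. indicator K x *\<^sub>R (norm (inverse (h x)) powr p)) \<in> borel_measurable lebesgue"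
    using measurable_completion by metis
  define E where "E k = {x \<in> K. cmod (h x) \<le> (1 / 2) ^ k}" for k :: nat
  have "closed (K \<inter> h -` cball 0 r)" for r
    using K cont by (intro continuous_closed_preimage) (auto intro: compact_imp_closed)
  then have "compact (E k)" for k
    using K compact_Int_closed[of K "K \<inter> h -` cball 0 ((1 / 2) ^ k)"] by (simp add: E_def Int_def vimage_def)
  then have E: "E k \<in> lmeasurable" for k by (rule lmeasurable_compact)
  define a where "a = (2::real) powr p"
  have a: "a > 0" "a < 4"
  proof -
    have "a < 2 powr 2" unfolding a_def using p by (intro powr_less_mono) auto
    then show "a > 0" "a < 4" by (simp_all add: a_def)
  qed
  have powr2: "(2 ^ n) powr p = a ^ n" for n
    by (simp add: a_def powr_realpow[symmetric] powr_powr mult.commute)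
  have bound: "ennreal (norm (indicator K x *\<^sub>R (norm (inverse (h x)) powr p))) \<le>
      indicator K x + (\<Sum>k. ennreal (a ^ Suc k) * indicator (E k) x)" for x
  proof (cases "x \<in> K \<and> h x \<noteq> 0")
    case False
    then show ?thesis by (auto simp: indicator_def)
  next
    case True
    then have x: "x \<in> K" "cmod (h x) > 0" by auto
    show ?thesis
    proof (cases "cmod (h x) \<le> 1")
      case False
      then have "norm (inverse (h x)) powr p \<le> 1"
        using p by (intro powr_le1) (auto simp: norm_inverse inverse_le_1_iff)
      then have "ennreal (norm (indicator K x *\<^sub>R (norm (inverse (h x)) powr p))) \<le> 1" using x by simp
      also have "\<dots> \<le> indicator K x + (\<Sum>k. ennreal (a ^ Suc k) * indicator (E k) x)" using x by simp
      finally show ?thesis .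
    next
      case True
      obtain n0 where "(1 / 2) ^ n0 < cmod (h x)" using real_arch_pow_inv[OF x(2), of "1 / 2"] by auto
      then obtain n where n: "(1 / 2) ^ n < cmod (h x)" "\<And>m. m < n \<Longrightarrow> \<not> (1 / 2) ^ m < cmod (h x)"
        using exists_least_iff[of "\<lambda>n. (1 / 2) ^ n < cmod (h x)"] by blast
      obtain k where k: "n = Suc k" using n(1) True by (cases n) auto
      have "x \<in> E k" using n(2)[of k] x k by (simp add: E_def)
      have "inverse (cmod (h x)) \<le> inverse ((1 / 2) ^ n)" using n(1) by (intro le_imp_inverse_le) auto
      then have "norm (inverse (h x)) \<le> 2 ^ n" unfolding norm_inverse by (simp add: power_one_over)
      then have "norm (inverse (h x)) powr p \<le> a ^ Suc k"
        using powr_mono2[of p "norm (inverse (h x))" "2 ^ n"] p powr2[of n] k by simp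
      then have "ennreal (norm (indicator K x *\<^sub>R (norm (inverse (h x)) powr p))) \<le> ennreal (a ^ Suc k) * indicator (E k) x"
        using x \<open>x \<in> E k\<close> by (simp add: ennreal_leI)
      also have "\<dots> \<le> (\<Sum>k. ennreal (a ^ Suc k) * indicator (E k) x)"
      proof -
        define f where "f k = ennreal (a ^ Suc k) * indicator (E k) x" for k
        have "sum f {k} \<le> suminf f" by (intro sum_le_suminf summableI) auto
        then have "f k \<le> suminf f" by simp
        then show ?thesis unfolding f_def .
      qed
      also have "\<dots> \<le> indicator K x + (\<Sum>k. ennreal (a ^ Suc k) * indicator (E k) x)" by simp
      finally show ?thesis .
    qed
  qed
  have C0: "0 \<le> C" using order_trans[OF measure_nonneg C[of 1]] by simp
  have Em: "ennreal (a ^ Suc k) * emeasure lebesgue (E k) \<le> ennreal (a * C * (a / 4) ^ k)" for k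
  proof -
    have "emeasure lebesgue (E k) = ennreal (measure lebesgue (E k))" by (rule emeasure_eq_measure2[OF E])
    also have "\<dots> \<le> ennreal (C * ((1 / 2) ^ k)\<^sup>2)" unfolding E_def by (intro ennreal_leI C) simp
    finally have "ennreal (a ^ Suc k) * emeasure lebesgue (E k) \<le> ennreal (a ^ Suc k) * ennreal (C * ((1 / 2) ^ k)\<^sup>2)"
      by (rule mult_left_mono) simp
    also have "\<dots> = ennreal (a ^ Suc k * (C * ((1 / 2) ^ k)\<^sup>2))" using a C0 by (simp add: ennreal_mult)
    also have "a ^ Suc k * (C * ((1 / 2) ^ k)\<^sup>2) = a * C * (a / 4) ^ k"
      by (simp add: power_divide power2_eq_square power_mult_distrib[symmetric])
    finally show ?thesis .
  qed
  have "(\<integral>\<^sup>+ x. ennreal (norm (indicator K x *\<^sub>R (norm (inverse (h x)) powr p))) \<partial>lebesgue) \<le>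
      (\<integral>\<^sup>+ x. indicator K x + (\<Sum>k. ennreal (a ^ Suc k) * indicator (E k) x) \<partial>lebesgue)"
    by (rule nn_integral_mono[OF bound])
  also have "\<dots> = emeasure lebesgue K + (\<Sum>k. ennreal (a ^ Suc k) * emeasure lebesgue (E k))"
  proof -
    have s: "E k \<in> sets lebesgue" "K \<in> sets lebesgue" for k
      using E[of k] lmeasurable_compact[OF K] by (auto intro: fmeasurableD)
    then have m: "(\<lambda>x. ennreal (a ^ Suc k) * indicator (E k) x) \<in> borel_measurable lebesgue" for k by measurable
    then have "(\<lambda>x. \<Sum>k. ennreal (a ^ Suc k) * indicator (E k) x) \<in> borel_measurable lebesgue" by measurable
    then show ?thesis
      using s by (subst nn_integral_add) (simp_all only: nn_integral_suminf[OF m] nn_integral_cmult_indicator[OF s(1)]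
          nn_integral_indicator[OF s(2)] borel_measurable_indicator)
  qed
  also have "\<dots> \<le> emeasure lebesgue K + (\<Sum>k. ennreal (a * C * (a / 4) ^ k))"
    by (intro add_left_mono suminf_le Em summableI)
  also have "(\<Sum>k. ennreal (a * C * (a / 4) ^ k)) = ennreal (\<Sum>k. a * C * (a / 4) ^ k)"
    using a C0 by (intro suminf_ennreal2 summable_mult summable_geometric) auto
  also have "emeasure lebesgue K + ennreal (\<Sum>k. a * C * (a / 4) ^ k) < \<infinity>"
    unfolding emeasure_eq_measure2[OF lmeasurable_compact[OF K]] by simp
  finally show "(\<integral>\<^sup>+ x. ennreal (norm (indicator K x *\<^sub>R (norm (inverse (h x)) powr p))) \<partial>lebesgue) < \<infinity>" .
qed

section \<open>Integration by parts\<close>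

lemma integrable_compact_support:
  fixes f :: "'a::euclidean_space \<Rightarrow> real"
  assumes K: "compact K" "continuous_on K f" "\<And>x. x \<notin> K \<Longrightarrow> f x = 0"
  shows "integrable lborel f"
proof -
  have "f = (\<lambda>x. indicator K x *\<^sub>R f x)" using K(3) by (auto simp: fun_eq_iff indicator_def)
  then show ?thesis using borel_integrable_compact[OF K(1,2)] by simp
qed

text \<open>The integrals of the difference quotients vanish by translation invariance, and
  dominated convergence passes to the derivative.\<close>

lemma integral_partial_zero:
  fixes h :: "'a::euclidean_space \<Rightarrow> real"
  assumes der: "\<And>x. (h has_derivative h' x) (at x)" and cont: "continuous_on UNIV (\<lambda>x. h' x b)"
    and K: "compact K" "\<And>x. x \<notin> K \<Longrightarrow> h x = 0"
  shows "integrable lborel (\<lambda>x. h' x b)" "(LINT x|lborel. h' x b) = 0"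
proof -
  have hc: "continuous_on X h" for X
    using der has_derivative_continuous by (blast intro: continuous_at_imp_continuous_on)
  have oK: "open (- K)" using K(1) by (simp add: compact_imp_closed open_Compl)
  have h'0: "h' x b = 0" if x: "x \<notin> K" for x
  proof -
    have "(h has_derivative (\<lambda>_. 0)) (at x)"
      by (rule has_derivative_transform_within_open[OF has_derivative_const[of 0] oK]) (use x K(2) in auto)
    then have "h' x = (\<lambda>_. 0)" by (rule has_derivative_unique[OF der])
    then show ?thesis by simp
  qed
  show i': "integrable lborel (\<lambda>x. h' x b)"
    by (rule integrable_compact_support[OF K(1) continuous_on_subset[OF cont] h'0]) auto
  have ih: "integrable lborel h" by (rule integrable_compact_support[OF K(1) hc K(2)])
  obtain M where M: "\<And>x. \<bar>h' x b\<bar> \<le> M" "0 < M"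
  proof -
    have "bounded ((\<lambda>x. h' x b) ` K)"
      by (intro compact_imp_bounded compact_continuous_image K(1) continuous_on_subset[OF cont]) auto
    then obtain B where B: "\<And>x. x \<in> K \<Longrightarrow> \<bar>h' x b\<bar> \<le> B" by (auto simp: bounded_iff)
    have "\<bar>h' x b\<bar> \<le> \<bar>B\<bar> + 1" for x using B[of x] h'0[of x] by (cases "x \<in> K") auto
    then show thesis by (rule that) simp
  qed
  define s where "s n x = real (Suc n) * (h (x + inverse (real (Suc n)) *\<^sub>R b) - h x)" for n x
  \<comment> \<open>A compact set outside which all difference quotients of step at most 1 vanish;
    its indicator gives the dominating function.\<close>
  define K' where "K' = (\<lambda>y. fst y - snd y *\<^sub>R b) ` (K \<times> {0..1::real})"
  have K': "compact K'"
    unfolding K'_def by (intro compact_continuous_image compact_Times K(1) compact_Icc continuous_intros)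
  have line: "((\<lambda>t. h (x + t *\<^sub>R b)) has_real_derivative h' (x + t *\<^sub>R b) b) (at t)" for x t
  proof -
    have "((\<lambda>t. h (x + t *\<^sub>R b)) has_derivative (\<lambda>r. h' (x + t *\<^sub>R b) (r *\<^sub>R b))) (at t)"
      by (rule has_derivative_compose[OF _ der]) (auto intro!: derivative_eq_intros)
    moreover have "h' (x + t *\<^sub>R b) (r *\<^sub>R b) = h' (x + t *\<^sub>R b) b * r" for r
      using linear_scale[OF has_derivative_linear[OF der]] by simp
    ultimately show ?thesis by (simp add: has_field_derivative_def)
  qed
  have small: "0 < inverse (real (Suc n))" "inverse (real (Suc n)) \<le> 1" for n by (simp_all add: field_simps)
  have bound: "norm (s n x) \<le> M * indicator K' x" for n x
  proof (cases "x \<in> K'")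
    case True
    let ?e = "inverse (real (Suc n))"
    obtain z where z: "h (x + ?e *\<^sub>R b) - h (x + 0 *\<^sub>R b) = (?e - 0) * h' (x + z *\<^sub>R b) b"
      using MVT2[OF small(1)[of n], of "\<lambda>t. h (x + t *\<^sub>R b)" "\<lambda>t. h' (x + t *\<^sub>R b) b"] line by blast
    have "s n x = h' (x + z *\<^sub>R b) b" using z unfolding s_def by (simp add: field_simps)
    then show ?thesis using M(1) True by simp
  next
    case False
    have "x + t *\<^sub>R b \<notin> K" if "0 \<le> t" "t \<le> 1" for t
    proof
      assume "x + t *\<^sub>R b \<in> K"
      then have "x \<in> K'" unfolding K'_def using that by (intro image_eqI[of _ _ "(x + t *\<^sub>R b, t)"]) auto
      then show False using False by simp
    qed
    from this[of 0] this[of "inverse (real (Suc n))"] have "s n x = 0"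
      unfolding s_def using K(2) small[of n] by simp
    then show ?thesis using M(2) by simp
  qed
  have lim: "(\<lambda>n. s n x) \<longlonglongrightarrow> h' x b" for x
  proof -
    have "((\<lambda>t. (h (x + t *\<^sub>R b) - h x) / t) \<longlongrightarrow> h' x b) (at 0)"
      using line[of x 0] by (simp add: DERIV_def)
    moreover have "filterlim (\<lambda>n. inverse (real (Suc n))) (at 0) sequentially"
      by (intro filterlim_atI LIMSEQ_inverse_real_of_nat) simp
    ultimately have "(\<lambda>n. (h (x + inverse (real (Suc n)) *\<^sub>R b) - h x) / inverse (real (Suc n))) \<longlonglongrightarrow> h' x b"
      by (rule filterlim_compose)
    then show ?thesis by (simp add: s_def divide_inverse mult.commute)
  qed
  have shift: "integrable lborel (\<lambda>x. h (c + x))" "(LINT x|lborel. h (c + x)) = (LINT x|lborel. h x)" for c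
  proof -
    have m: "(+) c \<in> lborel \<rightarrow>\<^sub>M borel" "h \<in> borel_measurable borel"
      using ih by simp_all
    show "integrable lborel (\<lambda>x. h (c + x))"
      using integrable_distr[OF m(1), of h] ih by (simp add: lborel_distr_plus)
    show "(LINT x|lborel. h (c + x)) = (LINT x|lborel. h x)"
      using integral_distr[OF m] by (simp add: lborel_distr_plus)
  qed
  have s0: "(LINT x|lborel. s n x) = 0" for n
  proof -
    define c where "c = inverse (real (Suc n)) *\<^sub>R b"
    have "(LINT x|lborel. s n x) = (LINT x|lborel. real (Suc n) * (h (c + x) - h x))"
      by (simp only: s_def c_def add.commute)
    also have "\<dots> = real (Suc n) * (LINT x|lborel. h (c + x) - h x)" by (rule integral_mult_right_zero)
    also have "(LINT x|lborel. h (c + x) - h x) = 0"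
      unfolding Bochner_Integration.integral_diff[OF shift(1) ih] shift(2) by simp
    finally show ?thesis by simp
  qed
  have "(\<lambda>n. LINT x|lborel. s n x) \<longlonglongrightarrow> (LINT x|lborel. h' x b)"
  proof (rule integral_dominated_convergence)
    show "integrable lborel (\<lambda>x. M * indicator K' x)"
      using K' emeasure_compact_finite[OF K'] by (intro integrable_mult_right integrable_real_indicator) (auto intro: borel_compact)
    show "s n \<in> borel_measurable lborel" for n
      unfolding s_def[abs_def] using shift(1)[of "inverse (real (Suc n)) *\<^sub>R b"] ih by (simp add: add.commute borel_measurable_integrable)
  qed (use i' lim bound in auto)
  then show "(LINT x|lborel. h' x b) = 0" by (simp add: s0 LIMSEQ_const_iff)
qed

lemma frechet_derivative_zero_outside:
  assumes "closed S" "x \<notin> S" "\<And>y. y \<notin> S \<Longrightarrow> f y = 0"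
  shows "frechet_derivative f (at x) = (\<lambda>_. 0)"
proof -
  have "(f has_derivative (\<lambda>_. 0)) (at x)"
    by (rule has_derivative_transform_within_open[OF has_derivative_const[of 0], of "- S"]) (use assms in auto)
  then show ?thesis by (rule frechet_derivative_at[symmetric])
qed

text \<open>\<open>D1 + D2\<close> is the divergence of the field \<open>k \<theta> X\<close>,
  extended by 0 outside \<open>U\<close>; its integral vanishes componentwise by
  \<open>integral_partial_zero\<close>.\<close>

lemma integral_transpose:
  fixes k :: "'d::euclidean_space \<Rightarrow> real" and X :: "'d \<Rightarrow> 'd" and \<theta> :: "'d \<Rightarrow> real"
  assumes k: "Cinf U k" and X: "Cinf U X" and \<theta>: "Cinf UNIV \<theta>"
    and S: "compact (closure {x. \<theta> x \<noteq> 0})" "closure {x. \<theta> x \<noteq> 0} \<subseteq> U"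
  defines "D1 \<equiv> \<lambda>x. indicator U x * (k x * divergence (\<lambda>y. \<theta> y *\<^sub>R X y) x)"
    and "D2 \<equiv> \<lambda>x. indicator U x * (\<theta> x * frechet_derivative k (at x) (X x))"
  shows "integrable lborel D1" "integrable lborel D2" "(LINT x|lborel. D1 x) = - (LINT x|lborel. D2 x)"
proof -
  have U: "open U" by (rule Cinf_open[OF k])
  define S where "S = closure {x. \<theta> x \<noteq> 0}"
  have SU: "S \<subseteq> U" "compact S" "closed S" using S by (simp_all add: S_def)
  have \<theta>0: "\<theta> x = 0" if "x \<notin> S" for x using that closure_subset[of "{x. \<theta> x \<noteq> 0}"] by (auto simp: S_def)
  have \<theta>U: "Cinf U \<theta>" by (rule Cinf_subset[OF \<theta> subset_UNIV U])
  define Y where "Y y = \<theta> y *\<^sub>R X y" for y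
  have YC: "Cinf U Y" unfolding Y_def[abs_def] by (rule Cinf_scaleR[OF \<theta>U X])
  have Y0: "frechet_derivative Y (at x) = (\<lambda>_. 0)" if "x \<notin> S" for x
    by (rule frechet_derivative_zero_outside[OF SU(3) that]) (simp add: Y_def \<theta>0)
  have kl: "frechet_derivative k (at x) v = (\<Sum>b\<in>Basis. (v \<bullet> b) * frechet_derivative k (at x) b)" if "x \<in> U" for x v
  proof -
    have l: "linear (frechet_derivative k (at x))" by (rule has_derivative_linear[OF Cinf_has_derivative[OF k that]])
    have "frechet_derivative k (at x) v = frechet_derivative k (at x) (\<Sum>b\<in>Basis. (v \<bullet> b) *\<^sub>R b)"
      by (simp only: euclidean_representation)
    then show ?thesis by (simp add: linear_sum[OF l] linear_scale[OF l])
  qed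
  have int: "integrable lborel (\<lambda>x. indicator U x * \<phi> x)" if "continuous_on U \<phi>" "\<And>x. x \<in> U \<Longrightarrow> x \<notin> S \<Longrightarrow> \<phi> x = 0" for \<phi> :: "'d \<Rightarrow> real"
  proof (rule integrable_compact_support[OF SU(2)])
    show "continuous_on S (\<lambda>x. indicator U x * \<phi> x)"
      using continuous_on_subset[OF that(1) SU(1)]
      by (rule continuous_on_eq) (use SU(1) in \<open>auto simp: indicator_def\<close>)
    show "indicator U x * \<phi> x = 0" if "x \<notin> S" for x using \<open>\<And>x. x \<in> U \<Longrightarrow> x \<notin> S \<Longrightarrow> \<phi> x = 0\<close>[of x] that by (auto simp: indicator_def)
  qed
  have D1: "D1 = (\<lambda>x. indicator U x * (k x * divergence Y x))" by (simp add: D1_def Y_def[abs_def])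
  show i1: "integrable lborel D1"
    unfolding D1
  proof (rule int)
    have "continuous_on U (\<lambda>x. frechet_derivative Y (at x) b)" for b
      by (rule Cinf_continuous_on[OF Cinf_frechet[OF YC]])
    then show "continuous_on U (\<lambda>x. k x * divergence Y x)"
      unfolding divergence_def by (intro continuous_intros Cinf_continuous_on[OF k])
    show "k x * divergence Y x = 0" if "x \<notin> S" for x by (simp add: divergence_def Y0[OF that])
  qed
  show i2: "integrable lborel D2"
    unfolding D2_def
  proof (rule int)
    have "continuous_on U (\<lambda>x. frechet_derivative k (at x) b)" for b
      by (rule Cinf_continuous_on[OF Cinf_frechet[OF k]])
    then have "continuous_on U (\<lambda>x. \<theta> x * (\<Sum>b\<in>Basis. (X x \<bullet> b) * frechet_derivative k (at x) b))"
      by (intro continuous_intros Cinf_continuous_on[OF X] Cinf_continuous_on[OF \<theta>U])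
    then show "continuous_on U (\<lambda>x. \<theta> x * frechet_derivative k (at x) (X x))"
      by (rule continuous_on_eq) (simp add: kl)
  qed (simp add: \<theta>0)
  \<comment> \<open>Smooth everywhere: the open sets \<open>U\<close> and the complement of the
    support cover the space, and \<open>h b\<close> is 0 on the second.\<close>
  define h where "h b y = (if y \<in> U then k y * (Y y \<bullet> b) else 0)" for b y
  have hU: "Cinf U (\<lambda>y. k y * (Y y \<bullet> b))" for b by (intro Cinf_mult Cinf_inner Cinf_const k YC U)
  have hC1: "Cinf U (h b)" for b by (rule Cinf_cong[OF hU[of b]]) (simp add: h_def)
  have hC2: "Cinf (- S) (h b)" for b
    by (rule Cinf_cong[OF Cinf_const[of "- S" 0]]) (use SU(3) in \<open>auto simp: h_def Y_def \<theta>0\<close>)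
  have un: "U \<union> - S = UNIV" using SU(1) by auto
  have hd: "(h b has_derivative frechet_derivative (h b) (at x)) (at x)" for b x
    using Cinf_has_derivative[OF hC1, of x b] Cinf_has_derivative[OF hC2, of x b] un by blast
  have hc: "continuous_on UNIV (\<lambda>x. frechet_derivative (h b) (at x) b)" for b
  proof -
    have "continuous_on (U \<union> - S) (\<lambda>x. frechet_derivative (h b) (at x) b)"
      by (intro continuous_on_open_Un U open_Compl SU(3) Cinf_continuous_on Cinf_frechet hC1 hC2)
    then show ?thesis by (simp only: un)
  qed
  have h0: "h b x = 0" if "x \<notin> S" for b x using that by (simp add: h_def Y_def \<theta>0)
  note z = integral_partial_zero[OF hd hc SU(2) h0]
  have sum: "D1 x + D2 x = (\<Sum>b\<in>Basis. frechet_derivative (h b) (at x) b)" for x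
  proof (cases "x \<in> U")
    case True
    have d: "frechet_derivative (h b) (at x) b = k x * (frechet_derivative Y (at x) b \<bullet> b) + frechet_derivative k (at x) b * (Y x \<bullet> b)" for b
    proof -
      have "((\<lambda>y. k y * (Y y \<bullet> b)) has_derivative
          (\<lambda>v. k x * (frechet_derivative Y (at x) v \<bullet> b) + frechet_derivative k (at x) v * (Y x \<bullet> b))) (at x)"
        by (intro has_derivative_mult has_derivative_inner_left Cinf_has_derivative[OF k True] Cinf_has_derivative[OF YC True])
      then have "(h b has_derivative (\<lambda>v. k x * (frechet_derivative Y (at x) v \<bullet> b) + frechet_derivative k (at x) v * (Y x \<bullet> b))) (at x)"
        by (rule has_derivative_transform_within_open[OF _ U True]) (simp add: h_def)
      from frechet_derivative_at[OF this, symmetric] show ?thesis by simp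
    qed
    have "D2 x = (\<Sum>b\<in>Basis. frechet_derivative k (at x) b * (Y x \<bullet> b))"
      using True by (simp add: D2_def kl Y_def sum_distrib_left mult_ac)
    then show ?thesis using True by (simp add: d D1 divergence_def sum.distrib sum_distrib_left)
  next
    case False
    then have "x \<notin> S" using SU(1) by auto
    from frechet_derivative_zero_outside[OF SU(3) this h0] have "frechet_derivative (h b) (at x) = (\<lambda>_. 0)" for b by auto
    then show ?thesis using False by (simp add: D1_def D2_def)
  qed
  have "(LINT x|lborel. D1 x) + (LINT x|lborel. D2 x) = (LINT x|lborel. D1 x + D2 x)"
    using i1 i2 by simp
  also have "\<dots> = (\<Sum>b\<in>Basis. LINT x|lborel. frechet_derivative (h b) (at x) b)"
    unfolding sum by (intro Bochner_Integration.integral_sum z(1))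
  also have "\<dots> = 0" by (simp add: z(2))
  finally show "(LINT x|lborel. D1 x) = - (LINT x|lborel. D2 x)" by simp
qed

text \<open>Four instances of the real formula, for the real and the imaginary part of
  \<open>g\<close> and the fields \<open>A\<close> and \<open>B\<close>.\<close>

lemma integral_transpose_complex:
  fixes g :: "'d::euclidean_space \<Rightarrow> complex" and A B :: "'d \<Rightarrow> 'd" and \<theta> :: "'d \<Rightarrow> real"
  assumes g: "Cinf U g" and A: "Cinf U A" and B: "Cinf U B" and \<theta>: "Cinf UNIV \<theta>"
    and S: "compact (closure {x. \<theta> x \<noteq> 0})" "closure {x. \<theta> x \<noteq> 0} \<subseteq> U"
  shows "(LINT x:U|lebesgue. g x * Complex (divergence (\<lambda>y. \<theta> y *\<^sub>R A y) x) (divergence (\<lambda>y. \<theta> y *\<^sub>R B y) x)) =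
     - (LINT x|lborel. indicator U x *\<^sub>R \<theta> x *\<^sub>R (frechet_derivative g (at x) (A x) + \<i> * frechet_derivative g (at x) (B x)))"
proof -
  have R: "Cinf U (\<lambda>x. Re (g x))" and I: "Cinf U (\<lambda>x. Im (g x))" using g by (rule Cinf_Re, rule Cinf_Im)
  let ?D1 = "\<lambda>k X x. indicator U x * (k x * divergence (\<lambda>y. \<theta> y *\<^sub>R X y) x)"
  let ?D2 = "\<lambda>k X x. indicator U x * (\<theta> x * frechet_derivative k (at x) (X x))"
  note RA = integral_transpose[OF R A \<theta> S] and RB = integral_transpose[OF R B \<theta> S]
    and IA = integral_transpose[OF I A \<theta> S] and IB = integral_transpose[OF I B \<theta> S]
  have split: "(LINT x|lborel. complex_of_real (a x) + \<i> * complex_of_real (b x)) =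
      complex_of_real (LINT x|lborel. a x) + \<i> * complex_of_real (LINT x|lborel. b x)"
      "integrable lborel (\<lambda>x. complex_of_real (a x) + \<i> * complex_of_real (b x))"
    if "integrable lborel a" "integrable lborel b" for a b :: "'d \<Rightarrow> real"
  proof -
    have bl: "bounded_linear complex_of_real" "bounded_linear (\<lambda>x. \<i> * complex_of_real x)"
      by (auto intro: bounded_linear_of_real bounded_linear_mult_right[THEN bounded_linear_compose])
    note i = integrable_bounded_linear[OF bl(1) that(1)] integrable_bounded_linear[OF bl(2) that(2)]
    show "integrable lborel (\<lambda>x. complex_of_real (a x) + \<i> * complex_of_real (b x))" using i by (rule Bochner_Integration.integrable_add)
    show "(LINT x|lborel. complex_of_real (a x) + \<i> * complex_of_real (b x)) =
      complex_of_real (LINT x|lborel. a x) + \<i> * complex_of_real (LINT x|lborel. b x)"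
      unfolding Bochner_Integration.integral_add[OF i] integral_bounded_linear[OF bl(1) that(1)]
        integral_bounded_linear[OF bl(2) that(2)] ..
  qed
  have e1: "indicator U x *\<^sub>R (g x * Complex (divergence (\<lambda>y. \<theta> y *\<^sub>R A y) x) (divergence (\<lambda>y. \<theta> y *\<^sub>R B y) x)) =
      complex_of_real (?D1 (\<lambda>x. Re (g x)) A x - ?D1 (\<lambda>x. Im (g x)) B x) +
      \<i> * complex_of_real (?D1 (\<lambda>x. Re (g x)) B x + ?D1 (\<lambda>x. Im (g x)) A x)" for x
    by (simp add: complex_eq_iff algebra_simps)
  have e2: "indicator U x *\<^sub>R \<theta> x *\<^sub>R (frechet_derivative g (at x) (A x) + \<i> * frechet_derivative g (at x) (B x)) =
      complex_of_real (?D2 (\<lambda>x. Re (g x)) A x - ?D2 (\<lambda>x. Im (g x)) B x) +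
      \<i> * complex_of_real (?D2 (\<lambda>x. Re (g x)) B x + ?D2 (\<lambda>x. Im (g x)) A x)" for x
  proof (cases "x \<in> U")
    case True
    have "((\<lambda>x. Re (g x)) has_derivative (\<lambda>v. Re (frechet_derivative g (at x) v))) (at x)"
      "((\<lambda>x. Im (g x)) has_derivative (\<lambda>v. Im (frechet_derivative g (at x) v))) (at x)"
      using Cinf_has_derivative[OF g True] by (auto intro: has_derivative_Re has_derivative_Im)
    then have "frechet_derivative (\<lambda>x. Re (g x)) (at x) = (\<lambda>v. Re (frechet_derivative g (at x) v))"
      "frechet_derivative (\<lambda>x. Im (g x)) (at x) = (\<lambda>v. Im (frechet_derivative g (at x) v))"
      by (auto dest: frechet_derivative_at)
    then show ?thesis by (simp add: complex_eq_iff algebra_simps)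
  qed simp
  have "(LINT x:U|lebesgue. g x * Complex (divergence (\<lambda>y. \<theta> y *\<^sub>R A y) x) (divergence (\<lambda>y. \<theta> y *\<^sub>R B y) x)) =
      (LINT x|lborel. complex_of_real (?D1 (\<lambda>x. Re (g x)) A x - ?D1 (\<lambda>x. Im (g x)) B x) +
      \<i> * complex_of_real (?D1 (\<lambda>x. Re (g x)) B x + ?D1 (\<lambda>x. Im (g x)) A x))"
    unfolding set_lebesgue_integral_def e1
    by (intro integral_completion borel_measurable_integrable split(2) Bochner_Integration.integrable_diff
        Bochner_Integration.integrable_add RA(1) RB(1) IA(1) IB(1))
  also have "\<dots> = - (LINT x|lborel. complex_of_real (?D2 (\<lambda>x. Re (g x)) A x - ?D2 (\<lambda>x. Im (g x)) B x) +
      \<i> * complex_of_real (?D2 (\<lambda>x. Re (g x)) B x + ?D2 (\<lambda>x. Im (g x)) A x))"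
    unfolding split(1)[OF Bochner_Integration.integrable_diff[OF RA(1) IB(1)] Bochner_Integration.integrable_add[OF RB(1) IA(1)]]
      split(1)[OF Bochner_Integration.integrable_diff[OF RA(2) IB(2)] Bochner_Integration.integrable_add[OF RB(2) IA(2)]]
      Bochner_Integration.integral_diff[OF RA(1) IB(1)] Bochner_Integration.integral_diff[OF RA(2) IB(2)]
      Bochner_Integration.integral_add[OF RB(1) IA(1)] Bochner_Integration.integral_add[OF RB(2) IA(2)]
      RA(3) RB(3) IA(3) IB(3)
    by (simp add: algebra_simps)
  finally show ?thesis unfolding e2 .
qed

section \<open>The reciprocal of the third coordinate\<close>

lemma local_parametrizationD:
  assumes "local_parametrization S U \<psi>"
  shows "Cinf U \<psi>" "\<psi> ` U \<subseteq> S"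
  using assms smooth_on_open_iff[of U \<psi>]
  by (auto simp: local_parametrization_def diffeomorphism_def dest: openin_imp_subset)

text \<open>A curve representing \<open>v\<close> stays in the image of \<open>\<psi>\<close> for
  small times, since the image is open in \<open>S\<close>. A local smooth extension
  \<open>G\<close> of the inverse pulls it back, and the velocity of the pulled back curve is the
  required preimage.\<close>

lemma local_parametrization_tangent:
  assumes lp: "local_parametrization S U \<psi>" and x: "x \<in> U" and v: "v \<in> tangent_space S (\<psi> x)"
  shows "\<exists>w. frechet_derivative \<psi> (at x) w = v"
proof -
  note C = local_parametrizationD[OF lp]
  obtain g where g: "diffeomorphism U (\<psi> ` U) \<psi> g" and op: "openin (top_of_set S) (\<psi> ` U)"
    using lp unfolding local_parametrization_def by blast
  obtain O1 where O1: "open O1" "\<psi> ` U = S \<inter> O1" using op by (auto simp: openin_open)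
  have "smooth_on (\<psi> ` U) g" using g by (simp add: diffeomorphism_def)
  then obtain O2 G where G: "open O2" "\<psi> x \<in> O2" "\<forall>k. Ck_on k O2 G" "\<forall>y\<in>\<psi> ` U \<inter> O2. G y = g y"
    using x unfolding smooth_on_def by blast
  have inv: "g (\<psi> y) = y" "\<psi> (g z) = z" "g z \<in> U" if "y \<in> U" "z \<in> \<psi> ` U" for y z
    using g that unfolding diffeomorphism_def homeomorphism_def by blast+
  have GC: "Cinf O2 G" using G(1,3) by (simp add: Cinf_def)
  obtain \<gamma> e where \<gamma>: "0 < e" "\<gamma> ` {-e<..<e} \<subseteq> S" "\<gamma> 0 = \<psi> x" "(\<gamma> has_vector_derivative v) (at (0::real))"
    using v unfolding tangent_space_def by blast
  have op12: "open (O1 \<inter> O2)" "\<gamma> 0 \<in> O1 \<inter> O2" using O1 G(1,2) x \<gamma>(3) by auto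
  have "isCont \<gamma> 0" using \<gamma>(4) has_vector_derivative_continuous by blast
  then have "\<forall>\<^sub>F t in nhds 0. \<gamma> t \<in> O1 \<inter> O2"
    unfolding isCont_def tendsto_def using op12 by (auto simp: eventually_at_filter elim: eventually_mono)
  then obtain T where T: "open T" "0 \<in> T" "\<And>t. t \<in> T \<Longrightarrow> \<gamma> t \<in> O1 \<inter> O2" unfolding eventually_nhds by blast
  have G0: "G (\<gamma> 0) = x" using G(2,4) x inv(1)[of x "\<psi> x"] \<gamma>(3) by auto
  define w where "w = frechet_derivative G (at (\<psi> x)) v"
  have "((\<lambda>t. G (\<gamma> t)) has_derivative (\<lambda>h. frechet_derivative G (at (\<gamma> 0)) (h *\<^sub>R v))) (at 0)"
    by (rule has_derivative_compose[OF \<gamma>(4)[unfolded has_vector_derivative_def] Cinf_has_derivative[OF GC]]) (simp add: \<gamma>(3) G(2))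
  from has_derivative_compose[OF this, of \<psi> "frechet_derivative \<psi> (at x)"]
  have "((\<lambda>t. \<psi> (G (\<gamma> t))) has_derivative (\<lambda>h. frechet_derivative \<psi> (at x) (frechet_derivative G (at (\<gamma> 0)) (h *\<^sub>R v)))) (at 0)"
    using Cinf_has_derivative[OF C(1) x] by (simp add: G0)
  then have "(\<gamma> has_derivative (\<lambda>h. frechet_derivative \<psi> (at x) (frechet_derivative G (at (\<gamma> 0)) (h *\<^sub>R v)))) (at 0)"
  proof (rule has_derivative_transform_within_open)
    show "open (T \<inter> {-e<..<e})" "0 \<in> T \<inter> {-e<..<e}" using T \<gamma>(1) by auto
    fix t assume "t \<in> T \<inter> {-e<..<e}"
    then have "\<gamma> t \<in> \<psi> ` U \<inter> O2" using T(3) \<gamma>(2) O1(2) by blast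
    then show "\<psi> (G (\<gamma> t)) = \<gamma> t" using G(4) inv(2)[OF x] by auto
  qed
  from has_derivative_unique[OF this \<gamma>(4)[unfolded has_vector_derivative_def]]
  have "frechet_derivative \<psi> (at x) (frechet_derivative G (at (\<gamma> 0)) (1 *\<^sub>R v)) = 1 *\<^sub>R v" by (rule fun_cong)
  then show ?thesis by auto
qed

text \<open>The vertical vector moves the third coordinate in the real direction and
  \<open>(\<i> / cc p) *s zt p\<close> in the imaginary one; this is where \<open>cc\<close> being
  nonzero on the torus enters.\<close>

lemma submersive_MM:
  fixes \<psi> :: "'d::euclidean_space \<Rightarrow> complex ^ 3"
  assumes lp: "local_parametrization MM U \<psi>" and x: "x \<in> U" "\<psi> x $ 3 = 0"
  shows "\<exists>L u. ((\<lambda>x. \<psi> x $ 3) has_derivative L) (at x) \<and> linear u \<and> (\<forall>z. L (u z) = z)"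
proof -
  note C = local_parametrizationD[OF lp]
  define p where "p = \<psi> x"
  have p: "p \<in> MM" "p \<in> CC" using C(2) x by (auto simp: p_def CC_eq)
  let ?D = "frechet_derivative \<psi> (at x)"
  have D: "(\<psi> has_derivative ?D) (at x)" by (rule Cinf_has_derivative[OF C(1) x(1)])
  have "vec3 0 0 1 \<in> tangent_space MM p" by (simp add: tangent_MM[OF p(1)] dqf_def dxi_def dmu_def)
  then obtain w1 where w1: "?D w1 = vec3 0 0 1" using local_parametrization_tangent[OF lp x(1)] unfolding p_def by blast
  have "(\<i> / cc p) *s zt p \<in> tangent_space MM p" by (rule zt_tangent[OF p(1)])
  then obtain w2 where w2: "?D w2 = (\<i> / cc p) *s zt p" using local_parametrization_tangent[OF lp x(1)] unfolding p_def by blast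
  have l: "linear ?D" by (rule has_derivative_linear[OF D])
  show ?thesis
  proof (rule exI, rule exI[of _ "\<lambda>z. Re z *\<^sub>R w1 + Im z *\<^sub>R w2"], intro conjI allI)
    show "((\<lambda>x. \<psi> x $ 3) has_derivative (\<lambda>v. ?D v $ 3)) (at x)" by (rule has_derivative_vec_nth[OF D])
    show "linear (\<lambda>z. Re z *\<^sub>R w1 + Im z *\<^sub>R w2)" by (rule linearI) (simp_all add: algebra_simps)
    show "?D (Re z *\<^sub>R w1 + Im z *\<^sub>R w2) $ 3 = z" for z
      using cc_nonzero[OF p(2)]
      by (simp add: linear_add[OF l] linear_scale[OF l] w1 w2 zt_nth complex_eq_iff)
  qed
qed

text \<open>The submersion property is assumed for all parametrizations of \<open>S\<close>, so that
  the statement covers both \<open>MM\<close> and \<open>MM - CC\<close>; for the latter it holds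
  vacuously.\<close>

lemma Lp_loc_reciprocal:
  fixes S :: "(complex ^ 3) set" and T :: "'d::euclidean_space itself"
  assumes sub: "\<And>U (\<psi> :: 'd \<Rightarrow> complex ^ 3) x. local_parametrization S U \<psi> \<Longrightarrow> x \<in> U \<Longrightarrow> \<psi> x $ 3 = 0 \<Longrightarrow>
      \<exists>L u. ((\<lambda>x. \<psi> x $ 3) has_derivative L) (at x) \<and> linear u \<and> (\<forall>z. L (u z) = z)"
    and p: "1 \<le> p" "p < (2 :: ereal)"
  shows "Lp_loc T p S (\<lambda>z. inverse (z $ 3))"
  unfolding Lp_loc_def
proof (intro allI impI conjI)
  fix U and \<psi> :: "'d \<Rightarrow> complex ^ 3" assume lp: "local_parametrization S U \<psi>"
  note C = local_parametrizationD[OF lp]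
  have hC: "Cinf U (\<lambda>x. \<psi> x $ 3)" by (rule Cinf_vec_nth[OF C(1)])
  have "(\<lambda>x. indicator U x *\<^sub>R (\<psi> x $ 3)) \<in> borel_measurable borel"
    using Cinf_open[OF C(1)] by (intro borel_measurable_continuous_on_indicator Cinf_continuous_on[OF hC]) auto
  then have "(\<lambda>x. inverse (indicator U x *\<^sub>R (\<psi> x $ 3))) \<in> borel_measurable lborel" by simp
  moreover have "(\<lambda>x. inverse (indicator U x *\<^sub>R (\<psi> x $ 3))) = (\<lambda>x. indicator U x *\<^sub>R ((\<lambda>z. inverse (z $ 3)) \<circ> \<psi>) x)"
    by (auto simp: fun_eq_iff indicator_def)
  ultimately show "set_borel_measurable lebesgue U ((\<lambda>z. inverse (z $ 3)) \<circ> \<psi>)"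
    unfolding set_borel_measurable_def using measurable_completion by metis
  fix K assume K: "compact K \<and> K \<subseteq> U"
  obtain r where r: "p = ereal r" "1 \<le> r" "r < 2" using p by (cases p) auto
  obtain c where "\<forall>r>0. measure lebesgue {x \<in> K. cmod (\<psi> x $ 3) \<le> r} \<le> c * r\<^sup>2"
    using sublevel_measure_compact[OF hC _ _ sub[OF lp]] K by blast
  then have "set_integrable lebesgue K (\<lambda>x. norm (inverse (\<psi> x $ 3)) powr r)"
    using K r by (intro reciprocal_power_integrable continuous_on_subset[OF Cinf_continuous_on[OF hC]]) auto
  then show "if p = \<infinity> then \<exists>B. AE x in lebesgue. x \<in> K \<longrightarrow> norm (inverse (\<psi> x $ 3)) \<le> B
      else set_integrable lebesgue K (\<lambda>x. norm (inverse (\<psi> x $ 3)) powr real_of_ereal p)"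
    by (simp add: r(1))
qed

lemma Lp_loc_MM: "1 \<le> p \<Longrightarrow> p < 2 \<Longrightarrow> Lp_loc T p MM (\<lambda>z. inverse (z $ 3))"
  by (rule Lp_loc_reciprocal[OF submersive_MM])

text \<open>\<open>e = 0\<close> yields the reciprocal itself and positive \<open>e\<close> its
  regularization.\<close>

lemma Cinf_reciprocal:
  fixes h :: "'a::euclidean_space \<Rightarrow> complex"
  assumes h: "Cinf U h" and e: "\<And>x. x \<in> U \<Longrightarrow> (cmod (h x))\<^sup>2 + e \<noteq> 0"
  shows "Cinf U (\<lambda>x. inverse ((cmod (h x))\<^sup>2 + e) *\<^sub>R cnj (h x))"
proof -
  have "Cinf U (\<lambda>x. h x \<bullet> h x + e)" by (intro Cinf_add Cinf_inner h Cinf_const Cinf_open[OF h])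
  then have "Cinf U (\<lambda>x. inverse (h x \<bullet> h x + e))" by (rule Cinf_inverse) (use e in \<open>simp add: power2_norm_eq_inner\<close>)
  then have "Cinf U (\<lambda>x. inverse (h x \<bullet> h x + e) *\<^sub>R cnj (h x))" by (intro Cinf_scaleR Cinf_cnj h)
  then show ?thesis by (simp add: power2_norm_eq_inner)
qed

text \<open>Off the torus the function is smooth, and being the restriction of a holomorphic
  function it is annihilated by the (0,1) field pointwise; integration by parts gives the
  distributional statement.\<close>

lemma CR_function_MM_CC:
  fixes T :: "'d::euclidean_space itself"
  shows "CR_function T (MM - CC) (\<lambda>z. inverse (z $ 3))"
  unfolding CR_function_def
proof (intro conjI allI impI)
  have nz: "\<psi> x $ 3 \<noteq> 0" if "local_parametrization (MM - CC) U \<psi>" "x \<in> U" for U x and \<psi> :: "'d \<Rightarrow> complex ^ 3"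
    using local_parametrizationD(2)[OF that(1)] that(2) by (auto simp: CC_eq)
  show "Lp_loc T 1 (MM - CC) (\<lambda>z. inverse (z $ 3))"
    by (rule Lp_loc_reciprocal) (use nz in \<open>blast, simp_all\<close>)
  fix U \<psi> A B and \<theta> :: "'d \<Rightarrow> real"
  assume as: "local_parametrization (MM - CC) U \<psi> \<and> smooth_on U A \<and> smooth_on U B \<and>
      (\<forall>x\<in>U. frechet_derivative \<psi> (at x) (B x) = J (frechet_derivative \<psi> (at x) (A x))) \<and>
      smooth_on UNIV \<theta> \<and> compact (closure {x. \<theta> x \<noteq> 0}) \<and> closure {x. \<theta> x \<noteq> 0} \<subseteq> U"
  then have lp: "local_parametrization (MM - CC) U \<psi>" by blast
  note C = local_parametrizationD[OF lp] and nz = nz[OF lp]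
  have U: "open U" by (rule Cinf_open[OF C(1)])
  have hC: "Cinf U (\<lambda>x. \<psi> x $ 3)" by (rule Cinf_vec_nth[OF C(1)])
  have inv: "inverse ((cmod w)\<^sup>2 + 0) *\<^sub>R cnj w = inverse w" for w :: complex
  proof (cases "w = 0")
    case False
    have "inverse ((cmod w)\<^sup>2 + 0) *\<^sub>R cnj w = inverse (complex_of_real ((cmod w)\<^sup>2)) * cnj w"
      by (simp only: scaleR_conv_of_real of_real_inverse add_0_right)
    then show ?thesis using False unfolding complex_norm_square by simp
  qed simp
  have gC: "Cinf U (\<lambda>x. inverse (\<psi> x $ 3))"
    using Cinf_reciprocal[OF hC, of 0] nz unfolding inv by simp
  have zero: "frechet_derivative (\<lambda>x. inverse (\<psi> x $ 3)) (at x) (A x) +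
      \<i> * frechet_derivative (\<lambda>x. inverse (\<psi> x $ 3)) (at x) (B x) = 0" if x: "x \<in> U" for x
  proof -
    let ?D = "frechet_derivative \<psi> (at x)"
    have "((\<lambda>x. \<psi> x $ 3) has_derivative (\<lambda>v. ?D v $ 3)) (at x)"
      by (rule has_derivative_vec_nth[OF Cinf_has_derivative[OF C(1) x]])
    note d = frechet_derivative_at[OF Deriv.has_derivative_inverse[OF nz[OF x] this], symmetric]
    have "?D (B x) $ 3 = \<i> * ?D (A x) $ 3" using as x by simp
    then show ?thesis unfolding d by (simp add: algebra_simps)
  qed
  have "(LINT x:U|lebesgue. inverse (\<psi> x $ 3) * Complex (divergence (\<lambda>y. \<theta> y *\<^sub>R A y) x) (divergence (\<lambda>y. \<theta> y *\<^sub>R B y) x)) =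
      - (LINT x|lborel. indicator U x *\<^sub>R \<theta> x *\<^sub>R (frechet_derivative (\<lambda>x. inverse (\<psi> x $ 3)) (at x) (A x) +
      \<i> * frechet_derivative (\<lambda>x. inverse (\<psi> x $ 3)) (at x) (B x)))"
    using as U smooth_on_open_iff[of U A] smooth_on_open_iff[of U B] smooth_on_open_iff[of UNIV \<theta>]
    by (intro integral_transpose_complex gC) auto
  also have "\<dots> = 0"
  proof -
    have e: "(\<lambda>x. indicator U x *\<^sub>R \<theta> x *\<^sub>R (frechet_derivative (\<lambda>x. inverse (\<psi> x $ 3)) (at x) (A x) +
      \<i> * frechet_derivative (\<lambda>x. inverse (\<psi> x $ 3)) (at x) (B x))) = (\<lambda>_. 0)"
    proof
      fix x
      show "indicator U x *\<^sub>R \<theta> x *\<^sub>R (frechet_derivative (\<lambda>x. inverse (\<psi> x $ 3)) (at x) (A x) +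
        \<i> * frechet_derivative (\<lambda>x. inverse (\<psi> x $ 3)) (at x) (B x)) = 0"
        using zero[of x] by (cases "x \<in> U") simp_all
    qed
    show ?thesis unfolding e by simp
  qed
  finally show "(LINT x:U|lebesgue. inverse (\<psi> x $ 3) * Complex (divergence (\<lambda>y. \<theta> y *\<^sub>R A y) x) (divergence (\<lambda>y. \<theta> y *\<^sub>R B y) x)) = 0" .
qed

section \<open>Bump functions\<close>

text \<open>The powers of \<open>inverse t\<close> make the family closed under differentiation up
  to linear combinations, see \<open>DERIV_flat\<close>, so that smoothness follows by induction for
  all \<open>n\<close> at once.\<close>

definition flat :: "nat \<Rightarrow> real \<Rightarrow> real" where
  "flat n t = (if t \<le> 0 then 0 else inverse t ^ n * exp (- inverse t))"

lemma flat_tendsto: "(flat n \<longlongrightarrow> 0) (at 0)"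
proof (rule filterlim_split_at)
  have "\<forall>\<^sub>F t in at_left 0. 0 = flat n t"
    by (auto simp: flat_def eventually_at_filter)
  then show "(flat n \<longlongrightarrow> 0) (at_left 0)" by (rule Lim_transform_eventually[OF tendsto_const])
  have "((\<lambda>t::real. inverse t ^ n / exp (inverse t)) \<longlongrightarrow> 0) (at_right 0)"
    by (rule filterlim_compose[OF tendsto_power_div_exp_0 filterlim_inverse_at_top_right])
  moreover have "\<forall>\<^sub>F t in at_right 0. inverse t ^ n / exp (inverse t) = flat n t"
    by (auto simp: flat_def eventually_at_filter exp_minus divide_inverse)
  ultimately show "(flat n \<longlongrightarrow> 0) (at_right 0)" by (rule Lim_transform_eventually)
qed

lemma DERIV_flat: "(flat n has_real_derivative flat (n + 2) t - real n * flat (n + 1) t) (at t)"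
proof (cases t "0 :: real" rule: linorder_cases)
  case less
  have "((\<lambda>_. 0) has_real_derivative 0) (at t)" by simp
  then have "(flat n has_real_derivative 0) (at t)"
    by (rule has_field_derivative_transform_within_open[where S = "{..<0}"]) (use less in \<open>auto simp: flat_def\<close>)
  then show ?thesis using less by (simp add: flat_def)
next
  case equal
  have "\<forall>\<^sub>F h in at 0. flat (Suc n) h = (flat n (0 + h) - flat n 0) / h"
    by (auto simp: flat_def eventually_at_filter divide_inverse)
  then have "((\<lambda>h. (flat n (0 + h) - flat n 0) / h) \<longlongrightarrow> 0) (at 0)"
    by (rule Lim_transform_eventually[OF flat_tendsto])
  then have "(flat n has_real_derivative 0) (at 0)" by (simp add: DERIV_def)
  then show ?thesis using equal by (simp add: flat_def)
next
  case greater
  have "((\<lambda>t. inverse t ^ n * exp (- inverse t)) has_real_derivative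
      inverse t ^ (n + 2) * exp (- inverse t) - real n * (inverse t ^ (n + 1) * exp (- inverse t))) (at t)"
  proof (rule DERIV_cong)
    have 1: "(inverse has_real_derivative - (inverse t ^ Suc (Suc 0))) (at t)" using greater by (intro DERIV_inverse) simp
    show "((\<lambda>t. inverse t ^ n * exp (- inverse t)) has_real_derivative
        (real n * (- (inverse t ^ Suc (Suc 0)) * inverse t ^ (n - Suc 0))) * exp (- inverse t) +
        (exp (- inverse t) * - (- (inverse t ^ Suc (Suc 0)))) * inverse t ^ n) (at t)"
      by (rule DERIV_mult[OF DERIV_power[OF 1] DERIV_fun_exp[OF DERIV_minus[OF 1]]])
  qed (cases n; simp add: algebra_simps)
  then have "(flat n has_real_derivative
      inverse t ^ (n + 2) * exp (- inverse t) - real n * (inverse t ^ (n + 1) * exp (- inverse t))) (at t)"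
    by (rule has_field_derivative_transform_within_open[where S = "{0<..}"]) (use greater in \<open>auto simp: flat_def\<close>)
  then show ?thesis using greater by (simp add: flat_def)
qed

lemma Cinf_flat: "Cinf UNIV (flat n)"
proof -
  have "\<forall>n. Ck_on k UNIV (flat n)" for k
  proof (induction k)
    case 0
    have "continuous_on UNIV (flat n)" for n
      using DERIV_flat DERIV_isCont by (blast intro: continuous_at_imp_continuous_on)
    then show ?case by simp
  next
    case (Suc k)
    show ?case
    proof (intro allI Ck_on_Suc open_UNIV)
      fix n and x :: real
      show "(flat n has_derivative (\<lambda>v. v *\<^sub>R flat (n + 2) x + (- (v * real n)) *\<^sub>R flat (n + 1) x)) (at x)"
        using DERIV_flat[of n x] unfolding has_field_derivative_def
        by (rule has_derivative_eq_rhs) (simp add: fun_eq_iff algebra_simps)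
    next
      fix n and v :: real
      show "Ck_on k UNIV (\<lambda>x. v *\<^sub>R flat (n + 2) x + (- (v * real n)) *\<^sub>R flat (n + 1) x)"
        using Suc by (intro Ck_on_add Ck_on_scaleR Ck_on_const open_UNIV) auto
    qed
  qed
  then show ?thesis by (simp add: Cinf_def)
qed

lemma bump_function_exists:
  fixes x0 :: "'a::euclidean_space"
  assumes d: "0 < d"
  obtains \<theta> :: "'a \<Rightarrow> real" and c where "Cinf UNIV \<theta>" "compact (closure {x. \<theta> x \<noteq> 0})" "\<And>x. 0 \<le> \<theta> x"
    "0 < c" "\<And>x. x \<in> ball x0 d \<Longrightarrow> c \<le> \<theta> x"
proof -
  \<comment> \<open>The support has radius \<open>2 * d\<close>, so that on the ball of radius
    \<open>d\<close> the argument of \<open>flat\<close> is at least \<open>3 * d\<^sup>2\<close>,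
    which bounds the bump from below.\<close>
  define \<theta> where "\<theta> x = flat 0 ((2 * d)\<^sup>2 - (x - x0) \<bullet> (x - x0))" for x
  have "Cinf UNIV (\<lambda>x :: 'a. (2 * d)\<^sup>2 - (x - x0) \<bullet> (x - x0))"
    by (intro Cinf_diff Cinf_inner Cinf_const Cinf_ident open_UNIV)
  then have "Cinf UNIV \<theta>" unfolding \<theta>_def[abs_def] by (rule Cinf_compose[OF Cinf_flat]) simp
  moreover have "{x. \<theta> x \<noteq> 0} \<subseteq> cball x0 (2 * d)"
  proof
    fix x assume "x \<in> {x. \<theta> x \<noteq> 0}"
    then have "(norm (x - x0))\<^sup>2 < (2 * d)\<^sup>2" by (auto simp: \<theta>_def flat_def power2_norm_eq_inner split: if_splits)
    then have "norm (x - x0) < 2 * d" by (rule power2_less_imp_less) (use d in simp)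
    then show "x \<in> cball x0 (2 * d)" by (simp add: dist_norm norm_minus_commute)
  qed
  then have "bounded {x. \<theta> x \<noteq> 0}" using bounded_cball bounded_subset by blast
  then have "compact (closure {x. \<theta> x \<noteq> 0})" by simp
  moreover have "0 \<le> \<theta> x" for x by (simp add: \<theta>_def flat_def)
  moreover have "0 < exp (- inverse (3 * d\<^sup>2))" by simp
  moreover have "exp (- inverse (3 * d\<^sup>2)) \<le> \<theta> x" if x: "x \<in> ball x0 d" for x
  proof -
    have "norm (x - x0) \<le> d" using x by (simp add: dist_norm norm_minus_commute)
    then have "(norm (x - x0))\<^sup>2 \<le> d\<^sup>2" by (rule power_mono) simp
    then have le: "3 * d\<^sup>2 \<le> (2 * d)\<^sup>2 - (x - x0) \<bullet> (x - x0)" by (simp add: power2_norm_eq_inner power_mult_distrib)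
    have p: "0 < 3 * d\<^sup>2" using d by simp
    then have "inverse ((2 * d)\<^sup>2 - (x - x0) \<bullet> (x - x0)) \<le> inverse (3 * d\<^sup>2)" using le by (intro le_imp_inverse_le)
    moreover have "\<not> (2 * d)\<^sup>2 - (x - x0) \<bullet> (x - x0) \<le> 0" using le p by linarith
    ultimately show ?thesis unfolding \<theta>_def flat_def by (simp only: if_False power_0 mult_1 exp_le_cancel_iff neg_le_iff_le)
  qed
  ultimately show thesis by (rule that)
qed

section \<open>The reciprocal is not a CR function across the torus\<close>

definition chart :: "real ^ 4 \<Rightarrow> complex ^ 3" where
  "chart y = unstraighten (\<lambda>p. \<i> * qf p) (embed4 y)"

lemma chart_diffeomorphism:
  "diffeomorphism UNIV MM chart (\<lambda>p. coords4 (straighten (\<lambda>p. \<i> * qf p) p))"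
  unfolding chart_def[abs_def]
  by (rule straightening.diffeomorphism_param[OF straightening_MM linear_embed(1,3) embed_coords(1,3)])
    (auto simp: lin4_def embed4_def intro: off_pole_lin)

lemma chart_surj: "range chart = MM"
  using chart_diffeomorphism by (simp add: diffeomorphism_def homeomorphism_def)

lemma chart_parametrization: "local_parametrization MM UNIV chart"
  unfolding local_parametrization_def chart_surj using chart_diffeomorphism by auto

lemma Cinf_chart: "Cinf UNIV chart"
  by (rule local_parametrizationD(1)[OF chart_parametrization])

text \<open>The sum over the basis makes the smoothness of the pulled back field evident.\<close>

definition pullback :: "(complex ^ 3 \<Rightarrow> complex ^ 3) \<Rightarrow> real ^ 4 \<Rightarrow> real ^ 4" where
  "pullback X y = (\<Sum>b\<in>Basis. (X (chart y) \<bullet> b) *\<^sub>R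
     coords4 (frechet_derivative (straighten (\<lambda>p. \<i> * qf p)) (at (chart y)) b))"

lemma Cinf_pullback:
  assumes "Cinf UNIV X"
  shows "Cinf UNIV (pullback X)"
proof -
  have 1: "Cinf UNIV (\<lambda>y. X (chart y))" by (rule Cinf_compose[OF assms Cinf_chart]) simp
  have r: "range chart \<subseteq> off_pole" using chart_surj MM_sphere punctured_sphere_iff by blast
  have 2: "Cinf UNIV (\<lambda>y. frechet_derivative (straighten (\<lambda>p. \<i> * qf p)) (at (chart y)) b)" for b
    by (rule Cinf_compose[OF Cinf_frechet[OF straightening.diffeo(1)[OF straightening_MM]] Cinf_chart r])
  have bl: "bounded_linear coords4" using linear_embed(3) by (simp add: linear_conv_bounded_linear)
  show ?thesis
    unfolding pullback_def[abs_def]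
    by (intro Cinf_sum Cinf_scaleR Cinf_inner 1 Cinf_const Cinf_linear_compose[OF bl] 2 open_UNIV)
qed

lemma chart_pullback:
  assumes X: "X (chart y) \<in> tangent_space MM (chart y)"
  shows "frechet_derivative chart (at y) (pullback X y) = X (chart y)"
proof -
  let ?\<phi> = "straighten (\<lambda>p. \<i> * qf p)" and ?\<psi> = "unstraighten (\<lambda>p. \<i> * qf p)"
  note s = straightening.diffeo[OF straightening_MM]
  define p where "p = chart y"
  have pM: "p \<in> MM" using chart_surj by (auto simp: p_def)
  then have p: "p \<in> off_pole" using MM_sphere punctured_sphere_iff by blast
  have e: "embed4 y \<in> off_pole" by (simp add: embed4_def off_pole_lin)
  have \<phi>p: "?\<phi> p = embed4 y" using s(6)[OF e] by (simp add: p_def chart_def)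
  have d: "(?\<phi> has_derivative frechet_derivative ?\<phi> (at p)) (at p)"
    "(?\<psi> has_derivative frechet_derivative ?\<psi> (at (embed4 y))) (at (embed4 y))"
    by (rule Cinf_has_derivative[OF s(1) p], rule Cinf_has_derivative[OF s(2) e])
  note inv = straightening.inverse_derivative[OF straightening_MM p d(1)] d(2)
  have lin: "linear (frechet_derivative ?\<phi> (at p))" by (rule has_derivative_linear[OF d(1)])
  have "pullback X y = coords4 (frechet_derivative ?\<phi> (at p) (\<Sum>b\<in>Basis. (X p \<bullet> b) *\<^sub>R b))"
    by (simp only: pullback_def p_def[symmetric] linear_sum[OF lin] linear_sum[OF linear_embed(3)]
        linear_scale[OF lin] linear_scale[OF linear_embed(3)])
  also have "\<dots> = coords4 (frechet_derivative ?\<phi> (at p) (X p))" by (simp only: euclidean_representation)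
  finally have pb: "pullback X y = coords4 (frechet_derivative ?\<phi> (at p) (X p))" .
  have "frechet_derivative ?\<phi> (at p) (X p) \<in> lin4"
    using X straightening.tangent_space_eq[OF straightening_MM pM d(1)] by (simp add: p_def)
  then have "embed4 (pullback X y) = frechet_derivative ?\<phi> (at p) (X p)" by (simp add: pb embed_coords(3))
  moreover have "(embed4 has_derivative embed4) (at y)"
    using linear_embed(1) by (simp add: linear_conv_bounded_linear bounded_linear_imp_has_derivative)
  from has_derivative_compose[OF this d(2)]
  have "(chart has_derivative (\<lambda>v. frechet_derivative ?\<psi> (at (embed4 y)) (embed4 v))) (at y)"
    by (simp add: chart_def[abs_def])
  then have "frechet_derivative chart (at y) = (\<lambda>v. frechet_derivative ?\<psi> (at (embed4 y)) (embed4 v))"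
    by (rule frechet_derivative_at[symmetric])
  moreover have "frechet_derivative ?\<psi> (at (embed4 y)) (frechet_derivative ?\<phi> (at p) (X p)) = X p"
    by (rule straightening.inverse_derivative(1)[OF straightening_MM p d(1)]) (use d(2) \<phi>p in simp)
  ultimately show ?thesis by (simp add: p_def)
qed

text \<open>The reciprocal of the third coordinate \<open>h\<close> is approximated by \<open>cnj h / (|h|\<^sup>2 + e)\<close>, whose image under
  the tangential Cauchy-Riemann operator has mass bounded from below near the torus.\<close>

lemma regularized_derivative:
  fixes h :: "'d::euclidean_space \<Rightarrow> complex"
  assumes h: "(h has_derivative h') (at x)" and A: "h' A = complex_of_real m" and B: "h' B = \<i> * complex_of_real m"
    and e: "0 < e"
  defines "g \<equiv> \<lambda>x. inverse ((cmod (h x))\<^sup>2 + e) *\<^sub>R cnj (h x)"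
  shows "frechet_derivative g (at x) A + \<i> * frechet_derivative g (at x) B =
     complex_of_real (2 * m * e * (inverse ((cmod (h x))\<^sup>2 + e))\<^sup>2)"
proof -
  define N where "N = h x \<bullet> h x + e"
  have N: "N \<noteq> 0" using e inner_ge_zero[of "h x"] unfolding N_def by linarith
  have gi: "g = (\<lambda>x. inverse (h x \<bullet> h x + e) *\<^sub>R cnj (h x))" by (simp add: g_def power2_norm_eq_inner)
  have "((\<lambda>x. h x \<bullet> h x + e) has_derivative (\<lambda>v. 2 * (h x \<bullet> h' v))) (at x)"
    using has_derivative_add[OF has_derivative_inner[OF h h] has_derivative_const[of e]]
    by (simp add: inner_commute)
  note i = Deriv.has_derivative_inverse[OF N[unfolded N_def] this]
  have "(g has_derivative (\<lambda>v. inverse N *\<^sub>R cnj (h' v) + (- (inverse N * (2 * (h x \<bullet> h' v)) * inverse N)) *\<^sub>R cnj (h x))) (at x)"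
    unfolding gi N_def by (rule has_derivative_scaleR[OF i bounded_linear.has_derivative[OF bounded_linear_cnj h]])
  note fd = frechet_derivative_at[OF this, symmetric]
  define K where "K = inverse N"
  have d: "frechet_derivative g (at x) v = K *\<^sub>R cnj (h' v) - (2 * K\<^sup>2 * (h x \<bullet> h' v)) *\<^sub>R cnj (h x)" for v
    unfolding fd by (simp add: power2_eq_square K_def)
  have hA: "h x \<bullet> h' A = m * Re (h x)" "h x \<bullet> h' B = m * Im (h x)"
    unfolding A B by (simp_all add: inner_complex_def)
  have "frechet_derivative g (at x) A + \<i> * frechet_derivative g (at x) B =
      complex_of_real (2 * m * K - 2 * m * K\<^sup>2 * (h x \<bullet> h x))"
    unfolding d hA unfolding A B
    by (simp add: complex_eq_iff inner_complex_def power2_eq_square algebra_simps)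
  also have "2 * m * K - 2 * m * K\<^sup>2 * (h x \<bullet> h x) = 2 * m * e * K\<^sup>2"
  proof -
    have KN: "K * N = 1" using N by (simp add: K_def)
    have "2 * m * K = 2 * m * K * (K * N)" unfolding KN by simp
    also have "\<dots> = 2 * m * K\<^sup>2 * (h x \<bullet> h x) + 2 * m * e * K\<^sup>2"
      unfolding N_def by (simp add: power2_eq_square algebra_simps)
    finally show ?thesis by simp
  qed
  finally show ?thesis by (simp only: K_def N_def power2_norm_eq_inner)
qed

text \<open>If the reciprocal were CR, the integrals of its regularizations against the transposed
  operator would tend to 0 by dominated convergence. Integrated by parts, they are bounded away from
  0: near the torus the regularized density is of order \<open>1 / r^2\<close> on a set of measure
  at least of order \<open>r^2\<close>.\<close>

lemma not_CR_function_MM: "\<not> CR_function TYPE(real ^ 4) MM (\<lambda>z. inverse (z $ 3))"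
proof
  assume CR: "CR_function TYPE(real ^ 4) MM (\<lambda>z. inverse (z $ 3))"
  obtain p0 where p0: "p0 \<in> CC" using CC_nonempty by blast
  then have "p0 \<in> range chart" unfolding chart_surj using CC_subset(2) by blast
  then obtain y0 where y0: "chart y0 = p0" by auto
  define h where "h y = chart y $ 3" for y
  have hC: "Cinf UNIV h" unfolding h_def[abs_def] by (rule Cinf_vec_nth[OF Cinf_chart])
  define m where "m y = (cmod (cc (chart y)))\<^sup>2" for y
  have ccC: "Cinf UNIV cc" unfolding cc_def[abs_def] by (intro Cinf_intros Cinf_xi open_UNIV)
  have zC: "Cinf UNIV (\<lambda>p. zt p $ i)" for i by (rule Cinf_vec_nth[OF Cinf_zt])
  \<comment> \<open>The factor \<open>cnj (cc p)\<close> gives the third entries the real value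
    \<open>(cmod (cc p))^2\<close> and \<open>\<i>\<close> times this value, as
    \<open>regularized_derivative\<close> requires.\<close>
  define X1 where "X1 p = cnj (cc p) *s zt p" for p
  define X2 where "X2 p = (\<i> * cnj (cc p)) *s zt p" for p
  have X12: "X1 = (\<lambda>p. vec3 (cnj (cc p) * zt p $ 1) (cnj (cc p) * zt p $ 2) (cnj (cc p) * zt p $ 3))"
    "X2 = (\<lambda>p. vec3 (\<i> * cnj (cc p) * zt p $ 1) (\<i> * cnj (cc p) * zt p $ 2) (\<i> * cnj (cc p) * zt p $ 3))"
    by (auto simp: fun_eq_iff vec3_eq_iff X1_def X2_def)
  have XC: "Cinf UNIV X1" "Cinf UNIV X2"
    unfolding X12 by (intro Cinf_vec3 Cinf_mult Cinf_const Cinf_cnj ccC zC open_UNIV)+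
  define A where "A = pullback X1"
  define B where "B = pullback X2"
  have AC: "Cinf UNIV A" "Cinf UNIV B" unfolding A_def B_def by (rule Cinf_pullback[OF XC(1)], rule Cinf_pullback[OF XC(2)])
  have cM: "chart y \<in> MM" for y using chart_surj by blast
  have dA: "frechet_derivative chart (at y) (A y) = X1 (chart y)" "frechet_derivative chart (at y) (B y) = X2 (chart y)" for y
    unfolding A_def B_def by (rule chart_pullback, simp add: X1_def X2_def zt_tangent[OF cM])+
  have J: "frechet_derivative chart (at y) (B y) = J (frechet_derivative chart (at y) (A y))" for y
    by (simp add: dA J_def X1_def X2_def vec_eq_iff)
  have hd: "(h has_derivative (\<lambda>v. frechet_derivative chart (at y) v $ 3)) (at y)" for y
    unfolding h_def[abs_def] by (rule has_derivative_vec_nth[OF Cinf_has_derivative[OF Cinf_chart UNIV_I]])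
  have ccn: "cnj (cc p) * cc p = complex_of_real ((cmod (cc p))\<^sup>2)" for p
    unfolding complex_norm_square by (simp add: mult.commute)
  have hA: "frechet_derivative chart (at y) (A y) $ 3 = complex_of_real (m y)"
    "frechet_derivative chart (at y) (B y) $ 3 = \<i> * complex_of_real (m y)" for y
    unfolding dA X1_def X2_def m_def ccn[symmetric] by (simp_all add: zt_nth)
  have mc: "continuous_on X m" for X
    unfolding m_def[abs_def]
    by (intro continuous_intros continuous_on_compose2[OF Cinf_continuous_on[OF ccC]]
        continuous_on_subset[OF Cinf_continuous_on[OF Cinf_chart]]) auto
  have m0: "0 < m y0" using cc_nonzero[OF p0] by (simp add: m_def y0)
  \<comment> \<open>A neighbourhood of \<open>y0\<close> on which the density \<open>m\<close> stays
    above half of its value at \<open>y0\<close>.\<close>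
  define U where "U = {y. m y0 / 2 < m y}"
  have "open U" unfolding U_def using mc[of UNIV] by (intro open_Collect_less continuous_intros)
  then have hU: "Cinf U h" by (rule Cinf_subset[OF hC subset_UNIV])
  have yU: "y0 \<in> U" using m0 by (simp add: U_def)
  have h0: "h y0 = 0" using p0 by (simp add: h_def y0 CC_eq)
  obtain L u where L: "(h has_derivative L) (at y0)" "linear u" "\<And>z. L (u z) = z"
    using submersive_MM[OF chart_parametrization UNIV_I, of y0] h0 unfolding h_def by blast
  obtain d M where d: "ball y0 d \<subseteq> U" "near_submersion h u y0 d M" using near_submersionI[OF hU yU L] by blast
  have d0: "0 < d" by (rule near_submersion.d[OF d(2)])
  obtain c r0 where c: "0 < c" "0 < r0" "\<And>r. 0 < r \<and> r < r0 \<Longrightarrow> c * r\<^sup>2 \<le> measure lebesgue {x \<in> ball y0 d. cmod (h x) \<le> r}"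
    using near_submersion.sublevel_measure_lower[OF d(2) h0] by blast
  obtain \<theta> :: "real ^ 4 \<Rightarrow> real" and t where \<theta>: "Cinf UNIV \<theta>" "compact (closure {x. \<theta> x \<noteq> 0})" "\<And>x. 0 \<le> \<theta> x"
    "0 < t" "\<And>x. x \<in> ball y0 d \<Longrightarrow> t \<le> \<theta> x" using bump_function_exists[OF d0, of y0] by metis
  define S where "S = closure {x. \<theta> x \<noteq> 0}"
  have cS: "compact S" unfolding S_def by (rule \<theta>(2))
  have \<theta>S: "\<theta> x = 0" if "x \<notin> S" for x using that closure_subset[of "{x. \<theta> x \<noteq> 0}"] by (auto simp: S_def)
  define W where "W x = Complex (divergence (\<lambda>y. \<theta> y *\<^sub>R A y) x) (divergence (\<lambda>y. \<theta> y *\<^sub>R B y) x)" for x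
  define g where "g e x = inverse ((cmod (h x))\<^sup>2 + e) *\<^sub>R cnj (h x)" for e x
  define \<kappa> where "\<kappa> e x = 2 * m x * e * (inverse ((cmod (h x))\<^sup>2 + e))\<^sup>2" for e x
  have hc: "continuous_on X h" for X by (rule continuous_on_subset[OF Cinf_continuous_on[OF hC]]) auto
  have npos: "0 < (cmod (h x))\<^sup>2 + e" if "0 < e" for e x using that by (simp add: add_nonneg_pos)
  have gC: "Cinf UNIV (g e)" if "0 < e" for e
    unfolding g_def[abs_def] by (rule Cinf_reciprocal[OF hC]) (use npos[OF that] in \<open>metis less_irrefl\<close>)
  have transpose: "(LINT x|lebesgue. g e x * W x) = - complex_of_real (LINT x|lebesgue. \<theta> x * \<kappa> e x)"
      "integrable lebesgue (\<lambda>x. \<theta> x * \<kappa> e x)" if e: "0 < e" for e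
  proof -
    have "continuous_on X (\<lambda>x. \<theta> x * \<kappa> e x)" for X
      unfolding \<kappa>_def
      by (intro continuous_intros hc mc continuous_on_subset[OF Cinf_continuous_on[OF \<theta>(1)]])
        (use npos[OF e] in \<open>auto simp: less_imp_neq[symmetric]\<close>)
    then have i: "integrable lborel (\<lambda>x. \<theta> x * \<kappa> e x)"
      by (rule integrable_compact_support[OF cS]) (simp add: \<theta>S)
    then have b: "(\<lambda>x. \<theta> x * \<kappa> e x) \<in> borel_measurable lborel" by simp
    show "integrable lebesgue (\<lambda>x. \<theta> x * \<kappa> e x)" using integrable_completion[OF b] i by simp
    have "(LINT x:UNIV|lebesgue. g e x * W x) =
        - (LINT x|lborel. indicator UNIV x *\<^sub>R \<theta> x *\<^sub>R (frechet_derivative (g e) (at x) (A x) + \<i> * frechet_derivative (g e) (at x) (B x)))"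
      unfolding W_def by (rule integral_transpose_complex[OF gC[OF e] AC \<theta>(1,2) subset_UNIV])
    also have "(\<lambda>x. indicator UNIV x *\<^sub>R \<theta> x *\<^sub>R (frechet_derivative (g e) (at x) (A x) + \<i> * frechet_derivative (g e) (at x) (B x))) =
        (\<lambda>x. complex_of_real (\<theta> x * \<kappa> e x))"
      unfolding g_def[abs_def] \<kappa>_def regularized_derivative[OF hd hA e] by (simp add: scaleR_conv_of_real)
    also have "(LINT x|lborel. complex_of_real (\<theta> x * \<kappa> e x)) = complex_of_real (LINT x|lborel. \<theta> x * \<kappa> e x)"
      by (rule integral_bounded_linear[OF bounded_linear_of_real i])
    finally show "(LINT x|lebesgue. g e x * W x) = - complex_of_real (LINT x|lebesgue. \<theta> x * \<kappa> e x)"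
      by (simp add: set_lebesgue_integral_def integral_completion[OF b])
  qed
  have lower: "c * t * m y0 / 4 \<le> (LINT x|lebesgue. \<theta> x * \<kappa> (r\<^sup>2) x)" if r: "0 < r" "r < r0" for r
  proof -
    define E where "E = {x \<in> ball y0 d. cmod (h x) \<le> r}"
    have E: "E \<in> lmeasurable" unfolding E_def by (intro sublevel_lmeasurable open_ball lmeasurable_ball hc)
    \<comment> \<open>On \<open>E\<close> the denominator is at most \<open>2 * r\<^sup>2\<close>,
      so the integrand is at least \<open>a\<close>, which equals
      \<open>t * m y0 / (4 * r\<^sup>2)\<close>. Multiplied by the lower bound for the measure of
      \<open>E\<close>, the powers of \<open>r\<close> cancel.\<close>
    define a where "a = t * (m y0 * r\<^sup>2 * (inverse (2 * r\<^sup>2))\<^sup>2)"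
    have r2: "0 < r\<^sup>2" using r by simp
    have "indicator E x * a \<le> \<theta> x * \<kappa> (r\<^sup>2) x" for x
    proof (cases "x \<in> E")
      case True
      then have x: "x \<in> ball y0 d" "cmod (h x) \<le> r" by (auto simp: E_def)
      have "(cmod (h x))\<^sup>2 \<le> r\<^sup>2" using x(2) by (intro power_mono) auto
      then have "inverse (2 * r\<^sup>2) \<le> inverse ((cmod (h x))\<^sup>2 + r\<^sup>2)" using npos[OF r2] by (intro le_imp_inverse_le) auto
      then have i1: "(inverse (2 * r\<^sup>2))\<^sup>2 \<le> (inverse ((cmod (h x))\<^sup>2 + r\<^sup>2))\<^sup>2" by (intro power_mono) auto
      have i2: "m y0 * r\<^sup>2 \<le> 2 * m x * r\<^sup>2" using d(1) x(1) r2 by (intro mult_right_mono) (auto simp: U_def)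
      have "m y0 * r\<^sup>2 * (inverse (2 * r\<^sup>2))\<^sup>2 \<le> \<kappa> (r\<^sup>2) x"
        unfolding \<kappa>_def by (rule mult_mono[OF i2 i1]) (simp_all add: m_def)
      then have "a \<le> \<theta> x * \<kappa> (r\<^sup>2) x"
        unfolding a_def using \<theta>(3)[of x] \<theta>(5)[OF x(1)] m0 by (intro mult_mono) auto
      then show ?thesis using True by simp
    next
      case False
      have "0 \<le> \<kappa> (r\<^sup>2) x" by (simp add: \<kappa>_def m_def)
      then show ?thesis using False \<theta>(3)[of x] by simp
    qed
    moreover have "integrable lebesgue (\<lambda>x. indicator E x * a)"
      using E by (intro integrable_mult_left integrable_real_indicator) (auto simp: fmeasurable_def)
    ultimately have "(LINT x|lebesgue. indicator E x * a) \<le> (LINT x|lebesgue. \<theta> x * \<kappa> (r\<^sup>2) x)"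
      using transpose(2)[OF r2] by (intro integral_mono) auto
    moreover have "(LINT x|lebesgue. indicator E x * a) = measure lebesgue E * a"
      using E by simp
    moreover have "c * r\<^sup>2 * a \<le> measure lebesgue E * a"
      using c(3)[of r] r \<theta>(4) m0 unfolding E_def by (intro mult_right_mono) (auto simp: a_def)
    moreover have "c * r\<^sup>2 * a = c * t * m y0 / 4"
      using r(1) by (simp add: a_def power2_eq_square field_simps)
    ultimately show ?thesis by linarith
  qed
  have YC: "Cinf UNIV (\<lambda>y. \<theta> y *\<^sub>R A y)" "Cinf UNIV (\<lambda>y. \<theta> y *\<^sub>R B y)"
    by (rule Cinf_scaleR[OF \<theta>(1) AC(1)], rule Cinf_scaleR[OF \<theta>(1) AC(2)])
  have Wc: "continuous_on UNIV W"
    unfolding W_def[abs_def] divergence_def Complex_eq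
    by (intro continuous_intros Cinf_continuous_on Cinf_frechet YC)
  have WS: "W x = 0" if "x \<notin> S" for x
  proof -
    have S: "closed S" by (simp add: S_def)
    have "frechet_derivative (\<lambda>y. \<theta> y *\<^sub>R A y) (at x) = (\<lambda>_. 0)"
      by (rule frechet_derivative_zero_outside[OF S that]) (simp add: \<theta>S)
    moreover have "frechet_derivative (\<lambda>y. \<theta> y *\<^sub>R B y) (at x) = (\<lambda>_. 0)"
      by (rule frechet_derivative_zero_outside[OF S that]) (simp add: \<theta>S)
    ultimately show ?thesis by (simp add: W_def divergence_def complex_eq_iff)
  qed
  obtain b where b: "\<And>x. cmod (W x) \<le> b" "0 \<le> b"
  proof -
    have "compact (W ` S)" using \<theta>(2) by (intro compact_continuous_image continuous_on_subset[OF Wc]) (auto simp: S_def)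
    then have "bounded (W ` S)" by (rule compact_imp_bounded)
    then obtain b where b: "\<And>x. x \<in> S \<Longrightarrow> cmod (W x) \<le> b" by (auto simp: bounded_iff)
    have "cmod (W x) \<le> \<bar>b\<bar>" for x using b[of x] WS[of x] by (cases "x \<in> S") auto
    then show thesis by (rule that) simp
  qed
  have "Lp_loc TYPE(real ^ 4) 1 MM (\<lambda>z. inverse (z $ 3))" by (rule Lp_loc_MM) simp_all
  note L1 = this[unfolded Lp_loc_def, rule_format, OF chart_parametrization, THEN conjunct2, rule_format, of S]
  have "set_integrable lebesgue S (\<lambda>x. norm (inverse (h x)) powr 1)"
    using L1 cS by (simp add: h_def)
  then have w: "integrable lebesgue (\<lambda>x. b * (indicator S x *\<^sub>R norm (inverse (h x)) powr 1))"
    unfolding set_integrable_def by (rule integrable_mult_right)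
  \<comment> \<open>Squares of radii that are below \<open>r0\<close>, so that \<open>lower\<close>
    applies, and that tend to 0.\<close>
  define e where "e n = (min (r0 / 2) (inverse (real (Suc n))))\<^sup>2" for n
  have e0: "0 < e n" for n
  proof -
    have "0 < min (r0 / 2) (inverse (real (Suc n)))" using c(2) by simp
    then show ?thesis unfolding e_def by (rule zero_less_power)
  qed
  have elim: "e \<longlonglongrightarrow> 0"
  proof -
    have "(\<lambda>n. (min (r0 / 2) (inverse (real (Suc n))))\<^sup>2) \<longlonglongrightarrow> (min (r0 / 2) 0)\<^sup>2"
      by (intro tendsto_intros LIMSEQ_inverse_real_of_nat)
    then show ?thesis using c(2) by (simp add: e_def[abs_def])
  qed
  \<comment> \<open>The regularizations are dominated by the reciprocal, which is integrable on the
    support of the test function.\<close>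
  have "(\<lambda>n. LINT x|lebesgue. g (e n) x * W x) \<longlonglongrightarrow> (LINT x|lebesgue. inverse (h x) * W x)"
  proof (rule integral_dominated_convergence[OF _ _ w])
    have lm: "f \<in> borel_measurable lebesgue" if "f \<in> borel_measurable borel" for f :: "real ^ 4 \<Rightarrow> complex"
      using measurable_completion[of f lborel borel] that by simp
    have hb: "h \<in> borel_measurable borel" "W \<in> borel_measurable borel"
      using hc[of UNIV] Wc by (auto intro: borel_measurable_continuous_onI)
    then show "(\<lambda>x. inverse (h x) * W x) \<in> borel_measurable lebesgue" by (intro lm) measurable
    show "(\<lambda>x. g (e n) x * W x) \<in> borel_measurable lebesgue" for n
      using Cinf_continuous_on[OF gC[OF e0[of n]]] Wc
      by (intro lm borel_measurable_continuous_onI continuous_on_mult)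
    show "AE x in lebesgue. (\<lambda>n. g (e n) x * W x) \<longlonglongrightarrow> inverse (h x) * W x"
    proof (rule AE_I2, rule tendsto_mult[OF _ tendsto_const])
      fix x
      show "(\<lambda>n. g (e n) x) \<longlonglongrightarrow> inverse (h x)"
      \<comment> \<open>At zeros of \<open>h\<close> the regularizations are 0, and so is the limit,
        as \<open>inverse 0 = 0\<close>.\<close>
      proof (cases "h x = 0")
        case False
        have "(\<lambda>n. inverse ((cmod (h x))\<^sup>2 + e n) *\<^sub>R cnj (h x)) \<longlonglongrightarrow> inverse ((cmod (h x))\<^sup>2 + 0) *\<^sub>R cnj (h x)"
          using False by (intro tendsto_intros elim) auto
        moreover have "inverse ((cmod (h x))\<^sup>2 + 0) *\<^sub>R cnj (h x) = inverse (complex_of_real ((cmod (h x))\<^sup>2)) * cnj (h x)"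
          by (simp only: scaleR_conv_of_real of_real_inverse add_0_right)
        then have "inverse ((cmod (h x))\<^sup>2 + 0) *\<^sub>R cnj (h x) = inverse (h x)"
          using False unfolding complex_norm_square by simp
        ultimately show ?thesis unfolding g_def by simp
      qed (simp add: g_def)
    qed
    show "AE x in lebesgue. norm (g (e n) x * W x) \<le> b * (indicator S x *\<^sub>R norm (inverse (h x)) powr 1)" for n
    proof (rule AE_I2)
      fix x
      show "norm (g (e n) x * W x) \<le> b * (indicator S x *\<^sub>R norm (inverse (h x)) powr 1)"
      proof (cases "x \<in> S \<and> h x \<noteq> 0")
        case True
        have "inverse ((cmod (h x))\<^sup>2 + e n) \<le> inverse ((cmod (h x))\<^sup>2)"
          using e0[of n] True by (intro le_imp_inverse_le) auto
        then have "inverse ((cmod (h x))\<^sup>2 + e n) * cmod (h x) \<le> inverse ((cmod (h x))\<^sup>2) * cmod (h x)"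
          by (rule mult_right_mono) simp
        also have "\<dots> = inverse (cmod (h x))" using True by (simp add: power2_eq_square)
        finally have "norm (g (e n) x) \<le> norm (inverse (h x))"
          using npos[OF e0[of n], of x] by (simp add: g_def norm_inverse)
        then have "norm (g (e n) x) * norm (W x) \<le> norm (inverse (h x)) * b"
          using b by (intro mult_mono) auto
        then show ?thesis using True by (simp add: norm_mult mult.commute)
      next
        case False
        then show ?thesis using WS[of x] b(2) by (auto simp: g_def)
      qed
    qed
  qed
  moreover have "(LINT x|lebesgue. inverse (h x) * W x) = 0"
  proof -
    have sm: "smooth_on UNIV A" "smooth_on UNIV B" "smooth_on UNIV \<theta>"
      by (rule Cinf_imp_smooth_on[OF _ subset_UNIV], rule AC \<theta>(1))+
    note CR' = conjunct2[OF CR[unfolded CR_function_def], rule_format, of UNIV chart A B \<theta>, folded W_def]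
    have "(LINT x:UNIV|lebesgue. inverse (chart x $ 3) * W x) = 0"
      by (rule CR', intro conjI ballI chart_parametrization sm \<theta>(2) subset_UNIV J)
    then show ?thesis by (simp add: set_lebesgue_integral_def h_def)
  qed
  ultimately have "(\<lambda>n. cmod (LINT x|lebesgue. g (e n) x * W x)) \<longlonglongrightarrow> 0"
    using tendsto_norm_zero by simp
  moreover have "c * t * m y0 / 4 \<le> cmod (LINT x|lebesgue. g (e n) x * W x)" for n
  proof -
    have "c * t * m y0 / 4 \<le> (LINT x|lebesgue. \<theta> x * \<kappa> (e n) x)"
      unfolding e_def by (rule lower) (use c(2) in auto)
    then show ?thesis unfolding transpose(1)[OF e0] norm_minus_cancel norm_of_real by linarith
  qed
  ultimately have "c * t * m y0 / 4 \<le> 0" by (intro LIMSEQ_le_const) auto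
  then show False using c(1) \<theta>(4) m0 by (simp add: mult_le_0_iff)
qed

lemma not_Lp_removable: "1 \<le> p \<Longrightarrow> p < 2 \<Longrightarrow> \<not> Lp_removable TYPE(real ^ 4) p MM CC"
  using Lp_loc_MM CR_function_MM_CC not_CR_function_MM unfolding Lp_removable_def by blast

theorem lemma14p1:
  shows "\<exists>M M1 C :: (complex ^ 3) set.
    smooth_submanifold 4 M \<and> generic M \<and> CR_dimension M 1 \<and>
    diffeomorphic M (ball (0 :: real ^ 4) 1) \<and>
    M1 \<subseteq> M \<and> smooth_submanifold 3 M1 \<and> maximally_real M1 \<and>
    diffeomorphic M1 (ball (0 :: real ^ 3) 1) \<and>
    C \<subseteq> M1 \<and> compact C \<and>
    diffeomorphic C (sphere (0 :: complex) 1 \<times> sphere (0 :: complex) 1) \<and>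
    transversal_to_char_foliation M M1 C \<and>
    (\<forall>\<alpha>. 0 < \<alpha> \<and> \<alpha> < 1 \<longrightarrow> \<not> nontransversality \<alpha> M M1 C) \<and>
    (\<forall>p\<in>M. finite_type_at 4 M p) \<and>
    globally_minimal M \<and>
    \<not> CR_removable TYPE(real ^ 4) M C \<and>
    \<not> W_removable M C \<and>
    (\<forall>p :: ereal. 1 \<le> p \<and> p < 2 \<longrightarrow> \<not> Lp_removable TYPE(real ^ 4) p M C)"
  by (rule exI[of _ MM], rule exI[of _ MM1], rule exI[of _ CC])
    (intro conjI allI impI ballI submanifold_MM generic_MM CR_dimension_MM diffeomorphic_MM MM1_subset
      maximally_real_MM1 CC_subset(1) compact_CC diffeomorphic_CC transversal_CC not_nontransversality
      finite_type_MM globally_minimal_MM not_CR_removable[OF CR_function_MM_CC] not_W_removable not_Lp_removable;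
      simp)

end
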